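(* For every canonical theory $T$, every $\phi\in\mathrm{Hom}^+(\mathcal A[T],\mathbb R)$ and every $\ell\in\mathbb N$: if $\phi$ satisfies $\mathrm{Independence}[\ell]$ then it satisfies $\mathrm{UCouple}[\ell]$, and if $\phi$ satisfies $\mathrm{UCouple}[\ell]$ then it satisfies $\mathrm{UInduce}[\ell]$.
   Context: All languages are finite relational first-order languages; each predicate symbol $P$ has an arity $k(P)\ge 1$. A canonical theory $T$ over a language $\mathcal L$ is a universal theory containing, for every $P\in\mathcal L$, the axiom $\forall\vec x\,(\bigvee_{i<j}x_i=x_j\to\neg P(x_1,\dots,x_{k(P)}))$. $T_1\cup T_2$ denotes the disjoint union of theories. $\mathcal K_V[T]$: models of $T$ on vertex set $V$; $\mathcal M_n[T]$: isomorphism classes of $n$-vertex models; $\mathcal M[T]=\bigcup_n\mathcal M_n[T]$. $\mathrm{Hom}^+(\mathcal A[T],\mathbb R)$ is the set of $\phi:\mathcal M[T]\to[0,1]$ with $\phi(M)=\lim_n p(M,N_n)$ for a sequence of finite models of $T$ of strictly increasing size, where $p(M,N)$ is the probability that a random $|M|$-subset of $V(N)$ induces a copy of $M$ (all limits assumed to exist). For $K\in\mathcal K_V[T]$, $|V|=m$: $\phi(\langle K\rangle)=\frac{|\mathrm{Aut}(K)|}{m!}\phi([K])$. For an atomless complete probability space $\Omega=(X,\mathcal A,\mu)$: $r(V)$ = finite nonempty subsets of $V$, $r(V,\ell)$ = those of size $\le\ell$, $\mathcal E_V(\Omega)=X^{r(V)}$, $\mathcal E_{V,\ell}(\Omega)=X^{r(V,\ell)}$,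 $\mathcal E_k=\mathcal E_{[k]}$; for injective $\alpha$, $\alpha^*(x)_A=x_{\alpha(A)}$. A $T$-on over $\Omega$ is a family of measurable peons $\mathcal N_P\subseteq\mathcal E_{k(P)}(\Omega)$ such that for $\theta$ random in $\mathcal E_{\mathbb N_+}(\Omega)$ (law $\mu$), the structure $\mathbf K$ on $\mathbb N_+$ with $R_P(\mathbf K)=\{\alpha\text{ injective}:\alpha^*(\theta)\in\mathcal N_P\}$ is a.s. a model of $T$; $\phi_{\mathcal N}(M)=\Pr[\mathbf K|_{[|M|]}\cong M]$, and every $\phi$ is of this form. A peon $\mathcal N_P\subseteq\mathcal E_k(\Omega)$ has rank $\le r$ if it equals $\mathcal H\times X^{\{A\subseteq[k]:|A|>r\}}$ with $\mathcal H\subseteq\mathcal E_{k,r}(\Omega)$, and is $\ell$-independent if it equals $\mathcal E_{k,\ell}(\Omega)\times\mathcal H$ with $\mathcal H\subseteq X^{\{A\subseteq[k]:|A|>\ell\}}$. $\mathrm{rk}(\phi)$ = minimum over $T$-ons representing $\phi$ of the maximal peon rank. $\mathrm{Independence}[\ell]$: $\phi=\phi_{\mathcal N}$ for a $T$-on with all peons $\ell$-independent. Open interpretation $I:T_1\rightsquigarrow T_2$: quasi-free formulas $I(P)$ in the language of $T_2$ such that each model $K$ of $T_2$ yields a model $I(K)$ of $T_1$ on $V(K)$ with $R_P(I(K))=\{\alpha:K\models I(P)(\alpha)\}$; $\phi^I(M)=\sum\{\phi(N):I(N)\cong M\}$. Structure-erasing $I_i:T_i\rightsquigarrow T_1\cup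 T_2$ maps $P\mapsto P$. A coupling of $\phi_1,\phi_2$ is $\xi\in\mathrm{Hom}^+(\mathcal A[T_1\cup T_2],\mathbb R)$ with $\xi^{I_i}=\phi_i$; independent coupling $(\phi_1\otimes\phi_2)(\langle M\rangle)=\phi_1(\langle I_1(M)\rangle)\phi_2(\langle I_2(M)\rangle)$; uniquely coupleable means the independent coupling is the only coupling. $\mathrm{UCouple}[\ell]$: uniquely coupleable with every $\psi$ of rank $\le\ell$ in any canonical theory. $T_{\ell\text{-Hypergraph}}$: one symmetric $\ell$-ary predicate $E$. For $\ell\ge1$, $\mathrm{UInduce}[\ell]$: for every $\psi\in\mathrm{Hom}^+(\mathcal A[T_{\ell\text{-Hypergraph}}],\mathbb R)$, every coupling $\xi$ of $\phi,\psi$ and every $M\in\mathcal M[T\cup T_{\ell\text{-Hypergraph}}]$ whose hypergraph part is complete, $\xi(M)=(\phi\otimes\psi)(M)$. $\mathrm{UInduce}[0]$ holds for all $\phi$. *)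

theory Defs
  imports
    "HOL-Probability.Probability"
    "HOL-Combinatorics.Permutations"
    "HOL-Library.Extended_Nat"
begin

section \<open>Languages, universal theories and their models\<close>

text \<open>Quantifier-free formulas over predicate symbols \<open>'p\<close>; variables are natural numbers.\<close>

datatype 'p qf_formula =
    Atom 'p "nat list"
  | Eq nat nat
  | Neg "'p qf_formula"
  | Imp "'p qf_formula" "'p qf_formula"
  | Disj "'p qf_formula list"

record ('p, 'v) fo_struct =
  verts :: "'v set"
  rel :: "'p \<Rightarrow> 'v list set"

fun holds :: "('p, 'v) fo_struct \<Rightarrow> (nat \<Rightarrow> 'v) \<Rightarrow> 'p qf_formula \<Rightarrow> bool" where
  "holds K a (Atom P is) \<longleftrightarrow> map a is \<in> rel K P"
| "holds K a (Eq i j) \<longleftrightarrow> a i = a j"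
| "holds K a (Neg f) \<longleftrightarrow> \<not> holds K a f"
| "holds K a (Imp f g) \<longleftrightarrow> (holds K a f \<longrightarrow> holds K a g)"
| "holds K a (Disj fs) \<longleftrightarrow> (\<exists>f\<in>set fs. holds K a f)"

text \<open>A universal theory is given by its language and by the quantifier-free matrices of its
  axioms; each member of \<open>axs T\<close> stands for its universal closure.\<close>

record 'p univ_theory =
  symbols :: "'p set"
  arity :: "'p \<Rightarrow> nat"
  axs :: "'p qf_formula set"

fun wf_formula :: "'p univ_theory \<Rightarrow> 'p qf_formula \<Rightarrow> bool" where
  "wf_formula T (Atom P is) \<longleftrightarrow> P \<in> symbols T \<and> length is = arity T P"
| "wf_formula T (Eq i j) \<longleftrightarrow> True"
| "wf_formula T (Neg f) \<longleftrightarrow> wf_formula T f"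
| "wf_formula T (Imp f g) \<longleftrightarrow> wf_formula T f \<and> wf_formula T g"
| "wf_formula T (Disj fs) \<longleftrightarrow> (\<forall>f\<in>set fs. wf_formula T f)"

definition canonical_axiom :: "'p \<Rightarrow> nat \<Rightarrow> 'p qf_formula" where
  "canonical_axiom P k =
     Imp (Disj [Eq i j. j \<leftarrow> [0..<k], i \<leftarrow> [0..<j]]) (Neg (Atom P [0..<k]))"

definition canonical_theory :: "'p univ_theory \<Rightarrow> bool" where
  "canonical_theory T \<longleftrightarrow>
     finite (symbols T) \<and> (\<forall>P\<in>symbols T. arity T P \<ge> 1) \<and>
     (\<forall>f\<in>axs T. wf_formula T f) \<and>
     (\<forall>P\<in>symbols T. canonical_axiom P (arity T P) \<in> axs T)"

definition disjoint_union :: "'p univ_theory \<Rightarrow> 'q univ_theory \<Rightarrow> ('p + 'q) univ_theory" where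
  "disjoint_union T1 T2 =
     \<lparr> symbols = symbols T1 <+> symbols T2,
       arity = case_sum (arity T1) (arity T2),
       axs = map_qf_formula Inl ` axs T1 \<union> map_qf_formula Inr ` axs T2 \<rparr>"

definition hypergraph_theory :: "nat \<Rightarrow> nat univ_theory" where
  "hypergraph_theory l =
     \<lparr> symbols = {0},
       arity = (\<lambda>_. l),
       axs = insert (canonical_axiom 0 l)
               {Imp (Atom 0 [0..<l]) (Atom 0 (map s [0..<l])) | s. s permutes {..<l}} \<rparr>"

lemma canonical_disjoint_union:
  assumes "canonical_theory T1" "canonical_theory T2"
  shows "canonical_theory (disjoint_union T1 T2)"
proof -
  have wf1: "wf_formula (disjoint_union T1 T2) (map_qf_formula Inl f)" if "wf_formula T1 f" for f
    using that by (induction f) (auto simp: disjoint_union_def)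
  have wf2: "wf_formula (disjoint_union T1 T2) (map_qf_formula Inr f)" if "wf_formula T2 f" for f
    using that by (induction f) (auto simp: disjoint_union_def)
  have ca: "map_qf_formula h (canonical_axiom P k) = canonical_axiom (h P) k"
    for h :: "'c \<Rightarrow> 'd" and P k
    by (simp add: canonical_axiom_def map_concat comp_def)
  show ?thesis
    using assms wf1 wf2 unfolding canonical_theory_def
    by (auto simp: disjoint_union_def simp flip: ca)
qed

lemma canonical_hypergraph_theory: "l \<ge> 1 \<Longrightarrow> canonical_theory (hypergraph_theory l)"
  by (auto simp: canonical_theory_def hypergraph_theory_def canonical_axiom_def)

text \<open>Relations of symbols outside the language are required to be empty, so that a structure is
  determined by its vertex set and the relations of the language.\<close>

definition models :: "'p univ_theory \<Rightarrow> 'v set \<Rightarrow> ('p, 'v) fo_struct set" where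
  "models T V = {K. verts K = V \<and>
     (\<forall>P\<in>symbols T. rel K P \<subseteq> {xs. length xs = arity T P \<and> set xs \<subseteq> V}) \<and>
     (\<forall>P. P \<notin> symbols T \<longrightarrow> rel K P = {}) \<and>
     (\<forall>f\<in>axs T. \<forall>a. range a \<subseteq> V \<longrightarrow> holds K a f)}"

definition induced :: "('p, 'v) fo_struct \<Rightarrow> 'v set \<Rightarrow> ('p, 'v) fo_struct" where
  "induced K U = \<lparr> verts = U, rel = (\<lambda>P. {xs \<in> rel K P. set xs \<subseteq> U}) \<rparr>"

definition struct_iso :: "('p, 'v) fo_struct \<Rightarrow> ('p, 'w) fo_struct \<Rightarrow> bool" where
  "struct_iso K K' \<longleftrightarrow>
     (\<exists>f. bij_betw f (verts K) (verts K') \<and> (\<forall>P. rel K' P = map f ` rel K P))"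

definition automorphisms :: "('p, 'v) fo_struct \<Rightarrow> ('v \<Rightarrow> 'v) set" where
  "automorphisms K = {f. f permutes verts K \<and> (\<forall>P. rel K P = map f ` rel K P)}"

text \<open>Isomorphism classes are taken among structures whose vertices are natural numbers, and
  \<open>{..<n}\<close> plays the role of \<open>[n]\<close>.\<close>

type_synonym 'p iso_class = "('p, nat) fo_struct set"

definition iso_class :: "('p, nat) fo_struct \<Rightarrow> 'p iso_class" where
  "iso_class K = {K'. struct_iso K K'}"

definition class_rep :: "'p iso_class \<Rightarrow> ('p, nat) fo_struct" where
  "class_rep C = (SOME K. K \<in> C)"

definition class_size :: "'p iso_class \<Rightarrow> nat" where
  "class_size C = card (verts (class_rep C))"

definition model_classes_n :: "'p univ_theory \<Rightarrow> nat \<Rightarrow> 'p iso_class set" where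
  "model_classes_n T n = iso_class ` models T {..<n}"

definition model_classes :: "'p univ_theory \<Rightarrow> 'p iso_class set" where
  "model_classes T = (\<Union>n. model_classes_n T n)"

section \<open>Limit objects\<close>

definition induced_density :: "'p iso_class \<Rightarrow> ('p, nat) fo_struct \<Rightarrow> real" where
  "induced_density C N =
     real (card {U. U \<subseteq> verts N \<and> card U = class_size C \<and> induced N U \<in> C})
       / real (card (verts N) choose class_size C)"

definition Hom_plus :: "'p univ_theory \<Rightarrow> ('p iso_class \<Rightarrow> real) set" where
  "Hom_plus T = {\<phi> \<in> model_classes T \<rightarrow>\<^sub>E {0..1}.
     \<exists>N :: nat \<Rightarrow> ('p, nat) fo_struct.
       (\<forall>n. finite (verts (N n)) \<and> N n \<in> models T (verts (N n))) \<and>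
       strict_mono (\<lambda>n. card (verts (N n))) \<and>
       (\<forall>C\<in>model_classes T. (\<lambda>n. induced_density C (N n)) \<longlonglongrightarrow> \<phi> C)}"

text \<open>The value of \<open>\<phi>\<close> at a labelled model, written \<open>\<phi>(\<langle>K\<rangle>)\<close>.\<close>

definition labelled :: "('p iso_class \<Rightarrow> real) \<Rightarrow> ('p, nat) fo_struct \<Rightarrow> real" where
  "labelled \<phi> K = real (card (automorphisms K)) / fact (card (verts K)) * \<phi> (iso_class K)"

section \<open>Open interpretations and couplings\<close>

text \<open>\<open>I P\<close> is a formula in the variables \<open>0, \<dots>, arity T P - 1\<close>.\<close>

definition interp :: "'p univ_theory \<Rightarrow> ('p \<Rightarrow> 'q qf_formula) \<Rightarrow>
    ('q, 'v) fo_struct \<Rightarrow> ('p, 'v) fo_struct" where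
  "interp T I K = \<lparr> verts = verts K,
     rel = (\<lambda>P. if P \<in> symbols T
                then {xs. length xs = arity T P \<and> set xs \<subseteq> verts K \<and> holds K (\<lambda>i. xs ! i) (I P)}
                else {}) \<rparr>"

definition interp_limit :: "'p univ_theory \<Rightarrow> 'q univ_theory \<Rightarrow> ('p \<Rightarrow> 'q qf_formula) \<Rightarrow>
    ('q iso_class \<Rightarrow> real) \<Rightarrow> 'p iso_class \<Rightarrow> real" where
  "interp_limit T1 T2 I \<phi> =
     (\<lambda>C\<in>model_classes T1. \<Sum>D | D \<in> model_classes T2 \<and> (\<exists>K\<in>D. interp T1 I K \<in> C). \<phi> D)"

definition erase_left :: "'p univ_theory \<Rightarrow> 'p \<Rightarrow> ('p + 'q) qf_formula" where
  "erase_left T1 P = Atom (Inl P) [0..<arity T1 P]"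

definition erase_right :: "'q univ_theory \<Rightarrow> 'q \<Rightarrow> ('p + 'q) qf_formula" where
  "erase_right T2 P = Atom (Inr P) [0..<arity T2 P]"

definition is_coupling :: "'p univ_theory \<Rightarrow> 'q univ_theory \<Rightarrow> ('p iso_class \<Rightarrow> real) \<Rightarrow>
    ('q iso_class \<Rightarrow> real) \<Rightarrow> (('p + 'q) iso_class \<Rightarrow> real) \<Rightarrow> bool" where
  "is_coupling T1 T2 \<phi>1 \<phi>2 \<xi> \<longleftrightarrow>
     \<xi> \<in> Hom_plus (disjoint_union T1 T2) \<and>
     interp_limit T1 (disjoint_union T1 T2) (erase_left T1) \<xi> = \<phi>1 \<and>
     interp_limit T2 (disjoint_union T1 T2) (erase_right T2) \<xi> = \<phi>2"

text \<open>The independent coupling is prescribed on labelled models; its value on a class is recovered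
  by inverting the factor in \<open>labelled\<close> (the result does not depend on the representative).\<close>

definition indep_coupling :: "'p univ_theory \<Rightarrow> 'q univ_theory \<Rightarrow> ('p iso_class \<Rightarrow> real) \<Rightarrow>
    ('q iso_class \<Rightarrow> real) \<Rightarrow> ('p + 'q) iso_class \<Rightarrow> real" where
  "indep_coupling T1 T2 \<phi>1 \<phi>2 =
     (\<lambda>C\<in>model_classes (disjoint_union T1 T2).
        let K = class_rep C in
          fact (card (verts K)) / real (card (automorphisms K)) *
          (labelled \<phi>1 (interp T1 (erase_left T1) K) *
           labelled \<phi>2 (interp T2 (erase_right T2) K)))"

definition uniquely_coupleable :: "'p univ_theory \<Rightarrow> 'q univ_theory \<Rightarrow>
    ('p iso_class \<Rightarrow> real) \<Rightarrow> ('q iso_class \<Rightarrow> real) \<Rightarrow> bool" where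
  "uniquely_coupleable T1 T2 \<phi>1 \<phi>2 \<longleftrightarrow>
     {\<xi>. is_coupling T1 T2 \<phi>1 \<phi>2 \<xi>} = {indep_coupling T1 T2 \<phi>1 \<phi>2}"

section \<open>Theons\<close>

definition atomless_complete_prob_space :: "'x measure \<Rightarrow> bool" where
  "atomless_complete_prob_space \<Omega> \<longleftrightarrow> prob_space \<Omega> \<and> complete_measure \<Omega> \<and>
     (\<forall>A\<in>sets \<Omega>. measure \<Omega> A > 0 \<longrightarrow>
        (\<exists>B\<in>sets \<Omega>. B \<subseteq> A \<and> 0 < measure \<Omega> B \<and> measure \<Omega> B < measure \<Omega> A))"

definition fin_subsets :: "'v set \<Rightarrow> 'v set set" where
  "fin_subsets V = {A. A \<subseteq> V \<and> finite A \<and> A \<noteq> {}}"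

definition fin_subsets_le :: "'v set \<Rightarrow> nat \<Rightarrow> 'v set set" where
  "fin_subsets_le V l = {A \<in> fin_subsets V. card A \<le> l}"

definition fin_subsets_gt :: "'v set \<Rightarrow> nat \<Rightarrow> 'v set set" where
  "fin_subsets_gt V l = {A \<in> fin_subsets V. card A > l}"

text \<open>The completed product measure on \<open>X\<close> to the power of \<open>fin_subsets V\<close>.\<close>

definition E_space :: "'x measure \<Rightarrow> 'v set \<Rightarrow> ('v set \<Rightarrow> 'x) measure" where
  "E_space \<Omega> V = completion (\<Pi>\<^sub>M A\<in>fin_subsets V. \<Omega>)"

text \<open>An injection \<open>\<alpha>\<close> from \<open>{..<k}\<close> is given as a distinct list of length \<open>k\<close>.\<close>

definition pull_back :: "'v list \<Rightarrow> ('v set \<Rightarrow> 'x) \<Rightarrow> nat set \<Rightarrow> 'x" where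
  "pull_back \<alpha> x = (\<lambda>A\<in>fin_subsets {..<length \<alpha>}. x ((\<lambda>i. \<alpha> ! i) ` A))"

definition theon_struct :: "'p univ_theory \<Rightarrow> ('p \<Rightarrow> (nat set \<Rightarrow> 'x) set) \<Rightarrow>
    (nat set \<Rightarrow> 'x) \<Rightarrow> ('p, nat) fo_struct" where
  "theon_struct T \<N> \<theta> = \<lparr> verts = UNIV,
     rel = (\<lambda>P. if P \<in> symbols T
                then {\<alpha>. length \<alpha> = arity T P \<and> distinct \<alpha> \<and> pull_back \<alpha> \<theta> \<in> \<N> P}
                else {}) \<rparr>"

definition is_theon :: "'p univ_theory \<Rightarrow> 'x measure \<Rightarrow> ('p \<Rightarrow> (nat set \<Rightarrow> 'x) set) \<Rightarrow> bool" where
  "is_theon T \<Omega> \<N> \<longleftrightarrow> atomless_complete_prob_space \<Omega> \<and>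
     (\<forall>P\<in>symbols T. \<N> P \<in> sets (E_space \<Omega> {..<arity T P})) \<and>
     (AE \<theta> in E_space \<Omega> UNIV. theon_struct T \<N> \<theta> \<in> models T UNIV)"

definition theon_limit :: "'p univ_theory \<Rightarrow> 'x measure \<Rightarrow> ('p \<Rightarrow> (nat set \<Rightarrow> 'x) set) \<Rightarrow>
    'p iso_class \<Rightarrow> real" where
  "theon_limit T \<Omega> \<N> = (\<lambda>C\<in>model_classes T.
     measure (E_space \<Omega> UNIV)
       {\<theta> \<in> space (E_space \<Omega> UNIV). induced (theon_struct T \<N> \<theta>) {..<class_size C} \<in> C})"

text \<open>In the next two definitions the two factors of the product are identified with the
  restrictions of \<open>x\<close> to the small and to the large subsets of \<open>{..<k}\<close>.\<close>

definition peon_rank_le :: "'x measure \<Rightarrow> nat \<Rightarrow> (nat set \<Rightarrow> 'x) set \<Rightarrow> nat \<Rightarrow> bool" where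
  "peon_rank_le \<Omega> k N r \<longleftrightarrow>
     (\<exists>H \<subseteq> fin_subsets_le {..<k} r \<rightarrow>\<^sub>E space \<Omega>.
        N = {x \<in> fin_subsets {..<k} \<rightarrow>\<^sub>E space \<Omega>. restrict x (fin_subsets_le {..<k} r) \<in> H})"

definition peon_independent :: "'x measure \<Rightarrow> nat \<Rightarrow> (nat set \<Rightarrow> 'x) set \<Rightarrow> nat \<Rightarrow> bool" where
  "peon_independent \<Omega> k N l \<longleftrightarrow>
     (\<exists>H \<subseteq> fin_subsets_gt {..<k} l \<rightarrow>\<^sub>E space \<Omega>.
        N = {x \<in> fin_subsets {..<k} \<rightarrow>\<^sub>E space \<Omega>. restrict x (fin_subsets_gt {..<k} l) \<in> H})"

definition peon_rank :: "'x measure \<Rightarrow> nat \<Rightarrow> (nat set \<Rightarrow> 'x) set \<Rightarrow> nat" where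
  "peon_rank \<Omega> k N = (LEAST r. peon_rank_le \<Omega> k N r)"

definition theon_rank :: "'p univ_theory \<Rightarrow> 'x measure \<Rightarrow> ('p \<Rightarrow> (nat set \<Rightarrow> 'x) set) \<Rightarrow> enat" where
  "theon_rank T \<Omega> \<N> = (SUP P\<in>symbols T. enat (peon_rank \<Omega> (arity T P) (\<N> P)))"

text \<open>HOL cannot quantify over the type of points of \<open>\<Omega>\<close> inside a formula, so this type is a
  parameter of every notion that quantifies over theons.  The infimum over \<open>enat\<close> is attained
  whenever some theon over a space with points in \<open>'x\<close> represents \<open>\<phi>\<close>, and it is \<open>\<infinity>\<close> otherwise;
  the latter happens in particular when \<open>'x\<close> carries no atomless probability space (e.g. when
  \<open>'x\<close> is finite), so theorems assuming \<open>UCouple TYPE('x)\<close> should exclude that case.\<close>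

definition limit_rank :: "'x itself \<Rightarrow> 'p univ_theory \<Rightarrow> ('p iso_class \<Rightarrow> real) \<Rightarrow> enat" where
  "limit_rank _ T \<phi> =
     Inf {theon_rank T \<Omega> \<N> | (\<Omega> :: 'x measure) \<N>. is_theon T \<Omega> \<N> \<and> theon_limit T \<Omega> \<N> = \<phi>}"

section \<open>The quasirandomness properties\<close>

definition Independence :: "'x itself \<Rightarrow> nat \<Rightarrow> 'p univ_theory \<Rightarrow> ('p iso_class \<Rightarrow> real) \<Rightarrow> bool" where
  "Independence _ l T \<phi> \<longleftrightarrow>
     (\<exists>(\<Omega> :: 'x measure) \<N>. is_theon T \<Omega> \<N> \<and> theon_limit T \<Omega> \<N> = \<phi> \<and>
        (\<forall>P\<in>symbols T. peon_independent \<Omega> (arity T P) (\<N> P) l))"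

text \<open>Every finite language is a renaming of one whose symbols are natural numbers, so \<open>T'\<close>
  ranges over all canonical theories up to the names of the symbols.\<close>

definition UCouple :: "'x itself \<Rightarrow> nat \<Rightarrow> 'p univ_theory \<Rightarrow> ('p iso_class \<Rightarrow> real) \<Rightarrow> bool" where
  "UCouple X l T \<phi> \<longleftrightarrow>
     (\<forall>(T' :: nat univ_theory) \<psi>. canonical_theory T' \<longrightarrow> \<psi> \<in> Hom_plus T' \<longrightarrow>
        limit_rank X T' \<psi> \<le> enat l \<longrightarrow> uniquely_coupleable T T' \<phi> \<psi>)"

definition complete_hypergraph :: "nat \<Rightarrow> (nat, 'v) fo_struct \<Rightarrow> bool" where
  "complete_hypergraph l H \<longleftrightarrow>
     rel H 0 = {xs. length xs = l \<and> distinct xs \<and> set xs \<subseteq> verts H}"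

definition UInduce :: "nat \<Rightarrow> 'p univ_theory \<Rightarrow> ('p iso_class \<Rightarrow> real) \<Rightarrow> bool" where
  "UInduce l T \<phi> \<longleftrightarrow> l = 0 \<or>
     (let H = hypergraph_theory l in
       \<forall>\<psi>\<in>Hom_plus H. \<forall>\<xi>. is_coupling T H \<phi> \<psi> \<xi> \<longrightarrow>
         (\<forall>C\<in>model_classes (disjoint_union T H).
            (\<forall>K\<in>C. complete_hypergraph l (interp H (erase_right H) K)) \<longrightarrow>
            \<xi> C = indep_coupling T H \<phi> \<psi> C))"

end

theory Submission
  imports Defs
begin

text \<open>
  \<open>Independence\<close> implies \<open>UCouple\<close>: a coupling of \<open>\<phi>\<close> with a limit \<open>\<psi>\<close> of rank at most \<open>l\<close> is an
  exchangeable law.  Evaluate it on about \<open>n ^ (l + 1)\<close> copies of the vertex set that pairwise share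
  at most \<open>l\<close> vertices.  The \<open>\<phi>\<close>-parts on these copies are independent, because they only depend
  on variables indexed by more than \<open>l\<close> vertices, whereas the \<open>\<psi>\<close>-parts are determined by only
  \<open>O(n ^ l)\<close> variables.  After discretising the latter, Hoeffding's inequality and a union bound show
  that no pattern of \<open>\<psi>\<close>-parts can be correlated with the \<open>\<phi>\<close>-parts.

  \<open>UCouple\<close> implies \<open>UInduce\<close>: it suffices that every limit of \<open>l\<close>-uniform hypergraphs has rank at
  most \<open>l\<close>, which is the Aldous--Hoover representation.  Half of the vertices of an exchangeable
  random hypergraph are used as auxiliary randomness.  Conditionally on the layers at proper
  subsets of \<open>A\<close>, the layer at \<open>A\<close> is independent of all layers at sets not containing \<open>A\<close>, so they can be
  simulated one after the other from independent uniform variables.  The dissociation of \<open>\<psi>\<close> makes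
  the layer at the empty set independent of the hypergraph and allows it to be frozen.
\<close>

section \<open>Consistent and dissociated laws\<close>

text \<open>Couplings are never represented by theons. A limit object is replaced by the family of
  its laws on labelled models with \<open>m\<close> vertices, and such families are characterised by
  consistency and dissociation. A coupling can thus be glued with auxiliary random patterns on a
  finite vertex set, and the independent coupling is seen to be a limit itself, which unique
  coupleability also asserts. The exponent \<open>l + 1\<close> comes from the union bound:
  Hoeffding's inequality over \<open>n ^ (l + 1)\<close> samples fails with probability
  exponentially small in \<open>n ^ (l + 1)\<close>, whereas \<open>O(n ^ l)\<close> discretised
  variables have only \<open>exp (O(n ^ l))\<close> patterns. In the second half the obstacle is
  that a single peon has to serve all tuples of vertices. Conditional laws are determined only
  almost everywhere, so they are made equivariant and repaired to genuine laws at every point before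
  the recursion uses them. The rank refers to theons whose points have a prescribed type, so the
  recursion is driven by a uniform variable constructed on the given space.\<close>

definition inj_maps :: "nat \<Rightarrow> 'v set \<Rightarrow> (nat \<Rightarrow> 'v) set" where
  "inj_maps m V = {x \<in> {..<m} \<rightarrow>\<^sub>E V. inj_on x {..<m}}"

text \<open>A sample is recorded as a structure on the fixed vertex set \<open>{..<m}\<close>, so
  that copies of \<open>K\<close> are counted by the equation \<open>pullback m x N = K\<close>
  instead of by isomorphism classes. The map \<open>x\<close> may be any function; only its values
  below \<open>m\<close> count.\<close>

definition pullback :: "nat \<Rightarrow> (nat \<Rightarrow> 'v) \<Rightarrow> ('p, 'v) fo_struct \<Rightarrow> ('p, nat) fo_struct" where
  "pullback m x K = \<lparr> verts = {..<m}, rel = (\<lambda>P. {ys. set ys \<subseteq> {..<m} \<and> map x ys \<in> rel K P}) \<rparr>"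

text \<open>\<open>struct_iso\<close> controls its bijection on the vertices only. On structures
  with tuples outside \<open>verts\<close> it need not be symmetric, and restricting a map to the
  vertices could change the image of a relation.\<close>

definition wf_struct :: "('p, 'v) fo_struct \<Rightarrow> bool" where
  "wf_struct K \<longleftrightarrow> (\<forall>P. \<forall>ys\<in>rel K P. set ys \<subseteq> verts K)"

definition iso_maps :: "('p, 'v) fo_struct \<Rightarrow> ('p, 'w) fo_struct \<Rightarrow> ('v \<Rightarrow> 'w) set" where
  "iso_maps K K' = {f \<in> verts K \<rightarrow>\<^sub>E verts K'. bij_betw f (verts K) (verts K') \<and>
     (\<forall>P. rel K' P = map f ` rel K P)}"

lemma verts_pullback [simp]: "verts (pullback m x K) = {..<m}"
  by (simp add: pullback_def)

lemma verts_induced [simp]: "verts (induced K U) = U"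
  by (simp add: induced_def)

lemma finite_inj_maps [simp]: "finite V \<Longrightarrow> finite (inj_maps m V)"
  unfolding inj_maps_def by (rule finite_subset[of _ "{..<m} \<rightarrow>\<^sub>E V"]) (auto intro: finite_PiE)

lemma wf_struct_pullback [simp]: "wf_struct (pullback m x K)"
  by (auto simp: wf_struct_def pullback_def)

lemma wf_struct_induced [simp]: "wf_struct (induced K U)"
  by (auto simp: wf_struct_def induced_def)

lemma verts_models: "K \<in> models T V \<Longrightarrow> verts K = V"
  by (simp add: models_def)

lemma wf_struct_models: "K \<in> models T V \<Longrightarrow> wf_struct K"
  unfolding wf_struct_def models_def by blast

lemma fo_struct_eqI:
  fixes K K' :: "('p, 'v) fo_struct"
  shows "verts K = verts K' \<Longrightarrow> (\<And>P. rel K P = rel K' P) \<Longrightarrow> K = K'"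
  by (cases K, cases K') auto

lemma pullback_cong:
  assumes "\<And>i. i < m \<Longrightarrow> x i = x' i"
  shows "pullback m x K = pullback m x' K"
proof -
  have "set ys \<subseteq> {..<m} \<and> map x ys \<in> R \<longleftrightarrow> set ys \<subseteq> {..<m} \<and> map x' ys \<in> R" for ys R
    using assms map_cong[of ys ys x x'] by (metis lessThan_iff subsetD)
  then show ?thesis by (simp add: pullback_def)
qed

lemma pullback_pullback:
  assumes "\<And>i. i < m \<Longrightarrow> y i < n"
  shows "pullback m y (pullback n x K) = pullback m (x \<circ> y) K"
  using assms by (auto simp: pullback_def fun_eq_iff)

lemma pullback_id: "wf_struct K \<Longrightarrow> verts K = {..<m} \<Longrightarrow> pullback m id K = K"
  by (intro fo_struct_eqI) (auto simp: pullback_def wf_struct_def)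

lemma holds_pullback:
  assumes "inj_on x {..<m}" "range a \<subseteq> {..<m}"
  shows "holds (pullback m x K) a f \<longleftrightarrow> holds K (x \<circ> a) f"
proof (induction f)
  case (Atom P js)
  have "set (map a js) \<subseteq> {..<m}" using assms by auto
  then show ?case by (simp add: pullback_def comp_def)
next
  case (Eq i j)
  have "a i \<in> {..<m}" "a j \<in> {..<m}" using assms by auto
  then show ?case using assms(1) by (auto dest: inj_onD)
qed auto

lemma pullback_models:
  assumes K: "K \<in> models T V" and x: "x \<in> {..<m} \<rightarrow> V" "inj_on x {..<m}"
  shows "pullback m x K \<in> models T {..<m}"
proof -
  have "holds (pullback m x K) a f" if "f \<in> axs T" "range a \<subseteq> {..<m}" for a f
  proof -
    have "range (x \<circ> a) \<subseteq> V" using that x by auto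
    then have "holds K (x \<circ> a) f" using K that by (auto simp: models_def)
    then show ?thesis using holds_pullback[OF x(2) that(2)] by blast
  qed
  moreover have "rel (pullback m x K) P \<subseteq> {xs. length xs = arity T P \<and> set xs \<subseteq> {..<m}}"
    if "P \<in> symbols T" for P
    using K that by (fastforce simp: models_def pullback_def)
  moreover have "rel (pullback m x K) P = {}" if "P \<notin> symbols T" for P
    using K that by (auto simp: models_def pullback_def)
  ultimately show ?thesis by (auto simp: models_def)
qed

lemma inj_mapsD:
  assumes "x \<in> inj_maps m V"
  shows "x \<in> {..<m} \<rightarrow>\<^sub>E V" "x \<in> {..<m} \<rightarrow> V" "inj_on x {..<m}" "\<And>i. i < m \<Longrightarrow> x i \<in> V"
  using assms by (auto simp: inj_maps_def)

lemma pullback_inj_maps_models: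
  "K \<in> models T V \<Longrightarrow> x \<in> inj_maps m V \<Longrightarrow> pullback m x K \<in> models T {..<m}"
  using pullback_models inj_mapsD(2,3) by metis

section \<open>Isomorphisms as extensional maps\<close>

lemma wf_struct_map_cong:
  assumes "wf_struct K" "\<And>v. v \<in> verts K \<Longrightarrow> f v = g v"
  shows "map f ` rel K P = map g ` rel K P"
proof (rule image_cong)
  fix ys assume "ys \<in> rel K P"
  then have "set ys \<subseteq> verts K" using assms by (auto simp: wf_struct_def)
  then show "map f ys = map g ys" using assms(2) by auto
qed simp

lemma struct_iso_iff: 
  assumes "wf_struct K"
  shows "struct_iso K K' \<longleftrightarrow> iso_maps K K' \<noteq> {}"
proof
  assume "struct_iso K K'"
  then obtain f where f: "bij_betw f (verts K) (verts K')" "\<And>P. rel K' P = map f ` rel K P"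
    by (auto simp: struct_iso_def)
  have "map (restrict f (verts K)) ` rel K P = map f ` rel K P" for P
    by (rule wf_struct_map_cong[OF assms]) auto
  then have "restrict f (verts K) \<in> iso_maps K K'"
    using f by (auto simp: iso_maps_def bij_betw_def)
  then show "iso_maps K K' \<noteq> {}" by auto
next
  assume "iso_maps K K' \<noteq> {}"
  then show "struct_iso K K'" by (auto simp: struct_iso_def iso_maps_def)
qed

lemma iso_maps_comp:
  assumes "wf_struct K" "f \<in> iso_maps K K'" "g \<in> iso_maps K' K''"
  shows "restrict (g \<circ> f) (verts K) \<in> iso_maps K K''"
proof -
  have "map (restrict (g \<circ> f) (verts K)) ` rel K P = map (g \<circ> f) ` rel K P" for P
    by (rule wf_struct_map_cong[OF assms(1)]) auto
  then have "map (restrict (g \<circ> f) (verts K)) ` rel K P = map g ` map f ` rel K P" for P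
    by (simp add: image_image)
  moreover have "bij_betw (restrict (g \<circ> f) (verts K)) (verts K) (verts K'')"
    using assms bij_betw_trans[of f "verts K" "verts K'" g "verts K''"]
    by (auto simp: iso_maps_def bij_betw_def)
  ultimately show ?thesis using assms by (auto simp: iso_maps_def PiE_iff)
qed

lemma iso_maps_inv:
  assumes "wf_struct K" "f \<in> iso_maps K K'"
  shows "restrict (inv_into (verts K) f) (verts K') \<in> iso_maps K' K"
proof -
  let ?g = "restrict (inv_into (verts K) f) (verts K')"
  have f: "bij_betw f (verts K) (verts K')" "\<And>P. rel K' P = map f ` rel K P"
    using assms by (auto simp: iso_maps_def)
  have "map (?g \<circ> f) ` rel K P = map id ` rel K P" for P
    by (rule wf_struct_map_cong[OF assms(1)]) (use f(1) in \<open>auto simp: bij_betw_def\<close>)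
  then have "map ?g ` rel K' P = rel K P" for P
    unfolding f(2) by (simp add: image_image)
  moreover have "bij_betw ?g (verts K') (verts K)"
    using bij_betw_inv_into[OF f(1)] by (auto simp: bij_betw_def)
  ultimately show ?thesis by (auto simp: iso_maps_def bij_betw_def)
qed

lemma card_self_iso_maps:
  assumes "wf_struct K"
  shows "card (iso_maps K K) = card (automorphisms K)"
proof -
  have "bij_betw (\<lambda>g. restrict g (verts K)) (automorphisms K) (iso_maps K K)"
  proof (rule bij_betwI[where g = "\<lambda>g v. if v \<in> verts K then g v else v"], goal_cases)
    case 1
    show ?case
    proof
      fix g assume g: "g \<in> automorphisms K"
      have "map (restrict g (verts K)) ` rel K P = map g ` rel K P" for P
        by (rule wf_struct_map_cong[OF assms]) auto
      moreover have "bij_betw (restrict g (verts K)) (verts K) (verts K)"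
        using g permutes_imp_bij[of g "verts K"] by (auto simp: automorphisms_def bij_betw_def)
      ultimately show "restrict g (verts K) \<in> iso_maps K K"
        using g by (auto simp: iso_maps_def automorphisms_def permutes_in_image)
    qed
  next
    case 2
    show ?case
    proof
      fix g assume g: "g \<in> iso_maps K K"
      let ?h = "\<lambda>v. if v \<in> verts K then g v else v"
      have "map ?h ` rel K P = map g ` rel K P" for P
        by (rule wf_struct_map_cong[OF assms]) auto
      moreover have "?h permutes verts K"
      proof (rule bij_imp_permutes)
        have "bij_betw g (verts K) (verts K)" using g by (auto simp: iso_maps_def)
        then show "bij_betw ?h (verts K) (verts K)" by (subst bij_betw_cong[of _ _ g]) auto
      qed auto
      ultimately show "?h \<in> automorphisms K"
        using g by (auto simp: iso_maps_def automorphisms_def)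
    qed
  next
    case (3 g)
    then show ?case by (auto simp: automorphisms_def permutes_def)
  next
    case (4 g)
    then show ?case by (auto simp: iso_maps_def PiE_iff extensional_def)
  qed
  then show ?thesis by (metis bij_betw_same_card)
qed

lemma card_iso_maps_cong:
  assumes wf: "wf_struct K" "wf_struct K'" and f: "f \<in> iso_maps K K'"
    and L: "wf_struct L"
  shows "card (iso_maps K' L) = card (iso_maps K L)" "card (iso_maps L K') = card (iso_maps L K)"
proof -
  define g where "g = restrict (inv_into (verts K) f) (verts K')"
  have g: "g \<in> iso_maps K' K" using iso_maps_inv[OF wf(1) f] by (simp add: g_def)
  have fb: "bij_betw f (verts K) (verts K')" using f by (auto simp: iso_maps_def)
  have gf: "g (f v) = v" if "v \<in> verts K" for v
    using fb that by (auto simp: bij_betw_def g_def)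
  have fg: "f (g v) = v" if "v \<in> verts K'" for v
    using fb that by (auto simp: bij_betw_def f_inv_into_f g_def)
  have fin: "f v \<in> verts K'" if "v \<in> verts K" for v using f that by (auto simp: iso_maps_def)
  have gin: "g v \<in> verts K" if "v \<in> verts K'" for v using g that by (auto simp: iso_maps_def)
  have "bij_betw (\<lambda>h. restrict (h \<circ> f) (verts K)) (iso_maps K' L) (iso_maps K L)"
  proof (rule bij_betwI[where g = "\<lambda>h. restrict (h \<circ> g) (verts K')"], goal_cases)
    case 1 show ?case using iso_maps_comp[OF wf(1) f] by auto
  next
    case 2 show ?case using iso_maps_comp[OF wf(2) g] by auto
  next
    case (3 h) 
    then have "h \<in> extensional (verts K')" by (auto simp: iso_maps_def PiE_iff)
    then show ?case using fg gin fin by (auto simp: fun_eq_iff extensional_def restrict_def)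
  next
    case (4 h) 
    then have "h \<in> extensional (verts K)" by (auto simp: iso_maps_def PiE_iff)
    then show ?case using gf gin fin by (auto simp: fun_eq_iff extensional_def restrict_def)
  qed
  then show "card (iso_maps K' L) = card (iso_maps K L)" by (rule bij_betw_same_card)
  have "bij_betw (\<lambda>h. restrict (g \<circ> h) (verts L)) (iso_maps L K') (iso_maps L K)"
  proof (rule bij_betwI[where g = "\<lambda>h. restrict (f \<circ> h) (verts L)"], goal_cases)
    case 1 show ?case using iso_maps_comp[OF L _ g] by auto
  next
    case 2 show ?case using iso_maps_comp[OF L _ f] by auto
  next
    case (3 h) 
    then have "h \<in> verts L \<rightarrow>\<^sub>E verts K'" by (auto simp: iso_maps_def)
    then show ?case using fg by (auto simp: fun_eq_iff PiE_iff extensional_def restrict_def)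
  next
    case (4 h) 
    then have "h \<in> verts L \<rightarrow>\<^sub>E verts K" by (auto simp: iso_maps_def)
    then show ?case using gf by (auto simp: fun_eq_iff PiE_iff extensional_def restrict_def)
  qed
  then show "card (iso_maps L K') = card (iso_maps L K)" by (rule bij_betw_same_card)
qed

lemma card_iso_maps:
  assumes "wf_struct K" "wf_struct K'" "struct_iso K K'"
  shows "card (iso_maps K K') = card (automorphisms K)"
    and "card (automorphisms K') = card (automorphisms K)"
  using assms card_iso_maps_cong[OF assms(1,2)] card_self_iso_maps
  by (metis all_not_in_conv struct_iso_iff)+

lemma struct_iso_refl: "struct_iso K K"
  unfolding struct_iso_def by (rule exI[of _ id]) auto

lemma struct_iso_sym: "wf_struct K \<Longrightarrow> struct_iso K K' \<Longrightarrow> struct_iso K' K"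
proof -
  assume wf: "wf_struct K" and "struct_iso K K'"
  then obtain f where "f \<in> iso_maps K K'" using struct_iso_iff by blast
  from iso_maps_inv[OF wf this] show "struct_iso K' K" 
    unfolding struct_iso_def iso_maps_def by blast
qed

lemma struct_iso_trans: "struct_iso K K' \<Longrightarrow> struct_iso K' K'' \<Longrightarrow> struct_iso K K''"
  unfolding struct_iso_def
proof safe
  fix f g assume *: "bij_betw f (verts K) (verts K')" "\<forall>P. rel K' P = map f ` rel K P" 
    "bij_betw g (verts K') (verts K'')" "\<forall>P. rel K'' P = map g ` rel K' P"
  show "\<exists>f. bij_betw f (verts K) (verts K'') \<and> (\<forall>P. rel K'' P = map f ` rel K P)"
    by (rule exI[of _ "g \<circ> f"]) (use * bij_betw_trans in \<open>auto simp: image_image\<close>)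
qed

lemma wf_struct_iso: "wf_struct K \<Longrightarrow> struct_iso K K' \<Longrightarrow> wf_struct K'"
  unfolding struct_iso_def wf_struct_def by (fastforce simp: bij_betw_def)

lemma iso_class_eq: 
  assumes "wf_struct K" "struct_iso K K'"
  shows "iso_class K = iso_class K'"
  using assms struct_iso_sym struct_iso_trans unfolding iso_class_def by blast

lemma class_rep_iso: "struct_iso K (class_rep (iso_class K))"
proof -
  have "K \<in> iso_class K" by (simp add: iso_class_def struct_iso_refl)
  then have "class_rep (iso_class K) \<in> iso_class K" unfolding class_rep_def by (rule someI)
  then show ?thesis by (simp add: iso_class_def)
qed

lemma struct_iso_card: "struct_iso K K' \<Longrightarrow> card (verts K') = card (verts K)"
  unfolding struct_iso_def using bij_betw_same_card by metis

lemma class_size_iso_class: "class_size (iso_class K) = card (verts K)"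
  unfolding class_size_def by (rule struct_iso_card[OF class_rep_iso])

lemma labelled_cong:
  assumes "wf_struct K" "struct_iso K K'"
  shows "labelled \<phi> K' = labelled \<phi> K"
  using assms card_iso_maps(2)[OF assms(1) wf_struct_iso[OF assms]] iso_class_eq struct_iso_card
  unfolding labelled_def by metis

lemma iso_maps_induced_iff:
  assumes "wf_struct K" "verts K = {..<m}" 
  shows "x \<in> iso_maps K (induced N U) \<longleftrightarrow> 
    x \<in> {..<m} \<rightarrow>\<^sub>E U \<and> bij_betw x {..<m} U \<and> pullback m x N = K"
proof -
  have "(\<forall>P. rel (induced N U) P = map x ` rel K P) \<longleftrightarrow> pullback m x N = K"
    if x: "bij_betw x {..<m} U"
  proof -
    have inj: "inj_on x {..<m}" and im: "x ` {..<m} = U" using x by (auto simp: bij_betw_def)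
    have surj: "\<exists>ys. set ys \<subseteq> {..<m} \<and> zs = map x ys" if "set zs \<subseteq> U" for zs
    proof (rule exI[of _ "map (inv_into {..<m} x) zs"], safe)
      show "v < m" if "v \<in> set (map (inv_into {..<m} x) zs)" for v
        using that \<open>set zs \<subseteq> U\<close> im inv_into_into[of _ x "{..<m}"] by auto
      have "map (x \<circ> inv_into {..<m} x) zs = zs"
        using \<open>set zs \<subseteq> U\<close> im by (intro map_idI) (auto simp: f_inv_into_f subset_iff)
      then show "zs = map x (map (inv_into {..<m} x) zs)" by simp
    qed
    have minj: "ys = ys'" if "map x ys = map x ys'" "set ys \<subseteq> {..<m}" "set ys' \<subseteq> {..<m}" for ys ys'
      using that inj by (metis inj_on_map_eq_map inj_on_subset Un_subset_iff)
    have sub: "set (map x ys) \<subseteq> U" if "set ys \<subseteq> {..<m}" for ys using that im by auto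
    show ?thesis
    proof
      assume H: "\<forall>P. rel (induced N U) P = map x ` rel K P"
      show "pullback m x N = K"
      proof (rule fo_struct_eqI)
        fix P
        have HP: "{xs \<in> rel N P. set xs \<subseteq> U} = map x ` rel K P" using H by (simp add: induced_def)
        show "rel (pullback m x N) P = rel K P"
        proof (intro set_eqI iffI)
          fix ys assume "ys \<in> rel (pullback m x N) P"
          then have ys: "set ys \<subseteq> {..<m}" "map x ys \<in> rel N P" by (auto simp: pullback_def)
          then have "map x ys \<in> map x ` rel K P" using HP sub by blast
          then obtain ys' where ys': "ys' \<in> rel K P" "map x ys = map x ys'" by auto
          then have "ys = ys'" using minj ys assms by (auto simp: wf_struct_def)
          then show "ys \<in> rel K P" using ys' by simp
        next
          fix ys assume ys: "ys \<in> rel K P"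
          then have "set ys \<subseteq> {..<m}" using assms by (auto simp: wf_struct_def)
          moreover have "map x ys \<in> rel N P" using HP ys by blast
          ultimately show "ys \<in> rel (pullback m x N) P" by (auto simp: pullback_def)
        qed
      qed (simp add: assms)
    next
      assume H: "pullback m x N = K"
      show "\<forall>P. rel (induced N U) P = map x ` rel K P"
      proof (intro allI set_eqI iffI)
        fix P zs assume "zs \<in> rel (induced N U) P"
        then have zs: "zs \<in> rel N P" "set zs \<subseteq> U" by (auto simp: induced_def)
        with surj obtain ys where "set ys \<subseteq> {..<m}" "zs = map x ys" by blast
        with zs show "zs \<in> map x ` rel K P" unfolding H[symmetric] by (auto simp: pullback_def)
      next
        fix P zs assume "zs \<in> map x ` rel K P"
        then show "zs \<in> rel (induced N U) P" 
          unfolding H[symmetric] using im by (fastforce simp: pullback_def induced_def)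
      qed
    qed
  qed
  then show ?thesis using assms by (auto simp: iso_maps_def)
qed

text \<open>An injection that pulls \<open>N\<close> back to \<open>K\<close> is an isomorphism from
  \<open>K\<close> onto an induced copy, and each copy is the target of one isomorphism per
  automorphism of \<open>K\<close>. This is the origin of the factor
  \<open>card (automorphisms K)\<close> in \<open>labelled\<close>.\<close>

lemma card_pullback_eq:
  assumes K: "wf_struct K" "verts K = {..<m}" and V: "finite V"
  shows "card {x \<in> inj_maps m V. pullback m x N = K} =
    card (automorphisms K) * card {U. U \<subseteq> V \<and> card U = m \<and> induced N U \<in> iso_class K}"
proof -
  let ?\<U> = "{U. U \<subseteq> V \<and> card U = m \<and> induced N U \<in> iso_class K}"
  have eq: "{x \<in> inj_maps m V. pullback m x N = K} = (\<Union>U\<in>?\<U>. iso_maps K (induced N U))"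
  proof (intro set_eqI iffI)
    fix x assume x: "x \<in> {x \<in> inj_maps m V. pullback m x N = K}"
    have "x \<in> iso_maps K (induced N (x ` {..<m}))"
      using x unfolding iso_maps_induced_iff[OF K] 
      by (auto simp: inj_maps_def bij_betw_def)
    moreover from this have "struct_iso K (induced N (x ` {..<m}))"
      using struct_iso_iff[OF K(1)] by blast
    moreover have "x ` {..<m} \<subseteq> V" "card (x ` {..<m}) = m"
      using x by (auto simp: inj_maps_def card_image)
    ultimately show "x \<in> (\<Union>U\<in>?\<U>. iso_maps K (induced N U))"
      by (auto simp: iso_class_def)
  next
    fix x assume "x \<in> (\<Union>U\<in>?\<U>. iso_maps K (induced N U))"
    then show "x \<in> {x \<in> inj_maps m V. pullback m x N = K}"
      by (auto simp: inj_maps_def bij_betw_def iso_maps_induced_iff[OF K] PiE_iff)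
  qed
  have finU: "finite ?\<U>" by (rule finite_subset[of _ "Pow V"]) (use V in auto)
  have "card (\<Union>U\<in>?\<U>. iso_maps K (induced N U)) = (\<Sum>U\<in>?\<U>. card (iso_maps K (induced N U)))"
  proof (rule card_UN_disjoint[OF finU])
    show "\<forall>U\<in>?\<U>. finite (iso_maps K (induced N U))"
    proof
      fix U assume "U \<in> ?\<U>"
      then have "finite U" using V finite_subset by auto
      then show "finite (iso_maps K (induced N U))"
        by (intro rev_finite_subset[OF finite_PiE[of "{..<m}" "\<lambda>_. U"]]) (auto simp: iso_maps_def K)
    qed
    show "\<forall>U\<in>?\<U>. \<forall>U'\<in>?\<U>. U \<noteq> U' \<longrightarrow> iso_maps K (induced N U) \<inter> iso_maps K (induced N U') = {}"
    proof (intro ballI impI equals0I)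
      fix U U' x assume "U \<noteq> U'" and x: "x \<in> iso_maps K (induced N U) \<inter> iso_maps K (induced N U')"
      have "x ` verts K = U" using IntD1[OF x] by (simp add: iso_maps_def bij_betw_def)
      moreover have "x ` verts K = U'" using IntD2[OF x] by (simp add: iso_maps_def bij_betw_def)
      ultimately show False using \<open>U \<noteq> U'\<close> by simp
    qed
  qed
  also have "\<dots> = (\<Sum>U\<in>?\<U>. card (automorphisms K))"
  proof (rule sum.cong[OF refl])
    fix U assume "U \<in> ?\<U>"
    then have "struct_iso K (induced N U)" by (simp add: iso_class_def)
    then show "card (iso_maps K (induced N U)) = card (automorphisms K)"
      using card_iso_maps(1)[OF K(1) wf_struct_induced] by blast
  qed
  finally show ?thesis using eq by simp
qed

text \<open>The preceding count is applied to structures whose only relation is empty: every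
  injection pulls one back to the other, and the automorphism group is the full symmetric
  group.\<close>

lemma card_inj_maps:
  fixes V :: "nat set"
  assumes "finite V"
  shows "card (inj_maps m V) = fact m * (card V choose m)"
proof -
  let ?N = "\<lparr> verts = V, rel = \<lambda>_::unit. {} \<rparr>" and ?K = "\<lparr> verts = {..<m}, rel = \<lambda>_::unit. {} \<rparr>"
  have "card {x \<in> inj_maps m V. pullback m x ?N = ?K} =
     card (automorphisms ?K) * card {U. U \<subseteq> V \<and> card U = m \<and> induced ?N U \<in> iso_class ?K}"
    by (rule card_pullback_eq) (auto simp: wf_struct_def assms)
  also have "{x \<in> inj_maps m V. pullback m x ?N = ?K} = inj_maps m V"
    by (auto simp: pullback_def)
  also have "{U. U \<subseteq> V \<and> card U = m \<and> induced ?N U \<in> iso_class ?K} = {U. U \<subseteq> V \<and> card U = m}"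
  proof -
    have "induced ?N U \<in> iso_class ?K" if "U \<subseteq> V" and m: "card U = m" for U
    proof -
      have "finite U" using that assms finite_subset by auto
      then obtain f where "bij_betw f {..<m} U"
        using m ex_bij_betw_nat_finite[of U] unfolding atLeast0LessThan by blast
      then show ?thesis by (auto simp: iso_class_def struct_iso_def induced_def)
    qed
    then show ?thesis by auto
  qed
  also have "automorphisms ?K = {f. f permutes {..<m}}" by (auto simp: automorphisms_def)
  finally show ?thesis using assms by (simp add: card_permutations[of _ m] n_subsets)
qed

section \<open>Uniformly random injections\<close>

definition sample_density :: "('p, nat) fo_struct \<Rightarrow> ('p, 'v) fo_struct \<Rightarrow> real" where
  "sample_density K N =
     real (card {x \<in> inj_maps (card (verts K)) (verts N). pullback (card (verts K)) x N = K}) /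
     real (card (inj_maps (card (verts K)) (verts N)))"

lemma sample_density_eq_induced_density:
  assumes K: "wf_struct K" "verts K = {..<m}" and N: "finite (verts N)"
  shows "sample_density K N =
    real (card (automorphisms K)) / fact m * induced_density (iso_class K) N"
proof -
  have "card (verts K) = m" using K by simp
  then show ?thesis
    unfolding sample_density_def induced_density_def class_size_iso_class
    by (simp add: card_pullback_eq[OF K N] card_inj_maps[OF N])
qed

lemma card_automorphisms_pos:
  assumes "finite (verts K)"
  shows "0 < card (automorphisms K)"
proof -
  have "id \<in> automorphisms K" by (auto simp: automorphisms_def permutes_id)
  moreover have "finite (automorphisms K)"
    by (rule finite_subset[OF _ finite_permutations[OF assms]]) (auto simp: automorphisms_def)
  ultimately show ?thesis by (auto simp: card_gt_0_iff)
qed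

lemma finite_models:
  assumes "finite (symbols T)" "finite V"
  shows "finite (models T V)"
proof -
  let ?R = "\<lambda>P. {xs. length xs = arity T P \<and> set xs \<subseteq> V}"
  let ?f = "\<lambda>K. restrict (rel K) (symbols T)"
  have fin: "finite (?R P)" for P
    by (rule rev_finite_subset[OF finite_lists_length_eq[OF assms(2), of "arity T P"]]) auto
  have "finite (\<Pi>\<^sub>E P\<in>symbols T. Pow (?R P))"
    using assms(1) fin by (intro finite_PiE) auto
  moreover have "?f ` models T V \<subseteq> (\<Pi>\<^sub>E P\<in>symbols T. Pow (?R P))"
  proof (rule image_subsetI)
    fix K assume "K \<in> models T V"
    then have "\<forall>P\<in>symbols T. rel K P \<subseteq> ?R P" by (simp add: models_def)
    then show "?f K \<in> (\<Pi>\<^sub>E P\<in>symbols T. Pow (?R P))" by simp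
  qed
  moreover have "inj_on ?f (models T V)"
  proof (rule inj_onI)
    fix K K' assume K: "K \<in> models T V" "K' \<in> models T V" and eq: "?f K = ?f K'"
    show "K = K'"
    proof (rule fo_struct_eqI)
      fix P show "rel K P = rel K' P"
        using K fun_cong[OF eq, of P] by (cases "P \<in> symbols T") (auto simp: models_def)
    qed (use K in \<open>auto simp: models_def\<close>)
  qed
  ultimately show ?thesis using finite_imageD[of ?f, OF finite_subset] by blast
qed

lemma card_inj_maps_prod:
  "finite V \<Longrightarrow> card (inj_maps m V) = prod ((-) (card V)) {0..<m}"
  unfolding inj_maps_def using card_inj_on_subset_funcset[of "{..<m}" V "{..<m}"] by simp

lemma inj_maps_restrict_comp:
  assumes "y \<in> inj_maps m {..<n}" "x \<in> inj_maps n V"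
  shows "restrict (x \<circ> y) {..<m} \<in> inj_maps m V"
  using assms unfolding inj_maps_def by (auto simp: inj_on_def PiE_iff)

text \<open>The essential point is that the number of extensions of \<open>z\<close> does not depend
  on \<open>z\<close>. Hence composing a uniformly random injection with \<open>y\<close> again
  gives a uniformly random injection.\<close>

lemma card_inj_maps_fiber:
  assumes V: "finite V" and y: "y \<in> inj_maps m {..<n}" and z: "z \<in> inj_maps m V"
  shows "card {x \<in> inj_maps n V. restrict (x \<circ> y) {..<m} = z} =
    prod ((-) (card V - m)) {0..<n - m}"
proof -
  let ?R = "{..<n} - y ` {..<m}" and ?W = "V - z ` {..<m}"
  have yi: "inj_on y {..<m}" "y ` {..<m} \<subseteq> {..<n}" and zi: "inj_on z {..<m}" "z ` {..<m} \<subseteq> V"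
    using y z by (auto simp: inj_maps_def)
  have cards: "card ?R = n - m" "card ?W = card V - m"
    using V yi zi by (simp_all add: card_Diff_subset card_image)
  \<comment> \<open>An extension of \<open>z\<close> amounts to an injection of the points outside
    the range of \<open>y\<close> into the points outside the range of \<open>z\<close>.\<close>
  let ?F = "{f \<in> ?R \<rightarrow>\<^sub>E ?W. inj_on f ?R}"
  let ?inv = "inv_into {..<m} y"
  let ?glue = "\<lambda>f i. if i \<in> y ` {..<m} then z (?inv i) else f i"
  have inv: "?inv (y i) = i" if "i < m" for i using yi(1) that by simp
  have "bij_betw (\<lambda>x. restrict x ?R) {x \<in> inj_maps n V. restrict (x \<circ> y) {..<m} = z} ?F"
  proof (rule bij_betwI[where g = ?glue], goal_cases)
    case 1
    show ?case
    proof
      fix x assume x: "x \<in> {x \<in> inj_maps n V. restrict (x \<circ> y) {..<m} = z}"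
      then have xi: "inj_on x {..<n}" "x \<in> {..<n} \<rightarrow>\<^sub>E V" by (auto simp: inj_maps_def)
      have zz: "z i = x (y i)" if "i < m" for i using x that by auto
      have "x i \<notin> z ` {..<m}" if "i \<in> ?R" for i
      proof
        assume "x i \<in> z ` {..<m}"
        then obtain k where "k < m" "x i = x (y k)" using zz by auto
        then have "i = y k" using xi(1) that yi(2) by (auto dest: inj_onD)
        then show False using that \<open>k < m\<close> by auto
      qed
      then show "restrict x ?R \<in> ?F" using xi by (auto simp: inj_on_def PiE_iff)
    qed
  next
    case 2
    show ?case
    proof
      fix f assume f: "f \<in> ?F"
      have 1: "?glue f i \<in> V" if "i < n" for i 
        using f that inv zi(2) by (auto simp: PiE_iff)
      have "inj_on (?glue f) (y ` {..<m} \<union> ?R)"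
      proof -
        have "inj_on (?glue f) (y ` {..<m})"
          using zi(1) inv by (auto simp: inj_on_def)
        moreover have "inj_on (?glue f) ?R" using f by (auto simp: inj_on_def)
        moreover have "?glue f ` (y ` {..<m}) \<subseteq> z ` {..<m}" using inv by auto
        moreover have "?glue f ` ?R \<subseteq> ?W" using f by auto
        ultimately show ?thesis unfolding inj_on_Un by blast
      qed
      then have "inj_on (?glue f) {..<n}" using yi(2) by (simp add: Un_absorb1)
      moreover have "?glue f i = undefined" if "\<not> i < n" for i
        using that f yi(2) by (auto simp: PiE_iff extensional_def)
      ultimately have "?glue f \<in> inj_maps n V"
        using 1 by (auto simp: inj_maps_def PiE_iff extensional_def)
      moreover have "restrict (?glue f \<circ> y) {..<m} = z"
        using inv z by (auto simp: fun_eq_iff inj_maps_def PiE_iff extensional_def)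
      ultimately show "?glue f \<in> {x \<in> inj_maps n V. restrict (x \<circ> y) {..<m} = z}" by simp
    qed
  next
    case (3 x)
    then have x: "\<And>i. i < m \<Longrightarrow> z i = x (y i)" "x \<in> extensional {..<n}"
      by (auto simp: inj_maps_def PiE_iff)
    show ?case
    proof
      fix i show "?glue (restrict x ?R) i = x i"
        using x inv by (cases "i < n") (auto simp: extensional_def)
    qed
  next
    case (4 f)
    then show ?case by (auto simp: fun_eq_iff PiE_iff extensional_def)
  qed
  then have "card {x \<in> inj_maps n V. restrict (x \<circ> y) {..<m} = z} = card ?F"
    by (rule bij_betw_same_card)
  also have "\<dots> = prod ((-) (card V - m)) {0..<n - m}"
    using card_inj_on_subset_funcset[of ?R ?W ?R] V cards by simp
  finally show ?thesis .
qed

lemma card_inj_maps_comp: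
  assumes V: "finite V" and y: "y \<in> inj_maps m {..<n}"
  shows "card {x \<in> inj_maps n V. Q (restrict (x \<circ> y) {..<m})} =
    prod ((-) (card V - m)) {0..<n - m} * card {z \<in> inj_maps m V. Q z}"
proof -
  let ?S = "{x \<in> inj_maps n V. Q (restrict (x \<circ> y) {..<m})}" and ?Z = "{z \<in> inj_maps m V. Q z}"
  let ?g = "\<lambda>x. restrict (x \<circ> y) {..<m}"
  have "card ?S = (\<Sum>z\<in>?Z. \<Sum>x\<in>{x \<in> ?S. ?g x = z}. 1)"
    by (subst sum.group) (use V inj_maps_restrict_comp[OF y] in auto)
  also have "\<dots> = (\<Sum>z\<in>?Z. prod ((-) (card V - m)) {0..<n - m})"
  proof (rule sum.cong[OF refl])
    fix z assume z: "z \<in> ?Z"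
    then have "{x \<in> ?S. ?g x = z} = {x \<in> inj_maps n V. ?g x = z}" by auto
    then show "(\<Sum>x\<in>{x \<in> ?S. ?g x = z}. 1) = prod ((-) (card V - m)) {0..<n - m}"
      using card_inj_maps_fiber[OF V y] z by simp
  qed
  finally show ?thesis by (simp add: mult.commute)
qed

lemma card_inj_maps_pos: "finite V \<Longrightarrow> m \<le> card V \<Longrightarrow> 0 < card (inj_maps m V)"
  by (auto simp: card_inj_maps_prod intro!: prod_pos)

lemma prob_inj_maps_comp:
  assumes V: "finite V" "n \<le> card V" and y: "y \<in> inj_maps m {..<n}"
  shows "real (card {x \<in> inj_maps n V. Q (restrict (x \<circ> y) {..<m})}) / real (card (inj_maps n V)) =
    real (card {z \<in> inj_maps m V. Q z}) / real (card (inj_maps m V))"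
proof -
  define c where "c = prod ((-) (card V - m)) {0..<n - m}"
  have "card (inj_maps n V) = c * card (inj_maps m V)"
    using card_inj_maps_comp[OF V(1) y, of "\<lambda>_. True"] by (simp add: c_def)
  moreover have "0 < card (inj_maps n V)" by (rule card_inj_maps_pos[OF V])
  ultimately have "c > 0" "card (inj_maps n V) = c * card (inj_maps m V)" by (auto intro: Nat.gr0I)
  then show ?thesis using card_inj_maps_comp[OF V(1) y, of Q, folded c_def] by simp
qed

lemma sum_sample_density:
  assumes T: "finite (symbols T)" and N: "N \<in> models T V" and V: "finite V"
  shows "(\<Sum>K | K \<in> models T {..<n} \<and> Q K. sample_density K N) =
    real (card {x \<in> inj_maps n V. Q (pullback n x N)}) / real (card (inj_maps n V))"
proof -
  let ?M = "{K. K \<in> models T {..<n} \<and> Q K}" and ?S = "{x \<in> inj_maps n V. Q (pullback n x N)}"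
  have fin: "finite ?M" by (rule rev_finite_subset[OF finite_models[OF T, of "{..<n}"]]) auto
  have vN: "verts N = V" using N by (rule verts_models)
  have "card ?S = (\<Sum>K\<in>?M. \<Sum>x\<in>{x \<in> ?S. pullback n x N = K}. 1)"
    by (subst sum.group) (use V fin pullback_inj_maps_models[OF N] in auto)
  also have "\<dots> = (\<Sum>K\<in>?M. card {x \<in> inj_maps n V. pullback n x N = K})"
  proof (rule sum.cong[OF refl])
    fix K assume "K \<in> ?M"
    then have "{x \<in> ?S. pullback n x N = K} = {x \<in> inj_maps n V. pullback n x N = K}" by auto
    then show "(\<Sum>x\<in>{x \<in> ?S. pullback n x N = K}. 1) = card {x \<in> inj_maps n V. pullback n x N = K}"
      by simp
  qed
  finally have "real (card ?S) = (\<Sum>K\<in>?M. real (card {x \<in> inj_maps n V. pullback n x N = K}))"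
    by simp
  moreover have "sample_density K N = real (card {x \<in> inj_maps n V. pullback n x N = K}) / 
      real (card (inj_maps n V))" if "K \<in> ?M" for K
  proof -
    have "card (verts K) = n" using that verts_models[of K T "{..<n}"] by simp
    then show ?thesis by (simp add: sample_density_def vN)
  qed
  ultimately show ?thesis by (simp add: sum_divide_distrib)
qed

text \<open>These are the laws of the finite samples of an exchangeable random model: the maps
  \<open>y\<close> with \<open>m = n\<close> express exchangeability, and the inclusions express
  Kolmogorov consistency.\<close>

definition consistent_law :: "'p univ_theory \<Rightarrow> (('p, nat) fo_struct \<Rightarrow> real) \<Rightarrow> bool" where
  "consistent_law T p \<longleftrightarrow>
     (\<forall>n. \<forall>K\<in>models T {..<n}. 0 \<le> p K) \<and>
     (\<forall>n. (\<Sum>K\<in>models T {..<n}. p K) = 1) \<and>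
     (\<forall>m n. \<forall>y\<in>inj_maps m {..<n}. \<forall>K\<in>models T {..<m}.
        (\<Sum>K' | K' \<in> models T {..<n} \<and> pullback m y K' = K. p K') = p K)"

text \<open>Samples on disjoint vertex sets are independent. Among exchangeable laws this is the
  extremality condition that singles out the laws of limit objects.\<close>

definition dissociated_law :: "'p univ_theory \<Rightarrow> (('p, nat) fo_struct \<Rightarrow> real) \<Rightarrow> bool" where
  "dissociated_law T p \<longleftrightarrow>
     (\<forall>m m'. \<forall>K\<in>models T {..<m}. \<forall>K'\<in>models T {..<m'}.
        (\<Sum>L | L \<in> models T {..<m + m'} \<and> pullback m id L = K \<and> pullback m' (\<lambda>i. m + i) L = K'. p L)
          = p K * p K')"

text \<open>For large \<open>n\<close> this is the probability that two independent uniform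
  injections of \<open>{..<m}\<close> and of \<open>{..<m'}\<close> into \<open>{..<n}\<close> have
  disjoint ranges.\<close>

definition disjoint_ratio :: "nat \<Rightarrow> nat \<Rightarrow> nat \<Rightarrow> real" where
  "disjoint_ratio m m' n = real (card (inj_maps (m + m') {..<n})) /
     (real (card (inj_maps m {..<n})) * real (card (inj_maps m' {..<n})))"

lemma disjoint_ratio_tendsto: "disjoint_ratio m m' \<longlonglongrightarrow> 1"
proof -
  have eq: "disjoint_ratio m m' n = (\<Prod>i<m'. real (n - (m + i)) / real (n - i))" if "n \<ge> m + m'" for n
  proof -
    have "prod ((-) n) {0..<m + m'} = prod ((-) n) {0..<m} * (\<Prod>i<m'. n - (m + i))"
      using prod.atLeastLessThan_concat[of 0 m "m + m'" "(-) n"]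
        prod.shift_bounds_nat_ivl[of "(-) n" 0 m m'] by (simp add: add.commute atLeast0LessThan)
    moreover have "prod ((-) n) {0..<m} \<noteq> 0" using that by auto
    moreover have "real (c * a) / (real c * b) = real a / b" if "c \<noteq> 0" for a c b
      using that by simp
    ultimately have "disjoint_ratio m m' n = real (\<Prod>i<m'. n - (m + i)) / real (prod ((-) n) {0..<m'})"
      by (simp only: disjoint_ratio_def card_inj_maps_prod finite_lessThan card_lessThan)
    then show ?thesis by (simp add: prod_dividef atLeast0LessThan)
  qed
  have "(\<lambda>n. \<Prod>i<m'. real (n - (m + i)) / real (n - i)) \<longlonglongrightarrow> (\<Prod>i<m'. 1)"
  proof (rule tendsto_prod)
    fix i
    have "(\<lambda>n. (real n - real (m + i)) / (real n - real i)) \<longlonglongrightarrow> 1"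
    proof -
      have "filterlim (\<lambda>n. - real i + real n) at_top sequentially"
        by (intro filterlim_tendsto_add_at_top[OF tendsto_const] filterlim_real_sequentially)
      then have "(\<lambda>n. 1 - real m * inverse (- real i + real n)) \<longlonglongrightarrow> 1 - real m * 0"
        by (intro tendsto_intros tendsto_inverse_0_at_top)
      moreover have "\<forall>\<^sub>F n in sequentially. 1 - real m * inverse (- real i + real n) =
          (real n - real (m + i)) / (real n - real i)"
        using eventually_gt_at_top[of i] by eventually_elim (simp add: field_simps)
      ultimately show ?thesis by (simp add: Lim_transform_eventually)
    qed
    moreover have "\<forall>\<^sub>F n in sequentially. (real n - real (m + i)) / (real n - real i) = 
        real (n - (m + i)) / real (n - i)"
      using eventually_ge_at_top[of "m + i"] by eventually_elim (simp add: of_nat_diff)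
    ultimately show "(\<lambda>n. real (n - (m + i)) / real (n - i)) \<longlonglongrightarrow> 1"
      by (rule Lim_transform_eventually)
  qed
  then have "(\<lambda>n. \<Prod>i<m'. real (n - (m + i)) / real (n - i)) \<longlonglongrightarrow> 1" by simp
  moreover have "\<forall>\<^sub>F n in sequentially. (\<Prod>i<m'. real (n - (m + i)) / real (n - i)) = disjoint_ratio m m' n"
    using eventually_ge_at_top[of "m + m'"] by eventually_elim (simp add: eq)
  ultimately show ?thesis by (rule Lim_transform_eventually)
qed

definition split_map :: "nat \<Rightarrow> nat \<Rightarrow> (nat \<Rightarrow> 'v) \<Rightarrow> (nat \<Rightarrow> 'v) \<times> (nat \<Rightarrow> 'v)" where
  "split_map m m' x = (restrict x {..<m}, restrict (\<lambda>i. x (m + i)) {..<m'})"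

lemma split_map_inj_maps:
  "split_map m m' ` inj_maps (m + m') (V :: 'v set) \<subseteq> inj_maps m V \<times> inj_maps m' V"
proof (rule image_subsetI)
  fix x :: "nat \<Rightarrow> 'v" assume x: "x \<in> inj_maps (m + m') V"
  have i: "inj_on x {..<m + m'}" "\<And>i. i < m + m' \<Longrightarrow> x i \<in> V" using x by (auto simp: inj_maps_def)
  have "inj_on (\<lambda>i. x (m + i)) {..<m'}"
    by (rule inj_onI) (use inj_onD[OF i(1)] in fastforce)
  then show "split_map m m' x \<in> inj_maps m V \<times> inj_maps m' V"
    using i by (auto simp: inj_maps_def split_map_def inj_on_def)
qed

lemma inj_on_split_map: "inj_on (split_map m m') (inj_maps (m + m') V)"
proof (rule inj_onI, rule ext)
  fix x x' i assume x: "x \<in> inj_maps (m + m') V" "x' \<in> inj_maps (m + m') V"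
    and eq: "split_map m m' x = split_map m m' x'"
  have 1: "restrict x {..<m} i = restrict x' {..<m} i"
    and 2: "restrict (\<lambda>i. x (m + i)) {..<m'} (i - m) = restrict (\<lambda>i. x' (m + i)) {..<m'} (i - m)"
    using eq by (auto simp: split_map_def)
  show "x i = x' i"
  proof (cases "i < m + m'")
    case True
    then show ?thesis using 1 2 by (auto simp: less_diff_conv2 split: if_splits)
  next
    case False
    then show ?thesis using x by (auto simp: inj_maps_def PiE_iff extensional_def)
  qed
qed

lemma card_inj_maps_add_le:
  assumes "finite V"
  shows "card (inj_maps (m + m') V) \<le> card (inj_maps m V) * card (inj_maps m' V)"
  using card_mono[OF _ split_map_inj_maps[of m m' V]] card_image[OF inj_on_split_map[of m m' V]] assms
  by (simp add: card_cartesian_product)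

lemma disjoint_ratio_le_1: "disjoint_ratio m m' n \<le> 1"
proof -
  have "real (card (inj_maps (m + m') {..<n})) \<le> 
      real (card (inj_maps m {..<n}) * card (inj_maps m' {..<n}))"
    using card_inj_maps_add_le[of "{..<n}" m m'] of_nat_mono by blast
  moreover have "a / b \<le> 1" if "a \<le> b" "b \<ge> 0" for a b :: real
    using that by (cases "b = 0") auto
  ultimately show ?thesis unfolding disjoint_ratio_def by (simp flip: of_nat_mult)
qed

text \<open>A uniform injection of \<open>{..<m + m'}\<close> is a pair of independent uniform
  injections conditioned on disjoint ranges. The conditioning moves the probability of an event by
  at most the probability of overlap: the upper bound comes from counting the event itself, the
  lower bound from counting its complement.\<close>

lemma card_split_map_bounds:
  assumes V: "finite V" "card V = n" "m + m' \<le> n"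
    and E: "E \<subseteq> inj_maps m V" "E' \<subseteq> inj_maps m' V"
  shows "\<bar>real (card {x \<in> inj_maps (m + m') V. split_map m m' x \<in> E \<times> E'}) / real (card (inj_maps (m + m') V))
     - (real (card E) / real (card (inj_maps m V))) * (real (card E') / real (card (inj_maps m' V)))\<bar>
    \<le> 1 - disjoint_ratio m m' n"
proof -
  let ?I = "inj_maps (m + m') V" and ?A = "inj_maps m V" and ?B = "inj_maps m' V"
  let ?d = "{x \<in> ?I. split_map m m' x \<in> E \<times> E'}"
  have fin: "finite ?A" "finite ?B" "finite ?I" "finite E" "finite E'"
    using V E by (auto intro: finite_subset)
  have inj: "inj_on (split_map m m') S" if "S \<subseteq> ?I" for S
    using inj_on_split_map[of m m' V] that inj_on_subset by blast
  have d1: "card ?d \<le> card E * card E'"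
    using card_inj_on_le[OF inj[of ?d], of "E \<times> E'"] fin by (auto simp: card_cartesian_product)
  have "card (?I - ?d) \<le> card (?A \<times> ?B - E \<times> E')"
    by (rule card_inj_on_le[OF inj]) (use split_map_inj_maps[of m m' V] fin in auto)
  moreover have "card (?A \<times> ?B - E \<times> E') = card ?A * card ?B - card E * card E'"
    using E fin by (subst card_Diff_subset) (auto simp: card_cartesian_product)
  moreover have "card (?I - ?d) = card ?I - card ?d"
    using fin by (subst card_Diff_subset) auto
  ultimately have d2: "real (card ?I) - real (card ?d) \<le> real (card ?A) * real (card ?B) - real (card E) * real (card E')"
  proof -
    assume *: "card (?I - ?d) \<le> card (?A \<times> ?B - E \<times> E')"
      "card (?A \<times> ?B - E \<times> E') = card ?A * card ?B - card E * card E'"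
      "card (?I - ?d) = card ?I - card ?d"
    have "card ?d \<le> card ?I" using fin by (intro card_mono) auto
    moreover have "card E * card E' \<le> card ?A * card ?B" 
      using fin E by (intro mult_mono card_mono) auto
    ultimately have "card ?I + card E * card E' \<le> card ?A * card ?B + card ?d" using * by linarith
    then have "real (card ?I + card E * card E') \<le> real (card ?A * card ?B + card ?d)"
      by (rule of_nat_mono)
    then show ?thesis by simp
  qed
  define a b A B D d where "a = real (card E)" and "b = real (card E')" and "A = real (card ?A)"
    and "B = real (card ?B)" and "D = real (card ?I)" and "d = real (card ?d)"
  have pos: "A > 0" "B > 0" "D > 0"
    using V card_inj_maps_pos[of V] by (auto simp: A_def B_def D_def)
  have le: "d \<le> a * b" "D - d \<le> A * B - a * b" "D \<le> A * B" "d \<le> D" "0 \<le> d"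
    using d1 d2 card_inj_maps_add_le[OF V(1), of m m'] fin
    by (auto simp: a_def b_def A_def B_def D_def d_def intro!: card_mono simp flip: of_nat_mult)
  have r: "disjoint_ratio m m' n = D / (A * B)"
    using V by (simp add: disjoint_ratio_def A_def B_def D_def card_inj_maps_prod)
  have AB: "A * B > 0" using pos by simp
  have "d / D = d / (A * B) + (d / D) * (1 - D / (A * B))" using pos by (simp add: field_simps)
  also have "\<dots> \<le> (a * b) / (A * B) + 1 * (1 - D / (A * B))"
    using pos le AB by (intro add_mono mult_right_mono divide_right_mono) (auto simp: divide_le_eq_1)
  finally have u: "d / D - (a * b) / (A * B) \<le> 1 - D / (A * B)" by simp
  have "(a * b) / (A * B) \<le> (A * B - D + d) / (A * B)"
    using le AB by (intro divide_right_mono) auto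
  also have "\<dots> = 1 - D / (A * B) + d / (A * B)" 
    using pos by (simp add: diff_divide_distrib add_divide_distrib)
  also have "\<dots> \<le> 1 - D / (A * B) + d / D"
    using pos le AB by (intro add_left_mono divide_left_mono) auto
  finally have "(a * b) / (A * B) - d / D \<le> 1 - D / (A * B)" by simp
  with u show ?thesis
    unfolding r by (simp add: a_def b_def A_def B_def D_def d_def abs_le_iff)
qed

text \<open>Along the convergent sequence total mass and consistency hold exactly once the models
  are large enough, while disjoint samples are independent up to the probability of overlap. All
  relations pass to the limit because they are finite sums of sample densities.\<close>

lemma Hom_plus_laws:
  assumes T: "finite (symbols T)" and \<phi>: "\<phi> \<in> Hom_plus T"
  shows "consistent_law T (labelled \<phi>)" "dissociated_law T (labelled \<phi>)"
proof -
  from \<phi> obtain N where N: "\<And>n. finite (verts (N n))" "\<And>n. N n \<in> models T (verts (N n))"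
    and mono: "strict_mono (\<lambda>n. card (verts (N n)))"
    and lim: "\<And>C. C \<in> model_classes T \<Longrightarrow> (\<lambda>n. induced_density C (N n)) \<longlonglongrightarrow> \<phi> C"
    unfolding Hom_plus_def by blast
  have top: "filterlim (\<lambda>n. card (verts (N n))) at_top sequentially"
    using mono by (rule filterlim_subseq)
  have large: "\<forall>\<^sub>F n in sequentially. m \<le> card (verts (N n))" for m
    using top by (auto simp: filterlim_at_top)
  have lab: "(\<lambda>n. sample_density K (N n)) \<longlonglongrightarrow> labelled \<phi> K" if K: "K \<in> models T {..<m}" for K m
  proof -
    have C: "iso_class K \<in> model_classes T" 
      using K by (auto simp: model_classes_def model_classes_n_def)
    show ?thesis
      using sample_density_eq_induced_density[OF wf_struct_models[OF K] verts_models[OF K] N(1)]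
        tendsto_mult_left[OF lim[OF C], of "real (card (automorphisms K)) / fact m"]
      by (simp add: labelled_def verts_models[OF K])
  qed
  have sums: "(\<lambda>n. \<Sum>K | K \<in> models T {..<m} \<and> Q K. sample_density K (N n)) \<longlonglongrightarrow>
     (\<Sum>K | K \<in> models T {..<m} \<and> Q K. labelled \<phi> K)" for Q m
    by (intro tendsto_sum lab) auto
  have "labelled \<phi> K \<ge> 0" if K: "K \<in> models T {..<m}" for K m
    by (rule LIMSEQ_le_const[OF lab[OF K]]) (auto simp: sample_density_def)
  moreover have "(\<Sum>K\<in>models T {..<m}. labelled \<phi> K) = 1" for m
  proof -
    have "\<forall>\<^sub>F n in sequentially. (\<Sum>K | K \<in> models T {..<m} \<and> True. sample_density K (N n)) = 1"
      using large[of m] 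
    proof eventually_elim
      case (elim n)
      have "card (inj_maps m (verts (N n))) > 0" using card_inj_maps_pos[OF N(1)] elim by blast
      then show ?case unfolding sum_sample_density[OF T N(2,1)] by simp
    qed
    then have "(\<lambda>n. \<Sum>K | K \<in> models T {..<m} \<and> True. sample_density K (N n)) \<longlonglongrightarrow> 1"
      by (rule tendsto_eventually)
    from LIMSEQ_unique[OF this sums] show ?thesis by simp
  qed
  moreover have "(\<Sum>K' | K' \<in> models T {..<n} \<and> pullback m y K' = K. labelled \<phi> K') = labelled \<phi> K"
    if y: "y \<in> inj_maps m {..<n}" and K: "K \<in> models T {..<m}" for m n y K
  proof -
    have "\<forall>\<^sub>F j in sequentially. sample_density K (N j) =
       (\<Sum>K' | K' \<in> models T {..<n} \<and> pullback m y K' = K. sample_density K' (N j))"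
      using large[of n] 
    proof eventually_elim
      case (elim j)
      have eq: "pullback m y (pullback n x (N j)) = pullback m (restrict (x \<circ> y) {..<m}) (N j)" for x
      proof -
        have "pullback m y (pullback n x (N j)) = pullback m (x \<circ> y) (N j)"
          using inj_mapsD(4)[OF y] by (intro pullback_pullback) auto
        also have "\<dots> = pullback m (restrict (x \<circ> y) {..<m}) (N j)"
          by (intro pullback_cong) auto
        finally show ?thesis .
      qed
      show ?case
        unfolding sum_sample_density[OF T N(2,1)] eq
        using prob_inj_maps_comp[OF N(1) elim y, of "\<lambda>z. pullback m z (N j) = K"]
        by (simp add: sample_density_def verts_models[OF K])
    qed
    then have "(\<lambda>j. \<Sum>K' | K' \<in> models T {..<n} \<and> pullback m y K' = K. sample_density K' (N j)) 
        \<longlonglongrightarrow> labelled \<phi> K"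
      by (rule Lim_transform_eventually[OF lab[OF K]])
    from LIMSEQ_unique[OF sums this] show ?thesis .
  qed
  ultimately show "consistent_law T (labelled \<phi>)"
    unfolding consistent_law_def by blast
  have "(\<Sum>L | L \<in> models T {..<m + m'} \<and> pullback m id L = K \<and> pullback m' (\<lambda>i. m + i) L = K'. labelled \<phi> L)
          = labelled \<phi> K * labelled \<phi> K'"
    if K: "K \<in> models T {..<m}" "K' \<in> models T {..<m'}" for m m' K K'
  proof -
    let ?Q = "\<lambda>L. pullback m id L = K \<and> pullback m' (\<lambda>i. m + i) L = K'"
    have "\<forall>\<^sub>F n in sequentially. \<bar>(\<Sum>L | L \<in> models T {..<m + m'} \<and> ?Q L. sample_density L (N n))
       - sample_density K (N n) * sample_density K' (N n)\<bar> \<le> 1 - disjoint_ratio m m' (card (verts (N n)))"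
      using large[of "m + m'"]
    proof eventually_elim
      case (elim n)
      let ?V = "verts (N n)"
      let ?E = "{z \<in> inj_maps m ?V. pullback m z (N n) = K}"
      let ?E' = "{z \<in> inj_maps m' ?V. pullback m' z (N n) = K'}"
      have "{x \<in> inj_maps (m + m') ?V. ?Q (pullback (m + m') x (N n))} =
        {x \<in> inj_maps (m + m') ?V. split_map m m' x \<in> ?E \<times> ?E'}"
      proof -
        have 1: "pullback m id (pullback (m + m') x (N n)) = pullback m (restrict x {..<m}) (N n)" for x
          by (subst pullback_pullback) (auto intro: pullback_cong)
        have 2: "pullback m' (\<lambda>i. m + i) (pullback (m + m') x (N n)) = 
            pullback m' (restrict (\<lambda>i. x (m + i)) {..<m'}) (N n)" for x
          by (subst pullback_pullback) (auto intro: pullback_cong)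
        show ?thesis
          using split_map_inj_maps[of m m' ?V] unfolding 1 2 split_map_def by auto
      qed
      then show ?case
        unfolding sum_sample_density[OF T N(2,1)]
        using card_split_map_bounds[OF N(1) refl elim, of ?E ?E']
        by (simp add: sample_density_def verts_models[OF K(1)] verts_models[OF K(2)])
    qed
    moreover have lim0: "(\<lambda>n. 1 - disjoint_ratio m m' (card (verts (N n)))) \<longlonglongrightarrow> 1 - 1"
      by (intro tendsto_intros filterlim_compose[OF disjoint_ratio_tendsto top])
    ultimately have "(\<lambda>n. (\<Sum>L | L \<in> models T {..<m + m'} \<and> ?Q L. sample_density L (N n))
       - sample_density K (N n) * sample_density K' (N n)) \<longlonglongrightarrow> 0"
      by (intro Lim_null_comparison[OF _ lim0[unfolded diff_self]]) (simp only: real_norm_def)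
    moreover have "(\<lambda>n. (\<Sum>L | L \<in> models T {..<m + m'} \<and> ?Q L. sample_density L (N n))
       - sample_density K (N n) * sample_density K' (N n)) \<longlonglongrightarrow>
       (\<Sum>L | L \<in> models T {..<m + m'} \<and> ?Q L. labelled \<phi> L) - labelled \<phi> K * labelled \<phi> K'"
      by (intro tendsto_diff tendsto_mult sums lab[OF K(1)] lab[OF K(2)])
    ultimately show ?thesis using LIMSEQ_unique by fastforce
  qed
  then show "dissociated_law T (labelled \<phi>)" unfolding dissociated_law_def by blast
qed

lemma consistent_lawD:
  assumes "consistent_law T p"
  shows "K \<in> models T {..<n} \<Longrightarrow> 0 \<le> p K"
    "(\<Sum>K\<in>models T {..<n}. p K) = 1"
    "y \<in> inj_maps m {..<n} \<Longrightarrow> K \<in> models T {..<m} \<Longrightarrow>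
      (\<Sum>K' | K' \<in> models T {..<n} \<and> pullback m y K' = K. p K') = p K"
  using assms by (auto simp: consistent_law_def)

lemma consistent_law_sum:
  assumes T: "finite (symbols T)" and p: "consistent_law T p" and y: "y \<in> inj_maps m {..<n}"
  shows "(\<Sum>K' | K' \<in> models T {..<n} \<and> Q (pullback m y K'). p K') =
    (\<Sum>K | K \<in> models T {..<m} \<and> Q K. p K)"
proof -
  let ?S = "{K'. K' \<in> models T {..<n} \<and> Q (pullback m y K')}" and ?M = "{K. K \<in> models T {..<m} \<and> Q K}"
  have fin: "finite ?S" "finite ?M"
    using rev_finite_subset[OF finite_models[OF T, of "{..<n}"], of ?S]
      rev_finite_subset[OF finite_models[OF T, of "{..<m}"], of ?M] by auto
  have "(\<Sum>K'\<in>?S. p K') = (\<Sum>K\<in>?M. \<Sum>K'\<in>{K' \<in> ?S. pullback m y K' = K}. p K')"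
    by (subst sum.group) (use fin pullback_inj_maps_models[OF _ y] in auto)
  also have "\<dots> = (\<Sum>K\<in>?M. p K)"
  proof (rule sum.cong[OF refl])
    fix K assume K: "K \<in> ?M"
    then have "{K' \<in> ?S. pullback m y K' = K} = {K'. K' \<in> models T {..<n} \<and> pullback m y K' = K}"
      by auto
    then show "(\<Sum>K'\<in>{K' \<in> ?S. pullback m y K' = K}. p K') = p K"
      using consistent_lawD(3)[OF p y] K by simp
  qed
  finally show ?thesis .
qed

lemma consistent_law_sum_le_1:
  assumes T: "finite (symbols T)" and p: "consistent_law T p" and S: "S \<subseteq> models T {..<n}"
  shows "0 \<le> (\<Sum>K\<in>S. p K)" "(\<Sum>K\<in>S. p K) \<le> 1"
proof -
  show "0 \<le> (\<Sum>K\<in>S. p K)" using consistent_lawD(1)[OF p] S by (intro sum_nonneg) auto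
  have "(\<Sum>K\<in>S. p K) \<le> (\<Sum>K\<in>models T {..<n}. p K)"
    using consistent_lawD(1)[OF p] S finite_models[OF T, of "{..<n}"] by (intro sum_mono2) auto
  then show "(\<Sum>K\<in>S. p K) \<le> 1" using consistent_lawD(2)[OF p] by simp
qed

lemma consistent_law_le_1:
  assumes "finite (symbols T)" "consistent_law T p" "K \<in> models T {..<n}"
  shows "p K \<le> 1"
  using consistent_law_sum_le_1(2)[OF assms(1,2), of "{K}" n] assms(3) by simp

text \<open>The two injections are glued to one injection \<open>w\<close>, along which consistency
  carries dissociation from consecutive blocks to arbitrary disjoint ranges.\<close>

lemma consistent_dissociated_law_injections:
  assumes T: "finite (symbols T)" and p: "consistent_law T p" "dissociated_law T p"
    and x: "x \<in> inj_maps m {..<n}" and x': "x' \<in> inj_maps m' {..<n}"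
    and disj: "x ` {..<m} \<inter> x' ` {..<m'} = {}"
    and K: "K \<in> models T {..<m}" "K' \<in> models T {..<m'}"
  shows "(\<Sum>L | L \<in> models T {..<n} \<and> pullback m x L = K \<and> pullback m' x' L = K'. p L) = p K * p K'"
proof -
  define w where "w = restrict (\<lambda>i. if i < m then x i else x' (i - m)) {..<m + m'}"
  have "inj_on w {..<m + m'}"
  proof (rule inj_onI)
    fix i j assume ij: "i \<in> {..<m + m'}" "j \<in> {..<m + m'}" "w i = w j"
    have ne: "x a \<noteq> x' b" if "a < m" "b < m'" for a b using disj that by auto
    consider "i < m" "j < m" | "i < m" "\<not> j < m" | "\<not> i < m" "j < m" | "\<not> i < m" "\<not> j < m" by blast
    then show "i = j"
    proof cases
      case 1 then show ?thesis using ij inj_mapsD(3)[OF x] by (auto simp: w_def inj_on_def)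
    next
      case 2 then show ?thesis using ij ne[of i "j - m"] by (auto simp: w_def)
    next
      case 3
      then have "i - m < m'" using ij by auto
      with 3 show ?thesis using ij ne[of j "i - m"] by (auto simp: w_def)
    next
      case 4
      then have "x' (i - m) = x' (j - m)" "i - m < m'" "j - m < m'" using ij by (auto simp: w_def)
      then have "i - m = j - m" using inj_mapsD(3)[OF x'] by (auto simp: inj_on_def)
      then show ?thesis using 4 by simp
    qed
  qed
  then have w: "w \<in> inj_maps (m + m') {..<n}"
    using inj_mapsD(4)[OF x] inj_mapsD(4)[OF x'] by (auto simp: inj_maps_def w_def)
  have e: "pullback m id (pullback (m + m') w L) = pullback m x L" 
    "pullback m' (\<lambda>i. m + i) (pullback (m + m') w L) = pullback m' x' L" for L :: "('a, nat) fo_struct"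
    by (subst pullback_pullback; auto simp: w_def intro!: pullback_cong)+
  show ?thesis
    using consistent_law_sum[OF T p(1) w, of "\<lambda>L. pullback m id L = K \<and> pullback m' (\<lambda>i. m + i) L = K'"]
      p(2) K by (simp add: e dissociated_law_def)
qed

text \<open>Two samples with disjoint ranges are uncorrelated by dissociation, so only overlapping samples
  contribute to the variance.\<close>

lemma sample_density_variance:
  assumes T: "finite (symbols T)" and p: "consistent_law T p" "dissociated_law T p"
    and K: "K \<in> models T {..<m}" and n: "m \<le> n"
  shows "(\<Sum>N\<in>models T {..<n}. p N * (sample_density K N - p K)\<^sup>2) \<le> 1 - disjoint_ratio m m n"
proof -
  let ?I = "inj_maps m {..<n}" and ?M = "models T {..<n}"
  define A where "A = real (card ?I)"
  have A: "A > 0" using card_inj_maps_pos[of "{..<n}" m] n by (simp add: A_def)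
  have finI: "finite ?I" and finM: "finite ?M" using finite_models[OF T] by auto
  define h where "h x N = (if pullback m x N = K then 1 else 0 :: real)" for x and N :: "('a, nat) fo_struct"
  have sd: "sample_density K N = (\<Sum>x\<in>?I. h x N) / A" if "N \<in> ?M" for N
    using finI by (simp add: sample_density_def verts_models[OF K] verts_models[OF that] A_def h_def
        sum.If_cases Int_def)
  have E1: "(\<Sum>N\<in>?M. p N * h x N) = p K" if "x \<in> ?I" for x
    using consistent_lawD(3)[OF p(1) that K] finM
    by (simp add: h_def if_distrib sum.If_cases Int_def cong: if_cong)
  have mean: "(\<Sum>N\<in>?M. p N * sample_density K N) = p K"
  proof -
    have "(\<Sum>N\<in>?M. p N * sample_density K N) = (\<Sum>N\<in>?M. \<Sum>x\<in>?I. p N * h x N) / A"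
      by (simp add: sd sum_distrib_left sum_divide_distrib cong: sum.cong)
    also have "(\<Sum>N\<in>?M. \<Sum>x\<in>?I. p N * h x N) = (\<Sum>x\<in>?I. \<Sum>N\<in>?M. p N * h x N)"
      by (rule sum.swap)
    also have "\<dots> = A * p K" using E1 by (simp add: A_def)
    finally show ?thesis using A by simp
  qed
  have p01: "0 \<le> p K" "p K \<le> 1" using consistent_lawD(1)[OF p(1) K] consistent_law_le_1[OF T p(1) K] by auto
  \<comment> \<open>The disjoint pairs are the image of the injections of \<open>{..<m + m}\<close>
    under the splitting map, so they make up the fraction \<open>disjoint_ratio m m n\<close> of all
    pairs.\<close>
  define D where "D = {xx \<in> ?I \<times> ?I. fst xx ` {..<m} \<inter> snd xx ` {..<m} = {}}"
  have cardD: "card D = card (inj_maps (m + m) {..<n})"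
  proof -
    have "split_map m m ` inj_maps (m + m) {..<n} = D"
    proof (intro set_eqI iffI)
      fix xx assume "xx \<in> split_map m m ` inj_maps (m + m) {..<n}"
      then obtain x where x: "x \<in> inj_maps (m + m) {..<n}" "xx = split_map m m x" by auto
      have "x i \<noteq> x (m + j)" if "i < m" "j < m" for i j
        using inj_onD[OF inj_mapsD(3)[OF x(1)], of i "m + j"] that by auto
      moreover have "xx \<in> ?I \<times> ?I" using x split_map_inj_maps[of m m "{..<n}"] by blast
      ultimately show "xx \<in> D" by (auto simp: D_def x split_map_def)
    next
      fix xx assume xx: "xx \<in> D"
      obtain y y' where y: "xx = (y, y')" by fastforce
      have yI: "y \<in> ?I" "y' \<in> ?I" "y ` {..<m} \<inter> y' ` {..<m} = {}" using xx by (auto simp: D_def y)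
      define w where "w = restrict (\<lambda>i. if i < m then y i else y' (i - m)) {..<m + m}"
      have ne: "y a \<noteq> y' b" if "a < m" "b < m" for a b using yI(3) that by auto
      have "inj_on w {..<m + m}"
      proof (rule inj_onI)
        fix i j assume ij: "i \<in> {..<m + m}" "j \<in> {..<m + m}" "w i = w j"
        consider "i < m" "j < m" | "i < m" "\<not> j < m" | "\<not> i < m" "j < m" | "\<not> i < m" "\<not> j < m" by blast
        then show "i = j"
        proof cases
          case 1 then show ?thesis using ij inj_mapsD(3)[OF yI(1)] by (auto simp: w_def inj_on_def)
        next
          case 2 then show ?thesis using ij ne[of i "j - m"] by (auto simp: w_def)
        next
          case 3
      then have "i - m < m" using ij by auto
      with 3 show ?thesis using ij ne[of j "i - m"] by (auto simp: w_def)
        next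
          case 4
          then have "y' (i - m) = y' (j - m)" "i - m < m" "j - m < m" using ij by (auto simp: w_def)
          then have "i - m = j - m" using inj_mapsD(3)[OF yI(2)] by (auto simp: inj_on_def)
          then show ?thesis using 4 by simp
        qed
      qed
      then have "w \<in> inj_maps (m + m) {..<n}"
        using inj_mapsD(4)[OF yI(1)] inj_mapsD(4)[OF yI(2)] by (auto simp: inj_maps_def w_def)
      moreover have "split_map m m w = xx"
        using inj_mapsD(1)[OF yI(1)] inj_mapsD(1)[OF yI(2)]
        by (auto simp: y split_map_def w_def fun_eq_iff PiE_iff extensional_def)
      ultimately show "xx \<in> split_map m m ` inj_maps (m + m) {..<n}" by blast
    qed
    then show ?thesis using card_image[OF inj_on_split_map[of m m "{..<n}"]] by simp
  qed
  have E2: "(\<Sum>N\<in>?M. p N * (h x N * h x' N)) \<le> (if (x, x') \<in> D then (p K)\<^sup>2 else 1)"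
    if "x \<in> ?I" "x' \<in> ?I" for x x'
  proof -
    have eq: "(\<Sum>N\<in>?M. p N * (h x N * h x' N)) = 
        (\<Sum>L | L \<in> ?M \<and> pullback m x L = K \<and> pullback m x' L = K. p L)"
      using finM by (intro sum.mono_neutral_cong_right) (auto simp: h_def)
    show ?thesis
    proof (cases "(x, x') \<in> D")
      case True
      then show ?thesis unfolding eq
        using consistent_dissociated_law_injections[OF T p that _ K K]
        by (simp add: D_def power2_eq_square)
    next
      case False
      then show ?thesis unfolding eq using consistent_law_sum_le_1(2)[OF T p(1), of "{L \<in> ?M. pullback m x L = K \<and> pullback m x' L = K}" n]
        by simp
    qed
  qed
  have r: "disjoint_ratio m m n = real (card D) / (A * A)"
    by (simp add: disjoint_ratio_def A_def cardD)
  have sq: "(\<Sum>N\<in>?M. p N * (sample_density K N)\<^sup>2) \<le> (p K)\<^sup>2 + (1 - disjoint_ratio m m n)"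
  proof -
    have "(\<Sum>N\<in>?M. p N * (sample_density K N)\<^sup>2) = 
        (\<Sum>N\<in>?M. \<Sum>xx\<in>?I \<times> ?I. p N * (h (fst xx) N * h (snd xx) N)) / (A * A)"
      unfolding sum_divide_distrib[of _ ?M]
    proof (rule sum.cong[OF refl])
      fix N assume "N \<in> ?M"
      then have "p N * (sample_density K N)\<^sup>2 = p N * ((\<Sum>x\<in>?I. h x N) * (\<Sum>x\<in>?I. h x N)) / (A * A)"
        by (simp add: sd power2_eq_square)
      also have "(\<Sum>x\<in>?I. h x N) * (\<Sum>x\<in>?I. h x N) = (\<Sum>xx\<in>?I \<times> ?I. h (fst xx) N * h (snd xx) N)"
        by (simp add: sum_product sum.cartesian_product case_prod_unfold)
      finally show "p N * (sample_density K N)\<^sup>2 =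
          (\<Sum>xx\<in>?I \<times> ?I. p N * (h (fst xx) N * h (snd xx) N)) / (A * A)"
        by (simp only: sum_distrib_left)
    qed
    also have "(\<Sum>N\<in>?M. \<Sum>xx\<in>?I \<times> ?I. p N * (h (fst xx) N * h (snd xx) N)) =
       (\<Sum>xx\<in>?I \<times> ?I. \<Sum>N\<in>?M. p N * (h (fst xx) N * h (snd xx) N))"
      by (rule sum.swap)
    also have "\<dots> \<le> (\<Sum>xx\<in>?I \<times> ?I. if xx \<in> D then (p K)\<^sup>2 else 1)"
    proof (rule sum_mono)
      fix xx assume "xx \<in> ?I \<times> ?I"
      then show "(\<Sum>N\<in>?M. p N * (h (fst xx) N * h (snd xx) N)) \<le> (if xx \<in> D then (p K)\<^sup>2 else 1)"
        using E2[of "fst xx" "snd xx"] by (simp add: mem_Times_iff)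
    qed
    also have "\<dots> = real (card D) * (p K)\<^sup>2 + (A * A - real (card D))"
    proof -
      have sub: "D \<subseteq> ?I \<times> ?I" by (auto simp: D_def)
      have "card D \<le> card (?I \<times> ?I)" by (rule card_mono[OF _ sub]) (use finI in simp)
      moreover from sub have "(?I \<times> ?I) \<inter> {xx. xx \<in> D} = D" "card ((?I \<times> ?I) \<inter> - {xx. xx \<in> D}) = card (?I \<times> ?I) - card D"
        using finI by (auto simp: Diff_eq[symmetric] card_Diff_subset finite_subset Collect_mem_eq)
      ultimately show ?thesis using finI
        by (simp add: sum.If_cases A_def card_cartesian_product of_nat_diff)
    qed
    also have "(real (card D) * (p K)\<^sup>2 + (A * A - real (card D))) / (A * A) =
       disjoint_ratio m m n * (p K)\<^sup>2 + (1 - disjoint_ratio m m n)"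
      using A by (simp add: r add_divide_distrib diff_divide_distrib)
    also have "\<dots> \<le> 1 * (p K)\<^sup>2 + (1 - disjoint_ratio m m n)"
      by (intro add_right_mono mult_right_mono disjoint_ratio_le_1) simp
    finally show ?thesis using A by (simp add: divide_right_mono)
  qed
  have "(\<Sum>N\<in>?M. p N * (sample_density K N - p K)\<^sup>2) =
     (\<Sum>N\<in>?M. p N * (sample_density K N)\<^sup>2 - 2 * p K * (p N * sample_density K N) + (p K)\<^sup>2 * p N)"
    by (intro sum.cong refl) (simp add: power2_eq_square algebra_simps)
  also have "\<dots> = (\<Sum>N\<in>?M. p N * (sample_density K N)\<^sup>2) - 2 * p K * p K + (p K)\<^sup>2 * 1"
    unfolding sum.distrib sum_subtractf
    by (simp only: mean consistent_lawD(2)[OF p(1)] flip: sum_distrib_left)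
  also have "\<dots> \<le> 1 - disjoint_ratio m m n" using sq by (simp add: power2_eq_square)
  finally show ?thesis .
qed

lemma model_classesE:
  assumes "C \<in> model_classes T"
  obtains m K where "K \<in> models T {..<m}" "C = iso_class K"
  using assms by (auto simp: model_classes_def model_classes_n_def)

text \<open>This is the converse of \<open>Hom_plus_laws\<close>, by the second moment method: a
  random model of size \<open>n\<close> drawn from the law has sample densities close to their
  expectations, so some single model is close for all small \<open>K\<close> at once.\<close>

lemma Hom_plusI:
  assumes T: "finite (symbols T)" and \<phi>: "\<phi> \<in> model_classes T \<rightarrow>\<^sub>E {0..1}"
    and p: "consistent_law T (labelled \<phi>)" "dissociated_law T (labelled \<phi>)"
  shows "\<phi> \<in> Hom_plus T"
proof -
  let ?p = "labelled \<phi>"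
  have step: "\<forall>\<^sub>F n in sequentially. \<exists>N\<in>models T {..<n}. \<forall>m\<le>j. \<forall>K\<in>models T {..<m}. 
      \<bar>sample_density K N - ?p K\<bar> < 1 / real (Suc j)" for j
  proof -
    define S where "S = (SIGMA m:{..j}. models T {..<m})"
    have finS: "finite S" unfolding S_def using finite_models[OF T] by auto
    have "(\<lambda>n. \<Sum>mK\<in>S. 1 - disjoint_ratio (fst mK) (fst mK) n) \<longlonglongrightarrow> (\<Sum>mK\<in>S. 1 - 1)"
      by (intro tendsto_intros disjoint_ratio_tendsto)
    then have "\<forall>\<^sub>F n in sequentially. (\<Sum>mK\<in>S. 1 - disjoint_ratio (fst mK) (fst mK) n) < (1 / real (Suc j))\<^sup>2"
      by (auto elim!: order_tendstoD(2))
    with eventually_ge_at_top[of j] show ?thesis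
    proof eventually_elim
      case (elim n)
      let ?M = "models T {..<n}" and ?e = "(1 / real (Suc j))\<^sup>2"
      let ?v = "\<lambda>N. \<Sum>mK\<in>S. (sample_density (snd mK) N - ?p (snd mK))\<^sup>2"
      have "(\<Sum>N\<in>?M. ?p N * ?v N) = (\<Sum>mK\<in>S. \<Sum>N\<in>?M. ?p N * (sample_density (snd mK) N - ?p (snd mK))\<^sup>2)"
        unfolding sum_distrib_left by (rule sum.swap)
      also have "\<dots> \<le> (\<Sum>mK\<in>S. 1 - disjoint_ratio (fst mK) (fst mK) n)"
        by (intro sum_mono sample_density_variance[OF T p]) (use elim in \<open>auto simp: S_def\<close>)
      also have "\<dots> < ?e" by (rule elim)
      finally have lt: "(\<Sum>N\<in>?M. ?p N * ?v N) < ?e" .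
      \<comment> \<open>The total squared error is below \<open>?e\<close> on average, hence for at
        least one model.\<close>
      have "\<exists>N\<in>?M. ?v N < ?e"
      proof (rule ccontr)
        assume "\<not> ?thesis"
        then have "(\<Sum>N\<in>?M. ?p N * ?e) \<le> (\<Sum>N\<in>?M. ?p N * ?v N)"
          using consistent_lawD(1)[OF p(1)] by (intro sum_mono mult_left_mono) (auto simp: not_less)
        moreover have "(\<Sum>N\<in>?M. ?p N * ?e) = ?e"
          using consistent_lawD(2)[OF p(1), of n] by (simp flip: sum_distrib_right)
        ultimately show False using lt by simp
      qed
      then obtain N where N: "N \<in> ?M" "?v N < ?e" by blast
      have "\<bar>sample_density K N - ?p K\<bar> < 1 / real (Suc j)" if "m \<le> j" "K \<in> models T {..<m}" for m K
      proof -
        have "(sample_density K N - ?p K)\<^sup>2 \<le> ?v N"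
          using member_le_sum[OF _ _ finS, of "(m, K)" "\<lambda>mK. (sample_density (snd mK) N - ?p (snd mK))\<^sup>2"] that
          by (simp add: S_def)
        with N(2) have "\<bar>sample_density K N - ?p K\<bar>\<^sup>2 < ?e" by simp
        then show ?thesis by (rule power2_less_imp_less) simp
      qed
      with N(1) show ?case by blast
    qed
  qed
  define good where "good j N \<longleftrightarrow> (\<forall>m\<le>j. \<forall>K\<in>models T {..<m}.
      \<bar>sample_density K N - ?p K\<bar> < 1 / real (Suc j))" for j and N :: "('a, nat) fo_struct"
  define ok where "ok j n \<longleftrightarrow> (\<exists>N\<in>models T {..<n}. good j N)" for j n
  have "\<exists>n0. \<forall>n\<ge>n0. ok j n" for j
    using step[of j] unfolding eventually_sequentially ok_def good_def .
  then obtain n0 where n0: "\<And>j n. n \<ge> n0 j \<Longrightarrow> ok j n" by metis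
  \<comment> \<open>Partial sums of \<open>Suc (n0 i)\<close> stay above the thresholds and increase
    strictly, as the sizes in \<open>Hom_plus\<close> must.\<close>
  define s where "s j = (\<Sum>i\<le>j. Suc (n0 i))" for j
  have s: "strict_mono s" "s j \<ge> n0 j" for j
    by (auto simp: s_def strict_mono_Suc_iff intro: order_trans[OF _ member_le_sum[of j]])
  from n0[OF s(2)] have "\<exists>N. N \<in> models T {..<s j} \<and> good j N" for j
    unfolding ok_def by blast
  then obtain N where N: "\<And>j. N j \<in> models T {..<s j}" and "\<And>j. good j (N j)" by metis
  then have close: "\<bar>sample_density K (N j) - ?p K\<bar> < 1 / real (Suc j)"
    if "m \<le> j" "K \<in> models T {..<m}" for j m K
    using that unfolding good_def by blast
  have vN: "verts (N j) = {..<s j}" for j by (rule verts_models[OF N])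
  have "(\<lambda>j. induced_density C (N j)) \<longlonglongrightarrow> \<phi> C" if C: "C \<in> model_classes T" for C
  proof -
    obtain m K where K: "K \<in> models T {..<m}" "C = iso_class K" using C by (rule model_classesE)
    have "(\<lambda>j. sample_density K (N j) - ?p K) \<longlonglongrightarrow> 0"
    proof (rule Lim_null_comparison)
      show "\<forall>\<^sub>F j in sequentially. norm (sample_density K (N j) - ?p K) \<le> 1 / real (Suc j)"
        using eventually_ge_at_top[of m] 
        by eventually_elim (use close[OF _ K(1)] in \<open>simp add: less_imp_le\<close>)
      show "(\<lambda>j. 1 / real (Suc j)) \<longlonglongrightarrow> 0" by (rule LIMSEQ_Suc[OF lim_1_over_n])
    qed
    then have lim: "(\<lambda>j. sample_density K (N j)) \<longlonglongrightarrow> ?p K" by (simp add: LIM_zero_iff)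
    let ?c = "real (card (automorphisms K)) / fact m"
    have c: "?c \<noteq> 0" using card_automorphisms_pos[of K] by (simp add: verts_models[OF K(1)])
    have "(\<lambda>j. ?c * induced_density C (N j)) \<longlonglongrightarrow> ?c * \<phi> C"
      using lim sample_density_eq_induced_density[OF wf_struct_models[OF K(1)] verts_models[OF K(1)]]
      by (simp add: labelled_def verts_models[OF K(1)] vN K(2))
    from tendsto_mult_left[OF this, of "inverse ?c"] show ?thesis using c by (simp add: field_simps)
  qed
  then show ?thesis unfolding Hom_plus_def using \<phi> N s(1)
    by (auto simp: vN intro!: exI[of _ N])
qed

section \<open>Reducts and couplings\<close>

lemma models_relD:
  assumes "K \<in> models T V" "xs \<in> rel K P"
  shows "P \<in> symbols T" "length xs = arity T P" "set xs \<subseteq> V"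
proof -
  show P: "P \<in> symbols T" using assms by (auto simp: models_def)
  then have "rel K P \<subseteq> {xs. length xs = arity T P \<and> set xs \<subseteq> V}"
    using assms(1) by (simp add: models_def)
  then show "length xs = arity T P" "set xs \<subseteq> V" using assms(2) by auto
qed

lemma induced_self: "wf_struct K \<Longrightarrow> induced K (verts K) = K"
  by (rule fo_struct_eqI) (auto simp: induced_def wf_struct_def)

lemma inj_maps_self_bij: "x \<in> inj_maps m {..<m} \<Longrightarrow> bij_betw x {..<m} {..<m}"
  unfolding inj_maps_def bij_betw_def using endo_inj_surj[of "{..<m}" x] by auto

lemma struct_iso_pullback_iff:
  assumes K: "wf_struct K" "verts K = {..<m}" and K': "wf_struct K'" "verts K' = {..<m}"
  shows "struct_iso K K' \<longleftrightarrow> (\<exists>x\<in>inj_maps m {..<m}. pullback m x K' = K)"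
proof -
  have "iso_maps K K' = {x \<in> inj_maps m {..<m}. pullback m x K' = K}"
    using iso_maps_induced_iff[OF K, of _ K' "{..<m}"] induced_self[OF K'(1)] K'(2) inj_maps_self_bij[of _ m]
    by (auto simp: inj_maps_def bij_betw_def)
  then show ?thesis using struct_iso_iff[OF K(1)] by auto
qed

lemma pullback_inj_maps_inj:
  assumes "x \<in> inj_maps m {..<m}" "wf_struct L" "verts L = {..<m}" "wf_struct L'" "verts L' = {..<m}"
    and eq: "pullback m x L = pullback m x L'"
  shows "L = L'"
proof -
  have b: "bij_betw x {..<m} {..<m}" using assms(1) by (rule inj_maps_self_bij)
  let ?y = "inv_into {..<m} x"
  have y: "?y i < m" "x (?y i) = i" if "i < m" for i
    using bij_betwE[OF bij_betw_inv_into[OF b]] bij_betw_inv_into_right[OF b] that by auto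
  have "pullback m ?y (pullback m x K) = K" if "wf_struct K" "verts K = {..<m}" for K :: "('a, nat) fo_struct"
  proof -
    have "pullback m ?y (pullback m x K) = pullback m (x \<circ> ?y) K" using y by (intro pullback_pullback) auto
    also have "\<dots> = pullback m id K" using y by (intro pullback_cong) auto
    finally show ?thesis using pullback_id that by metis
  qed
  then show ?thesis using assms by metis
qed

text \<open>Orbit-stabiliser for the permutations of \<open>{..<m}\<close> acting on models: every
  fibre of \<open>\<lambda>x. pullback m x K\<close> over the orbit has as many elements as there
  are automorphisms.\<close>

lemma card_iso_models:
  assumes T: "finite (symbols T)" and K: "K \<in> models T {..<m}"
  shows "card {K' \<in> models T {..<m}. struct_iso K K'} * card (automorphisms K) = fact m"
proof -
  let ?S = "{K' \<in> models T {..<m}. struct_iso K K'}" and ?I = "inj_maps m {..<m}"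
  note wf = wf_struct_models[OF K] verts_models[OF K]
  have wf': "wf_struct K'" "verts K' = {..<m}" if "K' \<in> ?S" for K'
    using that wf_struct_models verts_models by blast+
  have fib: "card {x \<in> ?I. pullback m x K = K'} = card (automorphisms K)" if K': "K' \<in> ?S" for K'
  proof -
    have iso: "struct_iso K' K" using struct_iso_sym[OF wf(1), of K'] K' by simp
    have "U = {..<m}" if "U \<subseteq> {..<m}" "card U = m" for U :: "nat set"
      using card_subset_eq[OF finite_lessThan that(1)] that by simp
    moreover have "induced K {..<m} \<in> iso_class K'"
      using induced_self[OF wf(1)] wf(2) iso by (simp add: iso_class_def)
    ultimately have "{U. U \<subseteq> {..<m} \<and> card U = m \<and> induced K U \<in> iso_class K'} = {{..<m}}"
      by (intro equalityI subsetI) auto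
    then show ?thesis
      using card_pullback_eq[OF wf'[OF K'], of "{..<m}" K] card_iso_maps(2)[OF wf(1) wf'(1)[OF K']] K' by simp
  qed
  have "card ?I = (\<Sum>K'\<in>?S. \<Sum>x\<in>{x \<in> ?I. pullback m x K = K'}. 1)"
  proof (subst sum.group)
    show "finite ?S" using finite_models[OF T, of "{..<m}"] by simp
    show "(\<lambda>x. pullback m x K) ` ?I \<subseteq> ?S"
    proof (rule image_subsetI)
      fix x assume x: "x \<in> ?I"
      then have "struct_iso (pullback m x K) K"
        using struct_iso_pullback_iff[OF wf_struct_pullback verts_pullback wf] by blast
      then show "pullback m x K \<in> ?S"
        using struct_iso_sym[OF wf_struct_pullback] pullback_inj_maps_models[OF K x] by auto
    qed
  qed auto
  also have "\<dots> = card ?S * card (automorphisms K)" using fib by simp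
  finally show ?thesis by (simp add: card_inj_maps)
qed

lemma class_value_eq_sum_labelled:
  assumes T: "finite (symbols T)" and K: "K \<in> models T {..<m}"
  shows "\<phi> (iso_class K) = (\<Sum>K' | K' \<in> models T {..<m} \<and> struct_iso K K'. labelled \<phi> K')"
proof -
  have "(\<Sum>K' | K' \<in> models T {..<m} \<and> struct_iso K K'. labelled \<phi> K') =
      real (card {K' \<in> models T {..<m}. struct_iso K K'}) * labelled \<phi> K"
    using labelled_cong[OF wf_struct_models[OF K], of _ \<phi>] by simp
  also have "\<dots> = real (card {K' \<in> models T {..<m}. struct_iso K K'} * card (automorphisms K)) / fact m * \<phi> (iso_class K)"
    by (simp add: labelled_def verts_models[OF K])
  finally show ?thesis unfolding card_iso_models[OF T K] by simp
qed

text \<open>Both structure-erasing interpretations arise from a renaming \<open>h\<close> of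
  symbols, namely \<open>Inl\<close> and \<open>Inr\<close>, so one proof treats them
  together.\<close>

definition reduct :: "('p \<Rightarrow> 'q) \<Rightarrow> ('q, 'v) fo_struct \<Rightarrow> ('p, 'v) fo_struct" where
  "reduct h K = \<lparr> verts = verts K, rel = (\<lambda>P. rel K (h P)) \<rparr>"

definition embeds :: "('p \<Rightarrow> 'q) \<Rightarrow> 'p univ_theory \<Rightarrow> 'q univ_theory \<Rightarrow> bool" where
  "embeds h T T' \<longleftrightarrow> (\<forall>P. h P \<in> symbols T' \<longleftrightarrow> P \<in> symbols T) \<and>
     (\<forall>P. arity T' (h P) = arity T P) \<and> map_qf_formula h ` axs T \<subseteq> axs T'"

lemma embeds_disjoint_union:
  "embeds Inl T1 (disjoint_union T1 T2)" "embeds Inr T2 (disjoint_union T1 T2)"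
  by (auto simp: embeds_def disjoint_union_def)

lemma verts_reduct [simp]: "verts (reduct h K) = verts K"
  by (simp add: reduct_def)

lemma reduct_pullback: "reduct h (pullback m x K) = pullback m x (reduct h K)"
  by (simp add: reduct_def pullback_def)

lemma wf_struct_reduct: "wf_struct K \<Longrightarrow> wf_struct (reduct h K)"
  by (auto simp: wf_struct_def reduct_def)

lemma struct_iso_reduct: "struct_iso K K' \<Longrightarrow> struct_iso (reduct h K) (reduct h K')"
  by (auto simp: struct_iso_def reduct_def)

lemma holds_reduct: "holds K a (map_qf_formula h f) \<longleftrightarrow> holds (reduct h K) a f"
  by (induction f) (auto simp: reduct_def)

lemma reduct_models:
  assumes "embeds h T T'" "K \<in> models T' V"
  shows "reduct h K \<in> models T V"
proof -
  have "rel K (h P) \<subseteq> {xs. length xs = arity T P \<and> set xs \<subseteq> V}" if "P \<in> symbols T" for P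
    using models_relD[OF assms(2), of _ "h P"] assms(1) by (auto simp: embeds_def)
  moreover have "rel K (h P) = {}" if "P \<notin> symbols T" for P
    using assms that unfolding embeds_def models_def by auto
  moreover have "holds (reduct h K) a f" if "f \<in> axs T" "range a \<subseteq> V" for f a
    using assms that unfolding embeds_def models_def by (auto simp flip: holds_reduct)
  ultimately show ?thesis using verts_models[OF assms(2)] by (simp add: models_def) (simp add: reduct_def)
qed

text \<open>\<open>interp\<close> cuts relations down to tuples of the right arity inside the vertex
  set. On a model nothing is cut off, and this is invariant under isomorphism, so it also holds for
  the arbitrary representatives that isomorphism classes supply.\<close>

lemma interp_eq_reduct:
  fixes K' :: "('q, 'w) fo_struct"
  assumes h: "embeds h T T'" and K: "K \<in> models T' V" and iso: "struct_iso K K'"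
  shows "interp T (\<lambda>P. Atom (h P) [0..<arity T P]) K' = reduct h K'"
proof (rule fo_struct_eqI)
  fix P
  obtain f where f: "bij_betw f (verts K) (verts K')" "\<And>P. rel K' P = map f ` rel K P"
    using iso by (auto simp: struct_iso_def)
  note R = reduct_models[OF h K]
  have sub: "length xs = arity T P \<and> set xs \<subseteq> verts K'" if "P \<in> symbols T" and xs: "xs \<in> rel K' (h P)" for xs
  proof -
    obtain ys where ys: "ys \<in> rel K (h P)" "xs = map f ys" using f(2)[of "h P"] xs by auto
    then have "length ys = arity T P" "set ys \<subseteq> V"
      using models_relD[OF K ys(1)] h by (auto simp: embeds_def)
    then show ?thesis using f(1) verts_models[OF K] ys(2) by (auto simp: bij_betw_def)
  qed
  have "rel K' (h P) = {}" if "P \<notin> symbols T"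
    using R f(2) that by (simp add: models_def) (simp add: reduct_def)
  moreover have "map (\<lambda>i. xs ! i) [0..<arity T P] = xs" if "length xs = arity T P" for xs :: "'w list"
    using that map_nth[of xs] by simp
  ultimately show "rel (interp T (\<lambda>P. Atom (h P) [0..<arity T P]) K') P = rel (reduct h K') P"
    using sub by (auto simp: interp_def reduct_def)
qed (simp add: interp_def)

text \<open>Each class of models of \<open>T'\<close> is split into its members on
  \<open>{..<m}\<close>, whose labelled values add up to the value of the class.\<close>

lemma interp_limit_reduct:
  fixes T :: "'p univ_theory" and T' :: "'q univ_theory"
  assumes T: "finite (symbols T)" "finite (symbols T')" and h: "embeds h T T'" and K: "K \<in> models T {..<m}"
  shows "interp_limit T T' (\<lambda>P. Atom (h P) [0..<arity T P]) \<xi> (iso_class K) =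
    (\<Sum>L | L \<in> models T' {..<m} \<and> struct_iso K (reduct h L). labelled \<xi> L)"
proof -
  let ?I = "\<lambda>P. Atom (h P) [0..<arity T P]"
  let ?S = "{L. L \<in> models T' {..<m} \<and> struct_iso K (reduct h L)}"
  have C: "iso_class K \<in> model_classes T" using K by (auto simp: model_classes_def model_classes_n_def)
  have eq: "{D. D \<in> model_classes T' \<and> (\<exists>L\<in>D. interp T ?I L \<in> iso_class K)} = iso_class ` ?S"
  proof (intro set_eqI iffI)
    fix D assume D: "D \<in> {D. D \<in> model_classes T' \<and> (\<exists>L\<in>D. interp T ?I L \<in> iso_class K)}"
    then have "D \<in> model_classes T'" by simp
    then obtain n L0 where L0: "L0 \<in> models T' {..<n}" "D = iso_class L0" by (rule model_classesE)
    obtain L :: "('q, nat) fo_struct" where L: "struct_iso L0 L" "struct_iso K (interp T ?I L)"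
      using D by (auto simp: L0 iso_class_def)
    have iso: "struct_iso K (reduct h L)" using L interp_eq_reduct[OF h L0(1) L(1)] by simp
    have "struct_iso (reduct h L) (reduct h L0)"
      using struct_iso_reduct[OF L(1)] struct_iso_sym wf_struct_reduct[OF wf_struct_models[OF L0(1)]] by blast
    then have iso0: "struct_iso K (reduct h L0)" using struct_iso_trans iso by blast
    then have "n = m" using struct_iso_card[OF iso0] by (simp add: verts_models[OF K] verts_models[OF L0(1)])
    then show "D \<in> iso_class ` ?S" using L0 iso0 by auto
  next
    fix D assume "D \<in> iso_class ` ?S"
    then obtain L where L: "L \<in> models T' {..<m}" "struct_iso K (reduct h L)" "D = iso_class L" by auto
    have "L \<in> D" by (simp add: L iso_class_def struct_iso_refl)
    moreover have "interp T ?I L \<in> iso_class K"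
      using interp_eq_reduct[OF h L(1) struct_iso_refl] L(2) by (simp add: iso_class_def)
    moreover have "D \<in> model_classes T'" using L by (auto simp: model_classes_def model_classes_n_def)
    ultimately show "D \<in> {D. D \<in> model_classes T' \<and> (\<exists>L\<in>D. interp T ?I L \<in> iso_class K)}" by blast
  qed
  have finS: "finite ?S" using finite_models[OF T(2), of "{..<m}"] by (rule rev_finite_subset) auto
  have "(\<Sum>L\<in>?S. labelled \<xi> L) = (\<Sum>D\<in>iso_class ` ?S. \<Sum>L\<in>{L \<in> ?S. iso_class L = D}. labelled \<xi> L)"
    by (subst sum.group) (use finS in auto)
  also have "\<dots> = (\<Sum>D\<in>iso_class ` ?S. \<xi> D)"
  proof (rule sum.cong[OF refl])
    fix D assume "D \<in> iso_class ` ?S"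
    then obtain L where L: "L \<in> models T' {..<m}" "struct_iso K (reduct h L)" "D = iso_class L" by auto
    note wf = wf_struct_models[OF L(1)]
    have "{L' \<in> ?S. iso_class L' = D} = {L'. L' \<in> models T' {..<m} \<and> struct_iso L L'}"
    proof (intro set_eqI iffI)
      fix L' assume "L' \<in> {L' \<in> ?S. iso_class L' = D}"
      moreover have "L' \<in> iso_class L'" by (simp add: iso_class_def struct_iso_refl)
      ultimately show "L' \<in> {L'. L' \<in> models T' {..<m} \<and> struct_iso L L'}"
        by (auto simp: L iso_class_def)
    next
      fix L' assume L': "L' \<in> {L'. L' \<in> models T' {..<m} \<and> struct_iso L L'}"
      then have "iso_class L' = D" using iso_class_eq[OF wf, of L'] L by simp
      moreover have "struct_iso K (reduct h L')" 
        using struct_iso_trans[OF L(2) struct_iso_reduct] L' by blast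
      ultimately show "L' \<in> {L' \<in> ?S. iso_class L' = D}" using L' by simp
    qed
    then show "(\<Sum>L\<in>{L \<in> ?S. iso_class L = D}. labelled \<xi> L) = \<xi> D"
      using class_value_eq_sum_labelled[OF T(2) L(1), of \<xi>] L(3) by simp
  qed
  finally show ?thesis using C by (simp add: interp_limit_def eq)
qed

text \<open>A consistent law is invariant under relabelling, so the sum over a class is spread evenly
  over its members.\<close>

lemma interp_limit_reduct_labelled:
  assumes T: "finite (symbols T)" "finite (symbols T')" and h: "embeds h T T'" and K: "K \<in> models T {..<m}"
    and \<xi>: "consistent_law T' (labelled \<xi>)"
    and \<phi>: "interp_limit T T' (\<lambda>P. Atom (h P) [0..<arity T P]) \<xi> = \<phi>"
  shows "labelled \<phi> K = (\<Sum>L | L \<in> models T' {..<m} \<and> reduct h L = K. labelled \<xi> L)"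
proof -
  let ?g = "\<lambda>K. \<Sum>L | L \<in> models T' {..<m} \<and> reduct h L = K. labelled \<xi> L"
  let ?S = "{L. L \<in> models T' {..<m} \<and> struct_iso K (reduct h L)}"
  let ?C = "{K' \<in> models T {..<m}. struct_iso K K'}"
  note wf = wf_struct_models[OF K] verts_models[OF K]
  have fin: "finite ?S" "finite ?C" 
    using finite_models[OF T(2), of "{..<m}"] finite_models[OF T(1), of "{..<m}"] by simp_all
  have g: "?g K' = ?g K" if K': "K' \<in> ?C" for K'
  proof -
    have wf': "wf_struct K'" "verts K' = {..<m}" using K' wf_struct_models verts_models by blast+
    obtain x where x: "x \<in> inj_maps m {..<m}" "pullback m x K' = K"
      using K' struct_iso_pullback_iff[OF wf wf'] by blast
    have "?g K = (\<Sum>L | L \<in> models T' {..<m} \<and> reduct h (pullback m x L) = K. labelled \<xi> L)"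
      by (rule consistent_law_sum[OF T(2) \<xi> x(1), symmetric])
    also have "\<dots> = ?g K'"
    proof (rule sum.cong)
      have "reduct h (pullback m x L) = K \<longleftrightarrow> reduct h L = K'" if L: "L \<in> models T' {..<m}" for L
      proof
        assume "reduct h (pullback m x L) = K"
        then have eq: "pullback m x (reduct h L) = pullback m x K'" by (simp add: reduct_pullback x(2))
        show "reduct h L = K'"
          by (rule pullback_inj_maps_inj[OF x(1) _ _ wf' eq])
             (use wf_struct_reduct[OF wf_struct_models[OF L]] verts_models[OF L] in auto)
      qed (simp add: reduct_pullback x(2))
      then show "{L. L \<in> models T' {..<m} \<and> reduct h (pullback m x L) = K} =
          {L. L \<in> models T' {..<m} \<and> reduct h L = K'}" by auto
    qed simp
    finally show ?thesis by simp
  qed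
  have "\<phi> (iso_class K) = (\<Sum>L\<in>?S. labelled \<xi> L)"
    using interp_limit_reduct[OF T h K, of \<xi>] by (simp add: \<phi>)
  also have "\<dots> = (\<Sum>K'\<in>?C. \<Sum>L\<in>{L \<in> ?S. reduct h L = K'}. labelled \<xi> L)"
    by (subst sum.group) (use fin reduct_models[OF h] in auto)
  also have "\<dots> = (\<Sum>K'\<in>?C. ?g K)"
  proof (rule sum.cong[OF refl])
    fix K' assume K': "K' \<in> ?C"
    then have "{L \<in> ?S. reduct h L = K'} = {L. L \<in> models T' {..<m} \<and> reduct h L = K'}" by auto
    then show "(\<Sum>L\<in>{L \<in> ?S. reduct h L = K'}. labelled \<xi> L) = ?g K" using g[OF K'] by simp
  qed
  also have "\<dots> = real (card ?C) * ?g K" by simp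
  finally have "labelled \<phi> K = real (card ?C * card (automorphisms K)) / fact m * ?g K"
    by (simp add: labelled_def wf(2))
  then show ?thesis unfolding card_iso_models[OF T(1) K] by simp
qed

section \<open>Models of a disjoint union as pairs of models\<close>

definition join :: "('p, 'v) fo_struct \<Rightarrow> ('q, 'v) fo_struct \<Rightarrow> ('p + 'q, 'v) fo_struct" where
  "join K1 K2 = \<lparr> verts = verts K1, rel = case_sum (rel K1) (rel K2) \<rparr>"

lemma reduct_join [simp]: 
  "reduct Inl (join K1 K2) = K1" "verts K1 = verts K2 \<Longrightarrow> reduct Inr (join K1 K2) = K2"
  by (simp_all add: reduct_def join_def)

lemma join_reduct: "join (reduct Inl K) (reduct Inr K) = K"
  by (rule fo_struct_eqI) (auto simp: join_def reduct_def split: sum.splits)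

lemma join_models:
  assumes "K1 \<in> models T1 V" "K2 \<in> models T2 V"
  shows "join K1 K2 \<in> models (disjoint_union T1 T2) V"
proof -
  have v: "verts K1 = V" "verts K2 = V" using assms verts_models by auto
  have h: "holds (join K1 K2) a (map_qf_formula Inl f) \<longleftrightarrow> holds K1 a f"
    "holds (join K1 K2) a (map_qf_formula Inr g) \<longleftrightarrow> holds K2 a g" for a f g
    by (simp_all add: holds_reduct v)
  have "\<forall>P\<in>symbols (disjoint_union T1 T2). rel (join K1 K2) P \<subseteq> {xs. length xs = arity (disjoint_union T1 T2) P \<and> set xs \<subseteq> V}"
    using models_relD(1,2)[OF assms(1)] models_relD(1,2)[OF assms(2)]
      subsetD[OF models_relD(3)[OF assms(1)]] subsetD[OF models_relD(3)[OF assms(2)]]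
    by (auto simp: join_def disjoint_union_def)
  moreover have "\<forall>P. P \<notin> symbols (disjoint_union T1 T2) \<longrightarrow> rel (join K1 K2) P = {}"
    using assms by (auto simp: models_def join_def disjoint_union_def split: sum.splits)
  moreover have "\<forall>f\<in>axs (disjoint_union T1 T2). \<forall>a. range a \<subseteq> V \<longrightarrow> holds (join K1 K2) a f"
    using assms h by (auto simp: models_def disjoint_union_def)
  ultimately show ?thesis using v by (simp add: models_def join_def)
qed

lemma sum_models_disjoint_union:
  "(\<Sum>K | K \<in> models (disjoint_union T1 T2) V \<and> Q1 (reduct Inl K) \<and> Q2 (reduct Inr K). f (reduct Inl K) * (g (reduct Inr K) :: real)) =
    (\<Sum>K1 | K1 \<in> models T1 V \<and> Q1 K1. f K1) * (\<Sum>K2 | K2 \<in> models T2 V \<and> Q2 K2. g K2)"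
proof -
  have "(\<Sum>K | K \<in> models (disjoint_union T1 T2) V \<and> Q1 (reduct Inl K) \<and> Q2 (reduct Inr K). f (reduct Inl K) * g (reduct Inr K)) =
    (\<Sum>KK\<in>{K1. K1 \<in> models T1 V \<and> Q1 K1} \<times> {K2. K2 \<in> models T2 V \<and> Q2 K2}. f (fst KK) * g (snd KK))"
  proof (rule sum.reindex_bij_witness[where i = "\<lambda>KK. join (fst KK) (snd KK)" 
        and j = "\<lambda>K. (reduct Inl K, reduct Inr K)"])
    fix KK assume KK: "KK \<in> {K1. K1 \<in> models T1 V \<and> Q1 K1} \<times> {K2. K2 \<in> models T2 V \<and> Q2 K2}"
    then have "verts (fst KK) = verts (snd KK)" using verts_models[of _ T1 V] verts_models[of _ T2 V] by force
    then show "(reduct Inl (join (fst KK) (snd KK)), reduct Inr (join (fst KK) (snd KK))) = KK"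
      "join (fst KK) (snd KK) \<in> {K \<in> models (disjoint_union T1 T2) V. Q1 (reduct Inl K) \<and> Q2 (reduct Inr K)}"
      using KK join_models[of "fst KK" T1 V "snd KK" T2] by auto
  qed (auto simp: join_reduct intro: reduct_models[OF embeds_disjoint_union(1)] reduct_models[OF embeds_disjoint_union(2)])
  then show ?thesis by (simp add: sum_product sum.cartesian_product case_prod_unfold)
qed

lemma erase_eq:
  "erase_left T1 = (\<lambda>P. Atom (Inl P) [0..<arity T1 P])" "erase_right T2 = (\<lambda>P. Atom (Inr P) [0..<arity T2 P])"
  by (auto simp: erase_left_def erase_right_def)

lemma finite_symbols_disjoint_union:
  "finite (symbols T1) \<Longrightarrow> finite (symbols T2) \<Longrightarrow> finite (symbols (disjoint_union T1 T2))"
  by (simp add: disjoint_union_def)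

text \<open>The prefactor in \<open>indep_coupling\<close> is inverse to the one in
  \<open>labelled\<close>, and both labelled factors are invariant under isomorphism, so the chosen
  class representative may be exchanged for \<open>K\<close>.\<close>

lemma labelled_indep_coupling:
  assumes K: "K \<in> models (disjoint_union T1 T2) {..<m}"
  shows "labelled (indep_coupling T1 T2 \<phi>1 \<phi>2) K =
    labelled \<phi>1 (reduct Inl K) * labelled \<phi>2 (reduct Inr K)"
proof -
  let ?R = "class_rep (iso_class K)"
  note wf = wf_struct_models[OF K] verts_models[OF K]
  have C: "iso_class K \<in> model_classes (disjoint_union T1 T2)" 
    using K by (auto simp: model_classes_def model_classes_n_def)
  have iso: "struct_iso K ?R" by (rule class_rep_iso)
  have "card (verts ?R) = m" using struct_iso_card[OF iso] wf by simp
  moreover have "card (automorphisms ?R) = card (automorphisms K)"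
    using card_iso_maps(2)[OF wf(1) wf_struct_iso[OF wf(1) iso] iso] .
  moreover have "labelled \<phi>1 (interp T1 (erase_left T1) ?R) = labelled \<phi>1 (reduct Inl K)"
    unfolding erase_eq interp_eq_reduct[OF embeds_disjoint_union(1) K iso]
    by (rule labelled_cong[OF wf_struct_reduct[OF wf(1)] struct_iso_reduct[OF iso]])
  moreover have "labelled \<phi>2 (interp T2 (erase_right T2) ?R) = labelled \<phi>2 (reduct Inr K)"
    unfolding erase_eq interp_eq_reduct[OF embeds_disjoint_union(2) K iso]
    by (rule labelled_cong[OF wf_struct_reduct[OF wf(1)] struct_iso_reduct[OF iso]])
  moreover have "card (automorphisms K) > 0" using card_automorphisms_pos[of K] wf by simp
  moreover have "indep_coupling T1 T2 \<phi>1 \<phi>2 (iso_class K) = fact (card (verts ?R)) / real (card (automorphisms ?R)) *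
      (labelled \<phi>1 (interp T1 (erase_left T1) ?R) * labelled \<phi>2 (interp T2 (erase_right T2) ?R))"
    using C by (simp add: indep_coupling_def Let_def)
  ultimately show ?thesis
    unfolding labelled_def[of "indep_coupling T1 T2 \<phi>1 \<phi>2"] by (simp add: wf(2))
qed

lemma consistent_law_cong:
  assumes eq: "\<And>n K. K \<in> models T {..<n} \<Longrightarrow> p K = q K"
  shows "consistent_law T p \<Longrightarrow> consistent_law T q" "dissociated_law T p \<Longrightarrow> dissociated_law T q"
proof -
  have s: "(\<Sum>K | K \<in> models T {..<n} \<and> Q K. q K) = (\<Sum>K | K \<in> models T {..<n} \<and> Q K. p K)"
    "(\<Sum>K\<in>models T {..<n}. q K) = (\<Sum>K\<in>models T {..<n}. p K)" for Q n
    by (rule sum.cong; use eq in auto)+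
  show "consistent_law T p \<Longrightarrow> consistent_law T q"
    unfolding consistent_law_def s by (auto simp: eq[symmetric])
  show "dissociated_law T p \<Longrightarrow> dissociated_law T q"
    unfolding dissociated_law_def s by (auto simp: eq[symmetric])
qed

lemma product_law:
  assumes p1: "consistent_law T1 p1" "dissociated_law T1 p1" and p2: "consistent_law T2 p2" "dissociated_law T2 p2"
  shows "consistent_law (disjoint_union T1 T2) (\<lambda>K. p1 (reduct Inl K) * p2 (reduct Inr K))"
    "dissociated_law (disjoint_union T1 T2) (\<lambda>K. p1 (reduct Inl K) * p2 (reduct Inr K))"
proof -
  let ?U = "disjoint_union T1 T2"
  note rm = reduct_models[OF embeds_disjoint_union(1)] reduct_models[OF embeds_disjoint_union(2)]
  have iff: "(K = L) = (reduct Inl K = reduct Inl L \<and> reduct Inr K = reduct Inr L)" for K L :: "('a + 'b, 'v) fo_struct"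
    by (metis join_reduct)
  have "0 \<le> p1 (reduct Inl K) * p2 (reduct Inr K)" if "K \<in> models ?U {..<n}" for K n
    using consistent_lawD(1)[OF p1(1)] consistent_lawD(1)[OF p2(1)] rm[OF that] by (intro mult_nonneg_nonneg) auto
  moreover have "(\<Sum>K\<in>models ?U {..<n}. p1 (reduct Inl K) * p2 (reduct Inr K)) = 1" for n
    using sum_models_disjoint_union[of p1 p2 T1 T2 "{..<n}" "\<lambda>_. True" "\<lambda>_. True"]
      consistent_lawD(2)[OF p1(1)] consistent_lawD(2)[OF p2(1)] by simp
  moreover have "(\<Sum>K' | K' \<in> models ?U {..<n} \<and> pullback m y K' = K. p1 (reduct Inl K') * p2 (reduct Inr K'))
     = p1 (reduct Inl K) * p2 (reduct Inr K)" if y: "y \<in> inj_maps m {..<n}" and K: "K \<in> models ?U {..<m}" for m n y K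
    using sum_models_disjoint_union[of p1 p2 T1 T2 "{..<n}" "\<lambda>L. pullback m y L = reduct Inl K" "\<lambda>L. pullback m y L = reduct Inr K"]
      consistent_lawD(3)[OF p1(1) y rm(1)[OF K]] consistent_lawD(3)[OF p2(1) y rm(2)[OF K]]
    by (simp add: iff[of "pullback m y _"] reduct_pullback)
  ultimately show "consistent_law ?U (\<lambda>K. p1 (reduct Inl K) * p2 (reduct Inr K))"
    unfolding consistent_law_def by blast
  have "(\<Sum>L | L \<in> models ?U {..<m + m'} \<and> pullback m id L = K \<and> pullback m' (\<lambda>i. m + i) L = K'. p1 (reduct Inl L) * p2 (reduct Inr L))
     = p1 (reduct Inl K) * p2 (reduct Inr K) * (p1 (reduct Inl K') * p2 (reduct Inr K'))" 
    if K: "K \<in> models ?U {..<m}" "K' \<in> models ?U {..<m'}" for m m' K K'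
  proof -
    have eq: "{L. L \<in> models ?U {..<m + m'} \<and> pullback m id L = K \<and> pullback m' (\<lambda>i. m + i) L = K'} =
      {L. L \<in> models ?U {..<m + m'} \<and> 
        (pullback m id (reduct Inl L) = reduct Inl K \<and> pullback m' (\<lambda>i. m + i) (reduct Inl L) = reduct Inl K') \<and>
        (pullback m id (reduct Inr L) = reduct Inr K \<and> pullback m' (\<lambda>i. m + i) (reduct Inr L) = reduct Inr K')}"
      by (auto simp: iff[of "pullback _ _ _"] reduct_pullback)
    show ?thesis unfolding eq
      unfolding sum_models_disjoint_union[of p1 p2 T1 T2 "{..<m + m'}" "\<lambda>L. pullback m id L = reduct Inl K \<and> pullback m' (\<lambda>i. m + i) L = reduct Inl K'" "\<lambda>L. pullback m id L = reduct Inr K \<and> pullback m' (\<lambda>i. m + i) L = reduct Inr K'"]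
      using p1(2) p2(2) rm[OF K(1)] rm[OF K(2)] unfolding dissociated_law_def by simp
  qed
  then show "dissociated_law ?U (\<lambda>K. p1 (reduct Inl K) * p2 (reduct Inr K))"
    unfolding dissociated_law_def by blast
qed

lemma Hom_plus_extensional: "\<phi> \<in> Hom_plus T \<Longrightarrow> \<phi> \<in> model_classes T \<rightarrow>\<^sub>E {0..1}"
  by (simp add: Hom_plus_def)

lemma model_class_fun_eqI:
  assumes "\<phi> \<in> extensional (model_classes T)" "\<psi> \<in> extensional (model_classes T)"
    and "\<And>m K. K \<in> models T {..<m} \<Longrightarrow> \<phi> (iso_class K) = \<psi> (iso_class K)"
  shows "\<phi> = \<psi>"
proof (rule extensionalityI[OF assms(1,2)])
  fix C assume "C \<in> model_classes T"
  then show "\<phi> C = \<psi> C" using assms(3) by (auto elim: model_classesE)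
qed

lemma labelled_eqI:
  assumes "\<phi> \<in> extensional (model_classes T)" "\<psi> \<in> extensional (model_classes T)"
    and eq: "\<And>m K. K \<in> models T {..<m} \<Longrightarrow> labelled \<phi> K = labelled \<psi> K"
  shows "\<phi> = \<psi>"
proof (rule model_class_fun_eqI[OF assms(1,2)])
  fix m :: nat and K assume K: "K \<in> models T {..<m}"
  have "card (automorphisms K) > 0" using card_automorphisms_pos[of K] by (simp add: verts_models[OF K])
  then show "\<phi> (iso_class K) = \<psi> (iso_class K)" using eq[OF K] by (simp add: labelled_def)
qed

text \<open>The product of the two laws is again consistent and dissociated, so
  \<open>Hom_plusI\<close> supplies a convergent sequence; none has to be built from the sequences
  of the two factors.\<close>

lemma indep_coupling_is_coupling:
  assumes T: "finite (symbols T1)" "finite (symbols T2)" and \<phi>: "\<phi>1 \<in> Hom_plus T1" "\<phi>2 \<in> Hom_plus T2"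
  shows "is_coupling T1 T2 \<phi>1 \<phi>2 (indep_coupling T1 T2 \<phi>1 \<phi>2)"
proof -
  let ?U = "disjoint_union T1 T2" and ?\<xi> = "indep_coupling T1 T2 \<phi>1 \<phi>2"
  note U = finite_symbols_disjoint_union[OF T]
  note laws = product_law[OF Hom_plus_laws[OF T(1) \<phi>(1)] Hom_plus_laws[OF T(2) \<phi>(2)]]
  have \<xi>: "consistent_law ?U (labelled ?\<xi>)" "dissociated_law ?U (labelled ?\<xi>)"
    by (rule consistent_law_cong[OF labelled_indep_coupling[symmetric]], assumption, rule laws)+
  have "?\<xi> \<in> model_classes ?U \<rightarrow>\<^sub>E {0..1}"
  proof
    fix C assume "C \<in> model_classes ?U"
    then obtain m K where K: "K \<in> models ?U {..<m}" "C = iso_class K" by (rule model_classesE)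
    \<comment> \<open>The value at a class is the total probability of its labelled members, hence
      at most 1.\<close>
    show "?\<xi> C \<in> {0..1}" unfolding K(2) class_value_eq_sum_labelled[OF U K(1), of ?\<xi>]
      using consistent_law_sum_le_1[OF U \<xi>(1), of "{K'. K' \<in> models ?U {..<m} \<and> struct_iso K K'}" m] by auto
  qed (simp add: indep_coupling_def)
  then have hom: "?\<xi> \<in> Hom_plus ?U" by (rule Hom_plusI[OF U _ \<xi>])
  have "interp_limit T1 ?U (erase_left T1) ?\<xi> = \<phi>1"
  proof (rule labelled_eqI)
    fix m :: nat and K assume K: "K \<in> models T1 {..<m}"
    have "labelled (interp_limit T1 ?U (erase_left T1) ?\<xi>) K = 
        (\<Sum>L | L \<in> models ?U {..<m} \<and> reduct Inl L = K. labelled ?\<xi> L)"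
      by (rule interp_limit_reduct_labelled[OF T(1) U embeds_disjoint_union(1) K \<xi>(1)]) (simp add: erase_eq)
    also have "\<dots> = (\<Sum>L | L \<in> models ?U {..<m} \<and> reduct Inl L = K \<and> True. labelled \<phi>1 (reduct Inl L) * labelled \<phi>2 (reduct Inr L))"
      by (intro sum.cong) (auto simp: labelled_indep_coupling)
    also have "\<dots> = (\<Sum>L | L \<in> models T1 {..<m} \<and> L = K. labelled \<phi>1 L) * (\<Sum>L | L \<in> models T2 {..<m} \<and> True. labelled \<phi>2 L)"
      by (rule sum_models_disjoint_union)
    also have "{L. L \<in> models T1 {..<m} \<and> L = K} = {K}" using K by auto
    finally show "labelled (interp_limit T1 ?U (erase_left T1) ?\<xi>) K = labelled \<phi>1 K"
      using consistent_lawD(2)[OF Hom_plus_laws(1)[OF T(2) \<phi>(2)]] by simp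
  qed (use Hom_plus_extensional[OF \<phi>(1)] in \<open>auto simp: interp_limit_def PiE_iff\<close>)
  moreover have "interp_limit T2 ?U (erase_right T2) ?\<xi> = \<phi>2"
  proof (rule labelled_eqI)
    fix m :: nat and K assume K: "K \<in> models T2 {..<m}"
    have "labelled (interp_limit T2 ?U (erase_right T2) ?\<xi>) K = 
        (\<Sum>L | L \<in> models ?U {..<m} \<and> reduct Inr L = K. labelled ?\<xi> L)"
      by (rule interp_limit_reduct_labelled[OF T(2) U embeds_disjoint_union(2) K \<xi>(1)]) (simp add: erase_eq)
    also have "\<dots> = (\<Sum>L | L \<in> models ?U {..<m} \<and> True \<and> reduct Inr L = K. labelled \<phi>1 (reduct Inl L) * labelled \<phi>2 (reduct Inr L))"
      by (intro sum.cong) (auto simp: labelled_indep_coupling)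
    also have "\<dots> = (\<Sum>L | L \<in> models T1 {..<m} \<and> True. labelled \<phi>1 L) * (\<Sum>L | L \<in> models T2 {..<m} \<and> L = K. labelled \<phi>2 L)"
      by (rule sum_models_disjoint_union)
    also have "{L. L \<in> models T2 {..<m} \<and> L = K} = {K}" using K by auto
    finally show "labelled (interp_limit T2 ?U (erase_right T2) ?\<xi>) K = labelled \<phi>2 K"
      using consistent_lawD(2)[OF Hom_plus_laws(1)[OF T(1) \<phi>(1)]] by simp
  qed (use Hom_plus_extensional[OF \<phi>(2)] in \<open>auto simp: interp_limit_def PiE_iff\<close>)
  ultimately show ?thesis using hom by (simp add: is_coupling_def)
qed

lemma coupling_marginals:
  assumes T: "finite (symbols T1)" "finite (symbols T2)" and \<xi>: "is_coupling T1 T2 \<phi>1 \<phi>2 \<xi>"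
  shows "K \<in> models T1 {..<m} \<Longrightarrow>
      labelled \<phi>1 K = (\<Sum>L | L \<in> models (disjoint_union T1 T2) {..<m} \<and> reduct Inl L = K. labelled \<xi> L)"
    "K' \<in> models T2 {..<m} \<Longrightarrow>
      labelled \<phi>2 K' = (\<Sum>L | L \<in> models (disjoint_union T1 T2) {..<m} \<and> reduct Inr L = K'. labelled \<xi> L)"
proof -
  note U = finite_symbols_disjoint_union[OF T]
  have c: "consistent_law (disjoint_union T1 T2) (labelled \<xi>)"
    using Hom_plus_laws(1)[OF U] \<xi> by (simp add: is_coupling_def)
  show "K \<in> models T1 {..<m} \<Longrightarrow>
      labelled \<phi>1 K = (\<Sum>L | L \<in> models (disjoint_union T1 T2) {..<m} \<and> reduct Inl L = K. labelled \<xi> L)"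
    by (rule interp_limit_reduct_labelled[OF T(1) U embeds_disjoint_union(1) _ c])
      (use \<xi> in \<open>simp_all add: is_coupling_def erase_eq\<close>)
  show "K' \<in> models T2 {..<m} \<Longrightarrow>
      labelled \<phi>2 K' = (\<Sum>L | L \<in> models (disjoint_union T1 T2) {..<m} \<and> reduct Inr L = K'. labelled \<xi> L)"
    by (rule interp_limit_reduct_labelled[OF T(2) U embeds_disjoint_union(2) _ c])
      (use \<xi> in \<open>simp_all add: is_coupling_def erase_eq\<close>)
qed

lemma coupling_eq_indep_couplingI:
  assumes \<xi>: "is_coupling T1 T2 \<phi>1 \<phi>2 \<xi>"
    and eq: "\<And>m K. K \<in> models (disjoint_union T1 T2) {..<m} \<Longrightarrow>
      labelled \<xi> K = labelled \<phi>1 (reduct Inl K) * labelled \<phi>2 (reduct Inr K)"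
  shows "\<xi> = indep_coupling T1 T2 \<phi>1 \<phi>2"
proof (rule labelled_eqI)
  show "\<xi> \<in> extensional (model_classes (disjoint_union T1 T2))"
    using \<xi> Hom_plus_extensional[of \<xi>] by (auto simp: is_coupling_def PiE_iff)
next
  show "indep_coupling T1 T2 \<phi>1 \<phi>2 \<in> extensional (model_classes (disjoint_union T1 T2))"
    by (simp add: indep_coupling_def)
qed (simp add: eq labelled_indep_coupling)

section \<open>Laws of theons\<close>

definition reindex :: "nat \<Rightarrow> (nat \<Rightarrow> 'v) \<Rightarrow> ('v set \<Rightarrow> 'x) \<Rightarrow> nat set \<Rightarrow> 'x" where
  "reindex m x \<theta> = (\<lambda>A\<in>fin_subsets {..<m}. \<theta> (x ` A))"

text \<open>The sample on \<open>{..<m}\<close> is viewed as a function of the finitely many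
  variables at subsets of \<open>{..<m}\<close>, so that its law can be computed on a finite
  product.\<close>

definition local_struct :: "'p univ_theory \<Rightarrow> ('p \<Rightarrow> (nat set \<Rightarrow> 'x) set) \<Rightarrow> nat \<Rightarrow> (nat set \<Rightarrow> 'x) \<Rightarrow> ('p, nat) fo_struct" where
  "local_struct T \<N> m y = \<lparr> verts = {..<m},
     rel = (\<lambda>P. if P \<in> symbols T
                then {\<alpha>. length \<alpha> = arity T P \<and> distinct \<alpha> \<and> set \<alpha> \<subseteq> {..<m} \<and> pull_back \<alpha> y \<in> \<N> P}
                else {}) \<rparr>"

lemma fo_struct_eq_iff:
  fixes K K' :: "('p, 'v) fo_struct"
  shows "K = K' \<longleftrightarrow> verts K = verts K' \<and> (\<forall>P. rel K P = rel K' P)"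
  by (auto intro: fo_struct_eqI)

lemma finite_fin_subsets [simp]: "finite V \<Longrightarrow> finite (fin_subsets V)"
  by (rule rev_finite_subset[of "Pow V"]) (auto simp: fin_subsets_def)

lemma pull_back_eq_reindex: "pull_back \<alpha> = reindex (length \<alpha>) ((!) \<alpha>)"
  by (auto simp: pull_back_def reindex_def fun_eq_iff)

lemma image_fin_subsets:
  assumes "A \<in> fin_subsets {..<m}" "\<And>i. i < m \<Longrightarrow> x i \<in> V"
  shows "x ` A \<in> fin_subsets V"
  using assms by (auto simp: fin_subsets_def)

lemma pull_back_map:
  assumes "set ys \<subseteq> {..<m}"
  shows "pull_back (map x ys) \<theta> = pull_back ys (reindex m x \<theta>)"
proof
  fix A
  have 1: "(!) ys ` A \<in> fin_subsets {..<m}" if "A \<in> fin_subsets {..<length ys}"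
    using that assms nth_mem by (intro image_fin_subsets[of _ "length ys"]) (auto simp: subset_iff)
  have "(!) (map x ys) ` A = x ` ((!) ys ` A)" if "A \<in> fin_subsets {..<length ys}"
    using that unfolding image_image by (intro image_cong) (auto simp: fin_subsets_def)
  then show "pull_back (map x ys) \<theta> A = pull_back ys (reindex m x \<theta>) A"
    using 1 by (simp add: pull_back_def reindex_def)
qed

lemma pullback_theon_struct:
  assumes "inj_on x {..<m}"
  shows "pullback m x (theon_struct T \<N> \<theta>) = local_struct T \<N> m (reindex m x \<theta>)"
proof (rule fo_struct_eqI)
  fix P
  have "set ys \<subseteq> {..<m} \<and> distinct (map x ys) \<longleftrightarrow> set ys \<subseteq> {..<m} \<and> distinct ys" for ys
    using assms by (auto simp: distinct_map intro: inj_on_subset)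
  then show "rel (pullback m x (theon_struct T \<N> \<theta>)) P = rel (local_struct T \<N> m (reindex m x \<theta>)) P"
    by (auto simp: pullback_def theon_struct_def local_struct_def pull_back_map)
qed (simp add: local_struct_def)

lemma distr_reindex:
  fixes \<Omega> :: "'x measure"
  assumes "prob_space \<Omega>" and x: "inj_on x {..<m}" "\<And>i. i < m \<Longrightarrow> x i \<in> V"
  shows "distr (\<Pi>\<^sub>M A\<in>fin_subsets V. \<Omega>) (\<Pi>\<^sub>M A\<in>fin_subsets {..<m}. \<Omega>) (reindex m x) =
    (\<Pi>\<^sub>M A\<in>fin_subsets {..<m}. \<Omega>)"
  unfolding reindex_def
proof (rule distr_PiM_reindex[of "fin_subsets V" "\<lambda>_. \<Omega>" "\<lambda>A. x ` A"])
  show "inj_on ((`) x) (fin_subsets {..<m})"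
    using x(1) by (intro inj_on_subset[OF inj_on_image_Pow]) (auto simp: fin_subsets_def)
  show "(`) x \<in> fin_subsets {..<m} \<rightarrow> fin_subsets V"
    by (intro Pi_I image_fin_subsets x(2))
qed (use assms in auto)

lemma measurable_reindex [measurable]:
  assumes x: "\<And>i. i < m \<Longrightarrow> x i \<in> V"
  shows "reindex m x \<in> (\<Pi>\<^sub>M A\<in>fin_subsets V. \<Omega>) \<rightarrow>\<^sub>M (\<Pi>\<^sub>M A\<in>fin_subsets {..<m}. \<Omega>)"
  unfolding reindex_def
  by (intro measurable_restrict measurable_component_singleton image_fin_subsets[OF _ x])

lemma local_struct_sets:
  fixes \<Omega> :: "'x measure" and K :: "('p, nat) fo_struct"
  assumes T: "finite (symbols T)" 
    and N: "\<And>P. P \<in> symbols T \<Longrightarrow> \<N> P \<in> sets (\<Pi>\<^sub>M A\<in>fin_subsets {..<arity T P}. \<Omega>)"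
  shows "{y \<in> space (\<Pi>\<^sub>M A\<in>fin_subsets {..<m}. \<Omega>). local_struct T \<N> m y = K} \<in> sets (\<Pi>\<^sub>M A\<in>fin_subsets {..<m}. \<Omega>)"
proof -
  let ?M = "\<Pi>\<^sub>M A\<in>fin_subsets {..<m}. \<Omega>"
  let ?L = "\<lambda>P. {\<alpha>. length \<alpha> = arity T P \<and> distinct \<alpha> \<and> set \<alpha> \<subseteq> {..<m}}"
  have finL: "finite (?L P)" for P
    by (rule rev_finite_subset[OF finite_lists_length_eq[of "{..<m}" "arity T P"]]) auto
  have eq: "local_struct T \<N> m y = K \<longleftrightarrow> verts K = {..<m} \<and> (\<forall>P. P \<notin> symbols T \<longrightarrow> rel K P = {}) \<and>
     (\<forall>P\<in>symbols T. rel K P \<subseteq> ?L P) \<and> (\<forall>P\<in>symbols T. \<forall>\<alpha>\<in>?L P. pull_back \<alpha> y \<in> \<N> P \<longleftrightarrow> \<alpha> \<in> rel K P)" for y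
  proof -
    have "local_struct T \<N> m y = K \<longleftrightarrow> verts K = {..<m} \<and> (\<forall>P. rel (local_struct T \<N> m y) P = rel K P)"
      unfolding fo_struct_eq_iff[of _ K] by (auto simp: local_struct_def)
    also have "\<dots> \<longleftrightarrow> verts K = {..<m} \<and> (\<forall>P. P \<notin> symbols T \<longrightarrow> rel K P = {}) \<and>
      (\<forall>P\<in>symbols T. {\<alpha> \<in> ?L P. pull_back \<alpha> y \<in> \<N> P} = rel K P)"
    proof -
      have "(\<forall>P. rel (local_struct T \<N> m y) P = rel K P) \<longleftrightarrow> (\<forall>P. P \<notin> symbols T \<longrightarrow> rel K P = {}) \<and>
        (\<forall>P\<in>symbols T. rel (local_struct T \<N> m y) P = rel K P)"
        by (auto simp: local_struct_def)
      moreover have "rel (local_struct T \<N> m y) P = {\<alpha> \<in> ?L P. pull_back \<alpha> y \<in> \<N> P}" if "P \<in> symbols T" for P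
        using that by (auto simp: local_struct_def)
      ultimately show ?thesis by simp
    qed
    finally show ?thesis by blast
  qed
  have "{y \<in> space ?M. pull_back \<alpha> y \<in> \<N> P} \<in> sets ?M" if "P \<in> symbols T" "\<alpha> \<in> ?L P" for P \<alpha>
  proof -
    have "\<alpha> ! i < m" if "i < length \<alpha>" for i using \<open>\<alpha> \<in> ?L P\<close> nth_mem[OF that] by auto
    then have "pull_back \<alpha> \<in> ?M \<rightarrow>\<^sub>M (\<Pi>\<^sub>M A\<in>fin_subsets {..<length \<alpha>}. \<Omega>)"
      unfolding pull_back_eq_reindex by (intro measurable_reindex) auto
    from measurable_sets[OF this, of "\<N> P"] N[OF that(1)] that(2) show ?thesis
      by (simp add: vimage_def Int_def conj_commute)
  qed
  then have "{y \<in> space ?M. \<forall>P\<in>symbols T. \<forall>\<alpha>\<in>?L P. pull_back \<alpha> y \<in> \<N> P \<longleftrightarrow> \<alpha> \<in> rel K P} \<in> sets ?M"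
    by (intro sets.sets_Collect_finite_All' sets.sets_Collect_finite_All T finL sets.sets_Collect) auto
  then show ?thesis unfolding eq by (intro sets.sets_Collect_conj) auto
qed

text \<open>Common form of bounded rank and of independence of a peon: only the coordinates in
  \<open>J\<close> matter. One implication is enough because \<open>x\<close> and \<open>y\<close>
  may be exchanged.\<close>

definition cylinder_over :: "'i set \<Rightarrow> 'i set \<Rightarrow> 'x measure \<Rightarrow> ('i \<Rightarrow> 'x) set \<Rightarrow> bool" where
  "cylinder_over J I \<Omega> N \<longleftrightarrow> (\<forall>x\<in>space (\<Pi>\<^sub>M i\<in>I. \<Omega>). \<forall>y\<in>space (\<Pi>\<^sub>M i\<in>I. \<Omega>).
     restrict x J = restrict y J \<longrightarrow> x \<in> N \<longrightarrow> y \<in> N)"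

text \<open>By Fubini, almost every section of a Borel approximation is as good as the whole set.\<close>

lemma completion_cylinder:
  fixes \<Omega> :: "'x measure"
  assumes \<Omega>: "prob_space \<Omega>" and I: "finite I" and J: "J \<subseteq> I"
    and N: "N \<in> sets (completion (\<Pi>\<^sub>M i\<in>I. \<Omega>))" and cyl: "cylinder_over J I \<Omega> N"
  obtains N' where "N' \<in> sets (\<Pi>\<^sub>M i\<in>I. \<Omega>)" "cylinder_over J I \<Omega> N'"
    "AE x in \<Pi>\<^sub>M i\<in>I. \<Omega>. x \<in> N \<longleftrightarrow> x \<in> N'"
proof -
  interpret prob_space \<Omega> by (rule \<Omega>)
  interpret P: product_prob_space "\<lambda>_. \<Omega>" UNIV by unfold_locales
  interpret PJ: prob_space "\<Pi>\<^sub>M i\<in>J. \<Omega>" by (rule prob_space_PiM) (rule \<Omega>)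
  interpret PI: prob_space "\<Pi>\<^sub>M i\<in>I - J. \<Omega>" by (rule prob_space_PiM) (rule \<Omega>)
  interpret pair_sigma_finite "\<Pi>\<^sub>M i\<in>I - J. \<Omega>" "\<Pi>\<^sub>M i\<in>J. \<Omega>" ..
  let ?M = "\<Pi>\<^sub>M i\<in>I. \<Omega>"
  have finJ: "finite J" using I J by (rule rev_finite_subset)
  define S where "S = main_part ?M N"
  have S: "S \<in> sets ?M" unfolding S_def by (rule main_part_sets[OF N])
  have NS: "AE x in ?M. x \<in> N \<longleftrightarrow> x \<in> S"
    using AE_notin_null_part[OF N] main_part_null_part_Un[OF N]
    unfolding S_def by (auto elim!: eventually_mono)
  have IJ: "I - J \<union> J = I" using J by auto
  have disj: "(I - J) \<inter> J = {}" by auto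
  have mrg: "distr ((\<Pi>\<^sub>M i\<in>I - J. \<Omega>) \<Otimes>\<^sub>M (\<Pi>\<^sub>M i\<in>J. \<Omega>)) ?M (merge (I - J) J) = ?M"
    using P.distr_merge[OF disj] I finJ by (simp add: IJ Un_absorb2[OF J])
  have mm: "merge (I - J) J \<in> (\<Pi>\<^sub>M i\<in>I - J. \<Omega>) \<Otimes>\<^sub>M (\<Pi>\<^sub>M i\<in>J. \<Omega>) \<rightarrow>\<^sub>M ?M"
    using measurable_merge[of "I - J" J "\<lambda>_. \<Omega>"] by (simp add: IJ Un_absorb2[OF J])
  have "AE zx in (\<Pi>\<^sub>M i\<in>I - J. \<Omega>) \<Otimes>\<^sub>M (\<Pi>\<^sub>M i\<in>J. \<Omega>). merge (I - J) J zx \<in> N \<longleftrightarrow> merge (I - J) J zx \<in> S"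
    by (rule AE_distrD[OF mm]) (unfold mrg, rule NS)
  from AE_pair[OF this] have "AE z in \<Pi>\<^sub>M i\<in>I - J. \<Omega>. AE x in \<Pi>\<^sub>M i\<in>J. \<Omega>. 
      merge (I - J) J (z, x) \<in> N \<longleftrightarrow> merge (I - J) J (z, x) \<in> S" .
  then have "AE z in \<Pi>\<^sub>M i\<in>I - J. \<Omega>. z \<in> space (\<Pi>\<^sub>M i\<in>I - J. \<Omega>) \<and> (AE x in \<Pi>\<^sub>M i\<in>J. \<Omega>. 
      merge (I - J) J (z, x) \<in> N \<longleftrightarrow> merge (I - J) J (z, x) \<in> S)" by simp
  from eventually_happens[OF this] PI.ae_filter_bot
  obtain z where z: "z \<in> space (\<Pi>\<^sub>M i\<in>I - J. \<Omega>)" and zae: "AE x in \<Pi>\<^sub>M i\<in>J. \<Omega>. 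
      merge (I - J) J (z, x) \<in> N \<longleftrightarrow> merge (I - J) J (z, x) \<in> S" by auto
  \<comment> \<open>Freezing the coordinates outside \<open>J\<close> at a good section
    \<open>z\<close> makes the Borel approximation depend on \<open>J\<close> alone, and
    \<open>N\<close> itself does not notice the freezing.\<close>
  define N' where "N' = {x \<in> space ?M. merge (I - J) J (z, restrict x J) \<in> S}"
  have rm: "(\<lambda>x. restrict x J) \<in> ?M \<rightarrow>\<^sub>M (\<Pi>\<^sub>M i\<in>J. \<Omega>)" by (rule measurable_restrict_subset[OF J])
  have "(\<lambda>x. merge (I - J) J (z, restrict x J)) \<in> ?M \<rightarrow>\<^sub>M ?M"
    by (rule measurable_compose[OF _ mm]) (use rm z in measurable)
  from measurable_sets[OF this S] have 1: "N' \<in> sets ?M" by (simp add: N'_def vimage_def Int_def conj_commute)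
  have 2: "cylinder_over J I \<Omega> N'" unfolding cylinder_over_def N'_def by (metis (no_types, lifting) mem_Collect_eq)
  have "id \<in> J \<rightarrow> I" using J by auto
  then have "distr ?M (\<Pi>\<^sub>M i\<in>J. \<Omega>) (\<lambda>x. restrict x J) = (\<Pi>\<^sub>M i\<in>J. \<Omega>)"
    using distr_PiM_reindex[of I "\<lambda>_. \<Omega>" id J] \<Omega> J by (auto simp: restrict_def[symmetric] cong: restrict_cong)
  then have "AE x in distr ?M (\<Pi>\<^sub>M i\<in>J. \<Omega>) (\<lambda>x. restrict x J). 
      merge (I - J) J (z, x) \<in> N \<longleftrightarrow> merge (I - J) J (z, x) \<in> S" using zae by (rule ssubst)
  from AE_distrD[OF rm this] have "AE x in ?M. 
      merge (I - J) J (z, restrict x J) \<in> N \<longleftrightarrow> merge (I - J) J (z, restrict x J) \<in> S" .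
  moreover have "AE x in ?M. merge (I - J) J (z, restrict x J) \<in> N \<longleftrightarrow> x \<in> N"
  proof (rule AE_I2)
    fix x assume x: "x \<in> space ?M"
    have w: "merge (I - J) J (z, restrict x J) \<in> space ?M"
      using x z J by (auto simp: space_PiM merge_def PiE_iff extensional_def)
    have "restrict (merge (I - J) J (z, restrict x J)) J = restrict x J" by (auto simp: merge_def fun_eq_iff)
    then show "merge (I - J) J (z, restrict x J) \<in> N \<longleftrightarrow> x \<in> N"
      using cyl x w unfolding cylinder_over_def by metis
  qed
  moreover have "AE x in ?M. x \<in> space ?M" by simp
  ultimately have 3: "AE x in ?M. x \<in> N \<longleftrightarrow> x \<in> N'"
    by eventually_elim (simp add: N'_def)
  from 1 2 3 show thesis by (rule that)
qed

lemma AE_pull_back: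
  fixes \<Omega> :: "'x measure"
  assumes \<Omega>: "prob_space \<Omega>" and \<alpha>: "distinct \<alpha>" 
    and "AE x in \<Pi>\<^sub>M A\<in>fin_subsets {..<length \<alpha>}. \<Omega>. Q x"
  shows "AE \<theta> in \<Pi>\<^sub>M A\<in>fin_subsets (UNIV :: 'v set). \<Omega>. Q (pull_back \<alpha> (\<theta> :: 'v set \<Rightarrow> 'x))"
proof -
  have "inj_on ((!) \<alpha>) {..<length \<alpha>}" using \<alpha> by (simp add: inj_on_nth)
  then have "AE x in distr (\<Pi>\<^sub>M A\<in>fin_subsets UNIV. \<Omega>) (\<Pi>\<^sub>M A\<in>fin_subsets {..<length \<alpha>}. \<Omega>) (reindex (length \<alpha>) ((!) \<alpha>)). Q x"
    using assms(3) by (subst distr_reindex[OF \<Omega>]) auto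
  then show ?thesis unfolding pull_back_eq_reindex by (rule AE_distrD[rotated]) (rule measurable_reindex, simp)
qed

lemma prob_theon_struct_pullback:
  fixes \<Omega> :: "'x measure" and K :: "('p, nat) fo_struct"
  assumes \<Omega>: "prob_space \<Omega>" and T: "finite (symbols T)" 
    and N: "\<And>P. P \<in> symbols T \<Longrightarrow> \<N> P \<in> sets (\<Pi>\<^sub>M A\<in>fin_subsets {..<arity T P}. \<Omega>)"
    and x: "inj_on x {..<m}"
  shows "{\<theta> \<in> space (\<Pi>\<^sub>M A\<in>fin_subsets UNIV. \<Omega>). pullback m x (theon_struct T \<N> \<theta>) = K} 
      \<in> sets (\<Pi>\<^sub>M A\<in>fin_subsets UNIV. \<Omega>)"
    and "measure (\<Pi>\<^sub>M A\<in>fin_subsets UNIV. \<Omega>) {\<theta> \<in> space (\<Pi>\<^sub>M A\<in>fin_subsets UNIV. \<Omega>). 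
       pullback m x (theon_struct T \<N> \<theta>) = K} =
     measure (\<Pi>\<^sub>M A\<in>fin_subsets {..<m}. \<Omega>) {y \<in> space (\<Pi>\<^sub>M A\<in>fin_subsets {..<m}. \<Omega>). local_struct T \<N> m y = K}"
proof -
  let ?M = "\<Pi>\<^sub>M A\<in>fin_subsets UNIV. \<Omega>" and ?M' = "\<Pi>\<^sub>M A\<in>fin_subsets {..<m}. \<Omega>"
  let ?E = "{y \<in> space ?M'. local_struct T \<N> m y = K}"
  have r: "reindex m x \<in> ?M \<rightarrow>\<^sub>M ?M'" by (rule measurable_reindex) simp
  have E: "?E \<in> sets ?M'" using T N by (rule local_struct_sets)
  have eq: "{\<theta> \<in> space ?M. pullback m x (theon_struct T \<N> \<theta>) = K} = reindex m x -` ?E \<inter> space ?M"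
    using measurable_space[OF r] by (auto simp: pullback_theon_struct[OF x])
  show "{\<theta> \<in> space ?M. pullback m x (theon_struct T \<N> \<theta>) = K} \<in> sets ?M"
    unfolding eq by (rule measurable_sets[OF r E])
  have "measure ?M' ?E = measure (distr ?M ?M' (reindex m x)) ?E"
    by (subst distr_reindex[OF \<Omega> x]) auto
  also have "\<dots> = measure ?M (reindex m x -` ?E \<inter> space ?M)" by (rule measure_distr[OF r E])
  finally show "measure ?M {\<theta> \<in> space ?M. pullback m x (theon_struct T \<N> \<theta>) = K} = measure ?M' ?E"
    unfolding eq by simp
qed

text \<open>There are only countably many tuples of vertices, so replacing peons by almost
  everywhere equal Borel sets leaves the random structure almost surely unchanged. The probability
  of a class is then divided equally among its labelled members, because relabelling vertices
  preserves the law of the variables.\<close>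

lemma theon_law:
  fixes \<Omega> :: "'x measure" and T :: "'p univ_theory"
  assumes T: "finite (symbols T)" and th: "is_theon T \<Omega> \<N>"
    and N': "\<And>P. P \<in> symbols T \<Longrightarrow> \<N>' P \<in> sets (\<Pi>\<^sub>M A\<in>fin_subsets {..<arity T P}. \<Omega>)"
    and ae: "\<And>P. P \<in> symbols T \<Longrightarrow> AE x in \<Pi>\<^sub>M A\<in>fin_subsets {..<arity T P}. \<Omega>. x \<in> \<N> P \<longleftrightarrow> x \<in> \<N>' P"
    and x: "inj_on x {..<m}" and K: "K \<in> models T {..<m}"
  shows "measure (\<Pi>\<^sub>M A\<in>fin_subsets UNIV. \<Omega>) {\<theta> \<in> space (\<Pi>\<^sub>M A\<in>fin_subsets UNIV. \<Omega>). 
      pullback m x (theon_struct T \<N>' \<theta>) = K} = labelled (theon_limit T \<Omega> \<N>) K"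
proof -
  let ?M = "\<Pi>\<^sub>M A\<in>fin_subsets (UNIV :: nat set). \<Omega>"
  let ?\<phi> = "theon_limit T \<Omega> \<N>"
  have \<Omega>: "prob_space \<Omega>" using th by (simp add: is_theon_def atomless_complete_prob_space_def)
  interpret prob_space ?M by (rule prob_space_PiM) (rule \<Omega>)
  define ev where "ev z L = {\<theta> \<in> space ?M. pullback m z (theon_struct T \<N>' \<theta>) = L}" for z L
  define q where "q L = measure ?M (ev id L)" for L
  have ev_sets: "ev z L \<in> sets ?M" if "inj_on z {..<m}" for z L
    unfolding ev_def by (rule prob_theon_struct_pullback(1)[OF \<Omega> T N' that])
  have ev_q: "measure ?M (ev z L) = q L" if "inj_on z {..<m}" for z L
    using prob_theon_struct_pullback(2)[OF \<Omega> T N' that, of L] 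
      prob_theon_struct_pullback(2)[OF \<Omega> T N' inj_on_id, of m L] unfolding ev_def q_def by simp
  have wf: "wf_struct (pullback m z L)" "verts (pullback m z L) = {..<m}" for z and L :: "('p, nat) fo_struct"
    by auto
  note wfK = wf_struct_models[OF K] verts_models[OF K]
  have pb: "AE \<theta> in ?M. pull_back \<alpha> \<theta> \<in> \<N> P \<longleftrightarrow> pull_back \<alpha> \<theta> \<in> \<N>' P"
    if "P \<in> symbols T" "length \<alpha> = arity T P" "distinct \<alpha>" for P and \<alpha> :: "nat list"
    by (rule AE_pull_back[OF \<Omega> that(3)]) (unfold that(2), rule ae[OF that(1)])
  have "AE \<theta> in ?M. \<forall>P\<in>symbols T. \<forall>\<alpha>\<in>{\<alpha>. length \<alpha> = arity T P \<and> distinct \<alpha>}. 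
      pull_back \<alpha> \<theta> \<in> \<N> P \<longleftrightarrow> pull_back \<alpha> \<theta> \<in> \<N>' P"
    unfolding AE_ball_countable[OF countable_finite[OF T]]
    by (subst AE_ball_countable) (auto intro!: pb)
  then have same: "AE \<theta> in ?M. theon_struct T \<N> \<theta> = theon_struct T \<N>' \<theta>"
    by eventually_elim (simp add: theon_struct_def fun_eq_iff, blast)
  have model: "AE \<theta> in ?M. theon_struct T \<N> \<theta> \<in> models T UNIV"
    using th unfolding is_theon_def E_space_def AE_completion_iff by blast
  let ?S = "{L. L \<in> models T {..<m} \<and> struct_iso K L}"
  have finS: "finite ?S" using finite_models[OF T, of "{..<m}"] by simp
  let ?A = "{\<theta> \<in> space ?M. induced (theon_struct T \<N> \<theta>) {..<m} \<in> iso_class K}"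
  let ?B = "\<Union>L\<in>?S. ev id L"
  have B: "?B \<in> sets ?M" using finS ev_sets by (intro sets.finite_UN) auto
  have AB: "AE \<theta> in ?M. \<theta> \<in> ?A \<longleftrightarrow> \<theta> \<in> ?B"
    using same model AE_space
  proof eventually_elim
    case (elim \<theta>)
    have id: "induced (theon_struct T \<N> \<theta>) {..<m} = pullback m id (theon_struct T \<N>' \<theta>)"
      unfolding elim(1) by (rule fo_struct_eqI) (auto simp: induced_def pullback_def)
    have "pullback m id (theon_struct T \<N>' \<theta>) \<in> models T {..<m}"
      using elim by (intro pullback_models[of _ T UNIV]) auto
    then show ?case using elim(3) by (auto simp: ev_def iso_class_def id)
  qed
  have "?\<phi> (iso_class K) = measure (completion ?M) ?A"
    using K class_size_iso_class[of K] 
    by (auto simp: theon_limit_def E_space_def wfK model_classes_def model_classes_n_def)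
  also have "\<dots> = measure (completion ?M) ?B"
  proof -
    \<comment> \<open>\<open>?A\<close> speaks about the original peons and is measurable only for
      the completion: it agrees with the Borel event \<open>?B\<close> up to a null set.\<close>
    have AB': "AE \<theta> in completion ?M. \<theta> \<in> ?B \<longleftrightarrow> \<theta> \<in> ?A"
      using AB by (auto simp: AE_completion_iff elim: eventually_mono)
    have "?A \<in> sets (completion ?M)" by (rule completion.in_sets_AE[OF AB']) (use B in auto)
    then show ?thesis using AB' B unfolding measure_def by (subst emeasure_eq_AE) auto
  qed
  also have "\<dots> = measure ?M ?B" using B by simp
  also have "\<dots> = (\<Sum>L\<in>?S. measure ?M (ev id L))"
  proof (rule finite_measure_finite_Union[OF finS])
    show "ev id ` ?S \<subseteq> events" using ev_sets[OF inj_on_id] by blast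
    show "disjoint_family_on (ev id) ?S" by (auto simp: disjoint_family_on_def ev_def)
  qed
  also have "\<dots> = (\<Sum>L\<in>?S. q K)"
  proof (rule sum.cong[OF refl])
    fix L assume L: "L \<in> ?S"
    have wfL: "wf_struct L" "verts L = {..<m}" using L wf_struct_models verts_models by blast+
    obtain z where z: "z \<in> inj_maps m {..<m}" "pullback m z L = K"
      using L struct_iso_pullback_iff[OF wfK wfL] by blast
    have "pullback m z M = K \<longleftrightarrow> pullback m id M = L" for M :: "('p, nat) fo_struct"
    proof -
      have e: "pullback m z M = pullback m z (pullback m id M)"
        using inj_mapsD(4)[OF z(1)] by (subst pullback_pullback) auto
      show ?thesis
      proof
        assume "pullback m z M = K"
        then have "pullback m z (pullback m id M) = pullback m z L" using e z(2) by simp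
        from pullback_inj_maps_inj[OF z(1) wf wfL this] show "pullback m id M = L" .
      qed (simp add: e z(2))
    qed
    then have "ev z K = ev id L" by (simp add: ev_def)
    then show "measure ?M (ev id L) = q K" using ev_q[OF inj_mapsD(3)[OF z(1)], of K] by simp
  qed
  finally have "?\<phi> (iso_class K) = real (card ?S) * q K" by simp
  then have "labelled ?\<phi> K = real (card {L \<in> models T {..<m}. struct_iso K L} * card (automorphisms K)) / fact m * q K"
    by (simp add: labelled_def wfK)
  also have "\<dots> = q K" unfolding card_iso_models[OF T K] by simp
  finally show ?thesis using ev_q[OF x, of K] by (simp add: ev_def)
qed

section \<open>Independence implies unique coupleability\<close>

lemma cylinder_restrict:
  fixes \<Omega> :: "'x measure"
  assumes \<Omega>: "prob_space \<Omega>" and J: "J \<subseteq> I"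
    and E: "E \<in> sets (\<Pi>\<^sub>M i\<in>I. \<Omega>)" and cyl: "cylinder_over J I \<Omega> E"
  obtains E' where "E' \<in> sets (\<Pi>\<^sub>M i\<in>J. \<Omega>)" "\<And>x. x \<in> space (\<Pi>\<^sub>M i\<in>I. \<Omega>) \<Longrightarrow> x \<in> E \<longleftrightarrow> restrict x J \<in> E'"
proof -
  obtain w where w: "w \<in> space \<Omega>" using prob_space.not_empty[OF \<Omega>] by blast
  \<comment> \<open>Coordinates outside \<open>J\<close> are filled with one fixed point; by the
    cylinder property the filling does not affect membership.\<close>
  define ext where "ext y = (\<lambda>i\<in>I. if i \<in> J then y i else w)" for y :: "'a \<Rightarrow> 'x"
  have ext: "ext \<in> (\<Pi>\<^sub>M i\<in>J. \<Omega>) \<rightarrow>\<^sub>M (\<Pi>\<^sub>M i\<in>I. \<Omega>)"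
    unfolding ext_def
  proof (rule measurable_restrict)
    fix i show "(\<lambda>y. if i \<in> J then y i else w) \<in> (\<Pi>\<^sub>M i\<in>J. \<Omega>) \<rightarrow>\<^sub>M \<Omega>"
      using w by (cases "i \<in> J") auto
  qed
  let ?E' = "ext -` E \<inter> space (\<Pi>\<^sub>M i\<in>J. \<Omega>)"
  have "x \<in> E \<longleftrightarrow> restrict x J \<in> ?E'" if x: "x \<in> space (\<Pi>\<^sub>M i\<in>I. \<Omega>)" for x
  proof -
    have r: "restrict x J \<in> space (\<Pi>\<^sub>M i\<in>J. \<Omega>)" using x J by (auto simp: space_PiM)
    have "ext (restrict x J) \<in> space (\<Pi>\<^sub>M i\<in>I. \<Omega>)" by (rule measurable_space[OF ext r])
    moreover have "restrict (ext (restrict x J)) J = restrict x J" using J by (auto simp: ext_def fun_eq_iff)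
    ultimately have "x \<in> E \<longleftrightarrow> ext (restrict x J) \<in> E" using cyl x unfolding cylinder_over_def by metis
    then show ?thesis using r by simp
  qed
  with measurable_sets[OF ext E] show thesis by (rule that)
qed

text \<open>Injections preserve cardinality, so a restriction of the peons to sets with
  \<open>c (card A)\<close> carries over to whole samples. The predicate \<open>c\<close> covers
  both \<open>> l\<close> for independence and \<open>\<le> l\<close> for rank.\<close>

lemma cylinder_local_struct:
  fixes \<Omega> :: "'x measure" and c :: "nat \<Rightarrow> bool"
  assumes N: "\<And>P. P \<in> symbols T \<Longrightarrow> 
      cylinder_over {A \<in> fin_subsets {..<arity T P}. c (card A)} (fin_subsets {..<arity T P}) \<Omega> (\<N> P)"
  shows "cylinder_over {A \<in> fin_subsets {..<m}. c (card A)} (fin_subsets {..<m}) \<Omega>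
     {y \<in> space (\<Pi>\<^sub>M A\<in>fin_subsets {..<m}. \<Omega>). local_struct T \<N> m y = K}"
proof -
  let ?J = "\<lambda>k. {A \<in> fin_subsets {..<k}. c (card A)}"
  have imp: "pull_back \<alpha> y \<in> \<N> P" 
    if P: "P \<in> symbols T" "length \<alpha> = arity T P" "distinct \<alpha>" "set \<alpha> \<subseteq> {..<m}"
      and xy: "x \<in> space (\<Pi>\<^sub>M A\<in>fin_subsets {..<m}. \<Omega>)" "y \<in> space (\<Pi>\<^sub>M A\<in>fin_subsets {..<m}. \<Omega>)"
        "restrict x (?J m) = restrict y (?J m)" and "pull_back \<alpha> x \<in> \<N> P" for P \<alpha> x y
  proof -
    have lt: "\<alpha> ! i < m" if "i < length \<alpha>" for i using P(4) nth_mem[OF that] by auto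
    have r: "pull_back \<alpha> \<in> (\<Pi>\<^sub>M A\<in>fin_subsets {..<m}. \<Omega>) \<rightarrow>\<^sub>M (\<Pi>\<^sub>M A\<in>fin_subsets {..<arity T P}. \<Omega>)"
      unfolding pull_back_eq_reindex P(2) by (rule measurable_reindex) (use lt P(2) in auto)
    have "restrict (pull_back \<alpha> x) (?J (arity T P)) = restrict (pull_back \<alpha> y) (?J (arity T P))"
    proof (rule restrict_ext)
      fix A assume A: "A \<in> ?J (arity T P)"
      have "inj_on ((!) \<alpha>) A" using P A by (intro inj_on_nth) (auto simp: fin_subsets_def)
      then have "(!) \<alpha> ` A \<in> ?J m"
        using A P lt by (auto simp: card_image image_fin_subsets)
      then show "pull_back \<alpha> x A = pull_back \<alpha> y A"
        using fun_cong[OF xy(3), of "(!) \<alpha> ` A"] A P(2) by (simp add: pull_back_def)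
    qed
    with N[OF P(1), unfolded cylinder_over_def, rule_format, OF measurable_space[OF r xy(1)] measurable_space[OF r xy(2)]]
    show ?thesis using \<open>pull_back \<alpha> x \<in> \<N> P\<close> by blast
  qed
  show ?thesis unfolding cylinder_over_def
  proof (intro ballI impI)
    fix x y assume xy: "x \<in> space (\<Pi>\<^sub>M A\<in>fin_subsets {..<m}. \<Omega>)" "y \<in> space (\<Pi>\<^sub>M A\<in>fin_subsets {..<m}. \<Omega>)"
        "restrict x (?J m) = restrict y (?J m)"
      and x: "x \<in> {y \<in> space (\<Pi>\<^sub>M A\<in>fin_subsets {..<m}. \<Omega>). local_struct T \<N> m y = K}"
    have "local_struct T \<N> m x = local_struct T \<N> m y"
    proof (rule fo_struct_eqI)
      fix P
      show "rel (local_struct T \<N> m x) P = rel (local_struct T \<N> m y) P"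
        using imp[OF _ _ _ _ xy] imp[OF _ _ _ _ xy(2,1) xy(3)[symmetric]]
        by (auto simp: local_struct_def)
    qed (simp add: local_struct_def)
    then show "y \<in> {y \<in> space (\<Pi>\<^sub>M A\<in>fin_subsets {..<m}. \<Omega>). local_struct T \<N> m y = K}"
      using x xy by simp
  qed
qed

text \<open>Each coordinate is seen only through the partition generated by \<open>\<D>\<close>.
  With one finite family for all coordinates there are at most \<open>2 ^ (card \<D> * k)\<close>
  patterns on \<open>k\<close> coordinates.\<close>

definition patterned :: "'x set set \<Rightarrow> 'i set \<Rightarrow> 'x measure \<Rightarrow> ('i \<Rightarrow> 'x) set \<Rightarrow> bool" where
  "patterned \<D> I \<Omega> E \<longleftrightarrow> (\<forall>x\<in>space (\<Pi>\<^sub>M i\<in>I. \<Omega>). \<forall>y\<in>space (\<Pi>\<^sub>M i\<in>I. \<Omega>).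
     (\<forall>i\<in>I. \<forall>D\<in>\<D>. x i \<in> D \<longleftrightarrow> y i \<in> D) \<longrightarrow> (x \<in> E \<longleftrightarrow> y \<in> E))"

lemma patternedD:
  assumes "patterned \<D> I \<Omega> E" "x \<in> space (\<Pi>\<^sub>M i\<in>I. \<Omega>)" "y \<in> space (\<Pi>\<^sub>M i\<in>I. \<Omega>)"
    and "\<forall>i\<in>I. \<forall>D\<in>\<D>. x i \<in> D \<longleftrightarrow> y i \<in> D"
  shows "x \<in> E \<longleftrightarrow> y \<in> E"
  using assms unfolding patterned_def by blast

lemma patterned_mono: 
  assumes "patterned \<D> I \<Omega> E" "\<D> \<subseteq> \<D>'"
  shows "patterned \<D>' I \<Omega> E"
  unfolding patterned_def
proof (intro ballI impI)
  fix x y assume xy: "x \<in> space (\<Pi>\<^sub>M i\<in>I. \<Omega>)" "y \<in> space (\<Pi>\<^sub>M i\<in>I. \<Omega>)"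
    and "\<forall>i\<in>I. \<forall>D\<in>\<D>'. x i \<in> D \<longleftrightarrow> y i \<in> D"
  then have "\<forall>i\<in>I. \<forall>D\<in>\<D>. x i \<in> D \<longleftrightarrow> y i \<in> D" using assms(2) by (meson subsetD)
  then show "x \<in> E \<longleftrightarrow> y \<in> E" using assms(1) xy unfolding patterned_def by blast
qed

text \<open>The sets that admit such approximations form a sigma-algebra, and it contains the sets
  that restrict a single coordinate, for which a family with one member suffices.\<close>

lemma PiM_approx_patterned:
  fixes \<Omega> :: "'x measure"
  assumes \<Omega>: "prob_space \<Omega>" and E: "E \<in> sets (\<Pi>\<^sub>M i\<in>(I :: 'b set). \<Omega>)" and "\<epsilon> > 0"
  obtains \<D> E' where "finite \<D>" "E' \<in> sets (\<Pi>\<^sub>M i\<in>I. \<Omega>)" "patterned \<D> I \<Omega> E'"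
    "measure (\<Pi>\<^sub>M i\<in>I. \<Omega>) (sym_diff E E') < \<epsilon>"
proof -
  let ?M = "\<Pi>\<^sub>M i\<in>I. \<Omega>"
  interpret prob_space ?M by (rule prob_space_PiM) (rule \<Omega>)
  define good where "good E \<longleftrightarrow> E \<in> sets ?M \<and> (\<forall>\<epsilon>>0. \<exists>\<D> E'. finite \<D> \<and> E' \<in> sets ?M \<and> 
      patterned \<D> I \<Omega> E' \<and> prob (sym_diff E E') < \<epsilon>)" for E
  have "E \<in> sigma_sets (\<Pi>\<^sub>E i\<in>I. space \<Omega>) {{f \<in> \<Pi>\<^sub>E i\<in>I. space \<Omega>. f i \<in> A} | i A. i \<in> I \<and> A \<in> sets \<Omega>}"
    using E by (simp add: sets_PiM_single)
  then have "good E"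
  proof induction
    case (Basic E)
    then obtain i A where iA: "E = {f \<in> \<Pi>\<^sub>E i\<in>I. space \<Omega>. f i \<in> A}" "i \<in> I" "A \<in> sets \<Omega>" by auto
    have "E \<in> sets ?M" unfolding sets_PiM_single using Basic by (rule sigma_sets.Basic)
    moreover have "patterned {A} I \<Omega> E" using iA by (auto simp: patterned_def space_PiM)
    ultimately show ?case unfolding good_def by (auto intro!: exI[of _ "{A}"] exI[of _ E])
  next
    case Empty
    have "patterned {} I \<Omega> {}" by (auto simp: patterned_def)
    then show ?case unfolding good_def by (auto intro!: exI[of _ "{}"])
  next
    case (Compl E)
    then have E: "E \<in> sets ?M" by (simp add: good_def)
    have "\<exists>\<D> E'. finite \<D> \<and> E' \<in> sets ?M \<and> patterned \<D> I \<Omega> E' \<and> prob (sym_diff (space ?M - E) E') < \<epsilon>"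
      if "\<epsilon> > 0" for \<epsilon>
    proof -
      obtain \<D> E' where *: "finite \<D>" "E' \<in> sets ?M" "patterned \<D> I \<Omega> E'" "prob (sym_diff E E') < \<epsilon>"
        using Compl.IH \<open>\<epsilon> > 0\<close> unfolding good_def by blast
      have eq: "sym_diff (space ?M - E) (space ?M - E') = sym_diff E E'"
      proof -
        have "sym_diff (S - A) (S - B) = sym_diff A B" if "A \<subseteq> S" "B \<subseteq> S" for A B S :: "('b \<Rightarrow> 'x) set"
          using that by blast
        then show ?thesis using sets.sets_into_space[OF E] sets.sets_into_space[OF *(2)] .
      qed
      have p1: "prob (sym_diff (space ?M - E) (space ?M - E')) < \<epsilon>" unfolding eq by (rule *(4))
      have p2: "patterned \<D> I \<Omega> (space ?M - E')"
        unfolding patterned_def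
      proof (intro ballI impI)
        fix x y assume xy: "x \<in> space ?M" "y \<in> space ?M" "\<forall>i\<in>I. \<forall>D\<in>\<D>. x i \<in> D \<longleftrightarrow> y i \<in> D"
        from *(3)[unfolded patterned_def, rule_format, OF xy(1,2)] xy(3) have "x \<in> E' \<longleftrightarrow> y \<in> E'" by blast
        with xy(1,2) show "x \<in> space ?M - E' \<longleftrightarrow> y \<in> space ?M - E'" by simp
      qed
      have p3: "space ?M - E' \<in> sets ?M" using *(2) by auto
      show ?thesis by (intro exI[of _ \<D>] exI[of _ "space ?M - E'"] conjI *(1) p3 p2 p1)
    qed
    moreover have "space ?M - E \<in> sets ?M" using E by auto
    ultimately have "good (space ?M - E)" unfolding good_def by simp
    then show ?case by (simp add: space_PiM)
  next
    case (Union A)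
    then have A: "A i \<in> sets ?M" for i by (simp add: good_def)
    have "\<exists>\<D> E'. finite \<D> \<and> E' \<in> sets ?M \<and> patterned \<D> I \<Omega> E' \<and> prob (sym_diff (\<Union>i. A i) E') < \<epsilon>"
      if \<epsilon>: "\<epsilon> > 0" for \<epsilon>
    proof -
      let ?B = "\<lambda>n. \<Union>i<n. A i"
      have "(\<lambda>n. prob (?B n)) \<longlonglongrightarrow> prob (\<Union>n. ?B n)"
        by (rule finite_Lim_measure_incseq) (use A in \<open>auto simp: incseq_def intro: less_le_trans\<close>)
      moreover have U: "(\<Union>n. ?B n) = (\<Union>i. A i)" by (auto intro: exI[of _ "Suc _"])
      ultimately have "(\<lambda>n. prob (?B n)) \<longlonglongrightarrow> prob (\<Union>i. A i)" by simp
      then have "\<forall>\<^sub>F n in sequentially. prob (?B n) > prob (\<Union>i. A i) - \<epsilon> / 2"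
        using \<epsilon> by (intro order_tendstoD(1)) auto
      then obtain n where n: "prob (?B n) > prob (\<Union>i. A i) - \<epsilon> / 2" 
        using eventually_happens'[OF sequentially_bot] by blast
      \<comment> \<open>Half of \<open>\<epsilon>\<close> pays for truncating the union at
        \<open>n\<close>, the other half is shared by the \<open>n\<close> approximations.\<close>
      define ap where "ap i \<D> E' \<longleftrightarrow> finite \<D> \<and> E' \<in> sets ?M \<and> patterned \<D> I \<Omega> E' \<and>
          prob (sym_diff (A i) E') < \<epsilon> / (2 * Suc n)" for i \<D> E'
      have "\<exists>\<D> E'. ap i \<D> E'" for i
      proof -
        have "\<epsilon> / (2 * Suc n) > 0" using \<epsilon> by simp
        then show ?thesis using Union.IH[of i] unfolding good_def ap_def by blast
      qed
      then obtain \<D> E' where ap: "\<And>i. ap i (\<D> i) (E' i)" by metis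
      have *: "finite (\<D> i)" "E' i \<in> sets ?M" "patterned (\<D> i) I \<Omega> (E' i)" 
        "prob (sym_diff (A i) (E' i)) < \<epsilon> / (2 * Suc n)" for i
        using ap[of i] by (simp_all add: ap_def)
      let ?E' = "\<Union>i<n. E' i" and ?D = "\<Union>i<n. \<D> i"
      have pat: "patterned ?D I \<Omega> (E' i)" if "i < n" for i
        by (rule patterned_mono[OF *(3)]) (use that in blast)
      have "patterned ?D I \<Omega> ?E'"
        unfolding patterned_def
      proof (intro ballI impI)
        fix x y assume xy: "x \<in> space ?M" "y \<in> space ?M" and D: "\<forall>i\<in>I. \<forall>D\<in>?D. x i \<in> D \<longleftrightarrow> y i \<in> D"
        have "x \<in> E' i \<longleftrightarrow> y \<in> E' i" if "i < n" for i
          by (rule patternedD[OF pat[OF that] xy D])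
        then show "x \<in> ?E' \<longleftrightarrow> y \<in> ?E'" by auto
      qed
      moreover have "prob (sym_diff (\<Union>i. A i) ?E') < \<epsilon>"
      proof -
        have "sym_diff (\<Union>i. A i) ?E' \<subseteq> ((\<Union>i. A i) - ?B n) \<union> (\<Union>i<n. sym_diff (A i) (E' i))" by blast
        then have "prob (sym_diff (\<Union>i. A i) ?E') \<le> prob (((\<Union>i. A i) - ?B n) \<union> (\<Union>i<n. sym_diff (A i) (E' i)))"
          using A *(2) by (intro finite_measure_mono) auto
        also have "\<dots> \<le> prob ((\<Union>i. A i) - ?B n) + prob (\<Union>i<n. sym_diff (A i) (E' i))"
          using A *(2) by (intro measure_Un_le) auto
        also have "prob ((\<Union>i. A i) - ?B n) = prob (\<Union>i. A i) - prob (?B n)"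
          using A by (intro finite_measure_Diff) auto
        also have "prob (\<Union>i<n. sym_diff (A i) (E' i)) \<le> (\<Sum>i<n. prob (sym_diff (A i) (E' i)))"
          using A *(2) by (intro measure_UNION_le) auto
        also have "\<dots> \<le> (\<Sum>i<n. \<epsilon> / (2 * Suc n))"
          by (intro sum_mono less_imp_le *(4))
        also have "\<dots> \<le> \<epsilon> / 2" using \<epsilon> by (simp add: field_simps)
        finally show ?thesis using n by simp
      qed
      ultimately show ?thesis using *(1,2) by (intro exI[of _ ?D] exI[of _ ?E']) auto
    qed
    with A show ?case unfolding good_def by (intro conjI) auto
  qed
  then show thesis using that \<open>\<epsilon> > 0\<close> unfolding good_def by blast
qed

text \<open>A partial Steiner system: the graphs of the integer polynomials of degree at most \<open>l\<close> with
  coefficients below \<open>n\<close>, evaluated at \<open>0, \<dots>, m - 1\<close>, pairwise share at most \<open>l\<close> points.\<close>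

definition packing_index :: "nat \<Rightarrow> nat \<Rightarrow> (nat \<Rightarrow> nat) set" where
  "packing_index l n = {..l} \<rightarrow>\<^sub>E {..<n}"

text \<open>The width exceeds every value of the polynomials, so the \<open>i\<close>-th vertex of
  each sample lies in the \<open>i\<close>-th block of this length. It is linear in
  \<open>n\<close>, so the \<open>n ^ (l + 1)\<close> samples use only \<open>O(n)\<close>
  vertices.\<close>

definition packing_width :: "nat \<Rightarrow> nat \<Rightarrow> nat \<Rightarrow> nat" where
  "packing_width l m n = n * (Suc l * Suc m ^ l)"

definition packing :: "nat \<Rightarrow> nat \<Rightarrow> nat \<Rightarrow> (nat \<Rightarrow> nat) \<Rightarrow> nat \<Rightarrow> nat" where
  "packing l m n a = (\<lambda>i\<in>{..<m}. i * packing_width l m n + (\<Sum>d\<le>l. a d * i ^ d))"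

lemma packing_value_less:
  assumes a: "a \<in> packing_index l n" and i: "i < m" and n: "n > 0"
  shows "(\<Sum>d\<le>l. a d * i ^ d) < packing_width l m n"
proof -
  have "(\<Sum>d\<le>l. a d * i ^ d) \<le> (\<Sum>d\<le>l. (n - 1) * Suc m ^ l)"
  proof (rule sum_mono)
    fix d assume d: "d \<in> {..l}"
    then have "a d < n" using a by (auto simp: packing_index_def PiE_iff)
    then have "a d \<le> n - 1" by simp
    moreover have "i ^ d \<le> Suc m ^ d" using i by (intro power_mono) auto
    moreover have "Suc m ^ d \<le> Suc m ^ l" using d by (intro power_increasing) auto
    ultimately show "a d * i ^ d \<le> (n - 1) * Suc m ^ l" by (intro mult_mono) auto
  qed
  also have "\<dots> = (n - 1) * (Suc l * Suc m ^ l)"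
    by (simp only: sum_constant card_atMost mult.left_commute of_nat_id)
  also have "\<dots> < packing_width l m n"
    unfolding packing_width_def using n by (intro mult_strict_right_mono) auto
  finally show ?thesis .
qed

lemma packing_eqD:
  assumes "a \<in> packing_index l n" "b \<in> packing_index l n" "i < m" "j < m" "n > 0"
    and "packing l m n a i = packing l m n b j"
  shows "i = j" "(\<Sum>d\<le>l. a d * i ^ d) = (\<Sum>d\<le>l. b d * i ^ d)"
proof -
  let ?W = "packing_width l m n"
  have eq: "i * ?W + (\<Sum>d\<le>l. a d * i ^ d) = j * ?W + (\<Sum>d\<le>l. b d * j ^ d)"
    using assms by (simp add: packing_def)
  have lt: "(\<Sum>d\<le>l. a d * i ^ d) < ?W" "(\<Sum>d\<le>l. b d * j ^ d) < ?W"
    using packing_value_less assms by auto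
  have "i = (i * ?W + (\<Sum>d\<le>l. a d * i ^ d)) div ?W" using lt by simp
  also have "\<dots> = j" unfolding eq using lt by simp
  finally show ij: "i = j" .
  show "(\<Sum>d\<le>l. a d * i ^ d) = (\<Sum>d\<le>l. b d * i ^ d)" using eq ij by simp
qed

lemma packing_inj_maps:
  assumes a: "a \<in> packing_index l n" and n: "n > 0"
  shows "packing l m n a \<in> inj_maps m {..<m * packing_width l m n}"
proof -
  have "packing l m n a i < m * packing_width l m n" if "i < m" for i
  proof -
    have "packing l m n a i < Suc i * packing_width l m n"
      using packing_value_less[OF a that n] that by (simp add: packing_def)
    also have "\<dots> \<le> m * packing_width l m n" using that by (intro mult_right_mono) auto
    finally show ?thesis .
  qed
  moreover have "inj_on (packing l m n a) {..<m}"
    by (rule inj_onI) (use packing_eqD(1)[OF a a _ _ n] in auto)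
  ultimately show ?thesis by (auto simp: inj_maps_def packing_def)
qed

text \<open>A common vertex has the same position \<open>i\<close> in both samples, since different
  positions lie in disjoint blocks. Then \<open>i\<close> is a root of the difference of the two
  polynomials, which is nonzero of degree at most \<open>l\<close>.\<close>

lemma card_packing_inter:
  assumes ab: "a \<in> packing_index l n" "b \<in> packing_index l n" "a \<noteq> b" and n: "n > 0"
  shows "card (packing l m n a ` {..<m} \<inter> packing l m n b ` {..<m}) \<le> l"
proof -
  define p where "p = (\<Sum>d\<le>l. monom (int (a d) - int (b d)) d)"
  have coeff: "coeff p d = (if d \<le> l then int (a d) - int (b d) else 0)" for d
    by (simp add: p_def coeff_sum)
  obtain d where "a d \<noteq> b d" using ab(3) by blast
  moreover from this have "d \<le> l"
    using ab(1,2) by (metis PiE_arb atMost_iff packing_index_def)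
  ultimately have "coeff p d \<noteq> 0" by (simp add: coeff)
  then have p0: "p \<noteq> 0" by auto
  have deg: "degree p \<le> l" by (rule degree_le) (simp add: coeff)
  have poly: "poly p (int i) = int (\<Sum>d\<le>l. a d * i ^ d) - int (\<Sum>d\<le>l. b d * i ^ d)" for i
    by (simp add: p_def poly_sum poly_monom left_diff_distrib sum_subtractf)
  let ?R = "{i. i < m \<and> (\<Sum>d\<le>l. a d * i ^ d) = (\<Sum>d\<le>l. b d * i ^ d)}"
  have "card ?R = card (int ` ?R)" by (simp add: card_image)
  also have "\<dots> \<le> card {x. poly p x = 0}"
    using poly_roots_finite[OF p0] by (intro card_mono) (auto simp: poly simp del: of_nat_sum)
  also have "\<dots> \<le> l" using card_poly_roots_bound[OF p0] deg by simp
  finally have R: "card ?R \<le> l" .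
  have "packing l m n a ` {..<m} \<inter> packing l m n b ` {..<m} \<subseteq> packing l m n a ` ?R"
  proof
    fix v assume "v \<in> packing l m n a ` {..<m} \<inter> packing l m n b ` {..<m}"
    then obtain i j where "i < m" "j < m" "v = packing l m n a i" "packing l m n a i = packing l m n b j" by auto
    with packing_eqD[OF ab(1,2) _ _ n, of i m j] have "i \<in> ?R" by simp
    then show "v \<in> packing l m n a ` ?R" using \<open>v = packing l m n a i\<close> by blast
  qed
  then have "card (packing l m n a ` {..<m} \<inter> packing l m n b ` {..<m}) \<le> card (packing l m n a ` ?R)"
    by (intro card_mono) auto
  also have "\<dots> \<le> card ?R" by (rule card_image_le) simp
  finally show ?thesis using R by simp
qed

lemma card_packing_index: "card (packing_index l n) = n ^ Suc l"
  by (simp add: packing_index_def card_PiE)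

lemma card_fin_subsets_le: "card {A \<in> fin_subsets {..<n}. card A \<le> l} \<le> n ^ l"
proof -
  have "{A \<in> fin_subsets {..<n}. card A \<le> l} \<subseteq> set ` {xs. set xs \<subseteq> {..<n} \<and> length xs = l}"
  proof
    fix A assume A: "A \<in> {A \<in> fin_subsets {..<n}. card A \<le> l}"
    then obtain a where a: "a \<in> A" by (auto simp: fin_subsets_def)
    obtain xs where xs: "set xs = A" "length xs = card A"
      using A by (metis (no_types, lifting) distinct_card finite_distinct_list fin_subsets_def mem_Collect_eq)
    \<comment> \<open>Repeating one element pads an enumeration of \<open>A\<close> to length
      exactly \<open>l\<close>.\<close>
    have "set (xs @ replicate (l - card A) a) = A" using xs a by (auto simp: set_replicate_conv_if)
    moreover have "length (xs @ replicate (l - card A) a) = l" using xs A by simp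
    ultimately show "A \<in> set ` {xs. set xs \<subseteq> {..<n} \<and> length xs = l}"
      using A by (intro rev_image_eqI[of "xs @ replicate (l - card A) a"]) (auto simp: fin_subsets_def)
  qed
  then have "card {A \<in> fin_subsets {..<n}. card A \<le> l} \<le> card (set ` {xs. set xs \<subseteq> {..<n} \<and> length xs = l})"
    by (intro card_mono finite_imageI finite_lists_length_eq) auto
  also have "\<dots> \<le> card {xs. set xs \<subseteq> {..<n} \<and> length xs = l}"
    by (intro card_image_le finite_lists_length_eq) auto
  finally show ?thesis by (simp add: card_lists_length_eq)
qed

text \<open>The configuration \<open>(K, H)\<close> is distributed as \<open>u\<close>, and given \<open>H\<close> a pattern \<open>g\<close> is drawn
  independently of \<open>K\<close>, so that \<open>(H, g)\<close> is distributed as \<open>v\<close>.\<close>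

lemma decoupling_bound:
  fixes u :: "'a \<Rightarrow> 'b \<Rightarrow> real" and v :: "'b \<Rightarrow> ('i \<Rightarrow> real) \<Rightarrow> real"
    and F :: "'i \<Rightarrow> 'a \<Rightarrow> real" and Q :: "'i \<Rightarrow> 'b \<Rightarrow> real" and x y \<epsilon> \<delta> \<eta> :: real
  assumes fin: "finite S1" "finite S2" "finite G" and A: "finite A" "A \<noteq> {}"
    and u: "\<And>K H. K \<in> S1 \<Longrightarrow> H \<in> S2 \<Longrightarrow> 0 \<le> u K H"
    and u1: "\<And>K. K \<in> S1 \<Longrightarrow> (\<Sum>H\<in>S2. u K H) = p1 K" and u2: "\<And>H. H \<in> S2 \<Longrightarrow> (\<Sum>K\<in>S1. u K H) = p2 H"
    and total: "(\<Sum>H\<in>S2. p2 H) = 1"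
    and v: "\<And>H g. H \<in> S2 \<Longrightarrow> g \<in> G \<Longrightarrow> 0 \<le> v H g" and v2: "\<And>H. H \<in> S2 \<Longrightarrow> (\<Sum>g\<in>G. v H g) = p2 H"
    and F: "\<And>a K. F a K \<in> {0..1}" and \<phi>: "\<phi> \<in> {0..1 :: real}"
    and g01: "\<And>g a. g \<in> G \<Longrightarrow> a \<in> A \<Longrightarrow> g a \<in> {0..1}"
    and close: "\<And>a. a \<in> A \<Longrightarrow> (\<Sum>H\<in>S2. \<Sum>g\<in>G. v H g * \<bar>Q a H - g a\<bar>) \<le> \<epsilon>"
    and x: "\<And>a. a \<in> A \<Longrightarrow> (\<Sum>K\<in>S1. \<Sum>H\<in>S2. u K H * (F a K * Q a H)) = x"
    and y: "\<And>a. a \<in> A \<Longrightarrow> (\<Sum>H\<in>S2. p2 H * Q a H) = y"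
    and bad: "\<And>g. g \<in> G \<Longrightarrow> (\<Sum>K | K \<in> S1 \<and> \<bar>\<Sum>a\<in>A. (F a K - \<phi>) * g a\<bar> \<ge> \<delta> * card A. p1 K) \<le> \<eta>"
    and \<delta>: "\<delta> \<ge> 0"
  shows "\<bar>x - \<phi> * y\<bar> \<le> 2 * \<epsilon> + \<delta> + card G * \<eta>"
proof -
  \<comment> \<open>Where \<open>p2 H = 0\<close> the quotient is 0 by convention, in agreement with
    the vanishing of \<open>u\<close> and \<open>v\<close> there, so both marginals come out right
    for all \<open>H\<close>.\<close>
  define w where "w K H g = u K H * v H g / p2 H" for K H g
  have p2: "0 \<le> p2 H" if "H \<in> S2" for H unfolding u2[OF that, symmetric] using u that by (intro sum_nonneg)
  have u0: "u K H = 0" if "K \<in> S1" "H \<in> S2" "p2 H = 0" for K H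
    using sum_nonneg_eq_0_iff[OF fin(1), of "\<lambda>K. u K H"] u2[OF that(2)] that u by simp
  have v0: "v H g = 0" if "g \<in> G" "H \<in> S2" "p2 H = 0" for H g
    using sum_nonneg_eq_0_iff[OF fin(3), of "v H"] v2[OF that(2)] that v by simp
  have w: "0 \<le> w K H g" if "K \<in> S1" "H \<in> S2" "g \<in> G" for K H g
    using that u v p2 by (simp add: w_def)
  have w1: "(\<Sum>K\<in>S1. w K H g) = v H g" if "H \<in> S2" "g \<in> G" for H g
  proof -
    have "(\<Sum>K\<in>S1. w K H g) = (\<Sum>K\<in>S1. u K H) * v H g / p2 H"
      by (simp add: w_def sum_distrib_right sum_divide_distrib)
    then show ?thesis using u2[OF that(1)] v0[OF that(2,1)] by (cases "p2 H = 0") auto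
  qed
  have w2: "(\<Sum>g\<in>G. w K H g) = u K H" if "K \<in> S1" "H \<in> S2" for K H
  proof -
    have "(\<Sum>g\<in>G. w K H g) = u K H * (\<Sum>g\<in>G. v H g) / p2 H"
      by (simp add: w_def sum_distrib_left sum_divide_distrib)
    then show ?thesis using v2[OF that(2)] u0[OF that] by (cases "p2 H = 0") auto
  qed
  define E where "E Z = (\<Sum>K\<in>S1. \<Sum>H\<in>S2. \<Sum>g\<in>G. w K H g * Z K H g)" for Z
  have E_mono: "E Z \<le> E Z'" if "\<And>K H g. K \<in> S1 \<Longrightarrow> H \<in> S2 \<Longrightarrow> g \<in> G \<Longrightarrow> Z K H g \<le> Z' K H g" for Z Z'
    unfolding E_def using that w by (intro sum_mono mult_left_mono) auto
  have E_abs: "\<bar>E Z\<bar> \<le> E (\<lambda>K H g. \<bar>Z K H g\<bar>)" for Z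
  proof -
    have "E Z \<le> E (\<lambda>K H g. \<bar>Z K H g\<bar>)" by (rule E_mono) simp
    moreover have "- E Z \<le> E (\<lambda>K H g. \<bar>Z K H g\<bar>)"
      using E_mono[of "\<lambda>K H g. - Z K H g" "\<lambda>K H g. \<bar>Z K H g\<bar>"] by (simp add: E_def sum_negf)
    ultimately show ?thesis by simp
  qed
  have E_diff: "E (\<lambda>K H g. Z K H g - Z' K H g) = E Z - E Z'" for Z Z'
    by (simp add: E_def right_diff_distrib sum_subtractf)
  have E_add: "E (\<lambda>K H g. Z K H g + Z' K H g) = E Z + E Z'" for Z Z'
    by (simp add: E_def distrib_left sum.distrib)
  have E_cmult: "E (\<lambda>K H g. c * Z K H g) = c * E Z" for Z c
    by (simp add: E_def sum_distrib_left mult.left_commute)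
  have E_sum: "E (\<lambda>K H g. \<Sum>i\<in>J. Z i K H g) = (\<Sum>i\<in>J. E (Z i))" for Z and J :: "'k set"
    unfolding E_def sum_distrib_left by (subst sum.swap[of _ J])+ simp
  have E_KH: "E (\<lambda>K H g. Z K H) = (\<Sum>K\<in>S1. \<Sum>H\<in>S2. u K H * Z K H)" for Z
    unfolding E_def by (intro sum.cong refl) (simp add: w2 flip: sum_distrib_right)
  have E_Hg: "E (\<lambda>K H g. Z H g) = (\<Sum>H\<in>S2. \<Sum>g\<in>G. v H g * Z H g)" for Z
  proof -
    have "E (\<lambda>K H g. Z H g) = (\<Sum>H\<in>S2. \<Sum>g\<in>G. \<Sum>K\<in>S1. w K H g * Z H g)"
      unfolding E_def by (simp add: sum.swap[of _ S1])
    also have "\<dots> = (\<Sum>H\<in>S2. \<Sum>g\<in>G. v H g * Z H g)"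
      by (intro sum.cong refl) (simp add: w1 flip: sum_distrib_right)
    finally show ?thesis .
  qed
  have E_const: "E (\<lambda>K H g. c) = c" for c
    using E_KH[of "\<lambda>_ _. c"] u1 u2 total by (subst (asm) sum.swap) (simp flip: sum_distrib_right)
  have x': "x = E (\<lambda>K H g. F a K * Q a H)" if "a \<in> A" for a using x[OF that] E_KH by simp
  have y': "y = E (\<lambda>K H g. Q a H)" if "a \<in> A" for a
    using y[OF that] E_KH[of "\<lambda>K H. Q a H"] u2 by (subst (asm) sum.swap) (simp flip: sum_distrib_right)
  define h where "h K g = (\<Sum>a\<in>A. (F a K - \<phi>) * g a)" for K g
  \<comment> \<open>Replacing \<open>Q a H\<close> by the pattern value \<open>g a\<close> costs at
    most \<open>\<epsilon>\<close> on average, because \<open>F a K - \<phi>\<close> is bounded by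
    1.\<close>
  have main: "\<bar>x - \<phi> * y - E (\<lambda>K H g. (F a K - \<phi>) * g a)\<bar> \<le> 2 * \<epsilon>" if a: "a \<in> A" for a
  proof -
    have "x - \<phi> * y - E (\<lambda>K H g. (F a K - \<phi>) * g a) =
        E (\<lambda>K H g. F a K * Q a H - \<phi> * Q a H - (F a K - \<phi>) * g a)"
      by (simp only: x'[OF a] y'[OF a] E_diff E_cmult)
    also have "\<dots> = E (\<lambda>K H g. (F a K - \<phi>) * (Q a H - g a))"
      by (rule arg_cong[of _ _ E]) (simp add: fun_eq_iff algebra_simps)
    also have "\<bar>\<dots>\<bar> \<le> E (\<lambda>K H g. \<bar>(F a K - \<phi>) * (Q a H - g a)\<bar>)" by (rule E_abs)
    also have "\<dots> \<le> E (\<lambda>K H g. \<bar>Q a H - g a\<bar>)"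
    proof (rule E_mono)
      fix K H g
      have "\<bar>F a K - \<phi>\<bar> \<le> 1" using F[of a K] \<phi> by auto
      then show "\<bar>(F a K - \<phi>) * (Q a H - g a)\<bar> \<le> \<bar>Q a H - g a\<bar>"
        unfolding abs_mult by (intro mult_left_le_one_le) auto
    qed
    also have "\<dots> \<le> \<epsilon>" unfolding E_Hg using close[OF a] .
    finally have "\<bar>x - \<phi> * y - E (\<lambda>K H g. (F a K - \<phi>) * g a)\<bar> \<le> \<epsilon>" .
    then show ?thesis by linarith
  qed
  have cA: "real (card A) > 0" using A by (simp add: card_gt_0_iff)
  \<comment> \<open>The left side does not depend on \<open>a\<close>, so averaging over
    \<open>A\<close> brings in the sum \<open>h\<close>, to which the concentration hypothesis
    \<open>bad\<close> applies.\<close>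
  have "real (card A) * (x - \<phi> * y) = (\<Sum>a\<in>A. x - \<phi> * y - E (\<lambda>K H g. (F a K - \<phi>) * g a)) + E (\<lambda>K H g. h K g)"
    by (simp add: sum_subtractf h_def E_sum)
  then have "\<bar>real (card A) * (x - \<phi> * y)\<bar> \<le> 
      (\<Sum>a\<in>A. \<bar>x - \<phi> * y - E (\<lambda>K H g. (F a K - \<phi>) * g a)\<bar>) + \<bar>E (\<lambda>K H g. h K g)\<bar>"
    using sum_abs[of "\<lambda>a. x - \<phi> * y - E (\<lambda>K H g. (F a K - \<phi>) * g a)" A] by linarith
  also have "\<dots> \<le> (\<Sum>a\<in>A. 2 * \<epsilon>) + E (\<lambda>K H g. \<bar>h K g\<bar>)"
    by (intro add_mono sum_mono main E_abs)
  \<comment> \<open>Off the bad event \<open>h\<close> is at most \<open>\<delta> * card A\<close>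
    in absolute value; on it the trivial bound \<open>card A\<close> is used.\<close>
  also have "E (\<lambda>K H g. \<bar>h K g\<bar>) \<le> E (\<lambda>K H g. card A * \<delta> + card A * of_bool (\<bar>h K g\<bar> \<ge> \<delta> * card A))"
  proof (rule E_mono)
    fix K H g assume g: "g \<in> G"
    have "\<bar>h K g\<bar> \<le> (\<Sum>a\<in>A. \<bar>(F a K - \<phi>) * g a\<bar>)" unfolding h_def by (rule sum_abs)
    also have "\<dots> \<le> (\<Sum>a\<in>A. 1)"
    proof (rule sum_mono)
      fix a assume a: "a \<in> A"
      have "\<bar>F a K - \<phi>\<bar> \<le> 1" "\<bar>g a\<bar> \<le> 1" using F[of a K] \<phi> g01[OF g a] by auto
      then have "\<bar>F a K - \<phi>\<bar> * \<bar>g a\<bar> \<le> 1 * 1" by (intro mult_mono) auto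
      then show "\<bar>(F a K - \<phi>) * g a\<bar> \<le> 1" by (simp add: abs_mult)
    qed
    finally have "\<bar>h K g\<bar> \<le> card A" by simp
    moreover have "0 \<le> real (card A) * \<delta>" using cA \<delta> by simp
    ultimately show "\<bar>h K g\<bar> \<le> card A * \<delta> + card A * of_bool (\<bar>h K g\<bar> \<ge> \<delta> * card A)"
      by (cases "\<bar>h K g\<bar> \<ge> \<delta> * card A") (auto simp: mult.commute)
  qed
  also have "\<dots> = card A * \<delta> + card A * E (\<lambda>K H g. of_bool (\<bar>h K g\<bar> \<ge> \<delta> * card A))"
    by (simp add: E_add E_cmult E_const)
  \<comment> \<open>Union bound over the patterns: for a fixed \<open>g\<close>, summing the weight
    over \<open>H\<close> leaves at most \<open>p1 K\<close>.\<close>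
  also have "E (\<lambda>K H g. of_bool (\<bar>h K g\<bar> \<ge> \<delta> * card A)) \<le> (\<Sum>g\<in>G. \<eta>)"
  proof -
    have "E (\<lambda>K H g. of_bool (\<bar>h K g\<bar> \<ge> \<delta> * card A)) = 
        (\<Sum>g\<in>G. \<Sum>K\<in>S1. (\<Sum>H\<in>S2. w K H g) * of_bool (\<bar>h K g\<bar> \<ge> \<delta> * card A))"
      unfolding E_def sum_distrib_right by (simp add: sum.swap[of _ G])
    also have "\<dots> \<le> (\<Sum>g\<in>G. \<eta>)"
    proof (rule sum_mono)
      fix g assume g: "g \<in> G"
      have "(\<Sum>H\<in>S2. w K H g) \<le> p1 K" if K: "K \<in> S1" for K
        unfolding u1[OF K, symmetric]
      proof (rule sum_mono)
        fix H assume H: "H \<in> S2"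
        show "w K H g \<le> u K H"
          unfolding w2[OF K H, symmetric] by (rule member_le_sum[OF g]) (use w[OF K H] fin in auto)
      qed
      then have "(\<Sum>K\<in>S1. (\<Sum>H\<in>S2. w K H g) * of_bool (\<bar>h K g\<bar> \<ge> \<delta> * card A)) \<le>
          (\<Sum>K\<in>S1. p1 K * of_bool (\<bar>h K g\<bar> \<ge> \<delta> * card A))"
        by (intro sum_mono mult_right_mono) auto
      also have "\<dots> = (\<Sum>K | K \<in> S1 \<and> \<bar>h K g\<bar> \<ge> \<delta> * card A. p1 K)"
        using fin(1) by (intro sum.mono_neutral_cong_right) auto
      also have "\<dots> \<le> \<eta>" using bad[OF g] unfolding h_def .
      finally show "(\<Sum>K\<in>S1. (\<Sum>H\<in>S2. w K H g) * of_bool (\<bar>h K g\<bar> \<ge> \<delta> * card A)) \<le> \<eta>" .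
    qed
    finally show ?thesis .
  qed
  finally have "\<bar>real (card A) * (x - \<phi> * y)\<bar> \<le> 
      (\<Sum>a\<in>A. 2 * \<epsilon>) + (card A * \<delta> + card A * (\<Sum>g\<in>G. \<eta>))" using cA by simp
  then have "card A * \<bar>x - \<phi> * y\<bar> \<le> card A * (2 * \<epsilon> + \<delta> + card G * \<eta>)"
    unfolding abs_mult using cA by (simp add: distrib_left mult.left_commute)
  then show ?thesis using cA by simp
qed

lemma indep_vars_component:
  assumes N: "prob_space N" and I: "I \<noteq> {}"
  shows "prob_space.indep_vars (\<Pi>\<^sub>M i\<in>I. N) (\<lambda>_. N) (\<lambda>i \<theta>. \<theta> i) I"
proof -
  let ?M = "\<Pi>\<^sub>M i\<in>I. N"
  interpret prob_space ?M by (rule prob_space_PiM) (rule N)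
  have "distr ?M ?M (\<lambda>x. \<lambda>i\<in>I. x i) = distr ?M ?M (\<lambda>x. x)"
    by (rule distr_cong) (auto simp: space_PiM PiE_restrict)
  also have "\<dots> = (\<Pi>\<^sub>M i\<in>I. distr ?M N (\<lambda>x. x i))"
    unfolding distr_id by (intro PiM_cong refl) (rule distr_PiM_component[of I "\<lambda>_. N", OF N, symmetric])
  finally show ?thesis
    by (subst indep_vars_iff_distr_eq_PiM'[OF I]) auto
qed

text \<open>By the cylinder property the sample along \<open>packing l m n a\<close> depends only on
  variables at sets of more than \<open>l\<close> vertices inside its range, and two ranges have no
  such set in common. For fixed weights \<open>g\<close> the weighted indicators are therefore
  independent, and Hoeffding's inequality applies.\<close>

lemma packing_concentration:
  fixes \<Omega> :: "'x measure" and T :: "'p univ_theory"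
  assumes \<Omega>: "prob_space \<Omega>" and T: "finite (symbols T)"
    and N: "\<And>P. P \<in> symbols T \<Longrightarrow> \<N> P \<in> sets (\<Pi>\<^sub>M A\<in>fin_subsets {..<arity T P}. \<Omega>)"
    and cyl: "\<And>P. P \<in> symbols T \<Longrightarrow> 
      cylinder_over {A \<in> fin_subsets {..<arity T P}. card A > l} (fin_subsets {..<arity T P}) \<Omega> (\<N> P)"
    and law: "\<And>x. x \<in> inj_maps m {..<m * packing_width l m n} \<Longrightarrow> 
      measure (\<Pi>\<^sub>M A\<in>fin_subsets UNIV. \<Omega>) {\<theta> \<in> space (\<Pi>\<^sub>M A\<in>fin_subsets UNIV. \<Omega>). 
        pullback m x (theon_struct T \<N> \<theta>) = K} = \<phi>"
    and n: "n > 0" and g: "\<And>a. a \<in> packing_index l n \<Longrightarrow> g a \<in> {0..1 :: real}" and \<delta>: "\<delta> \<ge> 0"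
  shows "measure (\<Pi>\<^sub>M A\<in>fin_subsets UNIV. \<Omega>) {\<theta> \<in> space (\<Pi>\<^sub>M A\<in>fin_subsets UNIV. \<Omega>).
      \<bar>\<Sum>a\<in>packing_index l n. (of_bool (pullback m (packing l m n a) (theon_struct T \<N> \<theta>) = K) - \<phi>) * g a\<bar>
        \<ge> \<delta> * n ^ Suc l} \<le> 2 * exp (- 2 * \<delta>\<^sup>2 * n ^ Suc l)"
proof -
  let ?M = "\<Pi>\<^sub>M A\<in>fin_subsets (UNIV :: nat set). \<Omega>" and ?I = "packing_index l n" 
  let ?gt = "{A \<in> fin_subsets {..<m}. card A > l}" and ?Mm = "\<Pi>\<^sub>M A\<in>fin_subsets {..<m}. \<Omega>"
  let ?x = "packing l m n"
  interpret M: prob_space ?M by (rule prob_space_PiM) (rule \<Omega>)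
  have finI: "finite ?I" by (auto simp: packing_index_def intro: finite_PiE)
  have xinj: "?x a \<in> inj_maps m {..<m * packing_width l m n}" if "a \<in> ?I" for a
    by (rule packing_inj_maps[OF that n])
  obtain E where E: "E \<in> sets (\<Pi>\<^sub>M A\<in>?gt. \<Omega>)"
    and Eiff: "\<And>y. y \<in> space ?Mm \<Longrightarrow> y \<in> {y \<in> space ?Mm. local_struct T \<N> m y = K} \<longleftrightarrow> restrict y ?gt \<in> E"
  proof -
    have sub: "?gt \<subseteq> fin_subsets {..<m}" by auto
    have ls: "{y \<in> space ?Mm. local_struct T \<N> m y = K} \<in> sets ?Mm" by (rule local_struct_sets[OF T N])
    have cy: "cylinder_over ?gt (fin_subsets {..<m}) \<Omega> {y \<in> space ?Mm. local_struct T \<N> m y = K}"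
      by (rule cylinder_local_struct[of T "\<lambda>k. k > l", OF cyl])
    show thesis by (rule cylinder_restrict[OF \<Omega> sub ls cy]) (rule that)
  qed
  define B where "B a = {A \<in> fin_subsets (UNIV :: nat set). A \<subseteq> ?x a ` {..<m} \<and> card A > l}" for a
  define h where "h a w = indicator E (\<lambda>A\<in>?gt. w (?x a ` A)) * g a" for a w
  have imB: "?x a ` A \<in> B a" if "a \<in> ?I" "A \<in> ?gt" for a A
  proof -
    have "inj_on (?x a) A" using inj_mapsD(3)[OF xinj[OF that(1)]] that(2)
      by (auto simp: fin_subsets_def intro: inj_on_subset)
    then have "card (?x a ` A) = card A" by (rule card_image)
    then show ?thesis using that(2) by (auto simp: B_def fin_subsets_def)
  qed
  have hm: "h a \<in> borel_measurable (\<Pi>\<^sub>M A\<in>B a. \<Omega>)" if "a \<in> ?I" for a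
  proof -
    have "(\<lambda>w. \<lambda>A\<in>?gt. w (?x a ` A)) \<in> (\<Pi>\<^sub>M A\<in>B a. \<Omega>) \<rightarrow>\<^sub>M (\<Pi>\<^sub>M A\<in>?gt. \<Omega>)"
      by (intro measurable_restrict measurable_component_singleton imB that)
    with E show ?thesis unfolding h_def by measurable
  qed
  define X where "X a \<theta> = h a (restrict (\<lambda>A. \<theta> A) (B a))" for a \<theta>
  have X: "X a \<theta> = of_bool (pullback m (?x a) (theon_struct T \<N> \<theta>) = K) * g a" if a: "a \<in> ?I" and \<theta>: "\<theta> \<in> space ?M" for a \<theta>
  proof -
    have r: "reindex m (?x a) \<theta> \<in> space ?Mm" by (rule measurable_space[OF measurable_reindex \<theta>]) simp
    have "(\<lambda>A\<in>?gt. restrict (\<lambda>A. \<theta> A) (B a) (?x a ` A)) = restrict (reindex m (?x a) \<theta>) ?gt"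
      using imB[OF a] by (auto simp: reindex_def fun_eq_iff)
    then show ?thesis
      unfolding X_def h_def pullback_theon_struct[OF inj_mapsD(3)[OF xinj[OF a]]]
      using Eiff[OF r] r by (simp add: indicator_def)
  qed
  have indep: "M.indep_vars (\<lambda>_. borel) X ?I"
  proof -
    have FS: "fin_subsets (UNIV :: nat set) \<noteq> {}" by (auto simp: fin_subsets_def)
    have "disjoint_family_on B ?I"
      unfolding disjoint_family_on_def
    proof (intro ballI impI, rule ccontr)
      fix a b assume ab: "a \<in> ?I" "b \<in> ?I" "a \<noteq> b" and "B a \<inter> B b \<noteq> {}"
      then obtain A where A: "A \<subseteq> ?x a ` {..<m} \<inter> ?x b ` {..<m}" "card A > l" by (auto simp: B_def)
      then have "card A \<le> card (?x a ` {..<m} \<inter> ?x b ` {..<m})" by (intro card_mono) auto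
      with card_packing_inter[OF ab n, of m] A(2) show False by simp
    qed
    from M.indep_vars_compose2[OF M.indep_vars_restrict[OF indep_vars_component[OF \<Omega> FS] _ this] hm]
    show ?thesis unfolding X_def by (auto simp: B_def)
  qed
  have Xm: "X a \<in> borel_measurable ?M" if "a \<in> ?I" for a using indep that by (auto simp: M.indep_vars_def)
  interpret H: Hoeffding_ineq ?M ?I X "\<lambda>_. 0" "\<lambda>_. 1" "\<Sum>a\<in>?I. M.expectation (X a)"
  proof unfold_locales
    show "AE \<theta> in ?M. X a \<theta> \<in> {0..1}" if "a \<in> ?I" for a
      using AE_space by eventually_elim (use X[OF that] g[OF that] in auto)
  qed (use finI indep in auto)
  have ex: "M.expectation (X a) = \<phi> * g a" if a: "a \<in> ?I" for a
  proof -
    let ?S = "{\<theta> \<in> space ?M. pullback m (?x a) (theon_struct T \<N> \<theta>) = K}"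
    have "?S \<in> sets ?M" by (rule prob_theon_struct_pullback(1)[OF \<Omega> T N inj_mapsD(3)[OF xinj[OF a]]])
    moreover have "M.expectation (X a) = (\<integral>\<theta>. indicator ?S \<theta> * g a \<partial>?M)"
      by (rule Bochner_Integration.integral_cong) (auto simp: X[OF a] indicator_def)
    ultimately show ?thesis using law[OF xinj[OF a]] by simp
  qed
  have S1: "(\<Sum>a\<in>?I. ((1::real) - 0)\<^sup>2) = real (n ^ Suc l)" by (simp add: card_packing_index)
  have nn: "real (n ^ Suc l) > 0" using n by simp
  have "M.prob {\<theta>\<in>space ?M. \<bar>(\<Sum>a\<in>?I. X a \<theta>) - (\<Sum>a\<in>?I. M.expectation (X a))\<bar> \<ge> \<delta> * real (n ^ Suc l)} \<le> 
      2 * exp (- 2 * (\<delta> * real (n ^ Suc l))\<^sup>2 / (\<Sum>a\<in>?I. ((1::real) - 0)\<^sup>2))"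
    by (rule H.Hoeffding_ineq_abs_ge) (use \<delta> nn S1 in auto)
  also have "- 2 * (\<delta> * real (n ^ Suc l))\<^sup>2 / (\<Sum>a\<in>?I. ((1::real) - 0)\<^sup>2) = - 2 * \<delta>\<^sup>2 * real (n ^ Suc l)"
    unfolding S1 using nn by (simp add: power2_eq_square)
  also have "{\<theta>\<in>space ?M. \<bar>(\<Sum>a\<in>?I. X a \<theta>) - (\<Sum>a\<in>?I. M.expectation (X a))\<bar> \<ge> \<delta> * real (n ^ Suc l)} =
     {\<theta> \<in> space ?M. \<bar>\<Sum>a\<in>?I. (of_bool (pullback m (?x a) (theon_struct T \<N> \<theta>) = K) - \<phi>) * g a\<bar> \<ge> \<delta> * real (n ^ Suc l)}"
  proof (rule Collect_cong, rule conj_cong[OF refl])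
    fix \<theta> assume "\<theta> \<in> space ?M"
    then have "(\<Sum>a\<in>?I. X a \<theta>) - (\<Sum>a\<in>?I. M.expectation (X a)) = 
      (\<Sum>a\<in>?I. (of_bool (pullback m (?x a) (theon_struct T \<N> \<theta>) = K) - \<phi>) * g a)"
      by (simp add: X ex left_diff_distrib flip: sum_subtractf)
    then show "(\<bar>(\<Sum>a\<in>?I. X a \<theta>) - (\<Sum>a\<in>?I. M.expectation (X a))\<bar> \<ge> \<delta> * real (n ^ Suc l)) = 
      (\<bar>\<Sum>a\<in>?I. (of_bool (pullback m (?x a) (theon_struct T \<N> \<theta>) = K) - \<phi>) * g a\<bar> \<ge> \<delta> * real (n ^ Suc l))" by simp
  qed
  finally show ?thesis by simp
qed

lemma sum_models_join:
  "(\<Sum>K\<in>models T1 V. \<Sum>H\<in>models T2 V. f (join K H)) = (\<Sum>L\<in>models (disjoint_union T1 T2) V. f L)"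
proof -
  have "(\<Sum>K\<in>models T1 V. \<Sum>H\<in>models T2 V. f (join K H)) = 
      (\<Sum>KH\<in>models T1 V \<times> models T2 V. f (join (fst KH) (snd KH)))"
    by (simp add: sum.cartesian_product case_prod_unfold)
  also have "\<dots> = (\<Sum>L\<in>models (disjoint_union T1 T2) V. f L)"
  proof (rule sum.reindex_bij_witness[where j = "\<lambda>KH. join (fst KH) (snd KH)" 
        and i = "\<lambda>K. (reduct Inl K, reduct Inr K)"])
    fix KK assume KK: "KK \<in> models T1 V \<times> models T2 V"
    then have "verts (fst KK) = verts (snd KK)" using verts_models[of _ T1 V] verts_models[of _ T2 V] by force
    then show "(reduct Inl (join (fst KK) (snd KK)), reduct Inr (join (fst KK) (snd KK))) = KK"
      "join (fst KK) (snd KK) \<in> models (disjoint_union T1 T2) V"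
      using KK join_models[of "fst KK" T1 V "snd KK" T2] by auto
  qed (auto simp: join_reduct intro: reduct_models[OF embeds_disjoint_union(1)] reduct_models[OF embeds_disjoint_union(2)])
  finally show ?thesis .
qed

lemma (in prob_space) prob_sum_fibers:
  assumes fin: "finite G" and A: "A \<in> events" and g: "\<And>g. g \<in> G \<Longrightarrow> {\<theta> \<in> space M. f \<theta> = g} \<in> events"
  shows "(\<Sum>g\<in>G. prob {\<theta> \<in> A. f \<theta> = g}) = prob {\<theta> \<in> A. f \<theta> \<in> G}"
proof -
  have eq: "{\<theta> \<in> A. f \<theta> = g} = A \<inter> {\<theta> \<in> space M. f \<theta> = g}" for g
    using sets.sets_into_space[OF A] by auto
  have "prob (\<Union>g\<in>G. {\<theta> \<in> A. f \<theta> = g}) = (\<Sum>g\<in>G. prob {\<theta> \<in> A. f \<theta> = g})"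
    by (rule finite_measure_finite_Union[OF fin]) (use A g in \<open>auto simp: eq disjoint_family_on_def\<close>)
  moreover have "(\<Union>g\<in>G. {\<theta> \<in> A. f \<theta> = g}) = {\<theta> \<in> A. f \<theta> \<in> G}" by auto
  ultimately show ?thesis by simp
qed

lemma pullback_pullback_id:
  "x \<in> inj_maps m {..<n} \<Longrightarrow> pullback m x (pullback n id K) = pullback m x K"
  using inj_mapsD(4)[of x m "{..<n}"] by (subst pullback_pullback) auto

lemma function_factors_through:
  assumes "\<And>x y. h x = h y \<Longrightarrow> x \<in> S \<Longrightarrow> y \<in> S \<Longrightarrow> q x = q y"
  shows "\<exists>f. \<forall>x\<in>S. q x = f (h x)"
proof (intro exI ballI)
  fix x assume x: "x \<in> S"
  have "(SOME x'. x' \<in> S \<and> h x' = h x) \<in> S \<and> h (SOME x'. x' \<in> S \<and> h x' = h x) = h x"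
    by (rule someI[of _ x]) (use x in simp)
  then show "q x = (\<lambda>p. q (SOME x'. x' \<in> S \<and> h x' = p)) (h x)" using assms x by metis
qed

text \<open>The number of patterns has an exponent of order \<open>n ^ l\<close>, the failure
  probability one of order \<open>n ^ (l + 1)\<close>, so every \<open>n\<close> beyond a constant
  works.\<close>

lemma union_bound_beats_patterns:
  fixes \<epsilon> :: real
  assumes "\<epsilon> > 0"
  obtains n :: nat where "n > 0" "2 ^ (d * (n * c) ^ l) * (2 * exp (- 2 * \<epsilon>\<^sup>2 * real (n ^ Suc l))) \<le> \<epsilon>"
proof -
  \<comment> \<open>\<open>s\<close> absorbs the factor \<open>2 / \<epsilon>\<close>; the maximum
    with 0 ensures \<open>s \<le> n ^ l * s\<close>.\<close>
  define s where "s = max 0 (ln (2 / \<epsilon>))"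
  obtain k :: nat where k: "real k \<ge> (d * c ^ l * ln 2 + s) / (2 * \<epsilon>\<^sup>2)"
    using real_arch_simple by blast
  define n where "n = Suc k"
  have n: "n > 0" "real n \<ge> (d * c ^ l * ln 2 + s) / (2 * \<epsilon>\<^sup>2)" using k by (auto simp: n_def)
  have "real (n ^ l) \<ge> 1" using n by simp
  have "d * c ^ l * ln 2 + s \<le> 2 * \<epsilon>\<^sup>2 * n"
    using n(2) assms by (simp add: pos_divide_le_eq mult.commute)
  then have "n ^ l * (d * c ^ l * ln 2 + s) \<le> n ^ l * (2 * \<epsilon>\<^sup>2 * n)"
    by (intro mult_left_mono) auto
  moreover have "s \<le> n ^ l * s" using \<open>real (n ^ l) \<ge> 1\<close> mult_right_mono[of 1 "real (n ^ l)" s] by (simp add: s_def)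
  ultimately have "(d * (n * c) ^ l) * ln 2 - 2 * \<epsilon>\<^sup>2 * real (n ^ Suc l) \<le> - s"
    by (simp add: algebra_simps power_mult_distrib)
  moreover have "(2::real) ^ k = exp (k * ln 2)" for k :: nat
    by (simp add: exp_of_nat_mult)
  ultimately have "2 ^ (d * (n * c) ^ l) * (2 * exp (- 2 * \<epsilon>\<^sup>2 * real (n ^ Suc l))) \<le> 2 * exp (- s)"
    by (simp add: mult.left_commute[of _ 2] flip: exp_add)
  also have "exp (- s) \<le> exp (- ln (2 / \<epsilon>))" by (simp add: s_def)
  also have "exp (- ln (2 / \<epsilon>)) = \<epsilon> / 2" using assms by (simp add: exp_minus)
  finally show thesis using that n(1) by simp
qed

text \<open>The coupling enters only through its laws on finite vertex sets and their marginals, and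
  each theon is used over its own space. The error \<open>4 * \<epsilon>\<close> consists of
  \<open>2 * \<epsilon>\<close> for replacing samples of the second structure by patterns,
  \<open>\<epsilon>\<close> for the deviation allowed in the concentration bound, and
  \<open>\<epsilon>\<close> for the union bound over all patterns.\<close>

lemma independent_low_rank_coupling:
  fixes \<Omega>1 :: "'x measure" and \<Omega>2 :: "'y measure" and T1 :: "'p univ_theory" and T2 :: "'q univ_theory"
  assumes \<Omega>: "prob_space \<Omega>1" "prob_space \<Omega>2" and T: "finite (symbols T1)" "finite (symbols T2)"
    and N1: "\<And>P. P \<in> symbols T1 \<Longrightarrow> \<N>1 P \<in> sets (\<Pi>\<^sub>M A\<in>fin_subsets {..<arity T1 P}. \<Omega>1)"
    and N2: "\<And>P. P \<in> symbols T2 \<Longrightarrow> \<N>2 P \<in> sets (\<Pi>\<^sub>M A\<in>fin_subsets {..<arity T2 P}. \<Omega>2)"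
    and cyl1: "\<And>P. P \<in> symbols T1 \<Longrightarrow> 
      cylinder_over {A \<in> fin_subsets {..<arity T1 P}. card A > l} (fin_subsets {..<arity T1 P}) \<Omega>1 (\<N>1 P)"
    and cyl2: "\<And>P. P \<in> symbols T2 \<Longrightarrow> 
      cylinder_over {A \<in> fin_subsets {..<arity T2 P}. card A \<le> l} (fin_subsets {..<arity T2 P}) \<Omega>2 (\<N>2 P)"
    and law1: "\<And>m x K. inj_on x {..<m} \<Longrightarrow> K \<in> models T1 {..<m} \<Longrightarrow>
      measure (\<Pi>\<^sub>M A\<in>fin_subsets UNIV. \<Omega>1) {\<theta> \<in> space (\<Pi>\<^sub>M A\<in>fin_subsets UNIV. \<Omega>1). 
        pullback m x (theon_struct T1 \<N>1 \<theta>) = K} = p1 K"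
    and law2: "\<And>m x K. inj_on x {..<m} \<Longrightarrow> K \<in> models T2 {..<m} \<Longrightarrow>
      measure (\<Pi>\<^sub>M A\<in>fin_subsets UNIV. \<Omega>2) {\<theta> \<in> space (\<Pi>\<^sub>M A\<in>fin_subsets UNIV. \<Omega>2). 
        pullback m x (theon_struct T2 \<N>2 \<theta>) = K} = p2 K"
    and c1: "consistent_law T1 p1" and c2: "consistent_law T2 p2" 
    and \<xi>: "consistent_law (disjoint_union T1 T2) \<xi>"
    and marg1: "\<And>m K. K \<in> models T1 {..<m} \<Longrightarrow>
      p1 K = (\<Sum>L | L \<in> models (disjoint_union T1 T2) {..<m} \<and> reduct Inl L = K. \<xi> L)"
    and marg2: "\<And>m K. K \<in> models T2 {..<m} \<Longrightarrow>
      p2 K = (\<Sum>L | L \<in> models (disjoint_union T1 T2) {..<m} \<and> reduct Inr L = K. \<xi> L)"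
    and L: "L \<in> models (disjoint_union T1 T2) {..<m}"
  shows "\<xi> L = p1 (reduct Inl L) * p2 (reduct Inr L)"
proof -
  let ?U = "disjoint_union T1 T2" and ?K0 = "reduct Inl L" and ?H0 = "reduct Inr L"
  let ?M1 = "\<Pi>\<^sub>M A\<in>fin_subsets (UNIV :: nat set). \<Omega>1" and ?M2 = "\<Pi>\<^sub>M A\<in>fin_subsets (UNIV :: nat set). \<Omega>2"
  interpret M1: prob_space ?M1 by (rule prob_space_PiM) (rule \<Omega>)
  interpret M2: prob_space ?M2 by (rule prob_space_PiM) (rule \<Omega>)
  note finU = finite_symbols_disjoint_union[OF T]
  note K0 = reduct_models[OF embeds_disjoint_union(1) L] and H0 = reduct_models[OF embeds_disjoint_union(2) L]
  let ?le = "{A \<in> fin_subsets {..<m}. card A \<le> l}" and ?Mm = "\<Pi>\<^sub>M A\<in>fin_subsets {..<m}. \<Omega>2"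
  have sub: "?le \<subseteq> fin_subsets {..<m}" by auto
  have ls: "{y \<in> space ?Mm. local_struct T2 \<N>2 m y = ?H0} \<in> sets ?Mm" by (rule local_struct_sets[OF T(2) N2])
  have cy: "cylinder_over ?le (fin_subsets {..<m}) \<Omega>2 {y \<in> space ?Mm. local_struct T2 \<N>2 m y = ?H0}"
    by (rule cylinder_local_struct[of T2 "\<lambda>k. k \<le> l", OF cyl2])
  \<comment> \<open>By bounded rank, the event that the second sample equals \<open>?H0\<close>
    involves only the variables at sets of at most \<open>l\<close> vertices.\<close>
  obtain E where E: "E \<in> sets (\<Pi>\<^sub>M A\<in>?le. \<Omega>2)"
    and Eiff: "\<And>y. y \<in> space ?Mm \<Longrightarrow> y \<in> {y \<in> space ?Mm. local_struct T2 \<N>2 m y = ?H0} \<longleftrightarrow> restrict y ?le \<in> E"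
    by (rule cylinder_restrict[OF \<Omega>(2) sub ls cy]) (rule that)
  have "\<bar>\<xi> L - p1 ?K0 * p2 ?H0\<bar> \<le> 4 * \<epsilon>" if \<epsilon>: "\<epsilon> > 0" for \<epsilon> :: real
  proof -
    obtain \<D> E' where \<D>: "finite \<D>" and E': "E' \<in> sets (\<Pi>\<^sub>M A\<in>?le. \<Omega>2)" and pat: "patterned \<D> ?le \<Omega>2 E'"
      and small: "measure (\<Pi>\<^sub>M A\<in>?le. \<Omega>2) (sym_diff E E') < \<epsilon>"
      by (rule PiM_approx_patterned[OF \<Omega>(2) E \<epsilon>]) (rule that)
    \<comment> \<open>The vertex set will have \<open>n * C\<close> elements. \<open>C\<close> does
      not depend on \<open>n\<close>, as the choice of \<open>n\<close> in the union bound
      requires.\<close>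
    define C where "C = m * (Suc l * Suc m ^ l)"
    obtain n :: nat where n: "n > 0" 
      and small_n: "2 ^ (card \<D> * (n * C) ^ l) * (2 * exp (- 2 * \<epsilon>\<^sup>2 * real (n ^ Suc l))) \<le> \<epsilon>"
      by (rule union_bound_beats_patterns[OF \<epsilon>]) (rule that)
    define V where "V = m * packing_width l m n"
    have VC: "V = n * C" by (simp add: V_def C_def packing_width_def)
    let ?A = "packing_index l n" and ?x = "packing l m n"
    let ?S1 = "models T1 {..<V}" and ?S2 = "models T2 {..<V}"
    have finA: "finite ?A" by (auto simp: packing_index_def intro: finite_PiE)
    have neA: "?A \<noteq> {}" using card_packing_index[of l n] n by auto
    have x: "?x a \<in> inj_maps m {..<V}" if "a \<in> ?A" for a unfolding V_def by (rule packing_inj_maps[OF that n])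
    have fin: "finite ?S1" "finite ?S2" using finite_models[OF T(1)] finite_models[OF T(2)] by auto
    define F where "F a K = (of_bool (pullback m (?x a) K = ?K0) :: real)" for a and K :: "('p, nat) fo_struct"
    define Q where "Q a H = (of_bool (pullback m (?x a) H = ?H0) :: real)" for a and H :: "('q, nat) fo_struct"
    note comp = pullback_pullback_id[OF x]
    define r where "r a \<theta> = restrict (reindex m (?x a) \<theta>) ?le" for a and \<theta> :: "nat set \<Rightarrow> 'y"
    have rm: "r a \<in> ?M2 \<rightarrow>\<^sub>M (\<Pi>\<^sub>M A\<in>?le. \<Omega>2)" for a
      unfolding r_def by (rule measurable_compose[OF measurable_reindex measurable_restrict_subset[OF sub]]) simp
    have rdistr: "distr ?M2 (\<Pi>\<^sub>M A\<in>?le. \<Omega>2) (r a) = (\<Pi>\<^sub>M A\<in>?le. \<Omega>2)" if "a \<in> ?A" for a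
    proof -
      have "id \<in> ?le \<rightarrow> fin_subsets {..<m}" by auto
      then have 1: "distr ?Mm (\<Pi>\<^sub>M A\<in>?le. \<Omega>2) (\<lambda>x. restrict x ?le) = (\<Pi>\<^sub>M A\<in>?le. \<Omega>2)"
        using distr_PiM_reindex[of "fin_subsets {..<m}" "\<lambda>_. \<Omega>2" id ?le] \<Omega>(2) by auto
      have mre: "reindex m (?x a) \<in> ?M2 \<rightarrow>\<^sub>M ?Mm" by (rule measurable_reindex) simp
      have "distr ?M2 (\<Pi>\<^sub>M A\<in>?le. \<Omega>2) (r a) = 
          distr (distr ?M2 ?Mm (reindex m (?x a))) (\<Pi>\<^sub>M A\<in>?le. \<Omega>2) (\<lambda>x. restrict x ?le)"
        by (subst distr_distr[OF measurable_restrict_subset[OF sub] mre]) (simp add: r_def[abs_def] comp_def)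
      also have "distr ?M2 ?Mm (reindex m (?x a)) = ?Mm"
        by (rule distr_reindex[OF \<Omega>(2) inj_mapsD(3)[OF x[OF that]]]) simp
      also note 1
      finally show ?thesis .
    qed
    \<comment> \<open>The pattern records for every sample of the packing whether the discretised
      event \<open>E'\<close> holds.\<close>
    define q where "q \<theta> = (\<lambda>a\<in>?A. of_bool (r a \<theta> \<in> E') :: real)" for \<theta>
    let ?G = "q ` space ?M2"
    let ?leV = "{A \<in> fin_subsets {..<V}. card A \<le> l}"
    let ?pt = "\<lambda>\<theta>. \<lambda>B\<in>?leV. {D \<in> \<D>. \<theta> B \<in> D}"
    \<comment> \<open>The pattern depends only on which members of \<open>\<D>\<close> contain each
      variable at a set of at most \<open>l\<close> vertices; this is what bounds the number of its
      values.\<close>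
    have q_pt: "q \<theta> = q \<theta>'" if "?pt \<theta> = ?pt \<theta>'" "\<theta> \<in> space ?M2" "\<theta>' \<in> space ?M2" for \<theta> \<theta>'
    proof -
      have "r a \<theta> \<in> E' \<longleftrightarrow> r a \<theta>' \<in> E'" if a: "a \<in> ?A" for a
      proof (rule patternedD[OF pat measurable_space[OF rm \<open>\<theta> \<in> space ?M2\<close>] measurable_space[OF rm \<open>\<theta>' \<in> space ?M2\<close>]], intro ballI)
        fix A D assume A: "A \<in> ?le" and D: "D \<in> \<D>"
        have "inj_on (?x a) A" using inj_mapsD(3)[OF x[OF a]] A by (auto simp: fin_subsets_def intro: inj_on_subset)
        then have "?x a ` A \<in> ?leV" using A inj_mapsD(4)[OF x[OF a]] 
          by (auto simp: card_image intro!: image_fin_subsets[of A m "?x a"])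
        then have "{D \<in> \<D>. \<theta> (?x a ` A) \<in> D} = {D \<in> \<D>. \<theta>' (?x a ` A) \<in> D}"
          using fun_cong[OF \<open>?pt \<theta> = ?pt \<theta>'\<close>, of "?x a ` A"] by simp
        then have "\<theta> (?x a ` A) \<in> D \<longleftrightarrow> \<theta>' (?x a ` A) \<in> D" using D by blast
        then show "r a \<theta> A \<in> D \<longleftrightarrow> r a \<theta>' A \<in> D" using A by (simp add: r_def reindex_def)
      qed
      then show ?thesis by (simp add: q_def fun_eq_iff)
    qed
    have fin_pt: "finite (?leV \<rightarrow>\<^sub>E Pow \<D>)" using \<D> by (intro finite_PiE) auto
    have pt_sub: "?pt ` space ?M2 \<subseteq> ?leV \<rightarrow>\<^sub>E Pow \<D>"
      by (rule image_subsetI) (simp only: restrict_PiE_iff, blast)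
    have "\<exists>f. \<forall>\<theta>\<in>space ?M2. q \<theta> = f (?pt \<theta>)"
      by (rule function_factors_through) (rule q_pt)
    then obtain f where f: "\<And>\<theta>. \<theta> \<in> space ?M2 \<Longrightarrow> q \<theta> = f (?pt \<theta>)" by blast
    then have Gf: "?G = f ` ?pt ` space ?M2" by (auto simp: image_iff)
    have finG: "finite ?G" unfolding Gf using finite_subset[OF pt_sub fin_pt] by simp
    have "card ?G \<le> card (?pt ` space ?M2)" unfolding Gf by (rule card_image_le[OF finite_subset[OF pt_sub fin_pt]])
    also have "\<dots> \<le> card (?leV \<rightarrow>\<^sub>E Pow \<D>)" by (rule card_mono[OF fin_pt pt_sub])
    also have "\<dots> = 2 ^ (card \<D> * card ?leV)" using \<D> by (simp add: card_PiE card_Pow power_mult)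
    also have "\<dots> \<le> 2 ^ (card \<D> * (n * C) ^ l)"
      using card_fin_subsets_le[of V l] by (intro power_increasing mult_left_mono) (auto simp: VC)
    finally have "card ?G \<le> 2 ^ (card \<D> * (n * C) ^ l)" .
    then have cardG: "real (card ?G) \<le> 2 ^ (card \<D> * (n * C) ^ l)" by (metis of_nat_le_iff of_nat_numeral of_nat_power)
    have rE': "{\<theta> \<in> space ?M2. r a \<theta> \<in> E'} \<in> sets ?M2" for a
      using measurable_sets[OF rm E'] by (simp add: vimage_def Int_def conj_commute)
    have qsets: "{\<theta> \<in> space ?M2. q \<theta> = g} \<in> sets ?M2" if g: "g \<in> ?G" for g
    proof -
      have "g \<in> extensional ?A" using g by (auto simp: q_def)
      then have "{\<theta> \<in> space ?M2. q \<theta> = g} = {\<theta> \<in> space ?M2. \<forall>a\<in>?A. of_bool (r a \<theta> \<in> E') = g a}"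
        by (auto simp: q_def fun_eq_iff extensional_def)
      moreover have "{\<theta> \<in> space ?M2. of_bool (r a \<theta> \<in> E') = g a} \<in> sets ?M2" for a
      proof -
        have "{\<theta> \<in> space ?M2. of_bool (r a \<theta> \<in> E') = g a} = {\<theta> \<in> space ?M2. (r a \<theta> \<in> E' \<and> g a = 1) \<or> (\<not> r a \<theta> \<in> E' \<and> g a = 0)}"
          by auto
        also have "\<dots> \<in> sets ?M2"
          by (intro sets.sets_Collect_disj sets.sets_Collect_conj sets.sets_Collect_neg rE') auto
        finally show ?thesis .
      qed
      ultimately show ?thesis using finA by (simp add: sets.sets_Collect_finite_All')
    qed
    define H where "H \<theta> = pullback V id (theon_struct T2 \<N>2 \<theta>)" for \<theta>
    define K where "K \<theta> = pullback V id (theon_struct T1 \<N>1 \<theta>)" for \<theta>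
    have Hs: "{\<theta> \<in> space ?M2. H \<theta> = h} \<in> sets ?M2" for h
      unfolding H_def by (rule prob_theon_struct_pullback(1)[OF \<Omega>(2) T(2) N2 inj_on_id])
    have Ks: "{\<theta> \<in> space ?M1. K \<theta> = k} \<in> sets ?M1" for k
      unfolding K_def by (rule prob_theon_struct_pullback(1)[OF \<Omega>(1) T(1) N1 inj_on_id])
    define v where "v h g = measure ?M2 {\<theta> \<in> {\<theta> \<in> space ?M2. H \<theta> = h}. q \<theta> = g}" for h g
    define u where "u k h = \<xi> (join k h)" for k h
    have "\<bar>\<xi> L - p1 ?K0 * p2 ?H0\<bar> \<le> 2 * \<epsilon> + \<epsilon> + card ?G * (2 * exp (- 2 * \<epsilon>\<^sup>2 * real (n ^ Suc l)))"
    proof (rule decoupling_bound[where A = ?A and F = F and Q = Q and u = u and v = v, OF fin finG finA neA])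
      show "0 \<le> u k h" if "k \<in> ?S1" "h \<in> ?S2" for k h
        unfolding u_def by (rule consistent_lawD(1)[OF \<xi> join_models[OF that]])
      show "(\<Sum>h\<in>?S2. u k h) = p1 k" if k: "k \<in> ?S1" for k
      proof -
        have "p1 k = (\<Sum>L\<in>models ?U {..<V}. \<xi> L * of_bool (reduct Inl L = k))"
          unfolding marg1[OF k] using finite_models[OF finU, of "{..<V}"] by (intro sum.mono_neutral_cong_left) auto
        also have "\<dots> = (\<Sum>k'\<in>?S1. \<Sum>h\<in>?S2. u k' h * of_bool (k' = k))"
          unfolding u_def sum_models_join[of "\<lambda>L. \<xi> L * of_bool (reduct Inl L = k)" T2 "{..<V}" T1, symmetric] by simp
        also have "\<dots> = (\<Sum>k'\<in>?S1. if k' = k then (\<Sum>h\<in>?S2. u k' h) else 0)"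
          by (intro sum.cong refl) auto
        also have "\<dots> = (\<Sum>h\<in>?S2. u k h)" using k fin by simp
        finally show ?thesis by simp
      qed
      show "(\<Sum>k\<in>?S1. u k h) = p2 h" if h: "h \<in> ?S2" for h
      proof -
        have "p2 h = (\<Sum>L\<in>models ?U {..<V}. \<xi> L * of_bool (reduct Inr L = h))"
          unfolding marg2[OF h] using finite_models[OF finU, of "{..<V}"] by (intro sum.mono_neutral_cong_left) auto
        also have "\<dots> = (\<Sum>k\<in>?S1. \<Sum>h'\<in>?S2. u k h' * of_bool (h' = h))"
          unfolding u_def sum_models_join[of "\<lambda>L. \<xi> L * of_bool (reduct Inr L = h)" T2 "{..<V}" T1, symmetric]
          by (intro sum.cong refl) (simp add: verts_models)
        also have "\<dots> = (\<Sum>k\<in>?S1. \<Sum>h'\<in>?S2. if h' = h then u k h' else 0)"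
          by (intro sum.cong refl) auto
        also have "\<dots> = (\<Sum>k\<in>?S1. u k h)" using h fin by simp
        finally show ?thesis by simp
      qed
      show "(\<Sum>h\<in>?S2. p2 h) = 1" by (rule consistent_lawD(2)[OF c2])
      show "0 \<le> v h g" for h g by (simp add: v_def)
      show "(\<Sum>g\<in>?G. v h g) = p2 h" if h: "h \<in> ?S2" for h
      proof -
        have "(\<Sum>g\<in>?G. v h g) = measure ?M2 {\<theta> \<in> {\<theta> \<in> space ?M2. H \<theta> = h}. q \<theta> \<in> ?G}"
          unfolding v_def by (rule M2.prob_sum_fibers[OF finG Hs qsets])
        also have "{\<theta> \<in> {\<theta> \<in> space ?M2. H \<theta> = h}. q \<theta> \<in> ?G} = {\<theta> \<in> space ?M2. H \<theta> = h}" by auto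
        finally show ?thesis using law2[OF inj_on_id h] by (simp add: H_def)
      qed
      show "F a k \<in> {0..1}" for a k by (simp add: F_def)
      show "p1 ?K0 \<in> {0..1}" using consistent_lawD(1)[OF c1 K0] consistent_law_le_1[OF T(1) c1 K0] by simp
      show "g a \<in> {0..1}" if "g \<in> ?G" "a \<in> ?A" for g a using that by (auto simp: q_def)
      \<comment> \<open>Sample and pattern disagree only if the variables fall into
        \<open>sym_diff E E'\<close>. Its probability is the same for every \<open>a\<close>, since
        \<open>r a\<close> always has the product law.\<close>
      show "(\<Sum>h\<in>?S2. \<Sum>g\<in>?G. v h g * \<bar>Q a h - g a\<bar>) \<le> \<epsilon>" if a: "a \<in> ?A" for a
      proof -
        let ?Z = "{hg \<in> ?S2 \<times> ?G. Q a (fst hg) \<noteq> snd hg a}"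
        let ?ev = "\<lambda>hg. {\<theta> \<in> {\<theta> \<in> space ?M2. H \<theta> = fst hg}. q \<theta> = snd hg}"
        have sd: "sym_diff E E' \<in> sets (\<Pi>\<^sub>M A\<in>?le. \<Omega>2)" using E E' by auto
        have evs: "?ev hg \<in> sets ?M2" if "hg \<in> ?Z" for hg
        proof -
          have "?ev hg = {\<theta> \<in> space ?M2. H \<theta> = fst hg} \<inter> {\<theta> \<in> space ?M2. q \<theta> = snd hg}" by auto
          then show ?thesis using Hs qsets that by auto
        qed
        have "(\<Sum>h\<in>?S2. \<Sum>g\<in>?G. v h g * \<bar>Q a h - g a\<bar>) = (\<Sum>hg\<in>?S2 \<times> ?G. v (fst hg) (snd hg) * \<bar>Q a (fst hg) - snd hg a\<bar>)"
          by (simp add: sum.cartesian_product case_prod_unfold)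
        also have "\<dots> = (\<Sum>hg\<in>?Z. measure ?M2 (?ev hg))"
          using fin finG a by (intro sum.mono_neutral_cong_right) (auto simp: v_def Q_def q_def)
        also have "\<dots> = measure ?M2 (\<Union>hg\<in>?Z. ?ev hg)"
        proof (rule M2.finite_measure_finite_Union[symmetric])
          show "finite ?Z" using fin finG by auto
          show "?ev ` ?Z \<subseteq> sets ?M2" using evs by blast
          show "disjoint_family_on ?ev ?Z" by (auto simp: disjoint_family_on_def)
        qed
        also have "\<dots> \<le> measure ?M2 (r a -` sym_diff E E' \<inter> space ?M2)"
        proof (rule M2.finite_measure_mono)
          show "(\<Union>hg\<in>?Z. ?ev hg) \<subseteq> r a -` sym_diff E E' \<inter> space ?M2"
          proof
            fix \<theta> assume "\<theta> \<in> (\<Union>hg\<in>?Z. ?ev hg)"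
            then have \<theta>: "\<theta> \<in> space ?M2" and ne: "Q a (H \<theta>) \<noteq> q \<theta> a" by auto
            have re: "reindex m (?x a) \<theta> \<in> space ?Mm" by (rule measurable_space[OF measurable_reindex \<theta>]) simp
            have "Q a (H \<theta>) = of_bool (r a \<theta> \<in> E)"
              using Eiff[OF re] re unfolding Q_def H_def comp[OF a] pullback_theon_struct[OF inj_mapsD(3)[OF x[OF a]]] r_def
              by simp
            with ne a have "(r a \<theta> \<in> E) \<noteq> (r a \<theta> \<in> E')"
              by (cases "r a \<theta> \<in> E"; cases "r a \<theta> \<in> E'") (simp_all add: q_def)
            with \<theta> show "\<theta> \<in> r a -` sym_diff E E' \<inter> space ?M2" by auto
          qed
          show "r a -` sym_diff E E' \<inter> space ?M2 \<in> sets ?M2" by (rule measurable_sets[OF rm sd])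
        qed
        also have "\<dots> = measure (distr ?M2 (\<Pi>\<^sub>M A\<in>?le. \<Omega>2) (r a)) (sym_diff E E')"
          by (rule measure_distr[OF rm sd, symmetric])
        also have "\<dots> \<le> \<epsilon>" unfolding rdistr[OF a] using small by simp
        finally show ?thesis .
      qed
      show "(\<Sum>k\<in>?S1. \<Sum>h\<in>?S2. u k h * (F a k * Q a h)) = \<xi> L" if a: "a \<in> ?A" for a
      proof -
        have iff: "(X = Y) = (reduct Inl X = reduct Inl Y \<and> reduct Inr X = reduct Inr Y)" for X Y :: "('p + 'q, nat) fo_struct"
          by (metis join_reduct)
        have "(\<Sum>k\<in>?S1. \<Sum>h\<in>?S2. u k h * (F a k * Q a h)) = 
            (\<Sum>k\<in>?S1. \<Sum>h\<in>?S2. (\<lambda>L'. \<xi> L' * (F a (reduct Inl L') * Q a (reduct Inr L'))) (join k h))"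
          by (intro sum.cong refl) (simp add: u_def verts_models)
        also have "\<dots> = (\<Sum>L'\<in>models ?U {..<V}. \<xi> L' * (F a (reduct Inl L') * Q a (reduct Inr L')))"
          by (rule sum_models_join)
        also have "\<dots> = (\<Sum>L' | L' \<in> models ?U {..<V} \<and> pullback m (?x a) L' = L. \<xi> L')"
          using finite_models[OF finU, of "{..<V}"]
          by (intro sum.mono_neutral_cong_right) (auto simp: F_def Q_def iff[of "pullback _ _ _"] reduct_pullback)
        also have "\<dots> = \<xi> L" by (rule consistent_lawD(3)[OF \<xi> x[OF a] L])
        finally show ?thesis .
      qed
      show "(\<Sum>h\<in>?S2. p2 h * Q a h) = p2 ?H0" if a: "a \<in> ?A" for a
      proof -
        have "(\<Sum>h\<in>?S2. p2 h * Q a h) = (\<Sum>h | h \<in> ?S2 \<and> pullback m (?x a) h = ?H0. p2 h)"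
          using fin by (intro sum.mono_neutral_cong_right) (auto simp: Q_def)
        also have "\<dots> = p2 ?H0" by (rule consistent_lawD(3)[OF c2 x[OF a] H0])
        finally show ?thesis .
      qed
      show "(\<Sum>k | k \<in> ?S1 \<and> \<epsilon> * card ?A \<le> \<bar>\<Sum>a\<in>?A. (F a k - p1 ?K0) * g a\<bar>. p1 k) 
          \<le> 2 * exp (- 2 * \<epsilon>\<^sup>2 * real (n ^ Suc l))" if g: "g \<in> ?G" for g
      proof -
        let ?bad = "{k. k \<in> ?S1 \<and> \<epsilon> * card ?A \<le> \<bar>\<Sum>a\<in>?A. (F a k - p1 ?K0) * g a\<bar>}"
        let ?B = "{\<theta> \<in> space ?M1. \<bar>\<Sum>a\<in>?A. (of_bool (pullback m (?x a) (theon_struct T1 \<N>1 \<theta>) = ?K0) - p1 ?K0) * g a\<bar>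
           \<ge> \<epsilon> * n ^ Suc l}"
        have "(\<Sum>k\<in>?bad. p1 k) = (\<Sum>k\<in>?bad. measure ?M1 {\<theta> \<in> space ?M1. K \<theta> = k})"
          using law1[OF inj_on_id] by (intro sum.cong refl) (simp add: K_def)
        also have "\<dots> = measure ?M1 (\<Union>k\<in>?bad. {\<theta> \<in> space ?M1. K \<theta> = k})"
        proof (rule M1.finite_measure_finite_Union[symmetric])
          show "finite ?bad" using fin by simp
          show "(\<lambda>k. {\<theta> \<in> space ?M1. K \<theta> = k}) ` ?bad \<subseteq> sets ?M1" using Ks by blast
          show "disjoint_family_on (\<lambda>k. {\<theta> \<in> space ?M1. K \<theta> = k}) ?bad" by (auto simp: disjoint_family_on_def)
        qed
        also have "\<dots> \<le> measure ?M1 ?B"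
        proof (rule M1.finite_measure_mono)
          have "(\<lambda>\<theta>. of_bool (pullback m (?x a) (theon_struct T1 \<N>1 \<theta>) = ?K0) :: real) \<in> borel_measurable ?M1" if a: "a \<in> ?A" for a
          proof -
            let ?W = "{\<theta> \<in> space ?M1. pullback m (?x a) (theon_struct T1 \<N>1 \<theta>) = ?K0}"
            have "?W \<in> sets ?M1" by (rule prob_theon_struct_pullback(1)[OF \<Omega>(1) T(1) N1 inj_mapsD(3)[OF x[OF a]]])
            then have "(indicator ?W :: _ \<Rightarrow> real) \<in> borel_measurable ?M1" by simp
            then show ?thesis by (rule measurable_cong[THEN iffD1, rotated]) (simp add: indicator_def)
          qed
          then have "(\<lambda>\<theta>. \<bar>\<Sum>a\<in>?A. (of_bool (pullback m (?x a) (theon_struct T1 \<N>1 \<theta>) = ?K0) - p1 ?K0) * g a\<bar>) \<in> borel_measurable ?M1"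
            by (intro borel_measurable_abs borel_measurable_sum borel_measurable_times borel_measurable_diff) auto
          then show "?B \<in> sets ?M1" by measurable
          show "(\<Union>k\<in>?bad. {\<theta> \<in> space ?M1. K \<theta> = k}) \<subseteq> ?B"
            by (auto simp: F_def K_def comp card_packing_index cong: sum.cong)
        qed
        also have "\<dots> \<le> 2 * exp (- 2 * \<epsilon>\<^sup>2 * real (n ^ Suc l))"
        proof -
          have g01: "g a \<in> {0..1}" if "a \<in> ?A" for a using g that by (auto simp: q_def)
          have law: "measure ?M1 {\<theta> \<in> space ?M1. pullback m z (theon_struct T1 \<N>1 \<theta>) = ?K0} = p1 ?K0"
            if "z \<in> inj_maps m {..<m * packing_width l m n}" for z
            by (rule law1[OF inj_mapsD(3)[OF that] K0])
          show ?thesis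
            using packing_concentration[OF \<Omega>(1) T(1) N1 cyl1 law n g01 less_imp_le[OF \<epsilon>]]
            unfolding of_nat_power .
        qed
        finally show ?thesis .
      qed
    qed (use \<epsilon> in auto)
    also have "card ?G * (2 * exp (- 2 * \<epsilon>\<^sup>2 * real (n ^ Suc l))) \<le> 
        2 ^ (card \<D> * (n * C) ^ l) * (2 * exp (- 2 * \<epsilon>\<^sup>2 * real (n ^ Suc l)))"
      by (intro mult_right_mono cardG) auto
    also note small_n
    finally show ?thesis by simp
  qed
  from this[of "e / 4" for e] have "\<bar>\<xi> L - p1 ?K0 * p2 ?H0\<bar> \<le> e" if "e > 0" for e using that by force
  then have "\<bar>\<xi> L - p1 ?K0 * p2 ?H0\<bar> \<le> 0" by (rule field_le_epsilon[of _ 0, simplified])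
  then show ?thesis by simp
qed

section \<open>Rank and independence of peons as cylinder conditions\<close>

lemma peon_rank_le_cylinder:
  assumes "peon_rank_le \<Omega> k N r" "r \<le> l"
  shows "cylinder_over {A \<in> fin_subsets {..<k}. card A \<le> l} (fin_subsets {..<k}) \<Omega> N"
  unfolding cylinder_over_def
proof (intro ballI impI)
  fix x y assume xy: "x \<in> space (\<Pi>\<^sub>M A\<in>fin_subsets {..<k}. \<Omega>)" "y \<in> space (\<Pi>\<^sub>M A\<in>fin_subsets {..<k}. \<Omega>)"
    and eq: "restrict x {A \<in> fin_subsets {..<k}. card A \<le> l} = restrict y {A \<in> fin_subsets {..<k}. card A \<le> l}"
    and "x \<in> N"
  have "x A = y A" if "A \<in> fin_subsets_le {..<k} r" for A
    using fun_cong[OF eq, of A] that \<open>r \<le> l\<close> by (simp add: fin_subsets_le_def)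
  then have "restrict x (fin_subsets_le {..<k} r) = restrict y (fin_subsets_le {..<k} r)" by (auto simp: fun_eq_iff)
  moreover obtain H where "N = {x \<in> fin_subsets {..<k} \<rightarrow>\<^sub>E space \<Omega>. restrict x (fin_subsets_le {..<k} r) \<in> H}"
    using assms(1) by (auto simp: peon_rank_le_def)
  ultimately show "y \<in> N" using xy \<open>x \<in> N\<close> by (simp add: space_PiM)
qed

lemma peon_independent_cylinder:
  assumes "peon_independent \<Omega> k N l"
  shows "cylinder_over {A \<in> fin_subsets {..<k}. card A > l} (fin_subsets {..<k}) \<Omega> N"
  using assms unfolding cylinder_over_def peon_independent_def fin_subsets_gt_def by (auto simp: space_PiM)

text \<open>The rank of a peon is at most its arity, so the \<open>LEAST\<close> in
  \<open>peon_rank\<close> is attained.\<close>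

lemma peon_rank_le_self:
  assumes "N \<in> sets (E_space \<Omega> {..<k})"
  shows "peon_rank_le \<Omega> k N k"
proof -
  have le: "fin_subsets_le {..<k} k = fin_subsets {..<k}"
    using card_mono[of "{..<k}"] by (fastforce simp: fin_subsets_le_def fin_subsets_def)
  have sub: "N \<subseteq> fin_subsets {..<k} \<rightarrow>\<^sub>E space \<Omega>"
    using sets.sets_into_space[OF assms] by (simp add: E_space_def space_PiM)
  then have "N = {x \<in> fin_subsets {..<k} \<rightarrow>\<^sub>E space \<Omega>. restrict x (fin_subsets {..<k}) \<in> N}"
    by (auto simp: PiE_restrict)
  with sub show ?thesis unfolding peon_rank_le_def le by blast
qed

lemma enat_Inf_in: "Inf S \<noteq> \<infinity> \<Longrightarrow> Inf S \<in> S" for S :: "enat set"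
  unfolding Inf_enat_def using LeastI_ex[of "\<lambda>x. x \<in> S"] by (auto split: if_splits)

lemma limit_rank_leD:
  fixes \<psi> :: "'q iso_class \<Rightarrow> real"
  assumes "limit_rank TYPE('y) T \<psi> \<le> enat l"
  obtains \<Omega> :: "'y measure" and \<N> where "is_theon T \<Omega> \<N>" "theon_limit T \<Omega> \<N> = \<psi>"
    "\<And>P. P \<in> symbols T \<Longrightarrow>
      cylinder_over {A \<in> fin_subsets {..<arity T P}. card A \<le> l} (fin_subsets {..<arity T P}) \<Omega> (\<N> P)"
proof -
  let ?S = "{theon_rank T \<Omega> \<N> | (\<Omega> :: 'y measure) \<N>. is_theon T \<Omega> \<N> \<and> theon_limit T \<Omega> \<N> = \<psi>}"
  have "Inf ?S \<noteq> \<infinity>" using assms unfolding limit_rank_def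
    by (metis enat.distinct(1) enat_ord_simps(5))
  then have "Inf ?S \<in> ?S" by (rule enat_Inf_in)
  then obtain \<Omega> :: "'y measure" and \<N> where th: "is_theon T \<Omega> \<N>" "theon_limit T \<Omega> \<N> = \<psi>"
    and rk: "Inf ?S = theon_rank T \<Omega> \<N>" by blast
  have "cylinder_over {A \<in> fin_subsets {..<arity T P}. card A \<le> l} (fin_subsets {..<arity T P}) \<Omega> (\<N> P)"
    if P: "P \<in> symbols T" for P
  proof -
    have "enat (peon_rank \<Omega> (arity T P) (\<N> P)) \<le> theon_rank T \<Omega> \<N>"
      unfolding theon_rank_def by (rule SUP_upper[OF P])
    also have "\<dots> \<le> enat l" using assms rk by (simp add: limit_rank_def)
    finally have "peon_rank \<Omega> (arity T P) (\<N> P) \<le> l" by simp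
    moreover have "\<N> P \<in> sets (E_space \<Omega> {..<arity T P})" using th(1) P by (simp add: is_theon_def)
    then have "peon_rank_le \<Omega> (arity T P) (\<N> P) (peon_rank \<Omega> (arity T P) (\<N> P))"
      unfolding peon_rank_def by (rule LeastI[OF peon_rank_le_self])
    ultimately show ?thesis by (intro peon_rank_le_cylinder)
  qed
  with th show thesis by (rule that)
qed

text \<open>Peons are measurable for the completed product, while Fubini and independence are
  applied to the product itself. Passing to Borel versions keeps both the cylinder property and the
  law of every sample.\<close>

lemma theon_Borel_version:
  fixes \<Omega> :: "'x measure" and c :: "nat \<Rightarrow> bool"
  assumes T: "finite (symbols T)" and th: "is_theon T \<Omega> \<N>"
    and cyl: "\<And>P. P \<in> symbols T \<Longrightarrow>
      cylinder_over {A \<in> fin_subsets {..<arity T P}. c (card A)} (fin_subsets {..<arity T P}) \<Omega> (\<N> P)"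
  obtains \<N>' where "\<And>P. P \<in> symbols T \<Longrightarrow> \<N>' P \<in> sets (\<Pi>\<^sub>M A\<in>fin_subsets {..<arity T P}. \<Omega>)"
    "\<And>P. P \<in> symbols T \<Longrightarrow>
      cylinder_over {A \<in> fin_subsets {..<arity T P}. c (card A)} (fin_subsets {..<arity T P}) \<Omega> (\<N>' P)"
    "\<And>m x K. inj_on x {..<m} \<Longrightarrow> K \<in> models T {..<m} \<Longrightarrow>
      measure (\<Pi>\<^sub>M A\<in>fin_subsets UNIV. \<Omega>) {\<theta> \<in> space (\<Pi>\<^sub>M A\<in>fin_subsets UNIV. \<Omega>). 
        pullback m x (theon_struct T \<N>' \<theta>) = K} = labelled (theon_limit T \<Omega> \<N>) K"
proof -
  have \<Omega>: "prob_space \<Omega>" using th by (simp add: is_theon_def atomless_complete_prob_space_def)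
  define good where "good P N' \<longleftrightarrow> N' \<in> sets (\<Pi>\<^sub>M A\<in>fin_subsets {..<arity T P}. \<Omega>) \<and>
    cylinder_over {A \<in> fin_subsets {..<arity T P}. c (card A)} (fin_subsets {..<arity T P}) \<Omega> N' \<and>
    (AE x in \<Pi>\<^sub>M A\<in>fin_subsets {..<arity T P}. \<Omega>. x \<in> \<N> P \<longleftrightarrow> x \<in> N')" for P N'
  have "\<exists>N'. good P N'" if P: "P \<in> symbols T" for P
  proof -
    have N: "\<N> P \<in> sets (completion (\<Pi>\<^sub>M A\<in>fin_subsets {..<arity T P}. \<Omega>))"
      using th P by (simp add: is_theon_def E_space_def)
    show ?thesis
      by (rule completion_cylinder[OF \<Omega> _ _ N cyl[OF P]]) (auto simp: good_def)
  qed
  then obtain \<N>' where N': "\<And>P. P \<in> symbols T \<Longrightarrow> good P (\<N>' P)" by metis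
  show thesis
  proof (rule that)
    show "\<N>' P \<in> sets (\<Pi>\<^sub>M A\<in>fin_subsets {..<arity T P}. \<Omega>)" if "P \<in> symbols T" for P
      using N'[OF that] by (simp add: good_def)
    show "cylinder_over {A \<in> fin_subsets {..<arity T P}. c (card A)} (fin_subsets {..<arity T P}) \<Omega> (\<N>' P)"
      if "P \<in> symbols T" for P using N'[OF that] by (simp add: good_def)
    show "measure (\<Pi>\<^sub>M A\<in>fin_subsets UNIV. \<Omega>) {\<theta> \<in> space (\<Pi>\<^sub>M A\<in>fin_subsets UNIV. \<Omega>). 
        pullback m x (theon_struct T \<N>' \<theta>) = K} = labelled (theon_limit T \<Omega> \<N>) K"
      if "inj_on x {..<m}" "K \<in> models T {..<m}" for m x K
      by (rule theon_law[OF T th _ _ that]) (use N' in \<open>simp_all add: good_def\<close>)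
  qed
qed

lemma canonical_theory_finite_symbols: "canonical_theory T \<Longrightarrow> finite (symbols T)"
  by (simp add: canonical_theory_def)

text \<open>The types \<open>'x\<close> and \<open>'y\<close> are unrelated, because the argument
  never places the two theons on a common space.\<close>

theorem Independence_imp_UCouple:
  fixes T :: "'p univ_theory"
  assumes T: "canonical_theory T" and \<phi>: "\<phi> \<in> Hom_plus T" and ind: "Independence TYPE('x) l T \<phi>"
  shows "UCouple TYPE('y) l T \<phi>"
  unfolding UCouple_def
proof (intro allI impI)
  fix T' :: "nat univ_theory" and \<psi>
  assume T': "canonical_theory T'" and \<psi>: "\<psi> \<in> Hom_plus T'" and rk: "limit_rank TYPE('y) T' \<psi> \<le> enat l"
  note fin = canonical_theory_finite_symbols[OF T] canonical_theory_finite_symbols[OF T']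
  obtain \<Omega>1 :: "'x measure" and \<N>1 where th1: "is_theon T \<Omega>1 \<N>1" "theon_limit T \<Omega>1 \<N>1 = \<phi>"
    and pi: "\<And>P. P \<in> symbols T \<Longrightarrow> peon_independent \<Omega>1 (arity T P) (\<N>1 P) l"
    using ind unfolding Independence_def by blast
  obtain \<N>1' where N1: "\<And>P. P \<in> symbols T \<Longrightarrow> \<N>1' P \<in> sets (\<Pi>\<^sub>M A\<in>fin_subsets {..<arity T P}. \<Omega>1)"
    and cyl1: "\<And>P. P \<in> symbols T \<Longrightarrow>
      cylinder_over {A \<in> fin_subsets {..<arity T P}. card A > l} (fin_subsets {..<arity T P}) \<Omega>1 (\<N>1' P)"
    and law1: "\<And>m x K. inj_on x {..<m} \<Longrightarrow> K \<in> models T {..<m} \<Longrightarrow>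
      measure (\<Pi>\<^sub>M A\<in>fin_subsets UNIV. \<Omega>1) {\<theta> \<in> space (\<Pi>\<^sub>M A\<in>fin_subsets UNIV. \<Omega>1). 
        pullback m x (theon_struct T \<N>1' \<theta>) = K} = labelled \<phi> K"
    by (rule theon_Borel_version[OF fin(1) th1(1), of "\<lambda>k. k > l", OF peon_independent_cylinder[OF pi]])
      (auto simp: th1(2) intro: that)
  obtain \<Omega>2 :: "'y measure" and \<N>2 where th2: "is_theon T' \<Omega>2 \<N>2" "theon_limit T' \<Omega>2 \<N>2 = \<psi>"
    and r: "\<And>P. P \<in> symbols T' \<Longrightarrow>
      cylinder_over {A \<in> fin_subsets {..<arity T' P}. card A \<le> l} (fin_subsets {..<arity T' P}) \<Omega>2 (\<N>2 P)"
    by (rule limit_rank_leD[OF rk]) (rule that)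
  obtain \<N>2' where N2: "\<And>P. P \<in> symbols T' \<Longrightarrow> \<N>2' P \<in> sets (\<Pi>\<^sub>M A\<in>fin_subsets {..<arity T' P}. \<Omega>2)"
    and cyl2: "\<And>P. P \<in> symbols T' \<Longrightarrow>
      cylinder_over {A \<in> fin_subsets {..<arity T' P}. card A \<le> l} (fin_subsets {..<arity T' P}) \<Omega>2 (\<N>2' P)"
    and law2: "\<And>m x K. inj_on x {..<m} \<Longrightarrow> K \<in> models T' {..<m} \<Longrightarrow>
      measure (\<Pi>\<^sub>M A\<in>fin_subsets UNIV. \<Omega>2) {\<theta> \<in> space (\<Pi>\<^sub>M A\<in>fin_subsets UNIV. \<Omega>2). 
        pullback m x (theon_struct T' \<N>2' \<theta>) = K} = labelled \<psi> K"
    by (rule theon_Borel_version[OF fin(2) th2(1), of "\<lambda>k. k \<le> l", OF r])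
      (auto simp: th2(2) intro: that)
  have \<Omega>: "prob_space \<Omega>1" "prob_space \<Omega>2"
    using th1(1) th2(1) by (simp_all add: is_theon_def atomless_complete_prob_space_def)
  have "\<xi> = indep_coupling T T' \<phi> \<psi>" if \<xi>: "is_coupling T T' \<phi> \<psi> \<xi>" for \<xi>
  proof (rule coupling_eq_indep_couplingI[OF \<xi>])
    fix m :: nat and L assume L: "L \<in> models (disjoint_union T T') {..<m}"
    have c: "consistent_law (disjoint_union T T') (labelled \<xi>)"
      using Hom_plus_laws(1)[OF finite_symbols_disjoint_union[OF fin]] \<xi> by (simp add: is_coupling_def)
    show "labelled \<xi> L = labelled \<phi> (reduct Inl L) * labelled \<psi> (reduct Inr L)"
      by (rule independent_low_rank_coupling[OF \<Omega> fin N1 N2 cyl1 cyl2 law1 law2 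
            Hom_plus_laws(1)[OF fin(1) \<phi>] Hom_plus_laws(1)[OF fin(2) \<psi>] c
            coupling_marginals(1)[OF fin \<xi>] coupling_marginals(2)[OF fin \<xi>] L])
  qed
  moreover have "is_coupling T T' \<phi> \<psi> (indep_coupling T T' \<phi> \<psi>)"
    by (rule indep_coupling_is_coupling[OF fin \<phi> \<psi>])
  ultimately show "uniquely_coupleable T T' \<phi> \<psi>" unfolding uniquely_coupleable_def by blast
qed

section \<open>Uniform random variables and coding\<close>

locale atomless_prob_space = prob_space +
  assumes atomless: "A \<in> events \<Longrightarrow> prob A > 0 \<Longrightarrow> \<exists>B\<in>events. B \<subseteq> A \<and> 0 < prob B \<and> prob B < prob A"
begin

text \<open>Splitting repeatedly and keeping the smaller of two pieces of positive measure at least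
  halves the measure each time.\<close>

lemma small_subset:
  assumes A: "A \<in> events" "prob A > 0" and e: "e > 0"
  shows "\<exists>B\<in>events. B \<subseteq> A \<and> 0 < prob B \<and> prob B < e"
proof -
  have "\<exists>B\<in>events. B \<subseteq> A \<and> 0 < prob B \<and> prob B \<le> prob A / 2 ^ n" for n
  proof (induction n)
    case 0
    then show ?case using A by auto
  next
    case (Suc n)
    then obtain B where B: "B \<in> events" "B \<subseteq> A" "0 < prob B" "prob B \<le> prob A / 2 ^ n" by blast
    obtain C where C: "C \<in> events" "C \<subseteq> B" "0 < prob C" "prob C < prob B" using atomless[OF B(1,3)] by blast
    have D: "prob (B - C) = prob B - prob C" by (rule finite_measure_Diff[OF B(1) C(1,2)])
    show ?case
    proof (cases "prob C \<le> prob B / 2")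
      case True
      then show ?thesis using B C by (intro bexI[of _ C]) auto
    next
      case False
      then show ?thesis using B C D by (intro bexI[of _ "B - C"]) auto
    qed
  qed
  moreover obtain n where "prob A / 2 ^ n < e"
  proof -
    obtain n where "(1 / 2 :: real) ^ n < e" using real_arch_pow_inv[OF e, of "1/2"] by auto
    moreover have "prob A / 2 ^ n \<le> 1 / 2 ^ n" by (intro divide_right_mono) auto
    ultimately show thesis by (intro that[of n]) (simp add: power_one_over)
  qed
  ultimately show ?thesis by (meson le_less_trans)
qed

text \<open>Sierpinski's theorem on the range of an atomless measure. The set grows greedily: each
  step adds a piece of at least half the supremum of what still fits below \<open>t\<close>. If the
  union fell short of \<open>t\<close>, some fixed set of positive measure outside it would have
  been available in every step, although the increments tend to zero.\<close>

lemma subset_of_measure: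
  assumes A: "A \<in> events" and t: "0 \<le> t" "t \<le> prob A"
  shows "\<exists>B\<in>events. B \<subseteq> A \<and> prob B = t"
proof -
  define cand where "cand B C \<longleftrightarrow> C \<in> events \<and> C \<subseteq> A - B \<and> prob B + prob C \<le> t" for B C
  define s where "s B = Sup (prob ` {C. cand B C})" for B
  have bdd: "bdd_above (prob ` {C. cand B C})" for B by (rule bdd_aboveI[of _ 1]) auto
  have step: "\<exists>C. cand B C \<and> s B \<le> 2 * prob C" if "prob B \<le> t" for B
  proof (cases "s B \<le> 0")
    case True
    then show ?thesis using that by (intro exI[of _ "{}"]) (simp add: cand_def)
  next
    case False
    have "prob ` {C. cand B C} \<noteq> {}" using that by (auto simp: cand_def intro!: exI[of _ "{}"])
    moreover have "s B / 2 < s B" using False by simp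
    ultimately obtain C where "cand B C" "s B / 2 < prob C"
      using less_cSupD[of "prob ` {C. cand B C}" "s B / 2"] unfolding s_def[of B, symmetric] by blast
    then show ?thesis by (intro exI[of _ C]) auto
  qed
  define ok where "ok B \<longleftrightarrow> B \<in> events \<and> B \<subseteq> A \<and> prob B \<le> t" for B
  have "\<exists>B'. ok B' \<and> B \<subseteq> B' \<and> s B \<le> 2 * (prob B' - prob B)" if B: "ok B" for B
  proof -
    obtain C where C: "cand B C" "s B \<le> 2 * prob C" using step B by (auto simp: ok_def)
    have "prob (B \<union> C) = prob B + prob C"
      using B C by (intro finite_measure_Union) (auto simp: ok_def cand_def)
    then show ?thesis using B C by (intro exI[of _ "B \<union> C"]) (auto simp: ok_def cand_def)
  qed
  moreover have "\<exists>B. ok B" using t by (intro exI[of _ "{}"]) (simp add: ok_def)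
  ultimately obtain B where B: "\<And>n. ok (B n)" "\<And>n. B n \<subseteq> B (Suc n) \<and> s (B n) \<le> 2 * (prob (B (Suc n)) - prob (B n))"
    using dependent_nat_choice[of "\<lambda>_. ok" "\<lambda>_ B B'. B \<subseteq> B' \<and> s B \<le> 2 * (prob B' - prob B)"] by metis
  let ?B = "\<Union>n. B n"
  have inc: "incseq B" using B(2) by (intro incseq_SucI) auto
  have ev: "B n \<in> events" "B n \<subseteq> A" "prob (B n) \<le> t" for n using B(1)[of n] by (auto simp: ok_def)
  have lim: "(\<lambda>n. prob (B n)) \<longlonglongrightarrow> prob ?B"
    by (rule finite_Lim_measure_incseq) (use ev inc in auto)
  have UB: "?B \<in> events" "?B \<subseteq> A" using ev by auto
  have le: "prob ?B \<le> t" using ev(3) by (intro LIMSEQ_le_const2[OF lim]) auto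
  have "prob ?B = t"
  proof (rule ccontr)
    assume "prob ?B \<noteq> t"
    with le have lt: "prob ?B < t" by simp
    have "prob (A - ?B) = prob A - prob ?B" by (rule finite_measure_Diff[OF A UB])
    then have "prob (A - ?B) > 0" using lt t by simp
    then obtain C where C: "C \<in> events" "C \<subseteq> A - ?B" "0 < prob C" "prob C < t - prob ?B"
      using small_subset[of "A - ?B" "t - prob ?B"] A UB lt by auto
    have "prob C \<le> s (B n)" for n
    proof -
      have "prob (B n) \<le> prob ?B" using UB by (intro finite_measure_mono) auto
      then have "cand (B n) C" using C by (auto simp: cand_def)
      then show ?thesis unfolding s_def by (intro cSup_upper bdd) auto
    qed
    then have lo: "prob C \<le> 2 * (prob (B (Suc n)) - prob (B n))" for n using B(2)[of n] by (meson order_trans)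
    have lm: "(\<lambda>n. 2 * (prob (B (Suc n)) - prob (B n))) \<longlonglongrightarrow> 2 * (prob ?B - prob ?B)"
      by (intro tendsto_intros lim LIMSEQ_Suc[OF lim])
    have "prob C \<le> 2 * (prob ?B - prob ?B)" by (rule LIMSEQ_le_const[OF lm]) (use lo in blast)
    then show False using C by simp
  qed
  with UB show ?thesis by blast
qed

lemma dyadic_partition:
  obtains E :: "nat \<Rightarrow> nat \<Rightarrow> 'a set"
  where "\<And>n j. E n j \<in> events" "\<And>n j. j < 2 ^ n \<Longrightarrow> prob (E n j) = 1 / 2 ^ n"
    "\<And>n x. x \<in> space M \<Longrightarrow> \<exists>!j. j < 2 ^ n \<and> x \<in> E n j" "\<And>n j. E (Suc n) j \<subseteq> E n (j div 2)"
proof -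
  have "\<exists>B. A \<in> events \<longrightarrow> B \<in> events \<and> B \<subseteq> A \<and> prob B = prob A / 2" for A
    using subset_of_measure[of A "prob A / 2"] by auto
  then obtain h where h: "\<And>A. A \<in> events \<Longrightarrow> h A \<in> events \<and> h A \<subseteq> A \<and> prob (h A) = prob A / 2" by metis
  define E where "E = rec_nat (\<lambda>j :: nat. if j = 0 then space M else {}) 
      (\<lambda>n E j. if even j then h (E (j div 2)) else E (j div 2) - h (E (j div 2)))"
  have E0: "E 0 j = (if j = 0 then space M else {})" for j by (simp add: E_def)
  have ES: "E (Suc n) j = (if even j then h (E n (j div 2)) else E n (j div 2) - h (E n (j div 2)))" for n j
    by (simp add: E_def)
  have ev: "E n j \<in> events" for n j
    by (induction n arbitrary: j) (use h in \<open>auto simp: E0 ES\<close>)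
  have pr: "prob (E n j) = 1 / 2 ^ n" if "j < 2 ^ n" for n j
    using that
  proof (induction n arbitrary: j)
    case 0
    then show ?case by (simp add: E0 prob_space)
  next
    case (Suc n)
    then have "prob (E n (j div 2)) = 1 / 2 ^ n" by auto
    moreover have "prob (E n (j div 2) - h (E n (j div 2))) = prob (E n (j div 2)) - prob (h (E n (j div 2)))"
      using h[OF ev] by (intro finite_measure_Diff ev) auto
    ultimately show ?case using h[OF ev, of n "j div 2"] by (auto simp: ES)
  qed
  have un: "\<exists>!j. j < 2 ^ n \<and> x \<in> E n j" if x: "x \<in> space M" for n x
  proof (induction n)
    case 0
    then show ?case using x by (auto simp: E0)
  next
    case (Suc n)
    then obtain k where k: "k < 2 ^ n" "x \<in> E n k" and uk: "\<And>k'. k' < 2 ^ n \<Longrightarrow> x \<in> E n k' \<Longrightarrow> k' = k" by blast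
    have *: "j < 2 ^ Suc n \<and> x \<in> E (Suc n) j \<longleftrightarrow> j = (if x \<in> h (E n k) then 2 * k else 2 * k + 1)" for j
    proof
      assume j: "j < 2 ^ Suc n \<and> x \<in> E (Suc n) j"
      then have "x \<in> E n (j div 2)" using h[OF ev, of n "j div 2"] by (auto simp: ES split: if_splits)
      then have "j div 2 = k" using uk j by auto
      then show "j = (if x \<in> h (E n k) then 2 * k else 2 * k + 1)" using j by (auto simp: ES split: if_splits)
    next
      assume "j = (if x \<in> h (E n k) then 2 * k else 2 * k + 1)"
      then show "j < 2 ^ Suc n \<and> x \<in> E (Suc n) j" using k by (auto simp: ES)
    qed
    show ?case unfolding * by simp
  qed
  have nest: "E (Suc n) j \<subseteq> E n (j div 2)" for n j using h[OF ev, of n "j div 2"] by (auto simp: ES)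
  show thesis by (rule that[of E, OF ev pr un nest])
qed

text \<open>The number of the dyadic cell that contains a point, divided by \<open>2 ^ n\<close>,
  converges to a uniform variable.\<close>

lemma exists_uniform:
  obtains V :: "'a \<Rightarrow> real" where "V \<in> borel_measurable M" "\<And>x. x \<in> space M \<Longrightarrow> 0 \<le> V x \<and> V x < 1"
    "\<And>a b. 0 \<le> a \<Longrightarrow> a \<le> b \<Longrightarrow> b \<le> 1 \<Longrightarrow> prob {x \<in> space M. a \<le> V x \<and> V x < b} = b - a"
proof -
  obtain E :: "nat \<Rightarrow> nat \<Rightarrow> 'a set" where E: "\<And>n j. E n j \<in> events" "\<And>n j. j < 2 ^ n \<Longrightarrow> prob (E n j) = 1 / 2 ^ n"
    "\<And>n x. x \<in> space M \<Longrightarrow> \<exists>!j. j < 2 ^ n \<and> x \<in> E n j" "\<And>n j. E (Suc n) j \<subseteq> E n (j div 2)"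
    by (rule dyadic_partition) (rule that)
  define v where "v n x = (THE j. j < 2 ^ n \<and> x \<in> E n j)" for n x
  have v: "v n x < 2 ^ n" "x \<in> E n (v n x)" if "x \<in> space M" for n x
    using theI'[OF E(3)[OF that]] by (auto simp: v_def)
  have v_eq: "v n x = j" if "x \<in> space M" "j < 2 ^ n" "x \<in> E n j" for n x j
    unfolding v_def by (rule the1_equality[OF E(3)[OF that(1)]]) (use that in auto)
  have vS: "v (Suc n) x div 2 = v n x" if x: "x \<in> space M" for n x
    using v[OF x, of "Suc n"] E(4)[of n "v (Suc n) x"] by (intro v_eq[OF x, symmetric]) auto
  define w where "w n x = real (v n x) / 2 ^ n" for n x
  have w_mono: "w n x \<le> w (Suc n) x" "w (Suc n) x + 1 / 2 ^ Suc n \<le> w n x + 1 / 2 ^ n" if x: "x \<in> space M" for n x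
  proof -
    have "2 * v n x \<le> v (Suc n) x" "v (Suc n) x + 1 \<le> 2 * v n x + 2" using vS[OF x, of n] by auto
    then have "2 * real (v n x) \<le> real (v (Suc n) x)" "real (v (Suc n) x) + 1 \<le> 2 * real (v n x) + 2" by linarith+
    then have "2 * real (v n x) / 2 ^ Suc n \<le> real (v (Suc n) x) / 2 ^ Suc n"
      "(real (v (Suc n) x) + 1) / 2 ^ Suc n \<le> (2 * real (v n x) + 2) / 2 ^ Suc n"
      by (intro divide_right_mono; simp)+
    then show "w n x \<le> w (Suc n) x" "w (Suc n) x + 1 / 2 ^ Suc n \<le> w n x + 1 / 2 ^ n"
      by (simp_all add: w_def add_divide_distrib)
  qed
  define W where "W x = lim (\<lambda>n. w n x)" for x
  have W: "(\<lambda>n. w n x) \<longlonglongrightarrow> W x" "w n x \<le> W x" "W x \<le> w n x + 1 / 2 ^ n" if x: "x \<in> space M" for n x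
  proof -
    have inc: "incseq (\<lambda>n. w n x)" using w_mono(1)[OF x] by (rule incseq_SucI)
    have dec: "decseq (\<lambda>n. w n x + 1 / 2 ^ n)" using w_mono(2)[OF x] by (rule decseq_SucI)
    have "w n x \<le> 2" for n
    proof -
      have "w 0 x = 0" using v(1)[OF x, of 0] by (simp add: w_def)
      moreover have "(0::real) \<le> 1 / 2 ^ n" by simp
      moreover have "w n x + 1 / 2 ^ n \<le> w 0 x + 1" using decseqD[OF dec, of 0 n] by simp
      ultimately show ?thesis by linarith
    qed
    then obtain L where "(\<lambda>n. w n x) \<longlonglongrightarrow> L"
      using incseq_convergent[OF inc, of 2] by blast
    then have "convergent (\<lambda>n. w n x)" by (rule convergentI)
    then show l: "(\<lambda>n. w n x) \<longlonglongrightarrow> W x" unfolding W_def by (simp add: convergent_LIMSEQ_iff)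
    show "w n x \<le> W x" by (rule incseq_le[OF inc l])
    have "(\<lambda>n. w n x + (1 / 2) ^ n) \<longlonglongrightarrow> W x + 0"
      by (intro tendsto_intros l LIMSEQ_power_zero) auto
    then have "(\<lambda>n. w n x + 1 / 2 ^ n) \<longlonglongrightarrow> W x" by (simp add: power_one_over)
    from decseq_ge[OF dec this] show "W x \<le> w n x + 1 / 2 ^ n" .
  qed
  have w_eq: "w n x = (\<Sum>j<2 ^ n. indicator (E n j) x * (real j / 2 ^ n))" if x: "x \<in> space M" for n x
  proof -
    have "(\<Sum>j<2 ^ n. indicator (E n j) x * (real j / 2 ^ n)) = (\<Sum>j<2 ^ n. if j = v n x then real j / 2 ^ n else 0)"
    proof (rule sum.cong[OF refl])
      fix j :: nat assume "j \<in> {..<2 ^ n}"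
      then have "x \<in> E n j \<longleftrightarrow> j = v n x" using v(2)[OF x, of n] v_eq[OF x, of j n] by auto
      then show "indicator (E n j) x * (real j / 2 ^ n) = (if j = v n x then real j / 2 ^ n else 0)"
        by (cases "j = v n x") (simp_all add: indicator_def)
    qed
    then show ?thesis using v(1)[OF x, of n] by (simp add: w_def)
  qed
  have wm: "w n \<in> borel_measurable M" for n
    by (subst measurable_cong[OF w_eq]) (use E(1) in auto)
  have Wm: "W \<in> borel_measurable M" by (rule borel_measurable_LIMSEQ_real[OF W(1) wm])
  have cdf: "prob {x \<in> space M. W x < t} = t" if t: "0 \<le> t" "t \<le> 1" for t
  proof -
    let ?P = "prob {x \<in> space M. W x < t}"
    have cnt: "prob {x \<in> space M. v n x \<in> S} = card S / 2 ^ n" if "S \<subseteq> {..<2 ^ n}" for n S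
    proof -
      have finS: "finite S" using that by (rule finite_subset) simp
      have eq: "{x \<in> space M. v n x \<in> S} = (\<Union>j\<in>S. E n j)"
      proof (intro equalityI subsetI)
        fix x assume "x \<in> (\<Union>j\<in>S. E n j)"
        then obtain j where j: "j \<in> S" "x \<in> E n j" by blast
        then have "x \<in> space M" using sets.sets_into_space[OF E(1)] by blast
        then show "x \<in> {x \<in> space M. v n x \<in> S}" using v_eq[of x j n] j that by auto
      qed (use v(2) in auto)
      have "disjoint_family_on (E n) S"
        unfolding disjoint_family_on_def
      proof (intro ballI impI)
        fix i j assume "i \<in> S" "j \<in> S" "i \<noteq> j"
        then show "E n i \<inter> E n j = {}" using v_eq[of _ i n] v_eq[of _ j n] that sets.sets_into_space[OF E(1)[of n i]] by blast
      qed
      then have "prob (\<Union>j\<in>S. E n j) = (\<Sum>j\<in>S. prob (E n j))"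
        by (intro finite_measure_finite_Union finS) (use E(1) in auto)
      also have "\<dots> = (\<Sum>j\<in>S. 1 / 2 ^ n)" by (intro sum.cong refl E(2)) (use that in auto)
      finally show ?thesis by (simp add: eq)
    qed
    \<comment> \<open>Only cells below \<open>k\<close> can meet the event \<open>W x < t\<close>,
      and all cells below \<open>k - 2\<close> lie inside it. The difference of two cells takes care
      of rounding and of points on the border of a cell.\<close>
    have bound: "t - 2 / 2 ^ n \<le> ?P" "?P \<le> t + 1 / 2 ^ n" for n
    proof -
      have pos: "(0::real) < 2 ^ n" by simp
      define k where "k = nat \<lceil>t * 2 ^ n\<rceil>"
      have k: "real k \<ge> t * 2 ^ n" "real k < t * 2 ^ n + 1" using t by (simp_all add: k_def) linarith+
      have "t * 2 ^ n \<le> 1 * 2 ^ n" using t by (intro mult_right_mono) auto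
      then have k2: "k \<le> 2 ^ n" by (simp add: k_def nat_le_iff ceiling_le_iff)
      have "{x \<in> space M. W x < t} \<subseteq> {x \<in> space M. v n x \<in> {..<k}}"
      proof safe
        fix x assume x: "x \<in> space M" and "W x < t"
        then have "w n x < t" using W(2)[OF x, of n] by simp
        then have "real (v n x) < t * 2 ^ n" by (simp add: w_def pos_divide_less_eq)
        then show "v n x < k" using k by linarith
      qed
      then have "?P \<le> prob {x \<in> space M. v n x \<in> {..<k}}"
      proof (rule finite_measure_mono)
        have "{x \<in> space M. v n x \<in> {..<k}} = (\<Union>j<k. E n j)"
        proof (intro equalityI subsetI)
          fix x assume "x \<in> (\<Union>j<k. E n j)"
          then obtain j where j: "j < k" "x \<in> E n j" by blast
          then have "x \<in> space M" using sets.sets_into_space[OF E(1)] by blast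
          then show "x \<in> {x \<in> space M. v n x \<in> {..<k}}" using v_eq[of x j n] j k2 by auto
        qed (use v(2) in auto)
        then show "{x \<in> space M. v n x \<in> {..<k}} \<in> events" using E(1) by auto
      qed
      also have "\<dots> = k / 2 ^ n" using cnt[of "{..<k}" n] k2 by simp
      also have "\<dots> \<le> (t * 2 ^ n + 1) / 2 ^ n" using k by (intro divide_right_mono) auto
      finally show "?P \<le> t + 1 / 2 ^ n" by (simp add: add_divide_distrib)
      have "t - 2 / 2 ^ n \<le> real (k - 2) / 2 ^ n"
      proof -
        have "t * 2 ^ n - 2 \<le> real (k - 2)" using k by linarith
        then have "(t * 2 ^ n - 2) / 2 ^ n \<le> real (k - 2) / 2 ^ n" by (rule divide_right_mono) simp
        then show ?thesis by (simp add: diff_divide_distrib)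
      qed
      also have "\<dots> = prob {x \<in> space M. v n x \<in> {..<k - 2}}" using cnt[of "{..<k - 2}" n] k2 by simp
      also have "\<dots> \<le> ?P"
      proof (rule finite_measure_mono)
        show "{x \<in> space M. v n x \<in> {..<k - 2}} \<subseteq> {x \<in> space M. W x < t}"
        proof safe
          fix x assume x: "x \<in> space M" and "v n x < k - 2"
          then have "real (v n x) + 1 < t * 2 ^ n" using k by linarith
          then have "w n x + 1 / 2 ^ n < t" by (simp add: w_def pos_less_divide_eq flip: add_divide_distrib) (simp add: pos_divide_less_eq)
          then show "W x < t" using W(3)[OF x, of n] by simp
        qed
      qed (use Wm in measurable)
      finally show "t - 2 / 2 ^ n \<le> ?P" .
    qed
    have z: "(\<lambda>n. c / 2 ^ n) \<longlonglongrightarrow> 0" for c :: real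
      using tendsto_mult_right_zero[OF LIMSEQ_power_zero[of "1/2 :: real"], of c] by (simp add: power_one_over)
    have "t - 0 \<le> ?P" using bound(1) by (intro LIMSEQ_le_const2[OF tendsto_diff[OF tendsto_const z[of 2]]]) auto
    moreover have "?P \<le> t + 0" using bound(2) by (intro LIMSEQ_le_const[OF tendsto_add[OF tendsto_const z[of 1]]]) auto
    ultimately show ?thesis by simp
  qed
  \<comment> \<open>The value 1 has probability zero and is moved to 0, so that \<open>V\<close>
    stays below 1 at every point.\<close>
  define V where "V x = (if W x < 1 then W x else 0)" for x
  have W0: "0 \<le> W x" if "x \<in> space M" for x using W(2)[OF that, of 0] v(1)[OF that, of 0] by (simp add: w_def)
  have Vm: "V \<in> borel_measurable M" unfolding V_def using Wm by measurable
  have "prob {x \<in> space M. a \<le> V x \<and> V x < b} = b - a" if ab: "0 \<le> a" "a \<le> b" "b \<le> 1" for a b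
  proof -
    have AE1: "AE x in M. W x < 1"
      using AE_prob_1[of "{x \<in> space M. W x < 1}"] cdf[of 1] by (auto elim: eventually_mono)
    have "prob {x \<in> space M. a \<le> V x \<and> V x < b} = prob ({x \<in> space M. W x < b} - {x \<in> space M. W x < a})"
      by (rule finite_measure_eq_AE) (use AE1 Vm Wm in \<open>auto elim!: eventually_mono simp: V_def\<close>)
    also have "\<dots> = prob {x \<in> space M. W x < b} - prob {x \<in> space M. W x < a}"
      by (rule finite_measure_Diff) (use Wm ab in auto)
    finally show ?thesis using cdf ab by simp
  qed
  with Vm show thesis using W0 by (intro that[of V]) (auto simp: V_def)
qed

end

section \<open>Random bit sequences coded by one uniform variable\<close>

definition cantor :: "(nat \<Rightarrow> bool) measure" where
  "cantor = (\<Pi>\<^sub>M i\<in>UNIV. count_space UNIV)"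

text \<open>The newest bit stands first, so that prolonging a prefix is a \<open>Cons\<close> and
  functions of prefixes can be defined by recursion on lists.\<close>

primrec bits_upto :: "nat \<Rightarrow> (nat \<Rightarrow> bool) \<Rightarrow> bool list" where
  "bits_upto 0 f = []"
| "bits_upto (Suc n) f = f n # bits_upto n f"

lemma length_bits_upto [simp]: "length (bits_upto n f) = n"
  by (induction n) auto

lemma bits_upto_eq_iff: "bits_upto n f = bits_upto n g \<longleftrightarrow> (\<forall>i<n. f i = g i)"
  by (induction n) (auto simp: less_Suc_eq)

lemma space_cantor [simp]: "space cantor = UNIV"
  by (simp add: cantor_def space_PiM)

lemma cantor_component [measurable]: "(\<lambda>f. f i) \<in> cantor \<rightarrow>\<^sub>M count_space UNIV"
  unfolding cantor_def by (rule measurable_component_singleton) simp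

lemma sets_cantor_cylinder: "{f. bits_upto n f = s} \<in> sets cantor"
proof (induction n arbitrary: s)
  case 0
  have "{f. bits_upto 0 f = s} = (if s = [] then space cantor else {})" by auto
  then show ?case by (metis sets.empty_sets sets.top)
next
  case (Suc n)
  have f: "{f. f n = b} \<in> sets cantor" for b
    using measurable_sets[OF cantor_component, of "{b}" n] by (simp add: vimage_def)
  have "{f. bits_upto (Suc n) f = b # t} = {f. f n = b} \<inter> {f. bits_upto n f = t}" for b t by auto
  then show ?case using f Suc by (cases s) auto
qed

lemma sets_cantor_cylinders:
  "sets cantor = sigma_sets UNIV (insert {} {{f. bits_upto n f = s} | n s. True})"
    (is "_ = sigma_sets UNIV ?E")
proof
  interpret S: sigma_algebra UNIV "sigma_sets UNIV ?E" by (rule sigma_algebra_sigma_sets) auto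
  have gen: "{f. f i \<in> A} \<in> sigma_sets UNIV ?E" for i A
  proof -
    have "{f. f i \<in> A} = (\<Union>s\<in>{s. s \<noteq> [] \<and> hd s \<in> A}. {f. bits_upto (Suc i) f = s})" by auto
    moreover have "{f. bits_upto (Suc i) f = s} \<in> sigma_sets UNIV ?E" for s
      by (intro sigma_sets.Basic insertI2) blast
    then have "(\<Union>s\<in>{s. s \<noteq> [] \<and> hd s \<in> A}. {f. bits_upto (Suc i) f = s}) \<in> sigma_sets UNIV ?E"
      by (intro S.countable_UN'') blast+
    ultimately show ?thesis by (simp only:)
  qed
  show "sets cantor \<subseteq> sigma_sets UNIV ?E"
  proof
    fix X assume "X \<in> sets cantor"
    then have "X \<in> sigma_sets UNIV {{f \<in> \<Pi>\<^sub>E i\<in>UNIV. space (count_space UNIV). f i \<in> A} | i A. 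
        i \<in> UNIV \<and> A \<in> sets (count_space (UNIV :: bool set))}"
      unfolding cantor_def sets_PiM_single by simp
    then show "X \<in> sigma_sets UNIV ?E"
    proof induction
      case (Basic X)
      then obtain i A where "X = {f. f i \<in> A}" by auto
      then show ?case using gen by (simp only:)
    next
      case Empty
      then show ?case by (rule sigma_sets.Empty)
    next
      case (Compl X)
      then show ?case by (intro sigma_sets.Compl)
    next
      case (Union X)
      then show ?case by (intro sigma_sets.Union)
    qed
  qed
  show "sigma_sets UNIV ?E \<subseteq> sets cantor"
    using sets.sigma_sets_subset[of ?E cantor] sets_cantor_cylinder by auto
qed

text \<open>Two prefix sets are nested or disjoint, so together with the empty set they form a
  generator that is stable under intersection.\<close>

lemma cantor_measure_eqI:
  assumes sets: "sets M = sets cantor" "sets N = sets cantor" and fin: "finite_measure M"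
    and eq: "\<And>n s. emeasure M {f. bits_upto n f = s} = emeasure N {f. bits_upto n f = s}"
  shows "M = N"
proof -
  let ?E = "insert {} {{f. bits_upto n f = s} | n s. True}"
  show ?thesis
  proof (rule measure_eqI_generator_eq[where E = ?E and \<Omega> = UNIV and A = "\<lambda>_. UNIV"])
  show "Int_stable ?E"
  proof (rule Int_stableI)
    have *: "{f. bits_upto n f = s} \<inter> {f. bits_upto k f = t} \<in> ?E" if "n \<le> k" for n k s t
    proof (cases "\<exists>g. bits_upto n g = s \<and> bits_upto k g = t")
      case True
      then obtain g where g: "bits_upto n g = s" "bits_upto k g = t" by blast
      then have "{f. bits_upto n f = s} \<inter> {f. bits_upto k f = t} = {f. bits_upto k f = t}"
        using that by (auto simp: bits_upto_eq_iff)
      then show ?thesis by auto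
    next
      case False
      then have "{f. bits_upto n f = s} \<inter> {f. bits_upto k f = t} = {}" by auto
      then show ?thesis by simp
    qed
    fix a b assume "a \<in> ?E" "b \<in> ?E"
    then show "a \<inter> b \<in> ?E"
    proof (elim insertE)
      assume "a \<in> {{f. bits_upto n f = s} | n s. True}" "b \<in> {{f. bits_upto n f = s} | n s. True}"
      then obtain n s k t where ab: "a = {f. bits_upto n f = s}" "b = {f. bits_upto k f = t}" by auto
      show ?thesis
      proof (cases "n \<le> k")
        case True then show ?thesis unfolding ab by (rule *)
      next
        case False then show ?thesis unfolding ab using *[of k n t s] by (simp add: Int_commute)
      qed
    qed auto
  qed
  show "?E \<subseteq> Pow UNIV" by auto
  show "sets M = sigma_sets UNIV ?E" "sets N = sigma_sets UNIV ?E" unfolding sets by (rule sets_cantor_cylinders)+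
  show "range (\<lambda>_::nat. UNIV) \<subseteq> ?E" by (auto intro!: exI[of _ 0])
  show "emeasure M UNIV \<noteq> \<infinity>" for i :: nat
    using finite_measure.emeasure_finite[OF fin] by simp
  show "emeasure M X = emeasure N X" if "X \<in> ?E" for X using that eq by auto
  qed auto
qed

text \<open>A law on \<open>nat \<Rightarrow> bool\<close> is described by the probabilities \<open>p s\<close> of its prefixes, most recent
  bit first.  The unit interval is split into nested intervals accordingly.\<close>

definition bit_law :: "(bool list \<Rightarrow> real) \<Rightarrow> bool" where
  "bit_law p \<longleftrightarrow> p [] = 1 \<and> (\<forall>s. 0 \<le> p s) \<and> (\<forall>s. p (True # s) + p (False # s) = p s)"

fun left_end :: "(bool list \<Rightarrow> real) \<Rightarrow> bool list \<Rightarrow> real" where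
  "left_end p [] = 0"
| "left_end p (False # s) = left_end p s"
| "left_end p (True # s) = left_end p s + p (False # s)"

primrec code_path :: "(bool list \<Rightarrow> real) \<Rightarrow> real \<Rightarrow> nat \<Rightarrow> bool list" where
  "code_path p u 0 = []"
| "code_path p u (Suc n) =
     (left_end p (code_path p u n) + p (False # code_path p u n) \<le> u) # code_path p u n"

definition code :: "(bool list \<Rightarrow> real) \<Rightarrow> real \<Rightarrow> nat \<Rightarrow> bool" where
  "code p u n = hd (code_path p u (Suc n))"

lemma bits_upto_code: "bits_upto n (code p u) = code_path p u n"
  by (induction n) (auto simp: code_def)

lemma code_path_eq_iff:
  assumes p: "bit_law p" and u: "0 \<le> u" "u < 1"
  shows "code_path p u n = s \<longleftrightarrow> length s = n \<and> left_end p s \<le> u \<and> u < left_end p s + p s"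
proof (induction n arbitrary: s)
  case 0
  then show ?case using p u by (auto simp: bit_law_def)
next
  case (Suc n)
  show ?case
  proof (cases s)
    case Nil
    then show ?thesis by simp
  next
    case (Cons b t)
    have "0 \<le> p (False # t)" "0 \<le> p (True # t)" "p (True # t) + p (False # t) = p t"
      using p by (auto simp: bit_law_def)
    then show ?thesis using Suc[of t] Cons by (cases b) auto
  qed
qed

lemma left_end_bounds:
  assumes p: "bit_law p"
  shows "0 \<le> left_end p s \<and> left_end p s + p s \<le> 1"
proof (induction s)
  case Nil
  then show ?case using p by (simp add: bit_law_def)
next
  case (Cons b t)
  have "0 \<le> p (False # t)" "0 \<le> p (True # t)" "p (True # t) + p (False # t) = p t"
    using p by (auto simp: bit_law_def)
  then show ?case using Cons by (cases b) auto
qed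

lemma code_path_measurable:
  assumes [measurable]: "\<And>s. (\<lambda>y. p y s) \<in> borel_measurable M" "U \<in> borel_measurable M"
  shows "{y \<in> space M. code_path (p y) (U y) n = s} \<in> sets M"
proof (induction n arbitrary: s)
  case 0
  then show ?case by auto
next
  case (Suc n)
  have le: "(\<lambda>y. left_end (p y) s) \<in> borel_measurable M" for s
  proof (induction s)
    case (Cons b t)
    then show ?case by (cases b) simp_all
  qed simp
  show ?case
  proof (cases s)
    case Nil
    then show ?thesis by simp
  next
    case (Cons b t)
    have "{y \<in> space M. code_path (p y) (U y) (Suc n) = s} = 
      {y \<in> space M. (left_end (p y) t + p y (False # t) \<le> U y) = b} \<inter> {y \<in> space M. code_path (p y) (U y) n = t}"
      unfolding Cons by auto
    moreover have "{y \<in> space M. (left_end (p y) t + p y (False # t) \<le> U y) = b} \<in> sets M"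
      using le[of t] by measurable
    ultimately show ?thesis using Suc by auto
  qed
qed

lemma measurable_cantorI:
  assumes "\<And>n s. {y \<in> space M. bits_upto n (f y) = s} \<in> sets M"
  shows "f \<in> M \<rightarrow>\<^sub>M cantor"
proof (rule measurable_sigma_sets[OF sets_cantor_cylinders])
  fix A assume "A \<in> insert {} {{f. bits_upto n f = s} | n s. True}"
  then show "f -` A \<inter> space M \<in> sets M" using assms by (auto simp: vimage_def Int_def conj_commute)
qed auto

lemma code_measurable:
  assumes "\<And>s. (\<lambda>y. p y s) \<in> borel_measurable M" "U \<in> borel_measurable M"
  shows "(\<lambda>y. code (p y) (U y)) \<in> M \<rightarrow>\<^sub>M cantor"
  by (rule measurable_cantorI) (simp add: bits_upto_code code_path_measurable[OF assms])

definition uniform_rv :: "'a measure \<Rightarrow> ('a \<Rightarrow> real) \<Rightarrow> bool" where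
  "uniform_rv M V \<longleftrightarrow> V \<in> borel_measurable M \<and> (\<forall>x\<in>space M. 0 \<le> V x \<and> V x < 1) \<and>
     (\<forall>a b. 0 \<le> a \<longrightarrow> a \<le> b \<longrightarrow> b \<le> 1 \<longrightarrow> measure M {x \<in> space M. a \<le> V x \<and> V x < b} = b - a)"

text \<open>\<open>code p\<close> acts as a quantile map: the prefix \<open>s\<close> is produced
  exactly on an interval of length \<open>p s\<close>.\<close>

lemma prob_code:
  assumes V: "uniform_rv M V" and p: "bit_law p" and s: "length s = n"
  shows "measure M {x \<in> space M. bits_upto n (code p (V x)) = s} = p s"
proof -
  have "{x \<in> space M. bits_upto n (code p (V x)) = s} = {x \<in> space M. left_end p s \<le> V x \<and> V x < left_end p s + p s}"
    using V code_path_eq_iff[OF p] s by (auto simp: bits_upto_code uniform_rv_def)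
  then show ?thesis
    using V left_end_bounds[OF p, of s] p unfolding uniform_rv_def bit_law_def by simp
qed

text \<open>The probability of a further \<open>True\<close> is clamped to the range that the prefix
  allows. Conditional probabilities satisfy the equations of a bit law only almost everywhere; the
  repair turns them into laws at every point, measurably and without changing those that are laws
  already.\<close>

fun repair :: "(bool list \<Rightarrow> real) \<Rightarrow> bool list \<Rightarrow> real" where
  "repair p [] = 1"
| "repair p (True # s) = max 0 (min (repair p s) (p (True # s)))"
| "repair p (False # s) = repair p s - max 0 (min (repair p s) (p (True # s)))"

lemma bit_law_repair: "bit_law (repair p)"
proof -
  have "0 \<le> repair p s" for s
  proof (induction s)
    case (Cons b t)
    then show ?case by (cases b) auto
  qed simp
  then show ?thesis by (simp add: bit_law_def)
qed

lemma repair_eq: "bit_law p \<Longrightarrow> repair p s = p s"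
proof (induction s)
  case (Cons b t)
  have "0 \<le> p (False # t)" "0 \<le> p (True # t)" "p (True # t) + p (False # t) = p t"
    using Cons(2) by (auto simp: bit_law_def)
  then show ?case using Cons by (cases b) auto
qed (simp add: bit_law_def)

lemma repair_measurable [measurable]:
  assumes "\<And>s. (\<lambda>y. p y s) \<in> borel_measurable M"
  shows "(\<lambda>y. repair (p y) s) \<in> borel_measurable M"
proof (induction s)
  case (Cons b t)
  then show ?case using assms by (cases b) simp_all
qed simp

section \<open>Exchangeable random hypergraphs\<close>

definition edge :: "(nat, 'v) fo_struct \<Rightarrow> 'v set \<Rightarrow> bool" where
  "edge K B \<longleftrightarrow> (\<exists>ys\<in>rel K 0. set ys = B)"

lemma hypergraph_axioms:
  assumes "K \<in> models (hypergraph_theory l) V"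
  shows "range a \<subseteq> V \<Longrightarrow> map a [0..<l] \<in> rel K 0 \<Longrightarrow> inj_on a {..<l}"
    and "range a \<subseteq> V \<Longrightarrow> map a [0..<l] \<in> rel K 0 \<Longrightarrow> s permutes {..<l} \<Longrightarrow> map a (map s [0..<l]) \<in> rel K 0"
proof -
  have ax: "holds K a f" if "f \<in> axs (hypergraph_theory l)" "range a \<subseteq> V" for f a
    using assms that by (simp add: models_def)
  show "inj_on a {..<l}" if "range a \<subseteq> V" "map a [0..<l] \<in> rel K 0" for a
  proof -
    have "holds K a (canonical_axiom 0 l)" by (rule ax) (use that in \<open>simp_all add: hypergraph_theory_def\<close>)
    then have ne: "a i \<noteq> a j" if "j < l" "i < j" for i j
      using \<open>map a [0..<l] \<in> rel K 0\<close> that by (force simp: canonical_axiom_def)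
    show ?thesis
    proof (rule inj_onI)
      fix i j assume "i \<in> {..<l}" "j \<in> {..<l}" "a i = a j"
      then show "i = j" using ne[of i j] ne[of j i] by (cases i j rule: linorder_cases) auto
    qed
  qed
  show "map a (map s [0..<l]) \<in> rel K 0"
    if "range a \<subseteq> V" "map a [0..<l] \<in> rel K 0" "s permutes {..<l}" for a s
  proof -
    have "holds K a (Imp (Atom 0 [0..<l]) (Atom 0 (map s [0..<l])))"
      by (rule ax) (use that in \<open>auto simp: hypergraph_theory_def\<close>)
    then show ?thesis using that by simp
  qed
qed

lemma hypergraph_rel:
  assumes K: "K \<in> models (hypergraph_theory l) V" and l: "l \<ge> 1" and ys: "ys \<in> rel K 0"
  shows "length ys = l" "set ys \<subseteq> V" "distinct ys"
    and "distinct zs \<Longrightarrow> set zs = set ys \<Longrightarrow> zs \<in> rel K 0"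
proof -
  show len: "length ys = l" and sub: "set ys \<subseteq> V"
    using models_relD[OF K ys] by (simp_all add: hypergraph_theory_def)
  \<comment> \<open>A valuation must map all variables into \<open>V\<close>. Those from
    \<open>l\<close> on receive the first entry of \<open>ys\<close>, which exists because
    \<open>l \<ge> 1\<close>.\<close>
  define a where "a i = (if i < l then ys ! i else ys ! 0)" for i
  have a: "map a [0..<l] = ys" using len by (auto simp: a_def intro!: nth_equalityI)
  have "ys ! i \<in> V" if "i < l" for i using sub nth_mem[of i ys] that len by blast
  then have ra: "range a \<subseteq> V" using l by (auto simp: a_def)
  have aK: "map a [0..<l] \<in> rel K 0" using ys by (simp only: a)
  have inj: "inj_on a {..<l}" by (rule hypergraph_axioms(1)[OF K ra aK])
  then show dist: "distinct ys" unfolding a[symmetric] by (simp add: distinct_map atLeast0LessThan)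
  show "zs \<in> rel K 0" if "distinct zs" "set zs = set ys"
  proof -
    have "mset zs = mset ys" using set_eq_iff_mset_eq_distinct[OF that(1) dist] that(2) by blast
    then obtain s where s: "s permutes {..<length ys}" "permute_list s ys = zs"
      by (rule mset_eq_permutation)
    have "s i < l" if "i < l" for i using permutes_in_image[OF s(1), of i] len that by simp
    then have "map a (map s [0..<l]) = map (\<lambda>i. ys ! s i) [0..<l]" by (simp add: a_def)
    also have "\<dots> = zs" using s(2) len by (simp add: permute_list_def)
    finally have "map a (map s [0..<l]) = zs" .
    with hypergraph_axioms(2)[OF K ra aK] s(1) len show ?thesis by auto
  qed
qed

lemma hypergraph_eqI:
  assumes K: "K \<in> models (hypergraph_theory l) V" "K' \<in> models (hypergraph_theory l) V" and l: "l \<ge> 1"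
    and eq: "\<And>B. B \<subseteq> V \<Longrightarrow> edge K B \<longleftrightarrow> edge K' B"
  shows "K = K'"
proof (rule fo_struct_eqI)
  have sub: "rel L 0 \<subseteq> rel L' 0" 
    if L: "L \<in> models (hypergraph_theory l) V" "L' \<in> models (hypergraph_theory l) V" 
      and imp: "\<And>B. B \<subseteq> V \<Longrightarrow> edge L B \<Longrightarrow> edge L' B" for L L'
  proof
    fix ys assume ys: "ys \<in> rel L 0"
    then have "edge L' (set ys)" using imp hypergraph_rel(2)[OF L(1) l ys] by (auto simp: edge_def)
    then obtain zs where zs: "zs \<in> rel L' 0" "set zs = set ys" by (auto simp: edge_def)
    show "ys \<in> rel L' 0"
      by (rule hypergraph_rel(4)[OF L(2) l zs(1) hypergraph_rel(3)[OF L(1) l ys] zs(2)[symmetric]])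
  qed
  fix P show "rel K P = rel K' P"
  proof (cases "P = 0")
    case True
    then show ?thesis using sub[OF K] sub[OF K(2,1)] eq by blast
  next
    case False
    then show ?thesis using K by (simp add: models_def hypergraph_theory_def)
  qed
qed (use K in \<open>simp add: models_def\<close>)

lemma edge_pullback:
  assumes "inj_on x {..<m}" "B \<subseteq> {..<m}"
  shows "edge (pullback m x K) B \<longleftrightarrow> edge K (x ` B)"
proof
  assume "edge (pullback m x K) B"
  then obtain ys where "map x ys \<in> rel K 0" "set ys = B" by (auto simp: edge_def pullback_def)
  then show "edge K (x ` B)" by (auto simp: edge_def intro!: bexI[of _ "map x ys"])
next
  assume "edge K (x ` B)"
  then obtain zs where zs: "zs \<in> rel K 0" "set zs = x ` B" by (auto simp: edge_def)
  let ?ys = "map (inv_into B x) zs"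
  have injB: "inj_on x B" using assms inj_on_subset by blast
  have "map x ?ys = zs" using zs(2) by (auto simp: f_inv_into_f intro!: map_idI)
  moreover have "set ?ys = B" using zs(2) injB by (auto simp: image_image)
  ultimately show "edge (pullback m x K) B" using zs assms by (auto simp: edge_def pullback_def intro!: exI[of _ ?ys])
qed

definition edge_bits :: "(nat, nat) fo_struct \<Rightarrow> nat \<Rightarrow> bool" where
  "edge_bits K i = edge K (set_decode i)"

lemma set_decode_less: "x \<in> set_decode i \<Longrightarrow> x < i"
proof -
  assume x: "x \<in> set_decode i"
  have "set_encode {x} \<le> set_encode (set_decode i)" 
    unfolding set_encode_def using x by (intro sum_mono2) auto
  then have "2 ^ x \<le> i" by simp
  then show "x < i" using less_exp[of x] by linarith
qed

lemma set_decode_subset: "i < n \<Longrightarrow> set_decode i \<subseteq> {..<n}"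
  using set_decode_less by fastforce

definition set_map :: "(nat \<Rightarrow> nat) \<Rightarrow> nat \<Rightarrow> nat" where
  "set_map \<pi> i = set_encode (\<pi> ` set_decode i)"

lemma set_decode_set_map [simp]: "set_decode (set_map \<pi> i) = \<pi> ` set_decode i"
  by (simp add: set_map_def)

lemma edge_bits_pullback:
  assumes "inj_on x {..<m}" "i < m"
  shows "edge_bits (pullback m x K) i = edge_bits K (set_map x i)"
  using edge_pullback[OF assms(1) set_decode_subset[OF assms(2)]] by (simp add: edge_bits_def)

text \<open>Bit \<open>i\<close> records whether \<open>set_decode i\<close> is an edge.  As \<open>set_decode i \<subseteq> {..<i}\<close>, the first \<open>n\<close>
  bits only involve the vertices below \<open>n\<close>.\<close>

definition hypergraph_bit_law :: "nat \<Rightarrow> ((nat, nat) fo_struct \<Rightarrow> real) \<Rightarrow> bool list \<Rightarrow> real" where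
  "hypergraph_bit_law l p s = (\<Sum>K | K \<in> models (hypergraph_theory l) {..<length s} \<and>
     bits_upto (length s) (edge_bits K) = s. p K)"

lemma restrict_id_inj_maps: "m \<le> n \<Longrightarrow> restrict id {..<m} \<in> inj_maps m {..<n}"
  by (auto simp: inj_maps_def inj_on_def)

lemma restrict_inj_maps:
  "inj \<pi> \<Longrightarrow> (\<And>i. i < n \<Longrightarrow> \<pi> i \<in> V) \<Longrightarrow> restrict \<pi> {..<n} \<in> inj_maps n V"
  using inj_on_subset[of \<pi> UNIV "{..<n}"] by (auto simp: inj_maps_def)

lemma bits_upto_cong: "(\<And>i. i < n \<Longrightarrow> f i = g i) \<Longrightarrow> bits_upto n f = bits_upto n g"
  by (simp add: bits_upto_eq_iff)

lemma finite_hypergraph_models: "finite (models (hypergraph_theory l) {..<n :: nat})"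
  by (rule finite_models) (simp_all add: hypergraph_theory_def)

text \<open>The first \<open>length s\<close> bits concern only vertices below
  \<open>length s\<close>, so by consistency the probability of \<open>s\<close> may be computed
  with one more vertex, where it splits according to the next bit.\<close>

lemma bit_law_hypergraph:
  assumes p: "consistent_law (hypergraph_theory l) p"
  shows "bit_law (hypergraph_bit_law l p)"
proof -
  let ?H = "hypergraph_theory l"
  have T: "finite (symbols ?H)" by (simp add: hypergraph_theory_def)
  have "hypergraph_bit_law l p [] = 1"
    using consistent_lawD(2)[OF p, of 0] by (simp add: hypergraph_bit_law_def)
  moreover have "0 \<le> hypergraph_bit_law l p s" for s
    unfolding hypergraph_bit_law_def using consistent_lawD(1)[OF p] by (intro sum_nonneg) auto
  moreover have "hypergraph_bit_law l p (True # s) + hypergraph_bit_law l p (False # s) = hypergraph_bit_law l p s" for s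
  proof -
    let ?n = "length s" and ?M = "models ?H {..<Suc (length s)}"
    let ?S = "\<lambda>b. {K. K \<in> ?M \<and> bits_upto (Suc ?n) (edge_bits K) = b # s}"
    have y: "restrict id {..<?n} \<in> inj_maps ?n {..<Suc ?n}" by (rule restrict_id_inj_maps) simp
    have "bits_upto ?n (edge_bits (pullback ?n (restrict id {..<?n}) K)) = bits_upto ?n (edge_bits K)" for K
    proof (rule bits_upto_cong)
      fix i assume i: "i < ?n"
      have "restrict id {..<?n} ` set_decode i = set_decode i"
        using set_decode_subset[OF i] by (auto simp: image_iff)
      then have "set_map (restrict id {..<?n}) i = i" by (simp add: set_map_def)
      then show "edge_bits (pullback ?n (restrict id {..<?n}) K) i = edge_bits K i"
        using edge_bits_pullback[OF inj_mapsD(3)[OF y] i] by simp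
    qed
    then have "hypergraph_bit_law l p s = (\<Sum>K | K \<in> ?M \<and> bits_upto ?n (edge_bits K) = s. p K)"
      using consistent_law_sum[OF T p y, of "\<lambda>K. bits_upto ?n (edge_bits K) = s"]
      by (simp add: hypergraph_bit_law_def)
    also have "{K. K \<in> ?M \<and> bits_upto ?n (edge_bits K) = s} = ?S True \<union> ?S False" by auto
    also have "(\<Sum>K\<in>?S True \<union> ?S False. p K) = (\<Sum>K\<in>?S True. p K) + (\<Sum>K\<in>?S False. p K)"
      using finite_hypergraph_models[of l "Suc ?n"] by (intro sum.union_disjoint) auto
    finally show ?thesis by (simp add: hypergraph_bit_law_def)
  qed
  ultimately show ?thesis by (simp add: bit_law_def)
qed

text \<open>The infinite exchangeable hypergraph is kept only as the law \<open>M\<close> of its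
  edge bits; \<open>p\<close> is the law of its finite samples.\<close>

locale exchangeable_hypergraph = M: prob_space M for M :: "(nat \<Rightarrow> bool) measure" +
  fixes l :: nat and p :: "(nat, nat) fo_struct \<Rightarrow> real"
  assumes sets_M: "sets M = sets cantor" and l: "l \<ge> 1"
    and consistent: "consistent_law (hypergraph_theory l) p"
    and dissociated: "dissociated_law (hypergraph_theory l) p"
    and cylinder: "\<And>n s. length s = n \<Longrightarrow> measure M {f. bits_upto n f = s} = hypergraph_bit_law l p s"
begin

lemma space_M [simp]: "space M = UNIV"
  using sets_eq_imp_space_eq[OF sets_M] by simp

lemma measurable_M [simp]: "measurable M N = measurable cantor N" "measurable N M = measurable N cantor"
  by (rule measurable_cong_sets[OF sets_M refl], rule measurable_cong_sets[OF refl sets_M])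

lemma finite_symbols: "finite (symbols (hypergraph_theory l))"
  by (simp add: hypergraph_theory_def)

lemma prob_bits:
  assumes R: "\<And>f g. bits_upto n f = bits_upto n g \<Longrightarrow> R f \<longleftrightarrow> R g"
  shows "{f. R f} \<in> sets M"
    "measure M {f. R f} = (\<Sum>K | K \<in> models (hypergraph_theory l) {..<n} \<and> R (edge_bits K). p K)"
proof -
  let ?S = "{s. length s = n \<and> (\<exists>f. bits_upto n f = s \<and> R f)}"
  have finS: "finite ?S" by (rule rev_finite_subset[OF finite_lists_length_eq[of UNIV n]]) auto
  have eq: "{f. R f} = (\<Union>s\<in>?S. {f. bits_upto n f = s})"
  proof (intro equalityI subsetI)
    fix f assume "f \<in> (\<Union>s\<in>?S. {f. bits_upto n f = s})"
    then obtain g where "bits_upto n g = bits_upto n f" "R g" by auto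
    then show "f \<in> {f. R f}" using R[of g f] by simp
  qed auto
  show "{f. R f} \<in> sets M" unfolding eq using finS sets_cantor_cylinder sets_M by auto
  have "measure M {f. R f} = (\<Sum>s\<in>?S. measure M {f. bits_upto n f = s})"
    unfolding eq by (rule M.finite_measure_finite_Union[OF finS])
      (use sets_cantor_cylinder sets_M in \<open>auto simp: disjoint_family_on_def\<close>)
  also have "\<dots> = (\<Sum>s\<in>?S. hypergraph_bit_law l p s)" by (intro sum.cong refl cylinder) auto
  also have "\<dots> = (\<Sum>s\<in>?S. \<Sum>K | K \<in> {K. K \<in> models (hypergraph_theory l) {..<n} \<and> R (edge_bits K)} \<and> bits_upto n (edge_bits K) = s. p K)"
  proof (rule sum.cong[OF refl])
    fix s assume s: "s \<in> ?S"
    then obtain g where g: "bits_upto n g = s" "R g" by auto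
    have "R (edge_bits K)" if "bits_upto n (edge_bits K) = s" for K
      using R[of g "edge_bits K"] g that by simp
    then show "hypergraph_bit_law l p s = (\<Sum>K | K \<in> {K. K \<in> models (hypergraph_theory l) {..<n} \<and> R (edge_bits K)} \<and> bits_upto n (edge_bits K) = s. p K)"
      unfolding hypergraph_bit_law_def using s by (intro sum.cong) auto
  qed
  also have "\<dots> = (\<Sum>K | K \<in> models (hypergraph_theory l) {..<n} \<and> R (edge_bits K). p K)"
    by (rule sum.group) (use finS finite_hypergraph_models[of l n] in auto)
  finally show "measure M {f. R f} = (\<Sum>K | K \<in> models (hypergraph_theory l) {..<n} \<and> R (edge_bits K). p K)" .
qed

section \<open>Invariance and independence under injections of the vertices\<close>

definition relabel :: "(nat \<Rightarrow> nat) \<Rightarrow> (nat \<Rightarrow> bool) \<Rightarrow> nat \<Rightarrow> bool" where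
  "relabel \<pi> f = (\<lambda>i. f (set_map \<pi> i))"

lemma measurable_cantor_reindex: "(\<lambda>f i. f (r i)) \<in> cantor \<rightarrow>\<^sub>M cantor" for r :: "nat \<Rightarrow> nat"
  unfolding cantor_def by (rule measurable_PiM_single') (auto simp: space_PiM intro: measurable_component_singleton)

lemma measurable_relabel: "relabel \<pi> \<in> cantor \<rightarrow>\<^sub>M cantor"
  unfolding relabel_def[abs_def] by (rule measurable_cantor_reindex)

lemma bits_bound:
  obtains n' where "\<And>i. i < n \<Longrightarrow> set_map \<pi> i < n'" "\<And>i. i < n \<Longrightarrow> \<pi> i < n'" "n \<le> (n' :: nat)"
proof (rule that[of "Suc (\<Sum>i<n. set_map \<pi> i + \<pi> i) + n"])
  fix i assume "i < n"
  then have "set_map \<pi> i + \<pi> i \<le> (\<Sum>i<n. set_map \<pi> i + \<pi> i)" by (intro member_le_sum) auto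
  then show "set_map \<pi> i < Suc (\<Sum>i<n. set_map \<pi> i + \<pi> i) + n" "\<pi> i < Suc (\<Sum>i<n. set_map \<pi> i + \<pi> i) + n" by auto
qed auto

lemma relabel_edge_bits:
  assumes "inj \<pi>" 
  shows "bits_upto n (relabel \<pi> (edge_bits K)) = bits_upto n (edge_bits (pullback n (restrict \<pi> {..<n}) K))"
proof (rule bits_upto_cong)
  fix i assume i: "i < n"
  have "restrict \<pi> {..<n} ` set_decode i = \<pi> ` set_decode i"
    using set_decode_subset[OF i] by (intro image_cong) auto
  then have "set_map (restrict \<pi> {..<n}) i = set_map \<pi> i" by (simp add: set_map_def)
  moreover have "inj_on (restrict \<pi> {..<n}) {..<n}" using assms by (auto simp: inj_on_def)
  ultimately show "relabel \<pi> (edge_bits K) i = edge_bits (pullback n (restrict \<pi> {..<n}) K) i"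
    using edge_bits_pullback[of "restrict \<pi> {..<n}" n i K] i by (simp add: relabel_def)
qed

text \<open>A prefix set involves finitely many vertices, where consistency of \<open>p\<close>
  applies. The map need not be onto, so exchangeability is available for moving an infinite set of
  vertices out of the way.\<close>

lemma distr_relabel:
  assumes \<pi>: "inj \<pi>"
  shows "distr M M (relabel \<pi>) = M"
proof (rule cantor_measure_eqI)
  show "finite_measure (distr M M (relabel \<pi>))"
    by (intro M.finite_measure_distr) (simp add: measurable_relabel)
  fix n s
  obtain n' where n': "\<And>i. i < n \<Longrightarrow> set_map \<pi> i < n'" "\<And>i. i < n \<Longrightarrow> \<pi> i < n'" "n \<le> n'" 
    by (rule bits_bound[of n \<pi>]) (rule that)
  have y: "restrict \<pi> {..<n} \<in> inj_maps n {..<n'}" by (rule restrict_inj_maps[OF \<pi>]) (simp add: n'(2))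
  let ?R = "\<lambda>f. bits_upto n (relabel \<pi> f) = s"
  have R: "?R f \<longleftrightarrow> ?R g" if "bits_upto n' f = bits_upto n' g" for f g
  proof -
    have "bits_upto n (relabel \<pi> f) = bits_upto n (relabel \<pi> g)"
      using that n'(1) by (intro bits_upto_cong) (simp add: bits_upto_eq_iff relabel_def)
    then show ?thesis by simp
  qed
  have "measure M {f. ?R f} = (\<Sum>K | K \<in> models (hypergraph_theory l) {..<n'} \<and> 
      bits_upto n (edge_bits (pullback n (restrict \<pi> {..<n}) K)) = s. p K)"
    using prob_bits(2)[OF R] by (simp add: relabel_edge_bits[OF \<pi>])
  also have "\<dots> = (\<Sum>K | K \<in> models (hypergraph_theory l) {..<n} \<and> bits_upto n (edge_bits K) = s. p K)"
    by (rule consistent_law_sum[OF finite_symbols consistent y])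
  also have "\<dots> = measure M {f. bits_upto n f = s}"
    by (rule prob_bits(2)[symmetric]) auto
  finally have "measure M {f. ?R f} = measure M {f. bits_upto n f = s}" .
  moreover have "emeasure (distr M M (relabel \<pi>)) {f. bits_upto n f = s} = emeasure M {f. ?R f}"
    using sets_cantor_cylinder[of n s] by (subst emeasure_distr) (auto simp: measurable_relabel sets_M vimage_def)
  ultimately show "emeasure (distr M M (relabel \<pi>)) {f. bits_upto n f = s} = emeasure M {f. bits_upto n f = s}"
    by (simp add: M.emeasure_eq_measure)
qed (simp_all add: sets_M)

text \<open>Prefixes again reduce the claim to finitely many vertices; the two images are disjoint
  there, and dissociation gives the product.\<close>

lemma relabel_independent:
  assumes \<pi>: "inj \<pi>" "inj \<rho>" and disj: "range \<pi> \<inter> range \<rho> = {}"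
  shows "measure M {f. bits_upto n (relabel \<pi> f) = s \<and> bits_upto n' (relabel \<rho> f) = t} =
    measure M {f. bits_upto n f = s} * measure M {f. bits_upto n' f = t}"
proof -
  obtain n1 where n1: "\<And>i. i < n \<Longrightarrow> set_map \<pi> i < n1" "\<And>i. i < n \<Longrightarrow> \<pi> i < n1" "n \<le> n1" 
    by (rule bits_bound[of n \<pi>]) (rule that)
  obtain n2 where n2: "\<And>i. i < n' \<Longrightarrow> set_map \<rho> i < n2" "\<And>i. i < n' \<Longrightarrow> \<rho> i < n2" "n' \<le> n2" 
    by (rule bits_bound[of n' \<rho>]) (rule that)
  let ?n = "max n1 n2" and ?H = "hypergraph_theory l"
  let ?x = "restrict \<pi> {..<n}" and ?x' = "restrict \<rho> {..<n'}"
  have x: "?x \<in> inj_maps n {..<?n}" "?x' \<in> inj_maps n' {..<?n}" 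
    using n1(2) n2(2) by (auto intro!: restrict_inj_maps \<pi> simp: less_max_iff_disj)
  have dx: "?x ` {..<n} \<inter> ?x' ` {..<n'} = {}" using disj by auto
  let ?R = "\<lambda>f. bits_upto n (relabel \<pi> f) = s \<and> bits_upto n' (relabel \<rho> f) = t"
  have R: "?R f \<longleftrightarrow> ?R g" if "bits_upto ?n f = bits_upto ?n g" for f g
  proof -
    have "bits_upto n (relabel \<pi> f) = bits_upto n (relabel \<pi> g)" "bits_upto n' (relabel \<rho> f) = bits_upto n' (relabel \<rho> g)"
      using that n1(1) n2(1) by (auto intro!: bits_upto_cong simp: bits_upto_eq_iff relabel_def less_max_iff_disj)
    then show ?thesis by simp
  qed
  let ?A = "{K. K \<in> models ?H {..<n} \<and> bits_upto n (edge_bits K) = s}" 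
  let ?B = "{K. K \<in> models ?H {..<n'} \<and> bits_upto n' (edge_bits K) = t}"
  have fin: "finite ?A" "finite ?B" using finite_hypergraph_models[of l n] finite_hypergraph_models[of l n'] by auto
  let ?S = "{K. K \<in> models ?H {..<?n} \<and> bits_upto n (edge_bits (pullback n ?x K)) = s \<and>
      bits_upto n' (edge_bits (pullback n' ?x' K)) = t}"
  have "measure M {f. ?R f} = (\<Sum>K\<in>?S. p K)"
    using prob_bits(2)[OF R] by (simp add: relabel_edge_bits[OF \<pi>(1)] relabel_edge_bits[OF \<pi>(2)])
  also have "\<dots> = (\<Sum>KK\<in>?A \<times> ?B. \<Sum>K\<in>{K \<in> ?S. (pullback n ?x K, pullback n' ?x' K) = KK}. p K)"
    by (rule sum.group[symmetric]) 
      (use fin finite_hypergraph_models[of l ?n] pullback_inj_maps_models[OF _ x(1)] pullback_inj_maps_models[OF _ x(2)] in auto)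
  also have "\<dots> = (\<Sum>KK\<in>?A \<times> ?B. p (fst KK) * p (snd KK))"
  proof (rule sum.cong[OF refl])
    fix KK assume KK: "KK \<in> ?A \<times> ?B"
    have "{K \<in> ?S. (pullback n ?x K, pullback n' ?x' K) = KK} = 
      {K. K \<in> models ?H {..<?n} \<and> pullback n ?x K = fst KK \<and> pullback n' ?x' K = snd KK}" using KK by auto
    then show "(\<Sum>K\<in>{K \<in> ?S. (pullback n ?x K, pullback n' ?x' K) = KK}. p K) = p (fst KK) * p (snd KK)"
      using consistent_dissociated_law_injections[OF finite_symbols consistent dissociated x dx, of "fst KK" "snd KK"] KK
      by auto
  qed
  also have "\<dots> = (\<Sum>K\<in>?A. p K) * (\<Sum>K\<in>?B. p K)"
    by (simp add: sum_product sum.cartesian_product case_prod_unfold)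
  also have "(\<Sum>K\<in>?A. p K) = measure M {f. bits_upto n f = s}" by (rule prob_bits(2)[symmetric]) auto
  also have "(\<Sum>K\<in>?B. p K) = measure M {f. bits_upto n' f = t}" by (rule prob_bits(2)[symmetric]) auto
  finally show ?thesis .
qed

end

text \<open>In place of an extension theorem for measures, the law of the infinite hypergraph is
  obtained by coding a single uniform variable.\<close>

lemma exchangeable_hypergraph_exists:
  fixes \<Omega> :: "'y measure"
  assumes \<Omega>: "prob_space \<Omega>" and V: "uniform_rv \<Omega> V" and l: "l \<ge> 1"
    and p: "consistent_law (hypergraph_theory l) p" "dissociated_law (hypergraph_theory l) p"
  obtains M where "exchangeable_hypergraph M l p"
proof -
  let ?q = "hypergraph_bit_law l p"
  let ?X = "\<lambda>w. code ?q (V w)"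
  have X: "?X \<in> \<Omega> \<rightarrow>\<^sub>M cantor" by (rule code_measurable) (use V in \<open>auto simp: uniform_rv_def\<close>)
  interpret D: prob_space "distr \<Omega> cantor ?X" by (rule prob_space.prob_space_distr[OF \<Omega> X])
  have "exchangeable_hypergraph (distr \<Omega> cantor ?X) l p"
  proof unfold_locales
    fix n and s :: "bool list" assume s: "length s = n"
    have "measure (distr \<Omega> cantor ?X) {f. bits_upto n f = s} = measure \<Omega> {x \<in> space \<Omega>. bits_upto n (?X x) = s}"
      by (subst measure_distr[OF X sets_cantor_cylinder]) (simp add: vimage_def Int_def conj_commute)
    also have "\<dots> = ?q s" by (rule prob_code[OF V bit_law_hypergraph[OF p(1)] s])
    finally show "measure (distr \<Omega> cantor ?X) {f. bits_upto n f = s} = ?q s" .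
  qed (use l p in auto)
  then show thesis by (rule that)
qed

section \<open>Even and odd vertices, and the layers of a hypergraph\<close>

definition ev :: "nat set \<Rightarrow> nat set" where "ev S = {a. 2 * a \<in> S}"
definition od :: "nat set \<Rightarrow> nat set" where "od S = {b. 2 * b + 1 \<in> S}"

text \<open>Even vertices \<open>2 * a\<close> carry the hypergraph that is to be simulated; odd vertices are
  auxiliary.  The layer at \<open>A\<close> records all edges whose even part is \<open>A\<close>, so that the layers are
  an Aldous--Hoover type array in which the layer at \<open>A\<close> depends on the others only through the
  layers at proper subsets of \<open>A\<close>.\<close>

definition idx :: "nat set \<Rightarrow> nat \<Rightarrow> nat" where
  "idx A j = set_encode ((\<lambda>a. 2 * a) ` A \<union> (\<lambda>b. 2 * b + 1) ` set_decode j)"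

definition layer :: "(nat \<Rightarrow> bool) \<Rightarrow> nat set \<Rightarrow> nat \<Rightarrow> bool" where
  "layer f A = (\<lambda>j. f (idx A j))"

definition assemble :: "(nat set \<Rightarrow> nat \<Rightarrow> bool) \<Rightarrow> nat \<Rightarrow> bool" where
  "assemble y i = y (ev (set_decode i)) (set_encode (od (set_decode i)))"

text \<open>All edges whose even part contains \<open>A\<close> are erased, so the sigma-algebra
  generated by \<open>mask A\<close> is that of the layers at sets not containing
  \<open>A\<close>.\<close>

definition mask :: "nat set \<Rightarrow> (nat \<Rightarrow> bool) \<Rightarrow> nat \<Rightarrow> bool" where
  "mask A f = (\<lambda>i. f i \<and> \<not> A \<subseteq> ev (set_decode i))"

definition cyl :: "bool list \<Rightarrow> (nat \<Rightarrow> bool) \<Rightarrow> real" where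
  "cyl s g = of_bool (bits_upto (length s) g = s)"

lemma cyl_bounds: "0 \<le> cyl s g" "cyl s g \<le> 1" "cyl s g * cyl s g = cyl s g"
  by (simp_all add: cyl_def)

lemma finite_ev_od: "finite S \<Longrightarrow> finite (ev S)" "finite S \<Longrightarrow> finite (od S)"
proof -
  assume S: "finite S"
  have "ev S = (\<lambda>a. 2 * a) -` S" "od S = (\<lambda>b. 2 * b + 1) -` S" by (auto simp: ev_def od_def)
  then show "finite (ev S)" "finite (od S)" using S by (auto intro!: finite_vimageI simp: inj_def)
qed

lemma ev_od_Un: "(\<lambda>a. 2 * a) ` ev S \<union> (\<lambda>b. 2 * b + 1) ` od S = S"
proof -
  have "x \<in> (\<lambda>a. 2 * a) ` ev S \<union> (\<lambda>b. 2 * b + 1) ` od S" if "x \<in> S" for x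
    using that by (cases "even x") (auto simp: ev_def od_def image_iff elim!: evenE oddE)
  then show ?thesis by (auto simp: ev_def od_def)
qed

lemma set_decode_idx: "finite A \<Longrightarrow> set_decode (idx A j) = (\<lambda>a. 2 * a) ` A \<union> (\<lambda>b. 2 * b + 1) ` set_decode j"
  by (simp add: idx_def)

lemma ev_idx: "finite A \<Longrightarrow> ev (set_decode (idx A j)) = A"
  by (auto simp: set_decode_idx ev_def) presburger

lemma od_idx: "finite A \<Longrightarrow> od (set_decode (idx A j)) = set_decode j"
  by (auto simp: set_decode_idx od_def) presburger

lemma idx_ev_od: "idx (ev (set_decode i)) (set_encode (od (set_decode i))) = i"
  by (simp only: idx_def set_encode_inverse[OF finite_ev_od(2)[OF finite_set_decode]] ev_od_Un) simp

lemma assemble_layer [simp]: "assemble (layer f) = f"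
  by (simp add: assemble_def layer_def fun_eq_iff idx_ev_od)

lemma layer_assemble: "finite A \<Longrightarrow> layer (assemble y) A = y A"
  by (simp add: assemble_def layer_def fun_eq_iff ev_idx od_idx)

lemma layer_mask: "finite B \<Longrightarrow> \<not> A \<subseteq> B \<Longrightarrow> layer (mask A f) B = layer f B"
  by (simp add: layer_def mask_def ev_idx fun_eq_iff)

lemma mask_mask [simp]: "mask A (mask A f) = mask A f"
  by (auto simp: mask_def)

lemma measurable_layer [measurable]: "(\<lambda>f. layer f A) \<in> cantor \<rightarrow>\<^sub>M cantor"
  unfolding layer_def cantor_def 
  by (rule measurable_PiM_single') (auto simp: space_PiM intro: measurable_component_singleton)

lemma measurable_cyl [measurable]: "cyl s \<in> borel_measurable cantor"
proof -
  have [measurable]: "{f. bits_upto (length s) f = s} \<in> sets cantor" by (rule sets_cantor_cylinder)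
  have "cyl s = indicator {f. bits_upto (length s) f = s}" by (auto simp: cyl_def indicator_def)
  then show ?thesis by simp
qed

lemma measurable_mask [measurable]: "mask A \<in> cantor \<rightarrow>\<^sub>M cantor"
  unfolding cantor_def
proof (rule measurable_PiM_single')
  fix i show "(\<lambda>f. mask A f i) \<in> Pi\<^sub>M UNIV (\<lambda>_. count_space UNIV) \<rightarrow>\<^sub>M count_space UNIV"
    by (cases "A \<subseteq> ev (set_decode i)") (auto simp: mask_def intro: measurable_component_singleton)
qed (auto simp: space_PiM)

context exchangeable_hypergraph
begin

lemma integrable_bounded:
  assumes "f \<in> borel_measurable cantor" "\<And>x. \<bar>f x\<bar> \<le> (b :: real)"
  shows "integrable M f"
  by (rule M.integrable_const_bound[of _ b]) (use assms in auto)

lemma integral_relabel: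
  assumes "inj \<pi>" "F \<in> borel_measurable cantor"
  shows "(\<integral>f. F (relabel \<pi> f) \<partial>M) = (\<integral>f. F f \<partial>M :: real)"
  using integral_distr[of "relabel \<pi>" M M F] assms by (simp add: measurable_relabel distr_relabel)

text \<open>The injection \<open>\<pi>\<close> keeps the vertices that
  \<open>cyl s (layer f A)\<close> looks at and sends all others to fresh odd vertices. Let
  \<open>h\<close> be the conditional probability given the masked hypergraph and \<open>q\<close>
  its relabelling along \<open>\<pi>\<close>. Exchangeability gives \<open>q * q\<close>,
  \<open>q * h\<close> and \<open>h * h\<close> the same integral, so \<open>q = h\<close> almost
  everywhere; and \<open>q\<close> sees only the layers at proper subsets of \<open>A\<close>, since
  the even part of any image under \<open>\<pi>\<close> lies in \<open>A\<close>.\<close>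

lemma cond_prob:
  assumes A: "finite A"
  obtains q where "q \<in> borel_measurable cantor" "\<And>f. 0 \<le> q f" "\<And>f. q f \<le> (1 :: real)"
    "\<And>f g. (\<And>B. B \<subset> A \<Longrightarrow> layer f B = layer g B) \<Longrightarrow> q f = q g"
    "\<And>\<Phi> b. \<Phi> \<in> borel_measurable cantor \<Longrightarrow> (\<And>f. \<bar>\<Phi> f\<bar> \<le> b) \<Longrightarrow> (\<And>f. \<Phi> (mask A f) = \<Phi> f) \<Longrightarrow>
       (\<integral>f. \<Phi> f * cyl s (layer f A) \<partial>M) = (\<integral>f. \<Phi> f * q f \<partial>M)"
proof -
  let ?n = "length s"
  let ?c = "\<lambda>f. cyl s (layer f A)"
  define G where "G = vimage_algebra UNIV (mask A) cantor"
  have spG: "space G = UNIV" by (simp add: G_def)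
  have mG: "\<Phi> \<in> borel_measurable G" 
    if "\<Phi> \<in> borel_measurable cantor" "\<And>f. \<Phi> (mask A f) = \<Phi> f" for \<Phi> :: "_ \<Rightarrow> real"
  proof -
    have "mask A \<in> G \<rightarrow>\<^sub>M cantor" unfolding G_def by (rule measurable_vimage_algebra1) simp
    then have "(\<lambda>f. \<Phi> (mask A f)) \<in> borel_measurable G" using that(1) by measurable
    then show ?thesis by (simp add: that(2))
  qed
  have sub: "subalgebra M G"
    unfolding subalgebra_def G_def using measurable_sets[OF measurable_mask] 
    by (auto simp: sets_vimage_algebra2 sets_M)
  interpret G: finite_measure_subalgebra M G
    by (intro finite_measure_subalgebra.intro finite_measure_subalgebra_axioms.intro sub) unfold_locales
  have c: "?c \<in> borel_measurable cantor" by measurable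
  have intc: "integrable M ?c" by (rule integrable_bounded[of _ 1]) (use c cyl_bounds in auto)
  let ?h0 = "real_cond_exp M G ?c"
  define h where "h f = max 0 (min 1 (?h0 f))" for f
  have hG: "h \<in> borel_measurable G" unfolding h_def[abs_def] by measurable
  have h: "h \<in> borel_measurable cantor"
    using measurable_from_subalg[OF sub hG] by simp
  have hb: "0 \<le> h f" "h f \<le> 1" for f by (auto simp: h_def)
  have "AE f in M. ?h0 f \<ge> 0" by (rule G.real_cond_exp_ge_c[OF intc]) (simp add: cyl_bounds)
  moreover have "AE f in M. ?h0 f \<le> 1" by (rule G.real_cond_exp_le_c[OF intc]) (simp add: cyl_bounds)
  ultimately have hh: "AE f in M. h f = ?h0 f" by eventually_elim (simp add: h_def)
  have proj: "(\<integral>f. \<Phi> f * ?c f \<partial>M) = (\<integral>f. \<Phi> f * h f \<partial>M)" 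
    if \<Phi>: "\<Phi> \<in> borel_measurable cantor" "\<And>f. \<bar>\<Phi> f\<bar> \<le> b" "\<And>f. \<Phi> (mask A f) = \<Phi> f" for \<Phi> b
  proof -
    have "\<bar>\<Phi> f * ?c f\<bar> \<le> b" for f
      using mult_mono[OF \<Phi>(2)[of f], of "?c f" 1] cyl_bounds[of s "layer f A"] \<Phi>(2)[of f]  by (simp add: abs_mult)
    then have "integrable M (\<lambda>f. \<Phi> f * ?c f)" by (rule integrable_bounded[rotated]) (use \<Phi>(1) c in measurable)
    then have "(\<integral>f. \<Phi> f * ?h0 f \<partial>M) = (\<integral>f. \<Phi> f * ?c f \<partial>M)"
      by (rule G.real_cond_exp_intg(2)) (use mG[OF \<Phi>(1,3)] c in auto)
    moreover have "(\<integral>f. \<Phi> f * ?h0 f \<partial>M) = (\<integral>f. \<Phi> f * h f \<partial>M)"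
      by (rule integral_cong_AE) (use hh \<Phi>(1) h in \<open>auto simp flip: measurable_M\<close>)
    ultimately show ?thesis by simp
  qed
  \<comment> \<open>A function that is measurable for the sigma-algebra generated by
    \<open>mask A\<close> is constant on the fibres of \<open>mask A\<close>, at every point and not
    just almost everywhere.\<close>
  have hmask: "h (mask A f) = h f" for f
  proof -
    have "{x \<in> space G. h x = h f} \<in> sets G" using hG by measurable
    then obtain C where "{x. h x = h f} = mask A -` C \<inter> UNIV"
      by (auto simp: spG G_def sets_vimage_algebra2)
    then have "x \<in> mask A -` C \<longleftrightarrow> h x = h f" for x by blast
    from this[of f] this[of "mask A f"] show ?thesis by simp
  qed
  let ?fix = "\<lambda>v. if even v then v div 2 \<in> A else v div 2 < ?n"
  \<comment> \<open>The odd vertices \<open>2 * b + 1\<close> with \<open>b < ?n\<close> are fixed,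
    and the shift by \<open>?n\<close> keeps the images of the moved vertices away from them. All
    moved vertices become odd.\<close>
  define \<pi> where "\<pi> v = (if ?fix v then v else 2 * (?n + v) + 1)" for v :: nat
  have inj: "inj \<pi>"
  proof (rule injI)
    fix v w assume "\<pi> v = \<pi> w"
    then show "v = w" by (auto simp: \<pi>_def split: if_splits)
  qed
  have \<pi>2: "\<pi> (2 * a) = 2 * a" if "a \<in> A" for a using that by (simp add: \<pi>_def)
  have \<pi>1: "\<pi> (2 * b + 1) = 2 * b + 1" if "b < ?n" for b using that by (simp add: \<pi>_def)
  have ev\<pi>: "ev (\<pi> ` D) = A \<inter> ev D" for D
  proof -
    have eq: "2 * a = \<pi> v \<longleftrightarrow> v = 2 * a \<and> a \<in> A" for v a
      by (auto simp: \<pi>_def split: if_splits) presburger+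
    show ?thesis by (auto simp: ev_def image_iff eq)
  qed
  have cT: "?c (relabel \<pi> f) = ?c f" for f
  proof -
    have "set_map \<pi> (idx A j) = idx A j" if "j < ?n" for j
    proof -
      have "\<pi> x = x" if "x \<in> set_decode (idx A j)" for x
        using that \<pi>2 \<pi>1 set_decode_subset[OF \<open>j < ?n\<close>] by (auto simp: set_decode_idx[OF A])
      then have "\<pi> ` set_decode (idx A j) = set_decode (idx A j)" by simp
      then show ?thesis by (simp add: set_map_def)
    qed
    then have "bits_upto ?n (layer (relabel \<pi> f) A) = bits_upto ?n (layer f A)"
      by (intro bits_upto_cong) (simp add: layer_def relabel_def)
    then show ?thesis by (simp add: cyl_def)
  qed
  define q where "q f = h (relabel \<pi> f)" for f
  have pm: "q \<in> borel_measurable cantor" unfolding q_def[abs_def] using h measurable_relabel by measurable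
  have dep: "q f = q g" if fg: "\<And>B. B \<subset> A \<Longrightarrow> layer f B = layer g B" for f g
  proof -
    have "mask A (relabel \<pi> f) i = mask A (relabel \<pi> g) i" for i
    proof (cases "A \<subseteq> ev (set_decode i)")
      case False
      let ?i = "set_map \<pi> i"
      have "ev (set_decode ?i) \<subset> A" using False by (simp add: ev\<pi>) blast
      from fg[OF this] have "f (idx (ev (set_decode ?i)) j) = g (idx (ev (set_decode ?i)) j)" for j
        by (simp add: layer_def fun_eq_iff)
      from this[of "set_encode (od (set_decode ?i))"] have "f ?i = g ?i" by (simp only: idx_ev_od)
      then show ?thesis by (simp add: mask_def relabel_def)
    qed (simp add: mask_def)
    then have "mask A (relabel \<pi> f) = mask A (relabel \<pi> g)" by (rule ext)
    then show ?thesis unfolding q_def using hmask by metis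
  qed
  have pmask: "q (mask A f) = q f" for f
    by (rule dep) (use A finite_subset[of _ A] in \<open>auto intro!: layer_mask\<close>)
  have pb: "0 \<le> q f" "q f \<le> 1" for f by (auto simp: q_def hb)
  have prodb: "\<bar>x * y\<bar> \<le> 1" if "0 \<le> x" "x \<le> 1" "0 \<le> y" "y \<le> 1" for x y :: real
    using that mult_le_one[of x y] by simp
  have "(\<integral>f. q f * q f \<partial>M) = (\<integral>f. h f * h f \<partial>M)"
    unfolding q_def using integral_relabel[OF inj, of "\<lambda>f. h f * h f"] h by simp
  moreover have "(\<integral>f. q f * h f \<partial>M) = (\<integral>f. h f * h f \<partial>M)"
  proof -
    have "(\<integral>f. q f * h f \<partial>M) = (\<integral>f. q f * ?c f \<partial>M)"
      by (rule proj[OF pm, of 1, symmetric]) (use pb pmask in auto)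
    also have "\<dots> = (\<integral>f. h (relabel \<pi> f) * ?c (relabel \<pi> f) \<partial>M)" unfolding cT by (simp add: q_def)
    also have "\<dots> = (\<integral>f. h f * ?c f \<partial>M)"
      by (rule integral_relabel[OF inj]) (use h c in measurable)
    also have "\<dots> = (\<integral>f. h f * h f \<partial>M)" by (rule proj[OF h, of 1]) (use hb hmask in auto)
    finally show ?thesis .
  qed
  moreover have "integrable M (\<lambda>f. q f * q f)" "integrable M (\<lambda>f. q f * h f)" "integrable M (\<lambda>f. h f * h f)"
    by (rule integrable_bounded[of _ 1]; use h pm pb hb prodb in simp)+
  ultimately have z: "(\<integral>f. (q f - h f) * (q f - h f) \<partial>M) = 0"
    and zi: "integrable M (\<lambda>f. (q f - h f) * (q f - h f))"
    by (simp_all add: left_diff_distrib right_diff_distrib mult.commute)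
  have "AE f in M. (q f - h f) * (q f - h f) = 0"
    using integral_nonneg_eq_0_iff_AE[OF zi] z by simp
  then have ph: "AE f in M. q f = h f" by simp
  show thesis
  proof (rule that[OF pm pb dep])
    fix \<Phi> b assume \<Phi>: "\<Phi> \<in> borel_measurable cantor" "\<And>f. \<bar>\<Phi> f\<bar> \<le> (b :: real)" "\<And>f. \<Phi> (mask A f) = \<Phi> f"
    have "(\<integral>f. \<Phi> f * ?c f \<partial>M) = (\<integral>f. \<Phi> f * h f \<partial>M)" by (rule proj[OF \<Phi>])
    also have "\<dots> = (\<integral>f. \<Phi> f * q f \<partial>M)"
      by (rule integral_cong_AE) (use ph \<Phi>(1) h pm in auto)
    finally show "(\<integral>f. \<Phi> f * ?c f \<partial>M) = (\<integral>f. \<Phi> f * q f \<partial>M)" .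
  qed
qed

end

lemma cyl_split: "cyl (True # s) g + cyl (False # s) g = cyl s g" "cyl [] g = 1"
  by (auto simp: cyl_def)

section \<open>Conditional laws that are equivariant under permutations of the even vertices\<close>

lemma extend_to_permutation:
  assumes A: "finite A" and \<beta>: "bij_betw \<beta> {..<card A} A"
  obtains \<sigma> :: "nat \<Rightarrow> nat" where "bij \<sigma>" "\<And>v. v < card A \<Longrightarrow> \<sigma> v = \<beta> v"
proof -
  let ?K = "{..<card A}"
  let ?B = "A \<union> ?K"
  have "card (?B - ?K) = card (?B - A)" using A by (simp add: card_Diff_subset)
  then obtain \<tau> where \<tau>: "bij_betw \<tau> (?B - ?K) (?B - A)"
    using finite_same_card_bij[of "?B - ?K" "?B - A"] A by auto
  define \<sigma> where "\<sigma> v = (if v \<in> ?K then \<beta> v else if v \<in> ?B then \<tau> v else v)" for v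
  have 1: "bij_betw \<sigma> ?K A" using \<beta> by (rule bij_betw_cong[THEN iffD1, rotated]) (simp add: \<sigma>_def)
  have 2: "bij_betw \<sigma> (?B - ?K) (?B - A)" 
    using \<tau> by (rule bij_betw_cong[THEN iffD1, rotated]) (auto simp: \<sigma>_def)
  have 3: "bij_betw \<sigma> (- ?B) (- ?B)" 
    using bij_betw_id by (rule bij_betw_cong[THEN iffD1, rotated]) (simp add: \<sigma>_def)
  have "bij_betw \<sigma> (?K \<union> (?B - ?K)) (A \<union> (?B - A))" by (rule bij_betw_combine[OF 1 2]) auto
  then have "bij_betw \<sigma> (?K \<union> (?B - ?K) \<union> - ?B) (A \<union> (?B - A) \<union> - ?B)"
    by (rule bij_betw_combine[OF _ 3]) auto
  moreover have "?K \<union> (?B - ?K) \<union> - ?B = UNIV" "A \<union> (?B - A) \<union> - ?B = UNIV" by auto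
  ultimately have "bij \<sigma>" by simp
  then show thesis by (rule that) (simp add: \<sigma>_def)
qed

definition lift_even :: "(nat \<Rightarrow> nat) \<Rightarrow> nat \<Rightarrow> nat" where
  "lift_even \<sigma> v = (if even v then 2 * \<sigma> (v div 2) else v)"

lemma lift_even_inverse: "(\<And>v. \<sigma> (\<tau> v) = v) \<Longrightarrow> lift_even \<sigma> (lift_even \<tau> v) = v"
  by (simp add: lift_even_def)

lemma inj_lift_even: "inj \<sigma> \<Longrightarrow> inj (lift_even \<sigma>)"
proof (rule injI)
  fix v w assume \<sigma>: "inj \<sigma>" and eq: "lift_even \<sigma> v = lift_even \<sigma> w"
  show "v = w"
  proof (cases "even v = even w")
    case True
    with eq have "even v \<Longrightarrow> v div 2 = w div 2" using injD[OF \<sigma>] by (simp add: lift_even_def)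
    with True eq show ?thesis by (cases "even v") (auto simp: lift_even_def elim!: evenE)
  next
    case False
    then show ?thesis using eq by (auto simp: lift_even_def split: if_splits)
  qed
qed

lemma ev_lift_even: "inj \<sigma> \<Longrightarrow> ev (lift_even \<sigma> ` S) = \<sigma> ` ev S"
proof -
  assume \<sigma>: "inj \<sigma>"
  have "2 * a = lift_even \<sigma> v \<longleftrightarrow> even v \<and> a = \<sigma> (v div 2)" for a v
    by (auto simp: lift_even_def)
  then have "ev (lift_even \<sigma> ` S) = {a. \<exists>v\<in>S. even v \<and> a = \<sigma> (v div 2)}"
    by (auto simp: ev_def image_iff)
  also have "\<dots> = \<sigma> ` ev S"
  proof (intro equalityI subsetI)
    fix a assume "a \<in> {a. \<exists>v\<in>S. even v \<and> a = \<sigma> (v div 2)}"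
    then obtain v where v: "v \<in> S" "even v" "a = \<sigma> (v div 2)" by blast
    then have "v div 2 \<in> ev S" by (simp add: ev_def)
    then show "a \<in> \<sigma> ` ev S" using v(3) by blast
  next
    fix a assume "a \<in> \<sigma> ` ev S"
    then obtain b where b: "2 * b \<in> S" "a = \<sigma> b" by (auto simp: ev_def)
    then show "a \<in> {a. \<exists>v\<in>S. even v \<and> a = \<sigma> (v div 2)}" by (auto intro!: bexI[of _ "2 * b"])
  qed
  finally show ?thesis .
qed

definition bijs :: "nat set \<Rightarrow> (nat \<Rightarrow> nat) set" where
  "bijs A = {\<beta> \<in> {..<card A} \<rightarrow>\<^sub>E A. bij_betw \<beta> {..<card A} A}"

lemma finite_bijs: "finite A \<Longrightarrow> finite (bijs A)"
  unfolding bijs_def by (rule finite_subset[OF _ finite_PiE[of "{..<card A}" "\<lambda>_. A"]]) auto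

lemma bijs_nonempty:
  assumes "finite A" shows "bijs A \<noteq> {}"
proof -
  obtain \<beta> where \<beta>: "bij_betw \<beta> {..<card A} A"
    using finite_same_card_bij[of "{..<card A}" A] assms by auto
  have "bij_betw (restrict \<beta> {..<card A}) {..<card A} A"
    using \<beta> by (rule bij_betw_cong[THEN iffD1, rotated]) simp
  moreover have "restrict \<beta> {..<card A} \<in> {..<card A} \<rightarrow>\<^sub>E A" using bij_betwE[OF \<beta>] by auto
  ultimately have "restrict \<beta> {..<card A} \<in> bijs A" unfolding bijs_def by blast
  then show ?thesis by blast
qed

lemma bijs_image: "\<beta> \<in> bijs A \<Longrightarrow> B \<subset> {..<card A} \<Longrightarrow> \<beta> ` B \<subset> A"
  unfolding bijs_def bij_betw_def using image_strict_mono[of \<beta> "{..<card A}" B] by auto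

context exchangeable_hypergraph
begin

lemma set_map_lift_even:
  assumes "inj \<sigma>" "finite B" shows "set_map (lift_even \<sigma>) (idx B j) = idx (\<sigma> ` B) j"
proof -
  have "lift_even \<sigma> ` ((\<lambda>a. 2 * a) ` B) = (\<lambda>a. 2 * a) ` \<sigma> ` B"
    "lift_even \<sigma> ` ((\<lambda>b. 2 * b + 1) ` set_decode j) = (\<lambda>b. 2 * b + 1) ` set_decode j"
    unfolding image_image by (intro image_cong refl, simp add: lift_even_def)+
  then have "lift_even \<sigma> ` set_decode (idx B j) = (\<lambda>a. 2 * a) ` \<sigma> ` B \<union> (\<lambda>b. 2 * b + 1) ` set_decode j"
    unfolding set_decode_idx[OF assms(2)] image_Un by (rule arg_cong2)
  then show ?thesis by (simp add: set_map_def idx_def)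
qed

lemma layer_relabel: "inj \<sigma> \<Longrightarrow> finite B \<Longrightarrow> layer (relabel (lift_even \<sigma>) f) B = layer f (\<sigma> ` B)"
  by (simp add: layer_def relabel_def set_map_lift_even)

definition is_cond :: "nat set \<Rightarrow> bool list \<Rightarrow> ((nat \<Rightarrow> bool) \<Rightarrow> real) \<Rightarrow> bool" where
  "is_cond A s q \<longleftrightarrow> q \<in> borel_measurable cantor \<and> (\<forall>f. 0 \<le> q f \<and> q f \<le> 1) \<and>
     (\<forall>f g. (\<forall>B. B \<subset> A \<longrightarrow> layer f B = layer g B) \<longrightarrow> q f = q g) \<and>
     (\<forall>\<Phi> b. \<Phi> \<in> borel_measurable cantor \<longrightarrow> (\<forall>f. \<bar>\<Phi> f\<bar> \<le> b) \<longrightarrow> (\<forall>f. \<Phi> (mask A f) = \<Phi> f) \<longrightarrow>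
       (\<integral>f. \<Phi> f * cyl s (layer f A) \<partial>M) = (\<integral>f. \<Phi> f * q f \<partial>M))"

text \<open>A fixed choice on the initial segments is transported to all other sets; averaging over
  all enumerations makes the result equivariant pointwise and not just almost everywhere.\<close>

definition kernel0 :: "nat \<Rightarrow> bool list \<Rightarrow> (nat set \<Rightarrow> nat \<Rightarrow> bool) \<Rightarrow> real" where
  "kernel0 k s y = (SOME q. is_cond {..<k} s q) (assemble y)"

definition raw :: "nat set \<Rightarrow> bool list \<Rightarrow> (nat set \<Rightarrow> nat \<Rightarrow> bool) \<Rightarrow> real" where
  "raw A s y = (\<Sum>\<beta>\<in>bijs A. kernel0 (card A) s (\<lambda>B. y (\<beta> ` B))) / real (card (bijs A))"

definition kernel :: "nat set \<Rightarrow> (nat set \<Rightarrow> nat \<Rightarrow> bool) \<Rightarrow> bool list \<Rightarrow> real" where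
  "kernel A y = repair (\<lambda>s. raw A s y)"

lemma is_cond_kernel0: "is_cond {..<k} s (\<lambda>f. kernel0 k s (layer f))"
proof -
  have "\<exists>q. is_cond {..<k} s q"
  proof (rule cond_prob[of "{..<k}" s])
    fix q :: "_ \<Rightarrow> real" assume q: "q \<in> borel_measurable cantor" "\<And>f. 0 \<le> q f" "\<And>f. q f \<le> 1"
      "\<And>f g. (\<And>B. B \<subset> {..<k} \<Longrightarrow> layer f B = layer g B) \<Longrightarrow> q f = q g"
      "\<And>\<Phi> b. \<Phi> \<in> borel_measurable cantor \<Longrightarrow> (\<And>f. \<bar>\<Phi> f\<bar> \<le> b) \<Longrightarrow> (\<And>f. \<Phi> (mask {..<k} f) = \<Phi> f) \<Longrightarrow>
       (\<integral>f. \<Phi> f * cyl s (layer f {..<k}) \<partial>M) = (\<integral>f. \<Phi> f * q f \<partial>M)"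
    have "is_cond {..<k} s q" unfolding is_cond_def
    proof (intro conjI allI impI)
      fix f g assume "\<forall>B. B \<subset> {..<k} \<longrightarrow> layer f B = layer g B"
      then show "q f = q g" by (intro q(4)) blast
    next
      fix \<Phi> :: "_ \<Rightarrow> real" and b
      assume \<Phi>: "\<Phi> \<in> borel_measurable cantor" "\<forall>f. \<bar>\<Phi> f\<bar> \<le> b" "\<forall>f. \<Phi> (mask {..<k} f) = \<Phi> f"
      show "(\<integral>f. \<Phi> f * cyl s (layer f {..<k}) \<partial>M) = (\<integral>f. \<Phi> f * q f \<partial>M)"
        by (rule q(5)[OF \<Phi>(1), of b]) (simp_all add: \<Phi>(2,3))
    qed (rule q(1) q(2) q(3))+
    then show ?thesis by blast
  qed simp
  then have "is_cond {..<k} s (SOME q. is_cond {..<k} s q)" by (rule someI_ex)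
  then show ?thesis by (simp add: kernel0_def)
qed

lemma kernel0_measurable: "(\<lambda>f. kernel0 k s (layer f)) \<in> borel_measurable cantor"
  and kernel0_bounds: "0 \<le> kernel0 k s y" "kernel0 k s y \<le> 1"
  and kernel0_cong: "(\<And>B. B \<subset> {..<k} \<Longrightarrow> y B = y' B) \<Longrightarrow> kernel0 k s y = kernel0 k s y'"
proof -
  have *: "kernel0 k s z = kernel0 k s (layer (assemble z))" for z by (simp add: kernel0_def)
  show "(\<lambda>f. kernel0 k s (layer f)) \<in> borel_measurable cantor"
    using is_cond_kernel0[of k s] unfolding is_cond_def by blast
  show "0 \<le> kernel0 k s y" "kernel0 k s y \<le> 1"
    unfolding *[of y] using is_cond_kernel0[of k s] unfolding is_cond_def by blast+
  assume eq: "\<And>B. B \<subset> {..<k} \<Longrightarrow> y B = y' B"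
  have "layer (assemble y) B = layer (assemble y') B" if "B \<subset> {..<k}" for B
    using eq[OF that] rev_finite_subset[of "{..<k}" B] that by (simp add: layer_assemble psubset_eq)
  then show "kernel0 k s y = kernel0 k s y'"
    unfolding *[of y] *[of y'] using is_cond_kernel0[of k s] unfolding is_cond_def by blast
qed

text \<open>A permutation that extends \<open>\<beta>\<close> is let act on the even vertices only.
  It carries the layers at subsets of \<open>{..<card A}\<close> to the layers at subsets of
  \<open>A\<close>, and exchangeability transports the defining property of the fixed choice along
  it.\<close>

lemma integral_kernel0:
  assumes A: "finite A" and \<beta>: "\<beta> \<in> bijs A" and \<Phi>: "\<Phi> \<in> borel_measurable cantor"
    "\<And>f. \<bar>\<Phi> f\<bar> \<le> b" "\<And>f. \<Phi> (mask A f) = \<Phi> f"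
  shows "(\<integral>f. \<Phi> f * cyl s (layer f A) \<partial>M) = (\<integral>f. \<Phi> f * kernel0 (card A) s (\<lambda>B. layer f (\<beta> ` B)) \<partial>M)"
proof -
  let ?k = "card A"
  have b: "bij_betw \<beta> {..<?k} A" using \<beta> by (simp add: bijs_def)
  obtain \<sigma> where \<sigma>: "bij \<sigma>" "\<And>v. v < ?k \<Longrightarrow> \<sigma> v = \<beta> v" 
    by (rule extend_to_permutation[OF A b]) (rule that)
  let ?\<tau> = "inv \<sigma>"
  have inj: "inj \<sigma>" "inj ?\<tau>" using \<sigma>(1) by (auto simp: bij_is_inj bij_imp_bij_inv)
  have inv: "?\<tau> (\<sigma> v) = v" "\<sigma> (?\<tau> v) = v" for v
    using \<sigma>(1) by (simp_all add: bij_is_inj surj_f_inv_f bij_is_surj)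
  have \<sigma>K: "\<sigma> ` {..<?k} = A" 
  proof -
    have "\<sigma> ` {..<?k} = \<beta> ` {..<?k}" using \<sigma>(2) by (intro image_cong) auto
    then show ?thesis using b by (simp add: bij_betw_def)
  qed
  have \<tau>A: "?\<tau> ` A = {..<?k}" 
  proof -
    have "?\<tau> ` \<sigma> ` {..<?k} = {..<?k}" unfolding image_image inv by simp
    then show ?thesis by (simp only: \<sigma>K)
  qed
  let ?r = "relabel (lift_even ?\<tau>)" and ?r' = "relabel (lift_even \<sigma>)"
  have rr: "?r (?r' f) = f" for f
  proof -
    have "set_map (lift_even \<sigma>) (set_map (lift_even ?\<tau>) i) = i" for i
      by (simp add: set_map_def image_image lift_even_inverse[of \<sigma> "inv \<sigma>", OF inv(2)])
    then show ?thesis by (simp add: relabel_def)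
  qed
  have [measurable]: "?r \<in> cantor \<rightarrow>\<^sub>M cantor" "?r' \<in> cantor \<rightarrow>\<^sub>M cantor" by (rule measurable_relabel)+
  have rmask: "?r (mask {..<?k} f) = mask A (?r f)" for f
  proof
    fix i
    have "{..<?k} \<subseteq> ?\<tau> ` ev (set_decode i) \<longleftrightarrow> A \<subseteq> ev (set_decode i)"
      using inj_image_subset_iff[OF inj(2), of A] by (simp only: \<tau>A)
    then show "?r (mask {..<?k} f) i = mask A (?r f) i"
      by (simp add: relabel_def mask_def ev_lift_even[OF inj(2)])
  qed
  have [measurable]: "(\<lambda>f. kernel0 ?k s (layer f)) \<in> borel_measurable cantor" by (rule kernel0_measurable)
  note \<Phi>(1)[measurable]
  have "(\<integral>f. \<Phi> f * cyl s (layer f A) \<partial>M) = (\<integral>f. \<Phi> (?r f) * cyl s (layer (?r f) A) \<partial>M)"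
    by (rule integral_relabel[OF inj_lift_even[OF inj(2)], symmetric]) measurable
  also have "\<dots> = (\<integral>f. \<Phi> (?r f) * cyl s (layer f {..<?k}) \<partial>M)"
    by (simp only: layer_relabel[OF inj(2) A] \<tau>A)
  also have "\<dots> = (\<integral>f. \<Phi> (?r f) * kernel0 ?k s (layer f) \<partial>M)"
  proof -
    have "(\<lambda>f. \<Phi> (?r f)) \<in> borel_measurable cantor" by measurable
    moreover have "\<forall>f. \<bar>\<Phi> (?r f)\<bar> \<le> b" "\<forall>f. \<Phi> (?r (mask {..<?k} f)) = \<Phi> (?r f)"
      using \<Phi> by (simp_all add: rmask)
    ultimately show ?thesis using is_cond_kernel0[of ?k s] unfolding is_cond_def by blast
  qed
  also have "\<dots> = (\<integral>f. \<Phi> (?r (?r' f)) * kernel0 ?k s (layer (?r' f)) \<partial>M)"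
    by (rule integral_relabel[OF inj_lift_even[OF inj(1)], symmetric]) measurable
  also have "\<dots> = (\<integral>f. \<Phi> f * kernel0 ?k s (\<lambda>B. layer f (\<beta> ` B)) \<partial>M)"
  proof -
    have "kernel0 ?k s (layer (?r' f)) = kernel0 ?k s (\<lambda>B. layer f (\<beta> ` B))" for f
    proof (rule kernel0_cong)
      fix B assume B: "B \<subset> {..<?k}"
      then have "\<sigma> ` B = \<beta> ` B" using \<sigma>(2) by (intro image_cong) auto
      moreover have "finite B" using B rev_finite_subset[of "{..<?k}" B] by blast
      ultimately show "layer (?r' f) B = layer f (\<beta> ` B)" using layer_relabel[OF inj(1)] by simp
    qed
    then show ?thesis by (simp add: rr)
  qed
  finally show ?thesis .
qed

lemma raw_bounds: "0 \<le> raw A s y" "raw A s y \<le> 1"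
proof -
  have "(\<Sum>\<beta>\<in>bijs A. kernel0 (card A) s (\<lambda>B. y (\<beta> ` B))) \<le> (\<Sum>\<beta>\<in>bijs A. 1)"
    by (intro sum_mono kernel0_bounds)
  then show "raw A s y \<le> 1" unfolding raw_def by (intro divide_le_eq_1[THEN iffD2]) auto
  show "0 \<le> raw A s y" unfolding raw_def by (intro divide_nonneg_nonneg sum_nonneg kernel0_bounds) simp
qed

lemma raw_cong:
  assumes "\<And>B. B \<subset> A \<Longrightarrow> y B = y' B" shows "raw A s y = raw A s y'"
  unfolding raw_def using assms bijs_image by (intro arg_cong2[of _ _ _ _ "(/)"] refl sum.cong kernel0_cong) auto

text \<open>Composition with \<open>\<alpha>\<close> is a bijection from the enumerations of
  \<open>A\<close> to those of its image, so both averages run over the same terms, for every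
  \<open>y\<close>.\<close>

lemma raw_equivariant:
  assumes A: "finite A" and \<alpha>: "inj_on \<alpha> A"
  shows "raw (\<alpha> ` A) s y = raw A s (\<lambda>B. y (\<alpha> ` B))"
proof -
  let ?k = "card A"
  have k: "card (\<alpha> ` A) = ?k" by (rule card_image[OF \<alpha>])
  define h where "h \<beta> = restrict (\<alpha> \<circ> \<beta>) {..<?k}" for \<beta>
  have bij: "bij_betw h (bijs A) (bijs (\<alpha> ` A))"
    unfolding bij_betw_def
  proof
    show "inj_on h (bijs A)"
    proof (rule inj_onI)
      fix \<beta> \<beta>' assume b: "\<beta> \<in> bijs A" "\<beta>' \<in> bijs A" "h \<beta> = h \<beta>'"
      show "\<beta> = \<beta>'"
      proof (rule PiE_ext[of _ "{..<?k}" "\<lambda>_. A"])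
        show "\<beta> \<in> {..<?k} \<rightarrow>\<^sub>E A" "\<beta>' \<in> {..<?k} \<rightarrow>\<^sub>E A" using b by (simp_all add: bijs_def)
        fix i assume i: "i \<in> {..<?k}"
        have "\<alpha> (\<beta> i) = \<alpha> (\<beta>' i)" using fun_cong[OF b(3), of i] i by (simp add: h_def)
        moreover have "\<beta> i \<in> A" "\<beta>' i \<in> A" using b i by (auto simp: bijs_def)
        ultimately show "\<beta> i = \<beta>' i" using inj_onD[OF \<alpha>] by blast
      qed
    qed
    show "h ` bijs A = bijs (\<alpha> ` A)"
    proof (intro equalityI subsetI)
      fix g assume "g \<in> h ` bijs A"
      then obtain \<beta> where g: "g = h \<beta>" "\<beta> \<in> bijs A" by blast
      have "bij_betw (\<alpha> \<circ> \<beta>) {..<?k} (\<alpha> ` A)"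
        by (rule bij_betw_trans[of _ _ A]) (use g(2) \<alpha> in \<open>auto simp: bijs_def inj_on_imp_bij_betw\<close>)
      then have "bij_betw g {..<?k} (\<alpha> ` A)" unfolding g(1) h_def
        by (rule bij_betw_cong[THEN iffD1, rotated]) simp
      then show "g \<in> bijs (\<alpha> ` A)" using bij_betwE by (auto simp: bijs_def k g(1) h_def) fastforce
    next
      fix g assume g: "g \<in> bijs (\<alpha> ` A)"
      let ?b = "restrict (inv_into A \<alpha> \<circ> g) {..<?k}"
      have gb: "bij_betw g {..<?k} (\<alpha> ` A)" using g by (simp add: bijs_def k)
      have "bij_betw (inv_into A \<alpha> \<circ> g) {..<?k} A"
        by (rule bij_betw_trans[OF gb bij_betw_inv_into[OF inj_on_imp_bij_betw[OF \<alpha>]]])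
      then have bb: "bij_betw ?b {..<?k} A" by (rule bij_betw_cong[THEN iffD1, rotated]) simp
      then have "?b \<in> bijs A" using bij_betwE[OF bb] by (auto simp: bijs_def)
      moreover have "h ?b = g"
      proof
        fix i show "h ?b i = g i"
        proof (cases "i < ?k")
          case True
          then have "g i \<in> \<alpha> ` A" using bij_betwE[OF gb] by simp
          with True show ?thesis by (simp add: h_def f_inv_into_f)
        next
          case False
          then show ?thesis using g by (simp add: h_def bijs_def k PiE_def extensional_def)
        qed
      qed
      ultimately show "g \<in> h ` bijs A" by (metis imageI)
    qed
  qed
  have "(\<Sum>\<gamma>\<in>bijs (\<alpha> ` A). kernel0 ?k s (\<lambda>B. y (\<gamma> ` B))) = (\<Sum>\<beta>\<in>bijs A. kernel0 ?k s (\<lambda>B. y (h \<beta> ` B)))"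
    by (rule sum.reindex_bij_betw[OF bij, symmetric])
  also have "\<dots> = (\<Sum>\<beta>\<in>bijs A. kernel0 ?k s (\<lambda>B. y (\<alpha> ` \<beta> ` B)))"
  proof (intro sum.cong refl kernel0_cong)
    fix \<beta> B assume "B \<subset> {..<?k}"
    then have "h \<beta> ` B = \<alpha> ` \<beta> ` B" unfolding h_def image_image by (intro image_cong) auto
    then show "y (h \<beta> ` B) = y (\<alpha> ` \<beta> ` B)" by simp
  qed
  finally show ?thesis unfolding raw_def k using bij_betw_same_card[OF bij] by simp
qed

lemma raw_measurable:
  assumes "\<And>B. B \<subset> A \<Longrightarrow> (\<lambda>\<omega>. Y \<omega> B) \<in> N \<rightarrow>\<^sub>M cantor"
  shows "(\<lambda>\<omega>. raw A s (Y \<omega>)) \<in> borel_measurable N"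
proof -
  \<comment> \<open>\<open>raw\<close> looks only at proper subsets of \<open>A\<close>; overwriting
    all other entries by a constant makes every entry measurable.\<close>
  define Z where "Z \<omega> B = (if B \<subset> A then Y \<omega> B else (\<lambda>_. False))" for \<omega> B
  have Z: "(\<lambda>\<omega>. Z \<omega> B) \<in> N \<rightarrow>\<^sub>M cantor" for B
    using assms by (cases "B \<subset> A") (auto simp: Z_def)
  have eq: "(\<lambda>\<omega>. raw A s (Y \<omega>)) = (\<lambda>\<omega>. raw A s (Z \<omega>))"
    by (intro ext raw_cong) (simp add: Z_def)
  have "(\<lambda>\<omega>. kernel0 (card A) s (\<lambda>B. Z \<omega> (\<beta> ` B))) \<in> borel_measurable N" for \<beta>
  proof -
    have "(\<lambda>\<omega>. assemble (\<lambda>B. Z \<omega> (\<beta> ` B))) \<in> N \<rightarrow>\<^sub>M cantor"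
      unfolding assemble_def cantor_def
    proof (rule measurable_PiM_single')
      fix i
      show "(\<lambda>\<omega>. Z \<omega> (\<beta> ` ev (set_decode i)) (set_encode (od (set_decode i)))) \<in> N \<rightarrow>\<^sub>M count_space UNIV"
        by (rule measurable_compose[OF Z cantor_component])
    qed (auto simp: space_PiM)
    from measurable_compose[OF this kernel0_measurable] show ?thesis by (simp add: kernel0_def)
  qed
  then show ?thesis unfolding eq unfolding raw_def by simp
qed

lemma raw_layer_measurable: "(\<lambda>f. raw A s (layer f)) \<in> borel_measurable cantor"
  by (rule raw_measurable) simp

lemma raw_mask:
  assumes "finite A" shows "raw A s (layer (mask A f)) = raw A s (layer f)"
  by (rule raw_cong) (use rev_finite_subset[OF assms] in \<open>auto intro!: layer_mask\<close>)

lemma integral_raw: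
  assumes A: "finite A" and \<Phi>: "\<Phi> \<in> borel_measurable cantor"
    "\<And>f. \<bar>\<Phi> f\<bar> \<le> b" "\<And>f. \<Phi> (mask A f) = \<Phi> f"
  shows "(\<integral>f. \<Phi> f * cyl s (layer f A) \<partial>M) = (\<integral>f. \<Phi> f * raw A s (layer f) \<partial>M)"
proof -
  let ?c = "real (card (bijs A))"
  let ?t = "\<lambda>\<beta> f. kernel0 (card A) s (\<lambda>B. layer f (\<beta> ` B))"
  have c: "?c > 0" using finite_bijs[OF A] bijs_nonempty[OF A] by (simp add: card_gt_0_iff)
  have m: "?t \<beta> \<in> borel_measurable cantor" for \<beta>
  proof -
    have "(\<lambda>\<omega>. assemble (\<lambda>B. layer \<omega> (\<beta> ` B))) \<in> cantor \<rightarrow>\<^sub>M cantor"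
      unfolding assemble_def layer_def by (rule measurable_cantor_reindex)
    from measurable_compose[OF this kernel0_measurable] show ?thesis by (simp add: kernel0_def)
  qed
  have int: "integrable M (\<lambda>f. \<Phi> f * ?t \<beta> f)" for \<beta>
  proof (rule integrable_bounded[of _ b])
    fix f show "\<bar>\<Phi> f * ?t \<beta> f\<bar> \<le> b"
      using mult_mono[OF \<Phi>(2)[of f], of "?t \<beta> f" 1] kernel0_bounds \<Phi>(2)[of f] by (simp add: abs_mult)
  qed (use \<Phi>(1) m in measurable)
  have "(\<integral>f. \<Phi> f * raw A s (layer f) \<partial>M) = (\<integral>f. (\<Sum>\<beta>\<in>bijs A. \<Phi> f * ?t \<beta> f) / ?c \<partial>M)"
    by (simp add: raw_def sum_distrib_left)
  also have "\<dots> = (\<Sum>\<beta>\<in>bijs A. \<integral>f. \<Phi> f * ?t \<beta> f \<partial>M) / ?c"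
    by (simp add: Bochner_Integration.integral_sum[OF int])
  also have "\<dots> = (\<Sum>\<beta>\<in>bijs A. \<integral>f. \<Phi> f * cyl s (layer f A) \<partial>M) / ?c"
    using integral_kernel0[OF A _ \<Phi>] by simp
  also have "\<dots> = (\<integral>f. \<Phi> f * cyl s (layer f A) \<partial>M)" using c by simp
  finally show ?thesis by simp
qed

lemma AE_eq_0_if_orthogonal:
  assumes "\<Phi> \<in> borel_measurable cantor" "\<And>f. \<bar>\<Phi> f\<bar> \<le> (b :: real)" "(\<integral>f. \<Phi> f * \<Phi> f \<partial>M) = 0"
  shows "AE f in M. \<Phi> f = 0"
proof -
  have "integrable M (\<lambda>f. \<Phi> f * \<Phi> f)"
  proof (rule integrable_bounded[of _ "b * b"])
    fix f show "\<bar>\<Phi> f * \<Phi> f\<bar> \<le> b * b"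
      using mult_mono[OF assms(2,2)[of f]] assms(2)[of f] by (simp add: abs_mult)
  qed (use assms(1) in measurable)
  from integral_nonneg_eq_0_iff_AE[OF this] assms(3) show ?thesis by simp
qed

text \<open>The defect in each equation is invariant under \<open>mask A\<close>, so it may serve as
  its own test function. Against it \<open>raw\<close> can be replaced by \<open>cyl\<close>, for
  which the equation is an identity; hence the square of the defect integrates to zero.\<close>

lemma raw_bit_law:
  assumes A: "finite A" shows "AE f in M. bit_law (\<lambda>s. raw A s (layer f))"
proof -
  let ?r = "\<lambda>s f. raw A s (layer f)"
  note [measurable] = raw_layer_measurable
  note rm = raw_mask[OF A]
  note rb = raw_bounds[of A]
  have int: "integrable M (\<lambda>f. \<Phi> f * ?r s f)" "integrable M (\<lambda>f. \<Phi> f * cyl s (layer f A))"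
    if "\<Phi> \<in> borel_measurable cantor" "\<And>f. \<bar>\<Phi> f\<bar> \<le> 2" for \<Phi> s
  proof -
    show "integrable M (\<lambda>f. \<Phi> f * ?r s f)"
    proof (rule integrable_bounded[of _ 2])
      fix f show "\<bar>\<Phi> f * ?r s f\<bar> \<le> 2"
        using mult_mono[OF that(2)[of f], of "?r s f" 1] rb by (simp add: abs_mult)
    qed (use that(1) in measurable)
    show "integrable M (\<lambda>f. \<Phi> f * cyl s (layer f A))"
    proof (rule integrable_bounded[of _ 2])
      fix f show "\<bar>\<Phi> f * cyl s (layer f A)\<bar> \<le> 2"
        using mult_mono[OF that(2)[of f], of "cyl s (layer f A)" 1] cyl_bounds by (simp add: abs_mult)
    qed (use that(1) in measurable)
  qed
  have "AE f in M. ?r [] f - 1 = 0"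
  proof (rule AE_eq_0_if_orthogonal[of _ 2])
    let ?\<Phi> = "\<lambda>f. ?r [] f - 1"
    have \<Phi>: "?\<Phi> \<in> borel_measurable cantor" by measurable
    have b: "\<bar>?\<Phi> f\<bar> \<le> 2" for f using rb[of "[]" "layer f"] by simp
    have "(\<integral>f. ?\<Phi> f * 1 \<partial>M) = (\<integral>f. ?\<Phi> f * ?r [] f \<partial>M)"
      using integral_raw[OF A \<Phi> b, of "[]"] rm by (simp add: cyl_split)
    moreover have "(\<integral>f. ?\<Phi> f * ?\<Phi> f \<partial>M) = (\<integral>f. ?\<Phi> f * ?r [] f \<partial>M) - (\<integral>f. ?\<Phi> f * 1 \<partial>M)"
      by (subst Bochner_Integration.integral_diff[symmetric])
        (use int(1)[OF \<Phi> b] int(2)[OF \<Phi> b, of "[]"] in \<open>auto simp: cyl_split right_diff_distrib\<close>)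
    ultimately show "(\<integral>f. ?\<Phi> f * ?\<Phi> f \<partial>M) = 0" by simp
  qed (use rb[of "[]"] in \<open>measurable, smt (verit)\<close>)
  moreover have "AE f in M. ?r (True # s) f + ?r (False # s) f - ?r s f = 0" for s
  proof (rule AE_eq_0_if_orthogonal[of _ 2])
    let ?\<Phi> = "\<lambda>f. ?r (True # s) f + ?r (False # s) f - ?r s f"
    show \<Phi>: "?\<Phi> \<in> borel_measurable cantor" by measurable
    show b: "\<bar>?\<Phi> f\<bar> \<le> 2" for f 
      using rb[of "True # s" "layer f"] rb[of "False # s" "layer f"] rb[of s "layer f"] by linarith
    have e: "(\<integral>f. ?\<Phi> f * cyl t (layer f A) \<partial>M) = (\<integral>f. ?\<Phi> f * ?r t f \<partial>M)" for t
      by (rule integral_raw[OF A \<Phi> b]) (simp add: rm)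
    note i = int[OF \<Phi> b]
    have "(\<integral>f. ?\<Phi> f * ?\<Phi> f \<partial>M) = 
        (\<integral>f. ?\<Phi> f * ?r (True # s) f \<partial>M) + (\<integral>f. ?\<Phi> f * ?r (False # s) f \<partial>M) - (\<integral>f. ?\<Phi> f * ?r s f \<partial>M)"
      using i(1)[of "True # s"] i(1)[of "False # s"] i(1)[of s]
      by (simp only: distrib_left right_diff_distrib Bochner_Integration.integral_add
          Bochner_Integration.integral_diff Bochner_Integration.integrable_add)
    also have "\<dots> = (\<integral>f. ?\<Phi> f * cyl (True # s) (layer f A) + ?\<Phi> f * cyl (False # s) (layer f A)
         - ?\<Phi> f * cyl s (layer f A) \<partial>M)"
      unfolding e[symmetric] using i(2)[of "True # s"] i(2)[of "False # s"] i(2)[of s] by simp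
    also have "\<dots> = (\<integral>f. 0 \<partial>M)"
      by (simp only: distrib_left[symmetric] cyl_split diff_self)
    finally show "(\<integral>f. ?\<Phi> f * ?\<Phi> f \<partial>M) = 0" by simp
  qed
  ultimately have "AE f in M. ?r [] f - 1 = 0 \<and> (\<forall>s. ?r (True # s) f + ?r (False # s) f - ?r s f = 0)"
    by (simp add: AE_all_countable)
  then show ?thesis by eventually_elim (simp add: bit_law_def rb)
qed

lemma bit_law_kernel: "bit_law (kernel A y)"
  unfolding kernel_def by (rule bit_law_repair)

lemma kernel_cong: "(\<And>B. B \<subset> A \<Longrightarrow> y B = y' B) \<Longrightarrow> kernel A y = kernel A y'"
  unfolding kernel_def using raw_cong[of A y y'] by simp

lemma kernel_equivariant:
  "finite A \<Longrightarrow> inj_on \<alpha> A \<Longrightarrow> kernel (\<alpha> ` A) y = kernel A (\<lambda>B. y (\<alpha> ` B))"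
  unfolding kernel_def by (simp add: raw_equivariant)

lemma kernel_measurable:
  "(\<And>B. B \<subset> A \<Longrightarrow> (\<lambda>\<omega>. Y \<omega> B) \<in> N \<rightarrow>\<^sub>M cantor) \<Longrightarrow> (\<lambda>\<omega>. kernel A (Y \<omega>) s) \<in> borel_measurable N"
  unfolding kernel_def by (intro repair_measurable raw_measurable)

text \<open>Almost surely \<open>raw\<close> is a bit law, which \<open>repair\<close> leaves alone,
  so \<open>kernel\<close> inherits the property of a conditional probability.\<close>

lemma nn_integral_kernel:
  assumes A: "finite A" and E: "E \<in> sets cantor" "\<And>f. mask A f \<in> E \<longleftrightarrow> f \<in> E"
  shows "(\<integral>\<^sup>+f. indicator E f * ennreal (kernel A (layer f) s) \<partial>M) =
    emeasure M {f \<in> E. bits_upto (length s) (layer f A) = s}"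
proof -
  note [measurable] = raw_layer_measurable E(1)
  let ?E = "{f \<in> E. bits_upto (length s) (layer f A) = s}"
  have m: "?E \<in> sets M"
  proof -
    have "{f \<in> space cantor. cyl s (layer f A) = 1} \<inter> E \<in> sets cantor" by measurable
    also have "{f \<in> space cantor. cyl s (layer f A) = 1} \<inter> E = ?E" by (auto simp: cyl_def)
    finally show ?thesis by (simp add: sets_M)
  qed
  have "(\<integral>\<^sup>+f. indicator E f * ennreal (kernel A (layer f) s) \<partial>M) = 
      (\<integral>\<^sup>+f. ennreal (indicator E f * raw A s (layer f)) \<partial>M)"
    by (rule nn_integral_cong_AE, use raw_bit_law[OF A] in eventually_elim)
      (auto simp: kernel_def repair_eq indicator_def)
  also have "\<dots> = ennreal (\<integral>f. indicator E f * raw A s (layer f) \<partial>M)"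
  proof (rule nn_integral_eq_integral)
    show "integrable M (\<lambda>f. indicator E f * raw A s (layer f))"
      by (rule integrable_bounded[of _ 1]) (use raw_bounds in \<open>auto simp: indicator_def\<close>)
  qed (simp add: raw_bounds)
  also have "(\<integral>f. indicator E f * raw A s (layer f) \<partial>M) = (\<integral>f. indicator E f * cyl s (layer f A) \<partial>M)"
    by (rule integral_raw[OF A, of _ 1, symmetric]) (use E in \<open>auto simp: indicator_def\<close>)
  also have "(\<lambda>f. indicator E f * cyl s (layer f A)) = indicator ?E"
    by (auto simp: cyl_def indicator_def)
  also have "ennreal (\<integral>f. indicator ?E f \<partial>M) = emeasure M ?E"
    using m by (simp add: M.emeasure_eq_measure)
  finally show ?thesis .
qed

end

section \<open>Simulation by independent uniform variables\<close>

text \<open>Restricting the measures to \<open>D\<close> and \<open>D'\<close> and mapping them to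
  bit sequences reduces the claim to prefix sets.\<close>

lemma cantor_joint_eqI:
  assumes N: "finite_measure N" "finite_measure N'" and D: "D \<in> sets N" "D' \<in> sets N'"
    and g: "g \<in> N \<rightarrow>\<^sub>M cantor" "g' \<in> N' \<rightarrow>\<^sub>M cantor"
    and eq: "\<And>s. emeasure N {x \<in> D. bits_upto (length s) (g x) = s} =
      emeasure N' {x \<in> D'. bits_upto (length s) (g' x) = s}"
    and C: "C \<in> sets cantor"
  shows "emeasure N {x \<in> D. g x \<in> C} = emeasure N' {x \<in> D'. g' x \<in> C}"
proof -
  have em: "emeasure (distr (density N (indicator D)) cantor g) C = emeasure N {x \<in> D. g x \<in> C}"
    if "D \<in> sets N" "g \<in> N \<rightarrow>\<^sub>M cantor" "C \<in> sets cantor" for N :: "'z measure" and D g C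
  proof -
    have m: "g -` C \<inter> space N \<in> sets N" by (rule measurable_sets[OF that(2,3)])
    have "emeasure (distr (density N (indicator D)) cantor g) C = emeasure (density N (indicator D)) (g -` C \<inter> space N)"
      using that by (subst emeasure_distr) auto
    also have "\<dots> = emeasure N (D \<inter> (g -` C \<inter> space N))"
      by (rule emeasure_restricted[OF that(1) m])
    also have "D \<inter> (g -` C \<inter> space N) = {x \<in> D. g x \<in> C}"
      using sets.sets_into_space[OF that(1)] by auto
    finally show ?thesis .
  qed
  have "distr (density N (indicator D)) cantor g = distr (density N' (indicator D')) cantor g'"
  proof (rule cantor_measure_eqI)
    show "finite_measure (distr (density N (indicator D)) cantor g)"
      by (intro finite_measure.finite_measure_distr finite_measure.finite_measure_restricted N D) (simp add: g)
    fix n s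
    show "emeasure (distr (density N (indicator D)) cantor g) {f. bits_upto n f = s} =
      emeasure (distr (density N' (indicator D')) cantor g') {f. bits_upto n f = s}"
    proof (cases "n = length s")
      case True
      then show ?thesis using eq[of s]
        by (simp add: em[OF D(1) g(1) sets_cantor_cylinder] em[OF D(2) g(2) sets_cantor_cylinder])
    next
      case False
      then have "{f. bits_upto n f = s} = {}" by auto
      then show ?thesis by simp
    qed
  qed simp_all
  then show ?thesis using em[OF D(1) g(1) C] em[OF D(2) g(2) C] by simp
qed

locale simulation = exchangeable_hypergraph M l p + Omega: prob_space \<Omega>
  for M :: "(nat \<Rightarrow> bool) measure" and l p and \<Omega> :: "'y measure" +
  fixes V :: "'y \<Rightarrow> real"
  assumes V: "uniform_rv \<Omega> V"
begin

text \<open>The layer at \<open>A\<close> is drawn from its conditional law given the layers already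
  drawn at proper subsets. The guard \<open>B \<subset> A\<close> gives termination and is invisible
  to the kernel. The sequence \<open>c\<close> plays the layer at the empty set and is also the
  default value at infinite sets.\<close>

function hat :: "(nat \<Rightarrow> bool) \<Rightarrow> (nat set \<Rightarrow> real) \<Rightarrow> nat set \<Rightarrow> nat \<Rightarrow> bool" where
  "hat c u A = (if finite A \<and> A \<noteq> {} 
     then code (kernel A (\<lambda>B. if B \<subset> A then hat c u B else (\<lambda>_. False))) (u A) else c)"
  by pat_completeness auto
termination
  by (relation "Wellfounded.measure (\<lambda>(c, u, A). card A)") (auto intro: psubset_card_mono)

declare hat.simps [simp del]

lemma hat_empty [simp]: "hat c u {} = c"
  by (simp add: hat.simps)

lemma hat_eq:
  assumes "finite A" "A \<noteq> {}" shows "hat c u A = code (kernel A (hat c u)) (u A)"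
proof -
  have "kernel A (\<lambda>B. if B \<subset> A then hat c u B else (\<lambda>_. False)) = kernel A (hat c u)"
    by (rule kernel_cong) simp
  then show ?thesis using assms by (subst hat.simps) simp
qed

text \<open>Equivariance of the kernel at every point is inherited along the recursion. It is what
  allows a single peon to describe all tuples of vertices.\<close>

lemma hat_equivariant:
  assumes "finite A" "inj_on \<beta> A" "\<And>B. B \<subseteq> A \<Longrightarrow> B \<noteq> {} \<Longrightarrow> u' B = u (\<beta> ` B)"
  shows "hat c u' A = hat c u (\<beta> ` A)"
  using assms
proof (induction A rule: finite_psubset_induct)
  case (psubset A)
  show ?case
  proof (cases "A = {}")
    case False
    have "kernel (\<beta> ` A) (hat c u) = kernel A (\<lambda>B. hat c u (\<beta> ` B))"
      by (rule kernel_equivariant[OF psubset(1) psubset.prems(1)])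
    also have "\<dots> = kernel A (hat c u')"
    proof (rule kernel_cong)
      fix B assume B: "B \<subset> A"
      have "inj_on \<beta> B" using psubset.prems(1) B inj_on_subset by blast
      moreover have "u' D = u (\<beta> ` D)" if "D \<subseteq> B" "D \<noteq> {}" for D
        by (rule psubset.prems(2)) (use that B in auto)
      ultimately show "hat c u (\<beta> ` B) = hat c u' B" using psubset(2)[OF B] by simp
    qed
    finally show ?thesis using psubset False by (simp add: hat_eq)
  qed simp
qed

lemma hat_cong:
  "finite A \<Longrightarrow> (\<And>B. B \<subseteq> A \<Longrightarrow> B \<noteq> {} \<Longrightarrow> u' B = u B) \<Longrightarrow> hat c u' A = hat c u A"
  using hat_equivariant[of A id u' u c] by simp

lemma hat_measurable:
  assumes "finite A" "c \<in> N \<rightarrow>\<^sub>M cantor" "\<And>B. B \<subseteq> A \<Longrightarrow> B \<noteq> {} \<Longrightarrow> (\<lambda>\<omega>. u \<omega> B) \<in> borel_measurable N"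
  shows "(\<lambda>\<omega>. hat (c \<omega>) (u \<omega>) A) \<in> N \<rightarrow>\<^sub>M cantor"
  using assms
proof (induction A rule: finite_psubset_induct)
  case (psubset A)
  show ?case
  proof (cases "A = {}")
    case False
    have "(\<lambda>\<omega>. hat (c \<omega>) (u \<omega>) B) \<in> N \<rightarrow>\<^sub>M cantor" if "B \<subset> A" for B
      using psubset(2)[OF that psubset.prems(1)] psubset.prems(2) that by blast
    then have "(\<lambda>\<omega>. code (kernel A (hat (c \<omega>) (u \<omega>))) (u \<omega> A)) \<in> N \<rightarrow>\<^sub>M cantor"
      by (intro code_measurable kernel_measurable psubset.prems(2)) (use False in auto)
    then show ?thesis using psubset False by (simp add: hat_eq)
  qed (use psubset.prems in simp)
qed

text \<open>Closure under nonempty subsets guarantees that all variables used by the recursion at a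
  member of \<open>S\<close> are available.\<close>

definition closed_sets :: "nat set set \<Rightarrow> bool" where
  "closed_sets S \<longleftrightarrow> finite S \<and> (\<forall>A\<in>S. finite A \<and> A \<noteq> {} \<and> (\<forall>B. B \<subseteq> A \<longrightarrow> B \<noteq> {} \<longrightarrow> B \<in> S))"

definition sim_space :: "nat set set \<Rightarrow> ((nat \<Rightarrow> bool) \<times> (nat set \<Rightarrow> 'y)) measure" where
  "sim_space S = M \<Otimes>\<^sub>M Pi\<^sub>M S (\<lambda>_. \<Omega>)"

definition sim :: "(nat \<Rightarrow> bool) \<times> (nat set \<Rightarrow> 'y) \<Rightarrow> nat set \<Rightarrow> nat \<Rightarrow> bool" where
  "sim \<omega> = hat (fst \<omega>) (\<lambda>B. V (snd \<omega> B))"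

lemma V_measurable [measurable]: "V \<in> borel_measurable \<Omega>"
  using V by (simp add: uniform_rv_def)

lemma prob_space_sim: "prob_space (sim_space S)"
proof -
  interpret Q: prob_space "Pi\<^sub>M S (\<lambda>_. \<Omega>)" by (rule prob_space_PiM) unfold_locales
  interpret R: pair_prob_space M "Pi\<^sub>M S (\<lambda>_. \<Omega>)" ..
  show ?thesis unfolding sim_space_def by (rule R.prob_space_axioms)
qed

lemma sim_measurable:
  assumes S: "closed_sets S" and B: "B \<in> insert {} S"
  shows "(\<lambda>\<omega>. sim \<omega> B) \<in> sim_space S \<rightarrow>\<^sub>M cantor"
  unfolding sim_def
proof (rule hat_measurable)
  show "finite B" using S B by (auto simp: closed_sets_def)
  show "fst \<in> sim_space S \<rightarrow>\<^sub>M cantor"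
    unfolding sim_space_def by (simp flip: measurable_M)
  fix D assume "D \<subseteq> B" "D \<noteq> {}"
  then have "D \<in> S" using S B unfolding closed_sets_def by auto
  then show "(\<lambda>\<omega>. V (snd \<omega> D)) \<in> borel_measurable (sim_space S)"
    unfolding sim_space_def by measurable
qed

section \<open>The joint law of finitely many simulated layers\<close>

definition tuple :: "nat set set \<Rightarrow> (nat set \<Rightarrow> nat \<Rightarrow> bool) \<Rightarrow> nat set \<Rightarrow> nat \<Rightarrow> bool" where
  "tuple S y = (\<lambda>B\<in>insert {} S. y B)"

abbreviation tuples :: "nat set set \<Rightarrow> (nat set \<Rightarrow> nat \<Rightarrow> bool) measure" where
  "tuples S \<equiv> Pi\<^sub>M (insert {} S) (\<lambda>_. cantor)"

lemma tuple_measurable: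
  "closed_sets S \<Longrightarrow> (\<lambda>\<omega>. tuple S (sim \<omega>)) \<in> sim_space S \<rightarrow>\<^sub>M tuples S"
  "(\<lambda>f. tuple S (layer f)) \<in> cantor \<rightarrow>\<^sub>M tuples S"
  unfolding tuple_def by (intro measurable_restrict sim_measurable, assumption+) (intro measurable_restrict measurable_layer)

lemma tuple_box: "tuple S y \<in> Pi\<^sub>E (insert {} S) Z \<longleftrightarrow> (\<forall>B\<in>insert {} S. y B \<in> Z B)"
  by (auto simp: tuple_def PiE_iff)

lemma box_sets:
  assumes Z: "\<And>B. Z B \<in> sets cantor"
  shows "closed_sets S \<Longrightarrow> {\<omega> \<in> space (sim_space S). \<forall>B\<in>insert {} S. sim \<omega> B \<in> Z B} \<in> sets (sim_space S)"
    "finite S \<Longrightarrow> {f. \<forall>B\<in>insert {} S. layer f B \<in> Z B} \<in> sets cantor"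
proof -
  have Z': "Pi\<^sub>E (insert {} S) Z \<in> sets (tuples S)" if "finite S"
    using that Z by (intro sets_PiM_I_finite) auto
  show "{\<omega> \<in> space (sim_space S). \<forall>B\<in>insert {} S. sim \<omega> B \<in> Z B} \<in> sets (sim_space S)" if "closed_sets S"
    using measurable_sets[OF tuple_measurable(1)[OF that] Z'] that
    unfolding vimage_def tuple_box closed_sets_def by (simp add: Int_def conj_commute)
  show "{f. \<forall>B\<in>insert {} S. layer f B \<in> Z B} \<in> sets cantor" if "finite S"
    using measurable_sets[OF tuple_measurable(2) Z'[OF that]] 
    unfolding vimage_def tuple_box by simp
qed

definition box_law :: "nat set set \<Rightarrow> bool" where
  "box_law S \<longleftrightarrow> (\<forall>Z. (\<forall>B. Z B \<in> sets cantor) \<longrightarrow>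
     emeasure (sim_space S) {\<omega> \<in> space (sim_space S). \<forall>B\<in>insert {} S. sim \<omega> B \<in> Z B} =
     emeasure M {f. \<forall>B\<in>insert {} S. layer f B \<in> Z B})"

lemma distr_tuple_eq:
  assumes S: "closed_sets S" and box: "box_law S"
  shows "distr (sim_space S) (tuples S) (\<lambda>\<omega>. tuple S (sim \<omega>)) = distr M (tuples S) (\<lambda>f. tuple S (layer f))"
proof (rule measure_eqI_PiM_finite[where I = "insert {} S" and M = "\<lambda>_. cantor" and A = "\<lambda>_::nat. space (tuples S)"])
  have fin: "finite S" using S by (simp add: closed_sets_def)
  then show "finite (insert {} S)" by simp
  fix A :: "nat set \<Rightarrow> (nat \<Rightarrow> bool) set" assume A: "\<And>i. i \<in> insert {} S \<Longrightarrow> A i \<in> sets cantor"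
  define Z where "Z B = (if B \<in> insert {} S then A B else UNIV)" for B
  have Z: "Z B \<in> sets cantor" for B using A sets.top[of cantor] by (auto simp: Z_def)
  have eq: "Pi\<^sub>E (insert {} S) A = Pi\<^sub>E (insert {} S) Z" by (intro PiE_cong) (simp add: Z_def)
  have Z': "Pi\<^sub>E (insert {} S) Z \<in> sets (tuples S)" using fin Z by (intro sets_PiM_I_finite) auto
  have mM: "(\<lambda>f. tuple S (layer f)) \<in> M \<rightarrow>\<^sub>M tuples S" using tuple_measurable(2) by simp
  have "emeasure (distr (sim_space S) (tuples S) (\<lambda>\<omega>. tuple S (sim \<omega>))) (Pi\<^sub>E (insert {} S) Z) =
      emeasure (sim_space S) {\<omega> \<in> space (sim_space S). \<forall>B\<in>insert {} S. sim \<omega> B \<in> Z B}"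
    unfolding emeasure_distr[OF tuple_measurable(1)[OF S] Z'] vimage_def tuple_box
    by (simp add: Int_def conj_commute)
  also have "\<dots> = emeasure M {f. \<forall>B\<in>insert {} S. layer f B \<in> Z B}"
    using box Z unfolding box_law_def by blast
  also have "\<dots> = emeasure (distr M (tuples S) (\<lambda>f. tuple S (layer f))) (Pi\<^sub>E (insert {} S) Z)"
    unfolding emeasure_distr[OF mM Z'] vimage_def tuple_box by simp
  finally show "emeasure (distr (sim_space S) (tuples S) (\<lambda>\<omega>. tuple S (sim \<omega>))) (Pi\<^sub>E (insert {} S) A) =
      emeasure (distr M (tuples S) (\<lambda>f. tuple S (layer f))) (Pi\<^sub>E (insert {} S) A)" unfolding eq .
next
  interpret N: prob_space "sim_space S" by (rule prob_space_sim)
  interpret D: prob_space "distr (sim_space S) (tuples S) (\<lambda>\<omega>. tuple S (sim \<omega>))"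
    by (rule N.prob_space_distr[OF tuple_measurable(1)[OF S]])
  fix i :: nat show "emeasure (distr (sim_space S) (tuples S) (\<lambda>\<omega>. tuple S (sim \<omega>))) (space (tuples S)) \<noteq> \<infinity>"
    by (simp add: D.emeasure_eq_measure)
next
  show "range (\<lambda>_::nat. space (tuples S)) \<subseteq> prod_algebra (insert {} S) (\<lambda>_. cantor)"
  proof -
    have "Pi\<^sub>E (insert {} S) (\<lambda>_. space cantor) \<in> prod_algebra (insert {} S) (\<lambda>_. cantor)"
    proof (rule prod_algebraI_finite)
      show "finite (insert {} S)" using S by (simp add: closed_sets_def)
      show "\<forall>i\<in>insert {} S. space cantor \<in> sets cantor" by (intro ballI sets.top)
    qed
    then show ?thesis unfolding space_PiM by blast
  qed
qed auto

text \<open>The layer at the empty set is the relabelling along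
  \<open>\<lambda>b. 2 * b + 1\<close>, hence again distributed as \<open>M\<close>. This is why
  \<open>sim_space\<close> draws \<open>c\<close> from \<open>M\<close>.\<close>

lemma box_law_empty: "box_law {}"
  unfolding box_law_def
proof (intro allI impI)
  fix Z :: "nat set \<Rightarrow> (nat \<Rightarrow> bool) set" assume Z: "\<forall>B. Z B \<in> sets cantor"
  interpret P: prob_space "Pi\<^sub>M {} (\<lambda>_. \<Omega>)" by (rule prob_space_PiM) unfold_locales
  let ?\<rho> = "\<lambda>b :: nat. 2 * b + 1"
  have "emeasure (sim_space {}) {\<omega> \<in> space (sim_space {}). \<forall>B\<in>{{}}. sim \<omega> B \<in> Z B} =
      emeasure (sim_space {}) (Z {} \<times> space (Pi\<^sub>M {} (\<lambda>_. \<Omega>)))"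
    by (rule arg_cong[where f = "emeasure _"]) (auto simp: sim_space_def space_pair_measure sim_def)
  also have "\<dots> = emeasure M (Z {})"
    unfolding sim_space_def using Z by (subst P.emeasure_pair_measure_Times) (auto simp: sets_M P.emeasure_space_1)
  also have "\<dots> = emeasure (distr M M (relabel ?\<rho>)) (Z {})" by (subst distr_relabel) (auto simp: inj_def)
  also have "\<dots> = emeasure M {f. relabel ?\<rho> f \<in> Z {}}"
    using Z by (subst emeasure_distr) (auto simp: measurable_relabel sets_M vimage_def)
  also have "{f. relabel ?\<rho> f \<in> Z {}} = {f. \<forall>B\<in>{{}}. layer f B \<in> Z B}"
    by (simp add: relabel_def layer_def set_map_def idx_def)
  finally show "emeasure (sim_space {}) {\<omega> \<in> space (sim_space {}). \<forall>B\<in>{{}}. sim \<omega> B \<in> Z B} =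
      emeasure M {f. \<forall>B\<in>{{}}. layer f B \<in> Z B}" .
qed

text \<open>No set in \<open>S\<close> contains \<open>A\<close>, so neither the variable at
  \<open>A\<close> nor \<open>mask A\<close> affects the layers over \<open>S\<close>. Integrating
  out that variable produces the factor \<open>kernel A\<close>, and the true layer at
  \<open>A\<close> produces the same factor by \<open>nn_integral_kernel\<close>. What remains
  involves only the layers over \<open>S\<close>, whose joint laws already agree.\<close>

lemma box_law_insert:
  assumes S: "closed_sets S" and AS: "closed_sets (insert A S)" and A: "A \<notin> S"
    and max: "\<And>B. B \<in> S \<Longrightarrow> \<not> A \<subseteq> B" and box: "box_law S"
  shows "box_law (insert A S)"
  unfolding box_law_def
proof (intro allI impI)
  fix Z :: "nat set \<Rightarrow> (nat \<Rightarrow> bool) set" assume "\<forall>B. Z B \<in> sets cantor"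
  then have Z: "Z B \<in> sets cantor" for B by simp
  have fA: "finite A" "A \<noteq> {}" and fS: "finite S" using AS by (auto simp: closed_sets_def)
  have AB: "\<not> A \<subseteq> B" if "B \<in> insert {} S" for B using that max fA by auto
  let ?N = "sim_space (insert A S)"
  let ?D = "{\<omega> \<in> space ?N. \<forall>B\<in>insert {} S. sim \<omega> B \<in> Z B}"
  let ?E = "{f. \<forall>B\<in>insert {} S. layer f B \<in> Z B}"
  let ?P = "Pi\<^sub>M S (\<lambda>_. \<Omega>)" and ?P' = "Pi\<^sub>M (insert A S) (\<lambda>_. \<Omega>)"
  interpret P: prob_space ?P by (rule prob_space_PiM) unfold_locales
  interpret P': prob_space ?P' by (rule prob_space_PiM) unfold_locales
  interpret PS: product_sigma_finite "\<lambda>_::nat set. \<Omega>" ..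
  have E: "?E \<in> sets cantor" by (rule box_sets(2)[OF Z fS])
  have D: "?D \<in> sets ?N"
  proof -
    have "{\<omega> \<in> space ?N. \<forall>B\<in>insert {} (insert A S). sim \<omega> B \<in> (if B = A then UNIV else Z B)} \<in> sets ?N"
      by (rule box_sets(1)[OF _ AS]) (use Z sets.top[of cantor] in auto)
    also have "{\<omega> \<in> space ?N. \<forall>B\<in>insert {} (insert A S). sim \<omega> B \<in> (if B = A then UNIV else Z B)} = ?D"
      using A fA by auto
    finally show ?thesis .
  qed
  have simA: "(\<lambda>\<omega>. sim \<omega> A) \<in> ?N \<rightarrow>\<^sub>M cantor" by (rule sim_measurable[OF AS]) simp
  have cyl_eq: "emeasure ?N {\<omega> \<in> ?D. bits_upto (length s) (sim \<omega> A) = s} =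
      emeasure M {f \<in> ?E. bits_upto (length s) (layer f A) = s}" for s
  proof -
    let ?n = "length s"
    let ?Q = "{\<omega> \<in> ?D. bits_upto ?n (sim \<omega> A) = s}"
    define g where "g y = indicator (Pi\<^sub>E (insert {} S) Z) y * ennreal (kernel A y s)" for y
    have Q: "?Q \<in> sets ?N"
    proof -
      have "(\<lambda>\<omega>. sim \<omega> A) -` {f. bits_upto ?n f = s} \<inter> space ?N \<in> sets ?N"
        by (rule measurable_sets[OF simA sets_cantor_cylinder])
      then have "?D \<inter> ((\<lambda>\<omega>. sim \<omega> A) -` {f. bits_upto ?n f = s} \<inter> space ?N) \<in> sets ?N" using D by blast
      also have "?D \<inter> ((\<lambda>\<omega>. sim \<omega> A) -` {f. bits_upto ?n f = s} \<inter> space ?N) = ?Q" by auto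
      finally show ?thesis .
    qed
    have Zb: "Pi\<^sub>E (insert {} S) Z \<in> sets (tuples S)" using fS Z by (intro sets_PiM_I_finite) auto
    have psub: "B \<in> insert {} S" if "B \<subset> A" for B
      using AS that unfolding closed_sets_def by (cases "B = {}") auto
    have g: "g \<in> borel_measurable (tuples S)"
      unfolding g_def using Zb
      by (intro borel_measurable_times_ennreal borel_measurable_indicator measurable_compose[OF _ measurable_ennreal] 
          kernel_measurable measurable_component_singleton psub)
    have kt: "kernel A (tuple S y) = kernel A y" for y
      by (rule kernel_cong) (use psub in \<open>auto simp: tuple_def\<close>)
    have gt: "g (tuple S y) = (if \<forall>B\<in>insert {} S. y B \<in> Z B then ennreal (kernel A y s) else 0)" for y
      by (simp add: g_def kt indicator_def tuple_box)
    \<comment> \<open>Given all other variables, the layer at \<open>A\<close> codes its kernel by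
      one uniform variable, so the prefix \<open>s\<close> has probability
      \<open>kernel A y s\<close>.\<close>
    have inner: "(\<integral>\<^sup>+w. indicator ?Q (c, \<theta>(A := w)) \<partial>\<Omega>) = g (tuple S (sim (c, \<theta>)))"
      if \<theta>: "\<theta> \<in> space ?P" for c \<theta>
    proof -
      let ?u = "\<lambda>B. V (\<theta> B)"
      have low: "sim (c, \<theta>(A := w)) B = sim (c, \<theta>) B" if "finite B" "\<not> A \<subseteq> B" for B w
        unfolding sim_def fst_conv snd_conv by (rule hat_cong) (use that in auto)
      have lowS: "sim (c, \<theta>(A := w)) B = sim (c, \<theta>) B" if "B \<in> insert {} S" for B w
        by (rule low) (use that S AB[OF that] in \<open>auto simp: closed_sets_def\<close>)
      have top: "sim (c, \<theta>(A := w)) A = code (kernel A (sim (c, \<theta>))) (V w)" for w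
      proof -
        have "sim (c, \<theta>(A := w)) A = code (kernel A (sim (c, \<theta>(A := w)))) (V w)"
          unfolding sim_def fst_conv snd_conv by (simp add: hat_eq[OF fA])
        also have "kernel A (sim (c, \<theta>(A := w))) = kernel A (sim (c, \<theta>))"
          by (rule kernel_cong) (use lowS psub in blast)
        finally show ?thesis .
      qed
      have sp: "(c, \<theta>(A := w)) \<in> space ?N" if "w \<in> space \<Omega>" for w
        using PiE_fun_upd[of w "\<lambda>_. space \<Omega>" A \<theta> S] \<theta> that by (simp add: sim_space_def space_pair_measure space_PiM)
      have "(\<integral>\<^sup>+w. indicator ?Q (c, \<theta>(A := w)) \<partial>\<Omega>) = 
        (\<integral>\<^sup>+w. (if \<forall>B\<in>insert {} S. sim (c, \<theta>) B \<in> Z B then 1 else 0) * 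
           indicator {w \<in> space \<Omega>. bits_upto ?n (code (kernel A (sim (c, \<theta>))) (V w)) = s} w \<partial>\<Omega>)"
        by (intro nn_integral_cong) (use sp lowS in \<open>auto simp: indicator_def top\<close>)
      also have "\<dots> = (if \<forall>B\<in>insert {} S. sim (c, \<theta>) B \<in> Z B then 1 else 0) * 
          emeasure \<Omega> {w \<in> space \<Omega>. bits_upto ?n (code (kernel A (sim (c, \<theta>))) (V w)) = s}"
      proof (rule nn_integral_cmult_indicator)
        have "(\<lambda>w. code (kernel A (sim (c, \<theta>))) (V w)) \<in> \<Omega> \<rightarrow>\<^sub>M cantor"
          by (rule code_measurable) auto
        from measurable_sets[OF this sets_cantor_cylinder[of ?n s]]
        show "{w \<in> space \<Omega>. bits_upto ?n (code (kernel A (sim (c, \<theta>))) (V w)) = s} \<in> sets \<Omega>"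
          by (simp add: vimage_def Int_def conj_commute)
      qed
      also have "\<dots> = g (tuple S (sim (c, \<theta>)))"
        unfolding gt Omega.emeasure_eq_measure prob_code[OF V bit_law_kernel refl] by simp
      finally show ?thesis .
    qed
    have Qm: "indicator ?Q \<in> borel_measurable (M \<Otimes>\<^sub>M ?P')"
      using Q unfolding sim_space_def by (rule borel_measurable_indicator)
    have gm: "(\<lambda>\<omega>. g (tuple S (sim \<omega>))) \<in> borel_measurable (M \<Otimes>\<^sub>M ?P)"
      using measurable_compose[OF tuple_measurable(1)[OF S] g] by (simp add: sim_space_def)
    have "emeasure ?N ?Q = (\<integral>\<^sup>+\<omega>. indicator ?Q \<omega> \<partial>(M \<Otimes>\<^sub>M ?P'))"
      using Q by (simp add: sim_space_def)
    also have "\<dots> = (\<integral>\<^sup>+c. \<integral>\<^sup>+\<theta>. indicator ?Q (c, \<theta>) \<partial>?P' \<partial>M)"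
      by (rule P'.nn_integral_fst[OF Qm, symmetric])
    also have "\<dots> = (\<integral>\<^sup>+c. \<integral>\<^sup>+\<theta>. g (tuple S (sim (c, \<theta>))) \<partial>?P \<partial>M)"
    proof (rule nn_integral_cong)
      fix c assume c: "c \<in> space M"
      have "(\<lambda>\<theta>. indicator ?Q (c, \<theta>) :: ennreal) \<in> borel_measurable ?P'"
        by (rule measurable_compose[OF measurable_Pair1'[OF c] Qm])
      from PS.product_nn_integral_insert[OF fS A this]
      have "(\<integral>\<^sup>+\<theta>. indicator ?Q (c, \<theta>) \<partial>?P') = (\<integral>\<^sup>+\<theta>. \<integral>\<^sup>+w. indicator ?Q (c, \<theta>(A := w)) \<partial>\<Omega> \<partial>?P)" .
      also have "\<dots> = (\<integral>\<^sup>+\<theta>. g (tuple S (sim (c, \<theta>))) \<partial>?P)"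
        by (rule nn_integral_cong) (rule inner)
      finally show "(\<integral>\<^sup>+\<theta>. indicator ?Q (c, \<theta>) \<partial>?P') = (\<integral>\<^sup>+\<theta>. g (tuple S (sim (c, \<theta>))) \<partial>?P)" .
    qed
    also have "\<dots> = (\<integral>\<^sup>+\<omega>. g (tuple S (sim \<omega>)) \<partial>sim_space S)"
      unfolding sim_space_def by (rule P.nn_integral_fst[OF gm])
    also have "\<dots> = (\<integral>\<^sup>+y. g y \<partial>distr (sim_space S) (tuples S) (\<lambda>\<omega>. tuple S (sim \<omega>)))"
      by (rule nn_integral_distr[OF tuple_measurable(1)[OF S], symmetric]) (simp add: g)
    also have "\<dots> = (\<integral>\<^sup>+y. g y \<partial>distr M (tuples S) (\<lambda>f. tuple S (layer f)))"
      by (simp only: distr_tuple_eq[OF S box])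
    also have "\<dots> = (\<integral>\<^sup>+f. g (tuple S (layer f)) \<partial>M)"
      by (rule nn_integral_distr) (simp_all add: tuple_measurable(2) g)
    also have "\<dots> = (\<integral>\<^sup>+f. indicator ?E f * ennreal (kernel A (layer f) s) \<partial>M)"
      by (intro nn_integral_cong) (simp add: gt indicator_def)
    also have "\<dots> = emeasure M {f \<in> ?E. bits_upto ?n (layer f A) = s}"
    proof (rule nn_integral_kernel[OF fA(1) E])
      fix f
      have "layer (mask A f) B = layer f B" if "B \<in> insert {} S" for B
        by (rule layer_mask) (use that S AB[OF that] in \<open>auto simp: closed_sets_def\<close>)
      then show "mask A f \<in> ?E \<longleftrightarrow> f \<in> ?E" by simp
    qed
    finally show ?thesis .
  qed
  interpret N: prob_space ?N by (rule prob_space_sim)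
  have "emeasure ?N {\<omega> \<in> ?D. sim \<omega> A \<in> Z A} = emeasure M {f \<in> ?E. layer f A \<in> Z A}"
    by (rule cantor_joint_eqI[OF _ _ D _ simA _ cyl_eq Z])
      (use E N.finite_measure_axioms M.finite_measure_axioms in \<open>simp_all add: sets_M measurable_layer\<close>)
  moreover have "{\<omega> \<in> ?D. sim \<omega> A \<in> Z A} = {\<omega> \<in> space ?N. \<forall>B\<in>insert {} (insert A S). sim \<omega> B \<in> Z B}"
    by auto
  moreover have "{f \<in> ?E. layer f A \<in> Z A} = {f. \<forall>B\<in>insert {} (insert A S). layer f B \<in> Z B}"
    by auto
  ultimately show "emeasure ?N {\<omega> \<in> space ?N. \<forall>B\<in>insert {} (insert A S). sim \<omega> B \<in> Z B} =
     emeasure M {f. \<forall>B\<in>insert {} (insert A S). layer f B \<in> Z B}" by simp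
qed

text \<open>Removing a member of maximal cardinality leaves a closed family in which no set contains
  the removed one.\<close>

lemma box_law_closed: "closed_sets S \<Longrightarrow> box_law S"
proof (induction "card S" arbitrary: S)
  case 0
  then have "S = {}" by (simp add: closed_sets_def)
  then show ?case using box_law_empty by simp
next
  case (Suc n)
  have fin: "finite S" using Suc.prems by (simp add: closed_sets_def)
  have ne: "S \<noteq> {}" using Suc.hyps(2) by auto
  obtain A where A: "A \<in> S" "\<And>B. B \<in> S \<Longrightarrow> card B \<le> card A"
  proof -
    have "Max (card ` S) \<in> card ` S" using fin ne by simp
    then obtain A where "A \<in> S" "card A = Max (card ` S)" by (metis imageE)
    then show thesis using that fin by (metis Max_ge finite_imageI imageI)
  qed
  let ?S = "S - {A}"
  have AB: "\<not> A \<subseteq> B" if "B \<in> ?S" for B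
  proof
    assume "A \<subseteq> B"
    moreover have "finite B" "card B \<le> card A" using that A Suc.prems by (auto simp: closed_sets_def)
    ultimately have "A = B" using card_seteq by blast
    then show False using that by simp
  qed
  have cl: "closed_sets ?S"
    unfolding closed_sets_def
  proof (intro conjI ballI allI impI)
    fix D B assume "D \<in> ?S" "B \<subseteq> D" "B \<noteq> {}"
    then show "B \<in> ?S" using Suc.prems AB[of D] unfolding closed_sets_def by auto
  qed (use Suc.prems in \<open>auto simp: closed_sets_def\<close>)
  have "box_law ?S" by (rule Suc.hyps(1)[OF _ cl]) (use Suc.hyps(2) fin A in simp)
  then have "box_law (insert A ?S)"
    by (intro box_law_insert cl) (use AB A Suc.prems in \<open>auto simp: insert_absorb\<close>)
  then show ?case using A by (simp add: insert_absorb)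
qed

end

section \<open>Independence of the hypergraph from its empty layer\<close>

context exchangeable_hypergraph
begin

text \<open>The product formula is extended from prefixes to measurable sets in one component after
  the other, by comparison with the product measure.\<close>

lemma relabel_independent_sets:
  assumes \<pi>: "inj \<pi>" "inj \<rho>" and disj: "range \<pi> \<inter> range \<rho> = {}"
    and X: "X \<in> sets cantor" and C: "C \<in> sets cantor"
  shows "emeasure M {f. relabel \<pi> f \<in> X \<and> relabel \<rho> f \<in> C} = emeasure M X * emeasure M C"
proof -
  interpret R: pair_prob_space M M ..
  let ?P = "M \<Otimes>\<^sub>M M"
  have fin: "finite_measure M" "finite_measure ?P" by unfold_locales
  have mr: "relabel \<pi> \<in> M \<rightarrow>\<^sub>M cantor" "relabel \<rho> \<in> M \<rightarrow>\<^sub>M cantor" by (simp_all add: measurable_relabel)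
  have mp: "fst \<in> ?P \<rightarrow>\<^sub>M cantor" "snd \<in> ?P \<rightarrow>\<^sub>M cantor" by (simp_all flip: measurable_M)
  have rs: "{f. relabel \<sigma> f \<in> Y} \<in> sets M" if "Y \<in> sets cantor" for \<sigma> Y
    using measurable_sets[OF measurable_relabel that] by (simp add: vimage_def sets_M)
  have Ps: "Y \<times> Z \<in> sets ?P" if "Y \<in> sets cantor" "Z \<in> sets cantor" for Y Z
    using that by (intro pair_measureI) (simp_all add: sets_M)
  have eP: "emeasure ?P (Y \<times> Z) = emeasure M Y * emeasure M Z" if "Y \<in> sets cantor" "Z \<in> sets cantor" for Y Z
    using that by (intro M.emeasure_pair_measure_Times) (simp_all add: sets_M)
  have U: "UNIV \<in> sets cantor" using sets.top[of cantor] by simp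
  have 1: "emeasure M {f \<in> {f. bits_upto (length t) (relabel \<rho> f) = t}. relabel \<pi> f \<in> X} = 
      emeasure ?P {z \<in> UNIV \<times> {f. bits_upto (length t) f = t}. fst z \<in> X}" for t
  proof (rule cantor_joint_eqI[OF fin _ _ mr(1) mp(1) _ X])
    show "{f. bits_upto (length t) (relabel \<rho> f) = t} \<in> sets M"
      using rs[OF sets_cantor_cylinder[of "length t" t], of \<rho>] by simp
    show "UNIV \<times> {f. bits_upto (length t) f = t} \<in> sets ?P" by (rule Ps[OF U sets_cantor_cylinder])
    fix s
    have "{z \<in> UNIV \<times> {f. bits_upto (length t) f = t}. bits_upto (length s) (fst z) = s} =
      {f. bits_upto (length s) f = s} \<times> {f. bits_upto (length t) f = t}" by auto
    moreover have "{f \<in> {f. bits_upto (length t) (relabel \<rho> f) = t}. bits_upto (length s) (relabel \<pi> f) = s} =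
      {f. bits_upto (length s) (relabel \<pi> f) = s \<and> bits_upto (length t) (relabel \<rho> f) = t}" by auto
    ultimately show "emeasure M {f \<in> {f. bits_upto (length t) (relabel \<rho> f) = t}. bits_upto (length s) (relabel \<pi> f) = s} =
        emeasure ?P {z \<in> UNIV \<times> {f. bits_upto (length t) f = t}. bits_upto (length s) (fst z) = s}"
      using relabel_independent[OF \<pi> disj, of "length s" s "length t" t]
      by (simp add: eP[OF sets_cantor_cylinder sets_cantor_cylinder] M.emeasure_eq_measure ennreal_mult)
  qed
  have "emeasure M {f \<in> {f. relabel \<pi> f \<in> X}. relabel \<rho> f \<in> C} = emeasure ?P {z \<in> X \<times> UNIV. snd z \<in> C}"
  proof (rule cantor_joint_eqI[OF fin rs[OF X] Ps[OF X U] mr(2) mp(2) _ C])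
    fix t
    have "{f \<in> {f. relabel \<pi> f \<in> X}. bits_upto (length t) (relabel \<rho> f) = t} =
      {f \<in> {f. bits_upto (length t) (relabel \<rho> f) = t}. relabel \<pi> f \<in> X}" by auto
    moreover have "{z \<in> UNIV \<times> {f. bits_upto (length t) f = t}. fst z \<in> X} = 
      {z \<in> X \<times> UNIV. bits_upto (length t) (snd z) = t}" by auto
    ultimately show "emeasure M {f \<in> {f. relabel \<pi> f \<in> X}. bits_upto (length t) (relabel \<rho> f) = t} =
      emeasure ?P {z \<in> X \<times> UNIV. bits_upto (length t) (snd z) = t}" using 1[of t] by simp
  qed
  moreover have "{z \<in> X \<times> UNIV. snd z \<in> C} = X \<times> C" by auto
  ultimately show ?thesis using eP[OF X C] by simp
qed

text \<open>Position 0 of a layer codes the empty set of odd vertices, so for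
  \<open>y = layer f\<close> the bit \<open>y B 0\<close> tells whether the even copy of
  \<open>B\<close> is an edge.\<close>

definition pat :: "(nat, nat) fo_struct \<Rightarrow> nat \<Rightarrow> (nat set \<Rightarrow> nat \<Rightarrow> bool) \<Rightarrow> bool" where
  "pat K m y \<longleftrightarrow> (\<forall>B\<subseteq>{..<m}. card B = l \<longrightarrow> y B 0 = edge K B)"

lemma edge_card: "K \<in> models (hypergraph_theory l) V \<Longrightarrow> edge K B \<Longrightarrow> card B = l"
  unfolding edge_def using hypergraph_rel(1,3)[OF _ l] distinct_card by blast

lemma prob_edges:
  assumes K: "K \<in> models (hypergraph_theory l) {..<m}"
  shows "{g. pat K m (\<lambda>B _. g (set_encode B))} \<in> sets M"
    "measure M {g. pat K m (\<lambda>B _. g (set_encode B))} = p K"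
proof -
  let ?H = "hypergraph_theory l"
  let ?R = "\<lambda>g. pat K m (\<lambda>B _. g (set_encode B))"
  \<comment> \<open>\<open>n\<close> exceeds the code of every subset of \<open>{..<m}\<close>, so
    all edges inside \<open>{..<m}\<close> are found among the first \<open>n\<close> bits.\<close>
  define n where "n = Suc (set_encode {..<m}) + m"
  have bound: "set_encode B < n" if "B \<subseteq> {..<m}" for B
  proof -
    have "set_encode B \<le> set_encode {..<m}" unfolding set_encode_def using that by (intro sum_mono2) auto
    then show ?thesis by (simp add: n_def)
  qed
  have R: "?R f = ?R g" if "bits_upto n f = bits_upto n g" for f g
    using that bound by (simp add: pat_def bits_upto_eq_iff)
  show "{g. ?R g} \<in> sets M" by (rule prob_bits(1)[OF R])
  let ?i = "restrict id {..<m}"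
  have i: "?i \<in> inj_maps m {..<n}" by (rule restrict_id_inj_maps) (simp add: n_def)
  have eq: "?R (edge_bits K') \<longleftrightarrow> pullback m ?i K' = K" if K': "K' \<in> models ?H {..<n}" for K'
  proof -
    have P: "pullback m ?i K' \<in> models ?H {..<m}" by (rule pullback_inj_maps_models[OF K' i])
    have e: "edge (pullback m ?i K') B = edge K' B" if "B \<subseteq> {..<m}" for B
    proof -
      have "?i ` B = B" using that by auto
      then show ?thesis using edge_pullback[OF inj_mapsD(3)[OF i] that] by simp
    qed
    have bits: "edge_bits K' (set_encode B) = edge K' B" if "B \<subseteq> {..<m}" for B
      using that rev_finite_subset[of "{..<m}" B] by (simp add: edge_bits_def)
    show ?thesis
    proof
      assume R': "?R (edge_bits K')"
      show "pullback m ?i K' = K"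
      proof (rule hypergraph_eqI[OF P K l])
        fix B assume B: "B \<subseteq> {..<m}"
        show "edge (pullback m ?i K') B \<longleftrightarrow> edge K B"
        proof (cases "card B = l")
          case True
          then show ?thesis using R' B bits[OF B] e[OF B] by (simp add: pat_def)
        next
          case False
          then show ?thesis using edge_card[OF P] edge_card[OF K] by blast
        qed
      qed
    next
      assume "pullback m ?i K' = K"
      then show "?R (edge_bits K')" using e bits by (auto simp: pat_def)
    qed
  qed
  have "measure M {g. ?R g} = (\<Sum>K' | K' \<in> models ?H {..<n} \<and> ?R (edge_bits K'). p K')"
    by (rule prob_bits(2)[OF R])
  also have "{K'. K' \<in> models ?H {..<n} \<and> ?R (edge_bits K')} = 
      {K'. K' \<in> models ?H {..<n} \<and> pullback m ?i K' = K}" using eq by blast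
  also have "(\<Sum>K' | K' \<in> models ?H {..<n} \<and> pullback m ?i K' = K. p K') = p K"
    by (rule consistent_lawD(3)[OF consistent i K])
  finally show "measure M {g. ?R g} = p K" .
qed

text \<open>The pattern uses even vertices only and the empty layer uses odd vertices only, so
  dissociation makes them independent.\<close>

lemma layers_law:
  assumes K: "K \<in> models (hypergraph_theory l) {..<m}" and C: "C \<in> sets cantor"
  shows "emeasure M {f. layer f {} \<in> C \<and> pat K m (layer f)} = ennreal (p K) * emeasure M C"
proof -
  let ?X = "{g. pat K m (\<lambda>B _. g (set_encode B))}"
  let ?\<pi> = "\<lambda>a :: nat. 2 * a" and ?\<rho> = "\<lambda>b :: nat. 2 * b + 1"
  have neg: "layer f {} = relabel ?\<rho> f" for f
    by (simp add: relabel_def layer_def set_map_def idx_def)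
  have pos: "pat K m (layer f) \<longleftrightarrow> relabel ?\<pi> f \<in> ?X" for f
  proof -
    have "layer f B 0 = relabel ?\<pi> f (set_encode B)" if "B \<subseteq> {..<m}" for B
      using that rev_finite_subset[of "{..<m}" B] by (simp add: relabel_def layer_def set_map_def idx_def)
    then show ?thesis by (simp add: pat_def)
  qed
  have "{f. layer f {} \<in> C \<and> pat K m (layer f)} = {f. relabel ?\<pi> f \<in> ?X \<and> relabel ?\<rho> f \<in> C}"
    unfolding neg pos by (simp only: conj_commute)
  moreover have "emeasure M {f. relabel ?\<pi> f \<in> ?X \<and> relabel ?\<rho> f \<in> C} = emeasure M ?X * emeasure M C"
  proof (rule relabel_independent_sets[OF _ _ _ _ C])
    show "range ?\<pi> \<inter> range ?\<rho> = {}" by auto presburger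
    show "?X \<in> sets cantor" using prob_edges(1)[OF K] by (simp add: sets_M)
  qed (auto simp: inj_def)
  moreover have "emeasure M ?X = ennreal (p K)" using prob_edges(2)[OF K] by (simp add: M.emeasure_eq_measure)
  ultimately show ?thesis by simp
qed

end

section \<open>Freezing the empty layer\<close>

context simulation
begin

lemma closed_sets_fin_subsets: "closed_sets (fin_subsets {..<m})"
  using rev_finite_subset by (auto simp: closed_sets_def fin_subsets_def)

lemma sim_law:
  assumes K: "K \<in> models (hypergraph_theory l) {..<m}" and C: "C \<in> sets cantor"
  shows "{\<omega> \<in> space (sim_space (fin_subsets {..<m})). fst \<omega> \<in> C \<and> pat K m (sim \<omega>)} \<in> sets (sim_space (fin_subsets {..<m}))"
    "emeasure (sim_space (fin_subsets {..<m})) {\<omega> \<in> space (sim_space (fin_subsets {..<m})). fst \<omega> \<in> C \<and> pat K m (sim \<omega>)} =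
      ennreal (p K) * emeasure M C"
proof -
  let ?S = "fin_subsets {..<m}"
  define Z where "Z B = (if B = {} then C else if card B = l then {f. f 0 = edge K B} else UNIV)" for B :: "nat set"
  have Z: "Z B \<in> sets cantor" for B
  proof -
    have "(\<lambda>f. f 0) -` {edge K B} \<inter> space cantor \<in> sets cantor"
      by (rule measurable_sets[OF cantor_component]) simp
    also have "(\<lambda>f. f 0) -` {edge K B} \<inter> space cantor = {f. f 0 = edge K B}" by auto
    finally show ?thesis using C sets.top[of cantor] by (auto simp: Z_def)
  qed
  have eq: "(\<forall>B\<in>insert {} ?S. y B \<in> Z B) \<longleftrightarrow> y {} \<in> C \<and> pat K m y" for y
  proof
    assume a: "\<forall>B\<in>insert {} ?S. y B \<in> Z B"
    have "y B 0 = edge K B" if B: "B \<subseteq> {..<m}" "card B = l" for B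
    proof -
      have "B \<noteq> {}" "finite B" using B l rev_finite_subset[OF _ B(1)] by auto
      then have "y B \<in> Z B" using a B by (auto simp: fin_subsets_def)
      then show ?thesis using B \<open>B \<noteq> {}\<close> by (simp add: Z_def)
    qed
    moreover have "y {} \<in> C" using a by (simp add: Z_def)
    ultimately show "y {} \<in> C \<and> pat K m y" by (simp add: pat_def)
  next
    assume "y {} \<in> C \<and> pat K m y"
    then show "\<forall>B\<in>insert {} ?S. y B \<in> Z B" by (auto simp: Z_def pat_def fin_subsets_def)
  qed
  have seq: "{\<omega> \<in> space (sim_space ?S). fst \<omega> \<in> C \<and> pat K m (sim \<omega>)} = 
      {\<omega> \<in> space (sim_space ?S). \<forall>B\<in>insert {} ?S. sim \<omega> B \<in> Z B}"
    unfolding eq by (simp add: sim_def)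
  show "{\<omega> \<in> space (sim_space ?S). fst \<omega> \<in> C \<and> pat K m (sim \<omega>)} \<in> sets (sim_space ?S)"
    unfolding seq by (rule box_sets(1)[OF Z closed_sets_fin_subsets])
  have "emeasure (sim_space ?S) {\<omega> \<in> space (sim_space ?S). \<forall>B\<in>insert {} ?S. sim \<omega> B \<in> Z B} =
      emeasure M {f. \<forall>B\<in>insert {} ?S. layer f B \<in> Z B}"
    using box_law_closed[OF closed_sets_fin_subsets] Z unfolding box_law_def by blast
  also have "\<dots> = ennreal (p K) * emeasure M C"
    unfolding eq by (rule layers_law[OF K C])
  finally show "emeasure (sim_space ?S) {\<omega> \<in> space (sim_space ?S). fst \<omega> \<in> C \<and> pat K m (sim \<omega>)} =
      ennreal (p K) * emeasure M C" unfolding seq .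
qed

text \<open>Over every event \<open>C\<close> for the empty layer the section probabilities
  integrate to \<open>p K\<close> times the measure of \<open>C\<close>. Densities are unique up to
  null sets, so almost every section has probability \<open>p K\<close>.\<close>

lemma AE_section_law:
  assumes K: "K \<in> models (hypergraph_theory l) {..<m}"
  shows "AE c in M. measure (Pi\<^sub>M (fin_subsets {..<m}) (\<lambda>_. \<Omega>))
      {\<theta> \<in> space (Pi\<^sub>M (fin_subsets {..<m}) (\<lambda>_. \<Omega>)). pat K m (sim (c, \<theta>))} = p K"
proof -
  let ?S = "fin_subsets {..<m}"
  let ?P = "Pi\<^sub>M ?S (\<lambda>_. \<Omega>)"
  interpret P: prob_space ?P by (rule prob_space_PiM) unfold_locales
  let ?Q = "\<lambda>C. {\<omega> \<in> space (sim_space ?S). fst \<omega> \<in> C \<and> pat K m (sim \<omega>)}"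
  let ?G = "\<lambda>c. emeasure ?P {\<theta> \<in> space ?P. pat K m (sim (c, \<theta>))}"
  have p0: "0 \<le> p K" by (rule consistent_lawD(1)[OF consistent K])
  have U: "UNIV \<in> sets cantor" using sets.top[of cantor] by simp
  have Q: "?Q C \<in> sets (M \<Otimes>\<^sub>M ?P)" if "C \<in> sets cantor" for C
    using sim_law(1)[OF K that] by (simp add: sim_space_def)
  have sec: "Pair c -` ?Q C = (if c \<in> C then {\<theta> \<in> space ?P. pat K m (sim (c, \<theta>))} else {})" for c C
    by (auto simp: sim_space_def space_pair_measure)
  have G: "?G \<in> borel_measurable M"
    using P.measurable_emeasure_Pair[OF Q[OF U]] unfolding sec by simp
  have int: "(\<integral>\<^sup>+c. ?G c * indicator C c \<partial>M) = ennreal (p K) * emeasure M C" if C: "C \<in> sets M" for C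
  proof -
    have C': "C \<in> sets cantor" using C by (simp add: sets_M)
    have "ennreal (p K) * emeasure M C = emeasure (M \<Otimes>\<^sub>M ?P) (?Q C)"
      using sim_law(2)[OF K C'] by (simp add: sim_space_def)
    also have "\<dots> = (\<integral>\<^sup>+c. emeasure ?P (Pair c -` ?Q C) \<partial>M)"
      by (rule P.emeasure_pair_measure_alt[OF Q[OF C']])
    also have "\<dots> = (\<integral>\<^sup>+c. ?G c * indicator C c \<partial>M)"
      unfolding sec by (intro nn_integral_cong) (simp add: indicator_def)
    finally show ?thesis by simp
  qed
  have "density M ?G = density M (\<lambda>_. ennreal (p K))"
  proof (rule measure_eqI)
    fix C assume "C \<in> sets (density M ?G)"
    then have C: "C \<in> sets M" by simp
    show "emeasure (density M ?G) C = emeasure (density M (\<lambda>_. ennreal (p K))) C"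
      using emeasure_density[OF G C] emeasure_density[OF borel_measurable_const C, of "ennreal (p K)"] int[OF C] C
      by (simp add: nn_integral_cmult_indicator)
  qed simp
  then have "AE c in M. ?G c = ennreal (p K)"
    using M.density_unique[OF G borel_measurable_const] by blast
  then show ?thesis
    by eventually_elim (simp add: P.emeasure_eq_measure p0)
qed

text \<open>Only countably many pairs of \<open>m\<close> and \<open>K\<close> are involved, so one
  \<open>c\<close> avoids all exceptional null sets.\<close>

lemma good_point:
  obtains c where "\<And>m K. K \<in> models (hypergraph_theory l) {..<m} \<Longrightarrow>
    measure (Pi\<^sub>M (fin_subsets {..<m}) (\<lambda>_. \<Omega>))
      {\<theta> \<in> space (Pi\<^sub>M (fin_subsets {..<m}) (\<lambda>_. \<Omega>)). pat K m (sim (c, \<theta>))} = p K"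
proof -
  have "AE c in M. \<forall>m. \<forall>K\<in>models (hypergraph_theory l) {..<m}. measure (Pi\<^sub>M (fin_subsets {..<m}) (\<lambda>_. \<Omega>))
      {\<theta> \<in> space (Pi\<^sub>M (fin_subsets {..<m}) (\<lambda>_. \<Omega>)). pat K m (sim (c, \<theta>))} = p K"
    by (intro AE_all_countable[THEN iffD2] allI AE_finite_allI finite_hypergraph_models AE_section_law)
  from eventually_happens[OF this] obtain c where "\<forall>m. \<forall>K\<in>models (hypergraph_theory l) {..<m}. 
      measure (Pi\<^sub>M (fin_subsets {..<m}) (\<lambda>_. \<Omega>))
      {\<theta> \<in> space (Pi\<^sub>M (fin_subsets {..<m}) (\<lambda>_. \<Omega>)). pat K m (sim (c, \<theta>))} = p K"
    using M.ae_filter_bot by blast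
  then show thesis by (intro that) blast
qed

end

text \<open>The rank bound is automatic for an \<open>l\<close>-ary predicate; the content is that
  some theon over the given space represents \<open>\<psi>\<close>. Its peon reads bit 0 of the
  simulated layer at \<open>{..<l}\<close>, with the empty layer frozen at a good point.\<close>

lemma limit_rank_hypergraph_le:
  fixes \<Omega> :: "'y measure"
  assumes at: "atomless_complete_prob_space \<Omega>" and l: "l \<ge> 1" and \<psi>: "\<psi> \<in> Hom_plus (hypergraph_theory l)"
  shows "limit_rank TYPE('y) (hypergraph_theory l) \<psi> \<le> enat l"
proof -
  let ?H = "hypergraph_theory l"
  have \<Omega>: "prob_space \<Omega>" using at by (simp add: atomless_complete_prob_space_def)
  interpret \<Omega>: atomless_prob_space \<Omega>
    by (intro atomless_prob_space.intro \<Omega> atomless_prob_space_axioms.intro)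
      (use at in \<open>auto simp: atomless_complete_prob_space_def\<close>)
  obtain V where V: "V \<in> borel_measurable \<Omega>" "\<And>x. x \<in> space \<Omega> \<Longrightarrow> 0 \<le> V x \<and> V x < 1"
    "\<And>a b. 0 \<le> a \<Longrightarrow> a \<le> b \<Longrightarrow> b \<le> 1 \<Longrightarrow> \<Omega>.prob {x \<in> space \<Omega>. a \<le> V x \<and> V x < b} = b - a"
    using \<Omega>.exists_uniform by blast
  then have V: "uniform_rv \<Omega> V" by (simp add: uniform_rv_def)
  have fs: "finite (symbols ?H)" by (simp add: hypergraph_theory_def)
  obtain M where "exchangeable_hypergraph M l (labelled \<psi>)"
    by (rule exchangeable_hypergraph_exists[OF \<Omega> V l Hom_plus_laws[OF fs \<psi>]])
  then interpret S: simulation M l "labelled \<psi>" \<Omega> V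
    by (intro simulation.intro simulation_axioms.intro \<Omega> V)
  obtain c where c: "\<And>m K. K \<in> models ?H {..<m} \<Longrightarrow>
    measure (Pi\<^sub>M (fin_subsets {..<m}) (\<lambda>_. \<Omega>))
      {\<theta> \<in> space (Pi\<^sub>M (fin_subsets {..<m}) (\<lambda>_. \<Omega>)). S.pat K m (S.sim (c, \<theta>))} = labelled \<psi> K"
    using S.good_point by blast
  define N where "N = {x \<in> space (Pi\<^sub>M (fin_subsets {..<l}) (\<lambda>_. \<Omega>)). S.sim (c, x) {..<l} 0}"
  define \<N> where "\<N> = (\<lambda>_ :: nat. N)"
  have N: "N \<in> sets (Pi\<^sub>M (fin_subsets {..<l}) (\<lambda>_. \<Omega>))"
  proof -
    have "(\<lambda>x. S.sim (c, x) {..<l}) \<in> Pi\<^sub>M (fin_subsets {..<l}) (\<lambda>_. \<Omega>) \<rightarrow>\<^sub>M cantor"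
      unfolding S.sim_def fst_conv snd_conv
    proof (rule S.hat_measurable)
      fix B assume "B \<subseteq> {..<l}" "B \<noteq> {}"
      then have "B \<in> fin_subsets {..<l}" using rev_finite_subset[of "{..<l}" B] by (simp add: fin_subsets_def)
      then have "(\<lambda>x. x B) \<in> Pi\<^sub>M (fin_subsets {..<l}) (\<lambda>_. \<Omega>) \<rightarrow>\<^sub>M \<Omega>"
        by (rule measurable_component_singleton)
      from measurable_compose[OF this S.V_measurable]
      show "(\<lambda>x. V (x B)) \<in> borel_measurable (Pi\<^sub>M (fin_subsets {..<l}) (\<lambda>_. \<Omega>))" .
    qed auto
    from measurable_sets[OF measurable_compose[OF this cantor_component], of "{True}" 0]
    show ?thesis by (simp add: N_def vimage_def Int_def conj_commute)
  qed
  \<comment> \<open>By pointwise equivariance, membership of a tuple depends only on its set of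
    entries. The relation is therefore symmetric for every \<open>\<theta>\<close>, and the axioms
    hold everywhere.\<close>
  have mem: "pull_back \<alpha> \<theta> \<in> N \<longleftrightarrow> S.sim (c, \<theta>) (set \<alpha>) 0"
    if \<alpha>: "length \<alpha> = l" "distinct \<alpha>" "set \<alpha> \<subseteq> V'" and \<theta>: "\<theta> \<in> space (Pi\<^sub>M (fin_subsets V') (\<lambda>_. \<Omega>))" for \<alpha> \<theta> V'
  proof -
    have inj: "inj_on ((!) \<alpha>) {..<l}" using \<alpha> by (simp add: inj_on_nth)
    have img: "(!) \<alpha> ` {..<l} = set \<alpha>" using \<alpha>(1) by (auto simp: set_conv_nth)
    have im: "(!) \<alpha> ` A \<in> fin_subsets V'" if "A \<in> fin_subsets {..<l}" for A
    proof -
      have "(!) \<alpha> ` A \<subseteq> set \<alpha>" using that img by (auto simp: fin_subsets_def)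
      then show ?thesis using that \<alpha>(3) by (auto simp: fin_subsets_def)
    qed
    have sp: "pull_back \<alpha> \<theta> \<in> space (Pi\<^sub>M (fin_subsets {..<l}) (\<lambda>_. \<Omega>))"
      using \<theta> im \<alpha>(1) by (auto simp: pull_back_def space_PiM)
    have "S.hat c (\<lambda>B. V (pull_back \<alpha> \<theta> B)) {..<l} = S.hat c (\<lambda>B. V (\<theta> B)) ((!) \<alpha> ` {..<l})"
    proof (rule S.hat_equivariant[OF _ inj])
      fix B assume "B \<subseteq> {..<l}" "B \<noteq> {}"
      then have "B \<in> fin_subsets {..<l}" using rev_finite_subset[of "{..<l}" B] by (simp add: fin_subsets_def)
      then show "V (pull_back \<alpha> \<theta> B) = V (\<theta> ((!) \<alpha> ` B))" using \<alpha>(1) by (simp add: pull_back_def)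
    qed simp
    then have "S.sim (c, pull_back \<alpha> \<theta>) {..<l} = S.sim (c, \<theta>) (set \<alpha>)" by (simp add: S.sim_def img)
    then show ?thesis using sp by (simp add: N_def)
  qed
  have th: "theon_struct ?H \<N> \<theta> \<in> models ?H UNIV" if \<theta>: "\<theta> \<in> space (Pi\<^sub>M (fin_subsets UNIV) (\<lambda>_. \<Omega>))" for \<theta>
  proof -
    let ?K = "theon_struct ?H \<N> \<theta>"
    have rel: "rel ?K 0 = {\<alpha>. length \<alpha> = l \<and> distinct \<alpha> \<and> S.sim (c, \<theta>) (set \<alpha>) 0}"
      using mem[OF _ _ _ \<theta>] by (auto simp: theon_struct_def hypergraph_theory_def \<N>_def)
    have "holds ?K a f" if f: "f \<in> axs ?H" for a f
    proof -
      have "f = canonical_axiom 0 l \<or> (\<exists>s. s permutes {..<l} \<and> f = Imp (Atom 0 [0..<l]) (Atom 0 (map s [0..<l])))"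
        using f by (auto simp: hypergraph_theory_def)
      then show ?thesis
      proof (elim disjE exE conjE)
        assume "f = canonical_axiom 0 l"
        moreover have "\<not> distinct (map a [0..<l])" if "i < j" "j < l" "a i = a j" for i j
          using that inj_onD[of a "{0..<l}" i j] by (auto simp: distinct_map)
        ultimately show ?thesis by (auto simp: canonical_axiom_def rel)
      next
        fix s assume s: "s permutes {..<l}" and f: "f = Imp (Atom 0 [0..<l]) (Atom 0 (map s [0..<l]))"
        have img: "s ` {0..<l} = {0..<l}" using permutes_image[OF s] by (simp add: atLeast0LessThan)
        have set: "set (map a (map s [0..<l])) = set (map a [0..<l])"
          using img by (simp only: set_map set_upt)
        have "distinct (map a (map s [0..<l]))" if "distinct (map a [0..<l])"
          using that img permutes_inj_on[OF s] by (simp add: distinct_map comp_inj_on)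
        then show ?thesis using set by (auto simp: f rel)
      qed
    qed
    then show ?thesis by (auto simp: models_def theon_struct_def hypergraph_theory_def)
  qed
  have isth: "is_theon ?H \<Omega> \<N>"
    unfolding is_theon_def
  proof (intro conjI ballI at)
    fix P assume "P \<in> symbols ?H"
    show "\<N> P \<in> sets (E_space \<Omega> {..<arity ?H P})"
      using N by (simp add: \<N>_def E_space_def hypergraph_theory_def sets_completionI_sets)
  next
    show "AE \<theta> in E_space \<Omega> UNIV. theon_struct ?H \<N> \<theta> \<in> models ?H UNIV"
      by (rule AE_I2) (simp add: E_space_def th)
  qed
  have N': "\<N> P \<in> sets (\<Pi>\<^sub>M A\<in>fin_subsets {..<arity ?H P}. \<Omega>)" for P
    using N by (simp add: \<N>_def hypergraph_theory_def)
  have "theon_limit ?H \<Omega> \<N> = \<psi>"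
  proof (rule labelled_eqI)
    fix m :: nat and K assume K: "K \<in> models ?H {..<m}"
    let ?P = "Pi\<^sub>M (fin_subsets {..<m}) (\<lambda>_. \<Omega>)"
    have inj: "inj_on id {..<m}" by simp
    have "labelled (theon_limit ?H \<Omega> \<N>) K = measure (\<Pi>\<^sub>M A\<in>fin_subsets UNIV. \<Omega>) {\<theta> \<in> space (\<Pi>\<^sub>M A\<in>fin_subsets UNIV. \<Omega>). 
       pullback m id (theon_struct ?H \<N> \<theta>) = K}"
      by (rule theon_law[OF fs isth N' _ inj K, symmetric]) simp
    also have "\<dots> = measure ?P {y \<in> space ?P. local_struct ?H \<N> m y = K}"
      by (rule prob_theon_struct_pullback(2)[OF \<Omega> fs N' inj])
    also have "{y \<in> space ?P. local_struct ?H \<N> m y = K} = {y \<in> space ?P. S.pat K m (S.sim (c, y))}"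
    proof (rule Collect_cong, rule conj_cong[OF refl])
      fix y assume y: "y \<in> space ?P"
      have rel: "rel (local_struct ?H \<N> m y) P = 
          (if P = 0 then {\<alpha>. length \<alpha> = l \<and> distinct \<alpha> \<and> set \<alpha> \<subseteq> {..<m} \<and> S.sim (c, y) (set \<alpha>) 0} else {})" for P
        using mem[OF _ _ _ y] by (auto simp: local_struct_def hypergraph_theory_def \<N>_def)
      have relK: "rel K P = (if P = 0 then {\<alpha>. length \<alpha> = l \<and> distinct \<alpha> \<and> set \<alpha> \<subseteq> {..<m} \<and> edge K (set \<alpha>)} else {})" for P
      proof (cases "P = 0")
        case True
        have "\<alpha> \<in> rel K 0" if "distinct \<alpha>" "edge K (set \<alpha>)" for \<alpha>
          using hypergraph_rel(4)[OF K l] that unfolding edge_def by metis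
        then show ?thesis using True hypergraph_rel(1-3)[OF K l] by (auto simp: edge_def)
      next
        case False
        then show ?thesis using K by (simp add: models_def hypergraph_theory_def)
      qed
      have "local_struct ?H \<N> m y = K \<longleftrightarrow> rel (local_struct ?H \<N> m y) 0 = rel K 0"
      proof -
        have "verts (local_struct ?H \<N> m y) = verts K" by (simp add: local_struct_def verts_models[OF K])
        moreover have "rel (local_struct ?H \<N> m y) P = rel K P" if "P \<noteq> 0" for P using that rel relK by simp
        ultimately show ?thesis unfolding fo_struct_eq_iff by metis
      qed
      also have "\<dots> \<longleftrightarrow> S.pat K m (S.sim (c, y))"
      proof
        assume eq: "rel (local_struct ?H \<N> m y) 0 = rel K 0"
        show "S.pat K m (S.sim (c, y))"
          unfolding S.pat_def
        proof (intro allI impI)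
          fix B assume B: "B \<subseteq> {..<m}" "card B = l"
          have "finite B" by (rule rev_finite_subset[OF _ B(1)]) simp
          then obtain \<alpha> where \<alpha>: "set \<alpha> = B" "distinct \<alpha>" using finite_distinct_list by blast
          then have "length \<alpha> = l" using B distinct_card by metis
          have "\<alpha> \<in> rel (local_struct ?H \<N> m y) 0 \<longleftrightarrow> \<alpha> \<in> rel K 0" by (simp only: eq)
          then show "S.sim (c, y) B 0 = edge K B"
            using \<alpha> B \<open>length \<alpha> = l\<close> by (simp add: rel relK)
        qed
      next
        assume "S.pat K m (S.sim (c, y))"
        then show "rel (local_struct ?H \<N> m y) 0 = rel K 0"
          unfolding rel relK S.pat_def using distinct_card by (auto simp: distinct_card)
      qed
      finally show "local_struct ?H \<N> m y = K \<longleftrightarrow> S.pat K m (S.sim (c, y))" .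
    qed
    also have "measure ?P {y \<in> space ?P. S.pat K m (S.sim (c, y))} = labelled \<psi> K" by (rule c[OF K])
    finally show "labelled (theon_limit ?H \<Omega> \<N>) K = labelled \<psi> K" .
  qed (use Hom_plus_extensional[OF \<psi>] in \<open>auto simp: theon_limit_def PiE_def\<close>)
  moreover have "theon_rank ?H \<Omega> \<N> \<le> enat l"
  proof -
    have "peon_rank \<Omega> l N \<le> l" unfolding peon_rank_def
      by (rule Least_le, rule peon_rank_le_self) (use N in \<open>simp add: E_space_def sets_completionI_sets\<close>)
    then show ?thesis by (simp add: theon_rank_def hypergraph_theory_def \<N>_def)
  qed
  ultimately show ?thesis
    unfolding limit_rank_def using isth by (intro Inf_lower2[of "theon_rank ?H \<Omega> \<N>"]) blast+
qed

text \<open>Uniqueness gives the product formula on all classes; those with a complete hypergraph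
  part are a special case.\<close>

theorem UCouple_imp_UInduce:
  fixes \<Omega> :: "'y measure"
  assumes at: "atomless_complete_prob_space \<Omega>" and uc: "UCouple TYPE('y) l T \<phi>"
  shows "UInduce l T \<phi>"
proof (cases "l = 0")
  case False
  then have l: "l \<ge> 1" by simp
  show ?thesis
    unfolding UInduce_def Let_def
  proof (intro disjI2 ballI allI impI)
    fix \<psi> \<xi> C assume \<psi>: "\<psi> \<in> Hom_plus (hypergraph_theory l)" and \<xi>: "is_coupling T (hypergraph_theory l) \<phi> \<psi> \<xi>"
    have "uniquely_coupleable T (hypergraph_theory l) \<phi> \<psi>"
      using uc canonical_hypergraph_theory[OF l] \<psi> limit_rank_hypergraph_le[OF at l \<psi>]
      unfolding UCouple_def by blast
    moreover have "\<xi> \<in> {\<xi>. is_coupling T (hypergraph_theory l) \<phi> \<psi> \<xi>}" using \<xi> by simp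
    ultimately have "\<xi> = indep_coupling T (hypergraph_theory l) \<phi> \<psi>"
      unfolding uniquely_coupleable_def by simp
    then show "\<xi> C = indep_coupling T (hypergraph_theory l) \<phi> \<psi> C" by simp
  qed
qed (simp add: UInduce_def)

theorem theorem3p2:
  fixes T :: "'p univ_theory" and \<phi> :: "'p iso_class \<Rightarrow> real" and l :: nat
    and \<Omega> :: "'y measure"
  assumes "canonical_theory T" and "\<phi> \<in> Hom_plus T"
    and "atomless_complete_prob_space \<Omega>"
  shows "(Independence TYPE('x) l T \<phi> \<longrightarrow> UCouple TYPE('y) l T \<phi>) \<and>
         (UCouple TYPE('y) l T \<phi> \<longrightarrow> UInduce l T \<phi>)"
  using Independence_imp_UCouple[OF assms(1,2)] UCouple_imp_UInduce[OF assms(3)] by blast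

end
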